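(* The pruning process $X=(X_t)_{t\ge0}$ is Feller continuous: for every $t\ge0$, $S_t\big(\mathcal C_b(\mathbb H^{f,\sigma})\big)\subseteq\mathcal C_b(\mathbb H^{f,\sigma})$, where $S_tG(\mathcal X):=\mathbb E^{\mathcal X}[G(X_t)]$ and $\mathbb H^{f,\sigma}$ carries the LWV-topology.
   Context: An $n$-pointed (rooted) metric measure space is $\mathcal X=(X,r,\rho,(u_1,\dots,u_n),\mu)$, abbreviated $(X,\underline u,\mu)$, where $(X,r)$ is a metric space, $\rho\in X$ the root, $u_1,\dots,u_n\in X$, and $\mu$ is a finite Borel measure with $(\mathrm{supp}(\mu),r)$ complete and separable (if separable but not complete, it is identified with its completion). Put $\mathrm{supp}(\mathcal X):=\mathrm{supp}(\mu)\cup\{\rho,u_1,\dots,u_n\}$. Two such spaces are equivalent if there is an isometry between their supports preserving measure, root and marked points; $\mathbb M_n$ is the set of equivalence classes. $\mathbb H_n\subseteq\mathbb M_n$ is the set of classes whose support is $0$-hyperbolic, i.e. $r(x_1,x_2)+r(x_3,x_4)\le\max\{r(x_1,x_3)+r(x_2,x_4),r(x_1,x_4)+r(x_2,x_3)\}$ for all points. Elements of $\mathbb H_n$ are always represented by $\mathbb R$-trees (connected $0$-hyperbolic spaces). In a rooted $\mathbb R$-tree $(T,r,\rho)$, $[x,y]$ is the unique path between $x,y$, $[x,y[:=[x,y]\setminus\{y\}$, and $[\![A]\!]:=\{\rho\}\cup\bigcup_{v\in A}[\rho,v]$ for a list or subset $A$ of $T$. $\|\mu\|$ is total mass, $\mu^\circ=\mu/\|\mu\|$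 for $\mu\ne0$. With $R^X(x_1,x_2,\dots):=(r(x_i,x_j))_{0\le i<j}$, $x_0:=\rho$, put $\boldsymbol\upsilon^{\mathcal X}:=\|\mu\|\cdot(R^X)_*\big(\bigotimes_{k=1}^n\delta_{u_k}\otimes(\mu^\circ)^{\otimes\mathbb N}\big)$ (and $0$ if $\mu=0$) for $\mathcal X=(X,\underline u,\mu)\in\mathbb M_n$. The $n$-pointed Gromov-weak (pGw) topology: $\mathcal X_N\to\mathcal X$ iff $\boldsymbol\upsilon^{\mathcal X_N}\Rightarrow\boldsymbol\upsilon^{\mathcal X}$ weakly and $R^{X_N}(\underline u_N)\to R^X(\underline u)$ (the latter automatic if $\mu\ne0$). For a rooted $\mathbb R$-tree $T$ with finite measure $\mu$ (separable support), $\mathrm{Sk}_\mu(T):=\bigcup_{v\in\mathrm{supp}(\mu)}[\rho,v[\ \cup\{v\in T:\mu(\{v\})>0\}$ and $\mathrm{Lf}_\mu(T):=[\![\mathrm{supp}(\mu)]\!]\setminus\mathrm{Sk}_\mu(T)$. A (rooted) bi-measure $\mathbb R$-tree is $(T,\mu,\nu)$ with $(T,r,\rho)$ a rooted $\mathbb R$-tree, $\mu$ a finite Borel measure on $T$ such that $(\mathrm{supp}(\mu),r)$ is complete and separable (if separable but not complete, it is identified with its completion), and $\nu$ a ($\sigma$-finite) measure on $T$ such that $\nu([\rho,u])<\infty$ for $\mu$-a.e. $u$ and $\nu(\mathrm{Lf}_\mu(T))=0$. Two of them are equivalent if there is an isometry $\phi:[\![\mathrm{supp}(\mu)]\!]\to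 T'$ preserving the root with $\phi_*\mu=\mu'$ and $\phi_*(\nu\restriction_{\mathrm{Sk}_\mu(T)})=\nu'\restriction_{\mathrm{Sk}_{\mu'}(T')}$ (so $\nu$ only matters on the $\mu$-skeleton). $\mathbb H^{f,\sigma}$ is the set of equivalence classes. For $\mathcal X=(T,\mu,\nu)\in\mathbb H^{f,\sigma}$: $\tau_{\mathcal X}(u_1,\dots,u_n):=([\![u_1,\dots,u_n]\!],(u_1,\dots,u_n),\nu\restriction_{[\![u_1,\dots,u_n]\!]})\in\mathbb H_n$ (for $\mu^{\otimes n}$-a.e. $\underline u$); $\varsigma_{\mathcal X}(\underline u):=(\tau_{\mathcal X}(u_1),\tau_{\mathcal X}(u_1,u_2),\dots)\in\prod_n\mathbb H_n$; $\varpi^{\mathcal X}:=\|\mu\|\cdot(\varsigma_{\mathcal X})_*((\mu^\circ)^{\otimes\mathbb N})$ ($:=0$ if $\mu=0$). The LWV-topology on $\mathbb H^{f,\sigma}$: $\mathcal X_N\to\mathcal X$ iff $\varpi^{\mathcal X_N}\Rightarrow\varpi^{\mathcal X}$ weakly as finite measures on $\prod_n\mathbb H_n$ with the product of pGw topologies. Pruning process. For $v\in T$ let $T^v:=\{w\in T:v\notin[\rho,w]\}$, and for a set $A\subseteq T$ let $T^A:=\bigcap_{v\in A}T^v$. For $\mathcal X=(T,\mu,\nu)\in\mathbb H^{f,\sigma}$ let $\pi^{\mathcal X}$ be a Poisson point measure on $\mathbb R_+\times T$ with intensity $\lambda\otimes\nu$ ($\lambda$ Lebesgue measure) and $\pi_t(\cdot):=\pi^{\mathcal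 X}([0,t]\times\cdot)$, identified with its set of atoms. The pruning process started in $X_0=\mathcal X$ is $X_t:=(T^{\pi_t},\mu\restriction_{T^{\pi_t}},\nu\restriction_{T^{\pi_t}})$, $t\ge0$ (if $T^{\pi_t}=\emptyset$, this is understood as the class of the one-point tree with zero measures). $\mathbb E^{\mathcal X}$ is expectation for the process started in $\mathcal X$. $\mathcal C_b(E)$ denotes the bounded continuous real functions on $E$. *)

theory Defs
  imports "HOL-Probability.Probability"
begin

section \<open>Borel measures, bounded continuous functions, weak convergence\<close>

definition borel_of :: "'a topology \<Rightarrow> 'a measure" where
  "borel_of E = sigma (topspace E) {U. openin E U}"

definition bounded_continuous :: "'a topology \<Rightarrow> ('a \<Rightarrow> real) set" where
  "bounded_continuous E = {f. continuous_map E euclideanreal f \<and> bounded (f ` topspace E)}"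

definition weak_topology :: "'a topology \<Rightarrow> 'a measure topology" where
  "weak_topology E =
     pullback_topology {M. sets M = sets (borel_of E) \<and> finite_measure M}
       (\<lambda>M. \<lambda>f\<in>bounded_continuous E. (\<integral>x. f x \<partial>M))
       (product_topology (\<lambda>_. euclideanreal) (bounded_continuous E))"

definition total_mass :: "'a measure \<Rightarrow> ennreal" where
  "total_mass \<mu> = emeasure \<mu> (space \<mu>)"

definition normalise :: "'a measure \<Rightarrow> 'a measure" where
  "normalise \<mu> = scale_measure (inverse (total_mass \<mu>)) \<mu>"

text \<open>
  Push-forward of a finite measure under a map that is defined and measurable only almost
  everywhere: a map is measurable for the completion as soon as it agrees off a null set with a
  measurable one.
\<close>

definition push_ae :: "'a measure \<Rightarrow> 'b measure \<Rightarrow> ('a \<Rightarrow> 'b) \<Rightarrow> 'b measure" where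
  "push_ae M N f = distr (completion M) N f"

section \<open>Metric spaces with a measure\<close>

text \<open>
  All spaces have their points in the type \<^typ>\<open>real\<close>. Only the support of a space (for trees: the
  subtree spanned by the support) matters up to equivalence; it is separable, hence has at most
  continuum many points, so every equivalence class has a representative with points in
  \<^typ>\<open>real\<close>.
\<close>

definition borel_on :: "real metric \<Rightarrow> real measure" where
  "borel_on T = borel_of (mtopology_of T)"

definition msupp :: "real metric \<Rightarrow> real measure \<Rightarrow> real set" where
  "msupp T \<mu> = {x \<in> mspace T. \<forall>U. openin (mtopology_of T) U \<and> x \<in> U \<longrightarrow> 0 < emeasure \<mu> U}"

text \<open>
  The last clause is automatic if \<open>T\<close> is separable. On a non-separable space it can fail only in
  the presence of real-valued measurable cardinals, and then \<open>\<mu>\<close> would not be carried by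
  its support, i.e. the space would not even be equivalent to itself.
\<close>

definition admissible_measure :: "real metric \<Rightarrow> real measure \<Rightarrow> bool" where
  "admissible_measure T \<mu> \<longleftrightarrow>
     sets \<mu> = sets (borel_on T) \<and> finite_measure \<mu> \<and>
     mcomplete_of (submetric T (msupp T \<mu>)) \<and>
     separable_space (mtopology_of (submetric T (msupp T \<mu>))) \<and>
     emeasure \<mu> (mspace T - msupp T \<mu>) = 0"

definition zero_hyperbolic :: "real metric \<Rightarrow> real set \<Rightarrow> bool" where
  "zero_hyperbolic T S \<longleftrightarrow>
     (\<forall>x1\<in>S. \<forall>x2\<in>S. \<forall>x3\<in>S. \<forall>x4\<in>S.
        mdist T x1 x2 + mdist T x3 x4
          \<le> max (mdist T x1 x3 + mdist T x2 x4) (mdist T x1 x4 + mdist T x2 x3))"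

definition isometric_on :: "real set \<Rightarrow> real metric \<Rightarrow> real metric \<Rightarrow> (real \<Rightarrow> real) \<Rightarrow> bool" where
  "isometric_on S T T' \<phi> \<longleftrightarrow>
     \<phi> ` S \<subseteq> mspace T' \<and> (\<forall>x\<in>S. \<forall>y\<in>S. mdist T' (\<phi> x) (\<phi> y) = mdist T x y)"

section \<open>Pointed metric measure spaces and the pointed Gromov-weak topology\<close>

record pmm =
  pmm_space :: "real metric"
  pmm_root :: real
  pmm_marks :: "real list"
  pmm_measure :: "real measure"

definition pmm_supp :: "pmm \<Rightarrow> real set" where
  "pmm_supp X =
     msupp (pmm_space X) (pmm_measure X) \<union> insert (pmm_root X) (set (pmm_marks X))"

definition pmm_spaces :: "nat \<Rightarrow> pmm set" where
  "pmm_spaces n = {X. pmm_root X \<in> mspace (pmm_space X) \<and>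
     length (pmm_marks X) = n \<and> set (pmm_marks X) \<subseteq> mspace (pmm_space X) \<and>
     admissible_measure (pmm_space X) (pmm_measure X)}"

definition pmm_equiv :: "pmm \<Rightarrow> pmm \<Rightarrow> bool" where
  "pmm_equiv X Y \<longleftrightarrow> (\<exists>\<phi>.
     isometric_on (pmm_supp X) (pmm_space X) (pmm_space Y) \<phi> \<and>
     \<phi> ` pmm_supp X = pmm_supp Y \<and>
     \<phi> (pmm_root X) = pmm_root Y \<and>
     map \<phi> (pmm_marks X) = pmm_marks Y \<and>
     distr (restrict_space (pmm_measure X) (pmm_supp X)) (borel_on (pmm_space Y)) \<phi>
       = pmm_measure Y)"

definition pmm_class :: "pmm \<Rightarrow> pmm set" where
  "pmm_class X = {Y \<in> pmm_spaces (length (pmm_marks X)). pmm_equiv X Y}"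

text \<open>The sets \<open>\<bbbM>\<^sub>n\<close> and \<open>\<bbbH>\<^sub>n\<close>.\<close>

definition pmm_classes :: "nat \<Rightarrow> pmm set set" where
  "pmm_classes n = pmm_class ` pmm_spaces n"

definition hyp_classes :: "nat \<Rightarrow> pmm set set" where
  "hyp_classes n = {C \<in> pmm_classes n. \<forall>X\<in>C. zero_hyperbolic (pmm_space X) (pmm_supp X)}"

definition representative :: "'a set \<Rightarrow> 'a" where
  "representative C = (SOME X. X \<in> C)"

text \<open>
  The distance matrix \<open>(r(x\<^sub>i, x\<^sub>j))\<close> for index pairs in \<open>I\<close>, where \<open>x\<^sub>0\<close> is the root; the
  point \<open>x\<^sub>k\<^sub>+\<^sub>1\<close> is stored as \<open>x k\<close>.
\<close>

definition dist_matrix ::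
    "(nat \<times> nat) set \<Rightarrow> real metric \<Rightarrow> real \<Rightarrow> (nat \<Rightarrow> real) \<Rightarrow> nat \<times> nat \<Rightarrow> real" where
  "dist_matrix I T \<rho> x = (\<lambda>(i, j)\<in>I. mdist T (case_nat \<rho> x i) (case_nat \<rho> x j))"

definition matrix_topology :: "(nat \<times> nat) set \<Rightarrow> (nat \<times> nat \<Rightarrow> real) topology" where
  "matrix_topology I = product_topology (\<lambda>_. euclideanreal) I"

definition all_pairs :: "(nat \<times> nat) set" where
  "all_pairs = {(i, j). i < j}"

definition pairs_upto :: "nat \<Rightarrow> (nat \<times> nat) set" where
  "pairs_upto n = {(i, j). i < j \<and> j \<le> n}"

definition upsilon :: "pmm \<Rightarrow> (nat \<times> nat \<Rightarrow> real) measure" where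
  "upsilon X =
     (let \<mu> = pmm_measure X; u = pmm_marks X; N = borel_of (matrix_topology all_pairs) in
      if total_mass \<mu> = 0 then null_measure N
      else scale_measure (total_mass \<mu>)
        (push_ae
          (\<Pi>\<^sub>M k\<in>UNIV. if k < length u then return (borel_on (pmm_space X)) (u ! k) else normalise \<mu>)
          N (dist_matrix all_pairs (pmm_space X) (pmm_root X))))"

text \<open>
  The topologies given by their convergent sequences are rendered as initial topologies with
  respect to the maps whose convergence is required. These are metrizable (a countable product of
  separable metrizable spaces is separable metrizable, and so are the finite measures on it with
  the weak topology), so that they are determined by their convergent sequences.
\<close>

definition pGw_topology :: "nat \<Rightarrow> pmm set topology" where
  "pGw_topology n =
     pullback_topology (hyp_classes n)
       (\<lambda>C. let X = representative C in
          (upsilon X,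
           dist_matrix (pairs_upto n) (pmm_space X) (pmm_root X) (\<lambda>k. pmm_marks X ! k)))
       (prod_topology (weak_topology (matrix_topology all_pairs)) (matrix_topology (pairs_upto n)))"

section \<open>Bi-measure trees and the LWV topology\<close>

record bitree =
  tree :: "real metric"
  rt :: real
  mu :: "real measure"
  nu :: "real measure"

definition rooted_R_tree :: "real metric \<Rightarrow> real \<Rightarrow> bool" where
  "rooted_R_tree T \<rho> \<longleftrightarrow>
     \<rho> \<in> mspace T \<and> connected_space (mtopology_of T) \<and> zero_hyperbolic T (mspace T)"

text \<open>
  The range of the unique path between two points of an \<open>\<real>\<close>-tree; see \<open>arc_eq_seg\<close> below.
\<close>

definition seg :: "real metric \<Rightarrow> real \<Rightarrow> real \<Rightarrow> real set" where
  "seg T x y = {z \<in> mspace T. mdist T x z + mdist T z y = mdist T x y}"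

definition gromov_prod :: "real metric \<Rightarrow> real \<Rightarrow> real \<Rightarrow> real \<Rightarrow> real" where
  "gromov_prod T z p q = (mdist T z p + mdist T z q - mdist T p q) / 2"

lemma mdist_self: "x \<in> mspace T \<Longrightarrow> mdist T x x = 0"
  by (rule mdist_zero[THEN iffD2]) auto

lemma gromov_prod_hyp:
  assumes "zero_hyperbolic T (mspace T)" "z \<in> mspace T" "p \<in> mspace T" "q \<in> mspace T" "r \<in> mspace T"
  shows "min (gromov_prod T z p r) (gromov_prod T z r q) \<le> gromov_prod T z p q"
proof -
  have "mdist T z r + mdist T p q \<le> max (mdist T z p + mdist T r q) (mdist T z q + mdist T r p)"
    using assms unfolding zero_hyperbolic_def by blast
  then show ?thesis
    unfolding gromov_prod_def min_le_iff_disj le_max_iff_disj using mdist_commute[of T r p] by argo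
qed

lemma gromov_prod_near:
  assumes "z \<in> mspace T" "p \<in> mspace T" "q \<in> mspace T"
  shows "mdist T z p - mdist T p q \<le> gromov_prod T z q p"
  using mdist_triangle[of z T q p] assms mdist_commute[of T q p] unfolding gromov_prod_def by (simp add: field_simps)

lemma openin_mtopology_of_iff:
  "openin (mtopology_of T) U \<longleftrightarrow>
     U \<subseteq> mspace T \<and> (\<forall>x\<in>U. \<exists>r>0. \<forall>y\<in>mspace T. mdist T x y < r \<longrightarrow> y \<in> U)"
proof -
  have "Metric_space.mball (mspace T) (mdist T) x r \<subseteq> U \<longleftrightarrow>
      (\<forall>y\<in>mspace T. mdist T x y < r \<longrightarrow> y \<in> U)" if "x \<in> mspace T" for x r
    unfolding Metric_space.mball_def[OF Metric_space_mspace_mdist] using that by blast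
  then show ?thesis
    unfolding mtopology_of_def Metric_space.openin_mtopology[OF Metric_space_mspace_mdist]
    by (metis subsetD)
qed

lemma seg_in_connected:
  assumes h: "zero_hyperbolic T (mspace T)" and S: "connectedin (mtopology_of T) S"
    and x: "x \<in> S" and y: "y \<in> S" and z: "z \<in> seg T x y"
  shows "z \<in> S"
proof (rule ccontr)
  assume nz: "z \<notin> S"
  have ST: "S \<subseteq> mspace T" using connectedin_subset_topspace[OF S] by simp
  have zT: "z \<in> mspace T" using z by (simp add: seg_def)
  have xT: "x \<in> mspace T" and yT: "y \<in> mspace T" using x y ST by auto
  define U where "U = {w \<in> mspace T. gromov_prod T z w x > 0}"
  define V where "V = {w \<in> mspace T. w \<noteq> z \<and> gromov_prod T z w x \<le> 0}"
  have pos: "w \<noteq> z \<Longrightarrow> w \<in> mspace T \<Longrightarrow> mdist T z w > 0" for w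
    using zT mdist_zero[of z T w] mdist_nonneg[of T z w] by linarith
  have Unz: "w \<noteq> z" if "w \<in> U" for w using that xT zT by (auto simp: U_def gromov_prod_def mdist_self)
  have loc: "gromov_prod T z v x > 0" if "w \<in> mspace T" "v \<in> mspace T" "gromov_prod T z w x > 0" "mdist T w v < mdist T z w" for v w
  proof -
    have "0 < gromov_prod T z v w" using gromov_prod_near[OF zT that(1,2)] that(4) by simp
    with gromov_prod_hyp[OF h zT that(2) xT that(1)] that(3) show ?thesis by linarith
  qed
  have loc2: "gromov_prod T z w x > 0" if "w \<in> mspace T" "v \<in> mspace T" "gromov_prod T z v x > 0" "mdist T w v < mdist T z w" for v w
  proof -
    have "0 < gromov_prod T z v w" using gromov_prod_near[OF zT that(1,2)] that(4) by simp
    moreover have "gromov_prod T z v w = gromov_prod T z w v" by (simp add: gromov_prod_def mdist_commute)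
    ultimately show ?thesis using gromov_prod_hyp[OF h zT that(1) xT that(2)] that(3) by linarith
  qed
  have "openin (mtopology_of T) U" unfolding openin_mtopology_of_iff
  proof (intro conjI ballI)
    fix w assume w: "w \<in> U"
    show "\<exists>r>0. \<forall>v\<in>mspace T. mdist T w v < r \<longrightarrow> v \<in> U"
      using w loc pos Unz by (intro exI[of _ "mdist T z w"]) (auto simp: U_def)
  qed (auto simp: U_def)
  moreover have "openin (mtopology_of T) V" unfolding openin_mtopology_of_iff
  proof (intro conjI ballI)
    fix w assume w: "w \<in> V"
    then have wT: "w \<in> mspace T" by (simp add: V_def)
    have "v \<in> V" if v: "v \<in> mspace T" "mdist T w v < mdist T z w" for v
    proof -
      have "v \<noteq> z" using v(2) mdist_commute[of T z w] by auto
      moreover have "\<not> gromov_prod T z v x > 0" using loc2[OF wT v(1) _ v(2)] w by (auto simp: V_def)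
      ultimately show ?thesis using v by (simp add: V_def)
    qed
    then show "\<exists>r>0. \<forall>v\<in>mspace T. mdist T w v < r \<longrightarrow> v \<in> V"
      using w pos by (intro exI[of _ "mdist T z w"]) (auto simp: V_def)
  qed (auto simp: V_def)
  moreover have "S \<subseteq> U \<union> V" using ST nz by (auto simp: U_def V_def)
  moreover have "U \<inter> V \<inter> S = {}" by (auto simp: U_def V_def)
  moreover have "x \<in> U" using pos[of x] x nz xT by (auto simp: U_def gromov_prod_def mdist_self)
  moreover have "y \<in> V" using y nz yT z by (auto simp: V_def gromov_prod_def seg_def mdist_commute)
  moreover have "\<not> (\<exists>U V. openin (mtopology_of T) U \<and> openin (mtopology_of T) V \<and> S \<subseteq> U \<union> V \<and>
      U \<inter> V \<inter> S = {} \<and> U \<inter> S \<noteq> {} \<and> V \<inter> S \<noteq> {})"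
    using S[unfolded connectedin] by (rule conjunct2)
  moreover have "U \<inter> S \<noteq> {}" "V \<inter> S \<noteq> {}"
    using \<open>x \<in> U\<close> \<open>y \<in> V\<close> x y by auto
  ultimately show False by meson
qed

lemma seg_point_exists:
  assumes h: "zero_hyperbolic T (mspace T)" and c: "connected_space (mtopology_of T)"
    and xT: "x \<in> mspace T" and yT: "y \<in> mspace T" and a: "0 \<le> a" "a \<le> mdist T x y"
  shows "\<exists>p\<in>seg T x y. mdist T x p = a"
proof (rule ccontr)
  assume n: "\<not> ?thesis"
  have "a \<noteq> mdist T x y" using n yT by (force simp: seg_def)
  then have a2: "a < mdist T x y" using a by simp
  define U where "U = {w \<in> mspace T. gromov_prod T x w y \<le> a}"
  define V where "V = {w \<in> mspace T. gromov_prod T x w y > a}"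
  have lip: "\<bar>gromov_prod T x v y - gromov_prod T x w y\<bar> \<le> mdist T w v"
    if "v \<in> mspace T" "w \<in> mspace T" for v w
    using mdist_triangle[of x T w v] mdist_triangle[of x T v w] mdist_triangle[of w T v y]
      mdist_triangle[of v T w y] xT yT that mdist_commute[of T v w]
    by (simp add: gromov_prod_def field_simps abs_le_iff)
  have eqc: "\<exists>r>0. \<forall>v\<in>mspace T. mdist T w v < r \<longrightarrow> gromov_prod T x v y \<le> a"
    if w: "w \<in> mspace T" and e: "gromov_prod T x w y = a" for w
  proof (intro exI[of _ "mdist T x w - a"] conjI ballI impI)
    have "mdist T x w \<noteq> a"
    proof
      assume eq: "mdist T x w = a"
      then have "w \<in> seg T x y" using w e by (simp add: seg_def gromov_prod_def field_simps)
      with n eq show False by blast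
    qed
    moreover have "a \<le> mdist T x w" using e mdist_triangle[of x T w y] xT yT w by (simp add: gromov_prod_def field_simps)
    ultimately show "0 < mdist T x w - a" by simp
    fix v assume v: "v \<in> mspace T" "mdist T w v < mdist T x w - a"
    have "a < gromov_prod T x v w" using gromov_prod_near[OF xT w v(1)] v(2) by simp
    moreover have "gromov_prod T x v w = gromov_prod T x w v" by (simp add: gromov_prod_def mdist_commute)
    ultimately show "gromov_prod T x v y \<le> a" using gromov_prod_hyp[OF h xT w yT v(1)] e by linarith
  qed
  have "openin (mtopology_of T) U" unfolding openin_mtopology_of_iff
  proof (intro conjI ballI)
    fix w assume w: "w \<in> U"
    show "\<exists>r>0. \<forall>v\<in>mspace T. mdist T w v < r \<longrightarrow> v \<in> U"
    proof (cases "gromov_prod T x w y = a")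
      case True with w eqc show ?thesis unfolding U_def by simp
    next
      case False
      have "v \<in> U" if v: "v \<in> mspace T" "mdist T w v < a - gromov_prod T x w y" for v
        using lip[OF v(1), of w] v w by (simp add: U_def abs_le_iff)
      then show ?thesis
        using w False by (intro exI[of _ "a - gromov_prod T x w y"]) (simp add: U_def)
    qed
  qed (simp add: U_def)
  moreover have "openin (mtopology_of T) V" unfolding openin_mtopology_of_iff
  proof (intro conjI ballI)
    fix w assume w: "w \<in> V"
    have "v \<in> V" if v: "v \<in> mspace T" "mdist T w v < gromov_prod T x w y - a" for v
      using lip[OF v(1), of w] v w by (simp add: V_def abs_le_iff)
    then show "\<exists>r>0. \<forall>v\<in>mspace T. mdist T w v < r \<longrightarrow> v \<in> V"
      using w by (intro exI[of _ "gromov_prod T x w y - a"]) (simp add: V_def)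
  qed (simp add: V_def)
  moreover have "mspace T \<subseteq> U \<union> V" "U \<inter> V = {}" by (auto simp: U_def V_def)
  moreover have "x \<in> U" using xT a by (auto simp: U_def gromov_prod_def mdist_self)
  moreover have "y \<in> V" using yT a2 by (auto simp: V_def gromov_prod_def mdist_self)
  moreover have "U \<noteq> {}" "V \<noteq> {}"
    using \<open>x \<in> U\<close> \<open>y \<in> V\<close> by auto
  moreover have "\<not> (\<exists>U V. openin (mtopology_of T) U \<and> openin (mtopology_of T) V \<and> mspace T \<subseteq> U \<union> V \<and>
      U \<inter> V = {} \<and> U \<noteq> {} \<and> V \<noteq> {})"
    using c[unfolded connected_space_def topspace_mtopology_of] .
  ultimately show False by meson
qed

lemma arc_eq_seg:
  assumes T: "rooted_R_tree T \<rho>" and g: "pathin (mtopology_of T) g" and inj: "inj_on g {0..1}"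
  shows "g ` {0..1} = seg T (g 0) (g 1)"
proof
  have h: "zero_hyperbolic T (mspace T)" and c: "connected_space (mtopology_of T)"
    using T by (auto simp: rooted_R_tree_def)
  have con: "connectedin (mtopology_of T) (g ` {s..t})" if "0 \<le> s" "t \<le> 1" for s t
  proof (rule connectedin_continuous_map_image)
    show "continuous_map (top_of_set {0..1}) (mtopology_of T) g" using g by (simp add: pathin_def)
    show "connectedin (top_of_set {0..1}) {s..t}" using that by (simp add: connectedin_subtopology)
  qed
  show "seg T (g 0) (g 1) \<subseteq> g ` {0..1}"
  proof
    fix z assume "z \<in> seg T (g 0) (g 1)"
    then show "z \<in> g ` {0..1}"
      by (rule seg_in_connected[OF h con, rotated -1]) simp_all
  qed
  have gT: "g s \<in> mspace T" if "s \<in> {0..1}" for s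
    using connectedin_subset_topspace[OF con[of 0 1]] that by auto
  show "g ` {0..1} \<subseteq> seg T (g 0) (g 1)"
  proof (rule ccontr)
    assume "\<not> ?thesis"
    then obtain s where s: "s \<in> {0..1}" and ns: "g s \<notin> seg T (g 0) (g 1)"
      by (meson image_subsetI)
    let ?x = "g 0" and ?y = "g 1" and ?w = "g s"
    have xT: "?x \<in> mspace T" and yT: "?y \<in> mspace T" and wT: "?w \<in> mspace T" using gT s by auto
    define a where "a = gromov_prod T ?x ?y ?w"
    have "0 \<le> a" "a \<le> mdist T ?x ?y"
      using mdist_triangle[OF yT xT wT] mdist_triangle[OF xT yT wT] mdist_commute[of T ?y ?x]
      unfolding a_def gromov_prod_def by simp_all
    from seg_point_exists[OF h c xT yT this]
    obtain p where p: "p \<in> seg T ?x ?y" and pa: "mdist T ?x p = a" by (rule bexE)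
    have pT: "p \<in> mspace T" using p by (simp add: seg_def)
    have py: "mdist T p ?y = mdist T ?x ?y - a" using p pa by (simp add: seg_def)
    have "mdist T p ?w + mdist T ?x ?y \<le> max (mdist T p ?x + mdist T ?w ?y) (mdist T p ?y + mdist T ?w ?x)"
      using h pT wT xT yT unfolding zero_hyperbolic_def by blast
    then have le: "mdist T p ?w \<le> mdist T ?x ?w - a"
      using pa py mdist_commute[of T p ?x] mdist_commute[of T ?w ?x] mdist_commute[of T ?w ?y]
      unfolding a_def gromov_prod_def le_max_iff_disj by argo
    have "p \<in> seg T ?x ?w"
      using le pa pT mdist_triangle[of ?x T p ?w] xT wT by (simp add: seg_def)
    moreover have "p \<in> seg T ?w ?y"
    proof -
      have "mdist T ?w p + mdist T p ?y \<le> mdist T ?w ?y"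
        using le py mdist_commute[of T p ?w] mdist_commute[of T ?w ?y]
        unfolding a_def gromov_prod_def by argo
      then show ?thesis using mdist_triangle[of ?w T p ?y] yT wT pT by (simp add: seg_def)
    qed
    moreover have "?x \<in> g ` {0..s}" "?w \<in> g ` {0..s}" "?w \<in> g ` {s..1}" "?y \<in> g ` {s..1}"
      using s by simp_all
    moreover have "connectedin (mtopology_of T) (g ` {0..s})" "connectedin (mtopology_of T) (g ` {s..1})"
      using con s by simp_all
    ultimately have p1: "p \<in> g ` {0..s}" and p2: "p \<in> g ` {s..1}"
      using \<open>p \<in> seg T ?x ?w\<close> \<open>p \<in> seg T ?w ?y\<close> by - (rule seg_in_connected[OF h], assumption+)+
    obtain s1 where s1: "s1 \<in> {0..s}" "p = g s1" using p1 by (rule imageE)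
    obtain s2 where s2: "s2 \<in> {s..1}" "p = g s2" using p2 by (rule imageE)
    have "s1 = s2"
      by (rule inj_onD[OF inj]) (use s s1 s2 in simp_all)
    then have "s1 = s" using s1(1) s2(1) by simp
    then have "p = ?w" using s1(2) by simp
    with p ns show False by simp
  qed
qed

definition span_tree :: "real metric \<Rightarrow> real \<Rightarrow> real set \<Rightarrow> real set" where
  "span_tree T \<rho> A = insert \<rho> (\<Union>v\<in>A. seg T \<rho> v)"

definition skeleton :: "bitree \<Rightarrow> real set" where
  "skeleton X =
     (\<Union>v\<in>msupp (tree X) (mu X). seg (tree X) (rt X) v - {v}) \<union>
     {v \<in> mspace (tree X). 0 < emeasure (mu X) {v}}"

definition supp_tree :: "bitree \<Rightarrow> real set" where
  "supp_tree X = span_tree (tree X) (rt X) (msupp (tree X) (mu X))"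

definition leaves :: "bitree \<Rightarrow> real set" where
  "leaves X = supp_tree X - skeleton X"

definition bitrees :: "bitree set" where
  "bitrees = {X. rooted_R_tree (tree X) (rt X) \<and>
     admissible_measure (tree X) (mu X) \<and>
     sets (nu X) = sets (borel_on (tree X)) \<and> sigma_finite_measure (nu X) \<and>
     (AE u in mu X. emeasure (nu X) (seg (tree X) (rt X) u) < \<infinity>) \<and>
     emeasure (nu X) (leaves X) = 0}"

definition bitree_equiv :: "bitree \<Rightarrow> bitree \<Rightarrow> bool" where
  "bitree_equiv X Y \<longleftrightarrow> (\<exists>\<phi>.
     isometric_on (supp_tree X) (tree X) (tree Y) \<phi> \<and>
     \<phi> (rt X) = rt Y \<and>
     distr (restrict_space (mu X) (supp_tree X)) (borel_on (tree Y)) \<phi> = mu Y \<and>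
     distr (restrict_space (nu X) (skeleton X)) (borel_on (tree Y)) \<phi>
       = density (nu Y) (indicator (skeleton Y)))"

text \<open>
  The class is also formed for \<open>X\<close> outside \<^const>\<open>bitrees\<close>, as it is needed for pruned trees.
  If the support of \<open>\<mu>\<close> is separable but not complete, the isometries \<open>\<phi>\<close> into trees
  \<open>Y\<close> with complete support are exactly the identifications with the completion (the isometry is
  not required to be onto, and the support of \<open>mu Y\<close> is the closure of the image of the
  support of \<open>mu X\<close>). If \<open>nu X\<close> charges leaves, that part of \<open>nu X\<close> is ignored,
  because only its restriction to the skeleton enters.
\<close>

definition bitree_class :: "bitree \<Rightarrow> bitree set" where
  "bitree_class X = {Y \<in> bitrees. bitree_equiv X Y}"

text \<open>The set \<open>\<bbbH>\<^sup>f\<^sup>,\<^sup>\<sigma>\<close>.\<close>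

definition bitree_classes :: "bitree set set" where
  "bitree_classes = bitree_class ` bitrees"

text \<open>
  Where \<open>nu X\<close> is infinite on the spanned subtree (a null set of tuples), it is replaced by
  the null measure to make the map total.
\<close>

definition tau :: "bitree \<Rightarrow> real list \<Rightarrow> pmm set" where
  "tau X us =
     (let S = span_tree (tree X) (rt X) (set us); \<nu> = restrict_space (nu X) S in
      pmm_class
        \<lparr>pmm_space = submetric (tree X) S, pmm_root = rt X, pmm_marks = us,
         pmm_measure = (if emeasure (nu X) S < \<infinity> then \<nu> else null_measure \<nu>)\<rparr>)"

text \<open>The sequence \<open>(u\<^sub>1, u\<^sub>2, \<dots>)\<close> is stored as \<open>(u 0, u 1, \<dots>)\<close>.\<close>

definition varsigma :: "bitree \<Rightarrow> (nat \<Rightarrow> real) \<Rightarrow> nat \<Rightarrow> pmm set" where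
  "varsigma X u = (\<lambda>n\<in>{1..}. tau X (map u [0..<n]))"

definition tau_topology :: "(nat \<Rightarrow> pmm set) topology" where
  "tau_topology = product_topology pGw_topology {1..}"

definition varpi :: "bitree \<Rightarrow> (nat \<Rightarrow> pmm set) measure" where
  "varpi X =
     (let N = borel_of tau_topology in
      if total_mass (mu X) = 0 then null_measure N
      else scale_measure (total_mass (mu X))
        (push_ae (\<Pi>\<^sub>M k\<in>(UNIV :: nat set). normalise (mu X)) N (varsigma X)))"

definition LWV_topology :: "bitree set topology" where
  "LWV_topology =
     pullback_topology bitree_classes (\<lambda>C. varpi (representative C)) (weak_topology tau_topology)"

section \<open>The pruning process\<close>

text \<open>A measure that is a countable sum of unit point masses.\<close>

definition point_measure_on :: "'a measure \<Rightarrow> 'a measure \<Rightarrow> bool" where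
  "point_measure_on \<Lambda> P \<longleftrightarrow>
     (\<exists>(I :: nat set) x. x \<in> I \<rightarrow> space \<Lambda> \<and> P = distr (count_space I) \<Lambda> x)"

definition poisson_point_measure :: "'w measure \<Rightarrow> 'a measure \<Rightarrow> ('w \<Rightarrow> 'a measure) \<Rightarrow> bool" where
  "poisson_point_measure \<Omega> \<Lambda> \<pi> \<longleftrightarrow>
     prob_space \<Omega> \<and>
     (\<forall>\<omega>\<in>space \<Omega>. point_measure_on \<Lambda> (\<pi> \<omega>)) \<and>
     (\<forall>B\<in>sets \<Lambda>. (\<lambda>\<omega>. emeasure (\<pi> \<omega>) B) \<in> borel_measurable \<Omega>) \<and>
     (\<forall>B\<in>sets \<Lambda>. emeasure \<Lambda> B < \<infinity> \<longrightarrow>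
        (\<forall>k::nat. measure \<Omega> {\<omega>\<in>space \<Omega>. emeasure (\<pi> \<omega>) B = of_nat k}
           = measure \<Lambda> B ^ k / fact k * exp (- measure \<Lambda> B))) \<and>
     (\<forall>B :: nat \<Rightarrow> 'a set. range B \<subseteq> sets \<Lambda> \<and> disjoint_family B \<longrightarrow>
        prob_space.indep_vars \<Omega> (\<lambda>_. borel) (\<lambda>i \<omega>. emeasure (\<pi> \<omega>) (B i)) UNIV)"

definition pruning_intensity :: "bitree \<Rightarrow> (real \<times> real) measure" where
  "pruning_intensity X = restrict_space lborel {0..} \<Otimes>\<^sub>M nu X"

text \<open>The atoms of \<open>\<pi>\<^sub>t = P([0,t] \<times> \<cdot>)\<close>, for a realisation \<open>P\<close> of the Poisson point measure.\<close>

definition cut_points :: "bitree \<Rightarrow> (real \<times> real) measure \<Rightarrow> real \<Rightarrow> real set" where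
  "cut_points X P t = {v \<in> mspace (tree X). 0 < emeasure P ({0..t} \<times> {v})}"

definition prune_set :: "bitree \<Rightarrow> real set \<Rightarrow> real set" where
  "prune_set X A = {w \<in> mspace (tree X). \<forall>v\<in>A. v \<notin> seg (tree X) (rt X) w}"

definition prune :: "bitree \<Rightarrow> real set \<Rightarrow> bitree" where
  "prune X A =
     (let S = prune_set X A in
      if S = {} then
        (let T0 = submetric (tree X) {rt X} in
         \<lparr>tree = T0, rt = rt X, mu = null_measure (borel_on T0), nu = null_measure (borel_on T0)\<rparr>)
      else
        \<lparr>tree = submetric (tree X) S, rt = rt X,
         mu = restrict_space (mu X) S, nu = restrict_space (nu X) S\<rparr>)"

text \<open>
  \<open>S\<^sub>t G\<close> as a function on classes: for a class \<open>C\<close> the process is realised on the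
  probability space \<open>\<Omega> C\<close> by means of the representative \<open>X C\<close> and the Poisson
  point measure \<open>\<pi> C\<close>. The expectation is taken with respect to the completed probability
  measure, so that the integrand has to be measurable only up to null sets.
\<close>

definition pruning_semigroup ::
    "(bitree set \<Rightarrow> bitree) \<Rightarrow> (bitree set \<Rightarrow> 'w measure) \<Rightarrow>
     (bitree set \<Rightarrow> 'w \<Rightarrow> (real \<times> real) measure) \<Rightarrow> real \<Rightarrow>
     (bitree set \<Rightarrow> real) \<Rightarrow> bitree set \<Rightarrow> real" where
  "pruning_semigroup X \<Omega> \<pi> t G C =
     (\<integral>\<omega>. G (bitree_class (prune (X C) (cut_points (X C) (\<pi> C \<omega>) t))) \<partial>completion (\<Omega> C))"

end

theory Submission imports Defs begin

text \<open>
  The pointed Gromov-weak and the LWV topology are initial topologies for countably many bounded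
  functionals which form an algebra: distances between sampled points, \<open>exp (- a)\<close> with \<open>a\<close>
  the mass of the spanned subtree, and \<open>exp (- 2 a)\<close> times the moments of the distance matrix under the
  unnormalised measure on this subtree. By Stone-Weierstrass, a kernel into \<open>\<bbbH>\<^sup>f\<^sup>,\<^sup>\<sigma>\<close> is weakly
  continuous once the expectations of products of these coordinates are continuous. For the
  pruned tree such a product only involves points that have not been cut off. Sampling them from
  the original tree and integrating out the Poisson cuts gives the factor
  \<open>exp (- t a)\<close>, where \<open>a\<close> is the mass of the subtree spanned by all the sampled points, times
  functionals of subtrees spanned by blocks of these points. The latter are not continuous in the
  Gromov-weak topology, but they are limits of continuous functions, and the approximation error is
  controlled by shift invariance of the sample.
\<close>

text \<open>The range of the coordinates need not be closed in the compact cube, so a bounded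
  continuous function need not extend to the cube: Stone-Weierstrass only reaches functions
  continuous on the whole cube. The others follow by a portmanteau argument, with approximation from
  below of both \<open>C + f\<close> and \<open>C - f\<close>. Moments are taken under unnormalised
  measures because restriction to a smaller subtree, or to the surviving points, then only inserts
  indicator factors, whereas normalising divides by masses that may vanish. The factor
  \<open>exp (- 2 a)\<close> instead of \<open>exp (- a)\<close> has two uses:
  \<open>a ^ m * exp (- 2 a)\<close> is bounded, and if \<open>a\<close> is overestimated by
  \<open>b\<close>, the error in every moment is at most a constant times
  \<open>exp (- a) - exp (- b)\<close>; with \<open>exp (- a)\<close> this comparison would fail for
  large \<open>a\<close>. So only the error of the mass functional has to be controlled. That error
  has a sign, and its integral is a difference of two continuous functions. The coordinates of the
  LWV topology grow with the mass of the tree, so the final argument is local in the mass.\<close>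

abbreviation "tree_span X \<equiv> span_tree (tree X) (rt X)"
abbreviation "matrix_borel \<equiv> borel_of (matrix_topology all_pairs)"

section \<open>Topologies generated by real-valued coordinates\<close>

lemma continuous_map_real_iff_tendsto:
  "continuous_map Z euclideanreal g \<longleftrightarrow> (\<forall>z\<in>topspace Z. (g \<longlongrightarrow> g z) (atin Z z))"
  by (simp add: continuous_map_atin)

lemma continuous_map_real_tendsto:
  "continuous_map Z euclideanreal g ==> z \<in> topspace Z ==> (g \<longlongrightarrow> g z) (atin Z z)"
  by (simp add: continuous_map_real_iff_tendsto)

lemma eventually_atin_topspace: "z \<in> topspace Z ==> \<forall>\<^sub>F y in atin Z z. y \<in> topspace Z"
  by (auto simp: eventually_atin intro!: exI[of _ "topspace Z"])

text \<open>The initial topology of the functions \<open>\<lambda>x. h x i\<close>, since function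
  types carry the product topology. The matrix space, the space of sequences of sampled subtrees and
  the LWV topology are all of this form, which makes \<open>weak_continuity\<close> applicable three
  times.\<close>

definition coord_topology :: "'a set \<Rightarrow> ('a \<Rightarrow> 'i \<Rightarrow> real) \<Rightarrow> 'a topology" where
  "coord_topology A h = pullback_topology A h euclidean"

lemma topspace_coord_topology [simp]: "topspace (coord_topology A h) = A"
  by (simp add: coord_topology_def topspace_pullback_topology)

lemma openin_coord_topology:
  "openin (coord_topology A h) U \<longleftrightarrow> (\<exists>V. open V \<and> U = h -` V \<inter> A)"
  by (simp add: coord_topology_def openin_pullback_topology)

lemma continuous_map_coord: "continuous_map (coord_topology A h) euclideanreal (\<lambda>x. h x i)"
proof -
  have "continuous_map euclidean euclideanreal (\<lambda>w :: 'b \<Rightarrow> real. w i)"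
    by simp
  then have "continuous_map (pullback_topology A h euclidean) euclideanreal ((\<lambda>w. w i) \<circ> h)"
    by (rule continuous_map_pullback)
  then show ?thesis by (simp add: coord_topology_def o_def)
qed

lemma continuous_map_into_coord_topology:
  assumes "\<And>z. z \<in> topspace Z ==> g z \<in> A"
    and "\<And>i. continuous_map Z euclideanreal (\<lambda>z. h (g z) i)"
  shows "continuous_map Z (coord_topology A h) g"
  unfolding coord_topology_def
proof (rule continuous_map_pullback')
  have "continuous_map Z (product_topology (\<lambda>i. euclidean) UNIV) (h \<circ> g)"
    using assms(2) by (auto simp: continuous_map_componentwise_UNIV)
  then show "continuous_map Z euclidean (h \<circ> g)"
    by (simp add: euclidean_product_topology)
qed (use assms(1) in auto)

lemma topology_eqI_continuous_id:
  assumes "topspace E = topspace E'" "continuous_map E E' (\<lambda>x. x)" "continuous_map E' E (\<lambda>x. x)"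
  shows "E = E'"
proof -
  have "openin E' U ==> openin E U" for U
    using openin_continuous_map_preimage[OF assms(2), of U] openin_subset[of E' U] assms(1)
    by (auto simp: Collect_conj_eq Int_absorb1)
  moreover have "openin E U ==> openin E' U" for U
    using openin_continuous_map_preimage[OF assms(3), of U] openin_subset[of E U] assms(1)
    by (auto simp: Collect_conj_eq Int_absorb1)
  ultimately show ?thesis by (auto simp: topology_eq)
qed

text \<open>The first premise makes \<open>E\<close> at least as fine as the coordinate topology,
  the second at most as fine. In applications the second one comes from a criterion for continuity
  into \<open>E\<close>.\<close>

lemma coord_topology_eqI:
  assumes "\<And>i. continuous_map E euclideanreal (\<lambda>x. h x i)"
    and "continuous_map (coord_topology (topspace E) h) E (\<lambda>x. x)"
  shows "E = coord_topology (topspace E) h"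
  by (rule topology_eqI_continuous_id)
     (use assms in \<open>auto intro!: continuous_map_into_coord_topology\<close>)

text \<open>Used to pass to trees of bounded mass, where the coordinates \<open>Psi\<close> are
  bounded.\<close>

lemma subtopology_coord_topology:
  "subtopology (coord_topology A h) B = coord_topology (A \<inter> B) h"
  unfolding topology_eq openin_subtopology openin_coord_topology by (auto; blast)

section \<open>Borel structures of abstract topologies\<close>

lemma space_borel_of [simp]: "space (borel_of E) = topspace E"
  by (simp add: borel_of_def space_measure_of_conv)

lemma sets_borel_of: "sets (borel_of E) = sigma_sets (topspace E) {U. openin E U}"
  unfolding borel_of_def by (rule sets_measure_of) (auto dest: openin_subset)

lemma openin_in_sets_borel_of: "openin E U ==> U \<in> sets (borel_of E)"
  by (auto simp: sets_borel_of)

lemma closedin_in_sets_borel_of: "closedin E U ==> U \<in> sets (borel_of E)"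
  using sets.compl_sets[OF openin_in_sets_borel_of[of E "topspace E - U"]]
  by (auto simp: closedin_def double_diff)

lemma continuous_map_measurable_borel_of:
  assumes "continuous_map E E' f"
  shows "f \<in> measurable (borel_of E) (borel_of E')"
  unfolding borel_of_def[of E']
proof (rule measurable_measure_of)
  show "f \<in> space (borel_of E) \<rightarrow> topspace E'"
    using assms by (auto simp: continuous_map_def)
  fix U assume "U \<in> {U. openin E' U}"
  then have "openin E {x \<in> topspace E. f x \<in> U}"
    using assms openin_continuous_map_preimage by blast
  moreover have "f -` U \<inter> space (borel_of E) = {x \<in> topspace E. f x \<in> U}" by auto
  ultimately show "f -` U \<inter> space (borel_of E) \<in> sets (borel_of E)"
    by (auto intro: openin_in_sets_borel_of)
qed (auto dest: openin_subset)

lemma continuous_map_real_borel_measurable: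
  "continuous_map E euclideanreal f ==> f \<in> borel_measurable (borel_of E)"
proof -
  assume "continuous_map E euclideanreal f"
  then have "f \<in> measurable (borel_of E) (borel_of euclideanreal)"
    by (rule continuous_map_measurable_borel_of)
  then show ?thesis by (simp add: borel_of_def borel_def)
qed

lemma measurable_coord_map:
  fixes h :: "'a \<Rightarrow> 'i :: countable \<Rightarrow> real"
  assumes "\<And>i. (\<lambda>x. h (f x) i) \<in> borel_measurable M"
  shows "(\<lambda>x. h (f x)) \<in> borel_measurable M"
  by (intro measurable_coordinatewise_then_product) (use assms in auto)

text \<open>Countability of the index type makes the Borel sets of the product of lines the product
  \<sigma>-algebra, so that coordinatewise measurability suffices.\<close>

lemma measurable_into_coord_topology:
  fixes h :: "'a \<Rightarrow> 'i :: countable \<Rightarrow> real"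
  assumes "\<And>x. x \<in> space M ==> f x \<in> A" "\<And>i. (\<lambda>x. h (f x) i) \<in> borel_measurable M"
  shows "f \<in> measurable M (borel_of (coord_topology A h))"
  unfolding borel_of_def
proof (rule measurable_measure_of)
  show "f \<in> space M \<rightarrow> topspace (coord_topology A h)"
    using assms(1) by auto
  fix U assume "U \<in> {U. openin (coord_topology A h) U}"
  then obtain V where V: "open V" "U = h -` V \<inter> A" by (auto simp: openin_coord_topology)
  have "(\<lambda>x. h (f x)) -` V \<inter> space M \<in> sets M"
    using measurable_coord_map[of h f M, OF assms(2)] V(1) by (intro measurable_sets) auto
  moreover have "f -` U \<inter> space M = (\<lambda>x. h (f x)) -` V \<inter> space M"
    using V assms(1) by auto
  ultimately show "f -` U \<inter> space M \<in> sets M" by simp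
qed (use openin_subset in fastforce)

section \<open>Polynomials on a compact cube\<close>

inductive_set coord_poly :: "(('i \<Rightarrow> real) \<Rightarrow> real) set" where
  const: "(\<lambda>_. c) \<in> coord_poly"
| add: "f \<in> coord_poly ==> g \<in> coord_poly ==> (\<lambda>w. f w + g w) \<in> coord_poly"
| coord: "f \<in> coord_poly ==> (\<lambda>w. w i * f w) \<in> coord_poly"

lemma coord_poly_scale: "f \<in> coord_poly ==> (\<lambda>w. c * f w) \<in> coord_poly"
proof (induction rule: coord_poly.induct)
  case (add f g)
  then show ?case using coord_poly.add by (force simp: distrib_left)
next
  case (coord f i)
  then show ?case using coord_poly.coord[of "\<lambda>w. c * f w" i] by (simp add: mult.left_commute)
qed (auto intro: coord_poly.const)

lemma coord_poly_mult: "f \<in> coord_poly ==> g \<in> coord_poly ==> (\<lambda>w. f w * g w) \<in> coord_poly"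
proof (induction rule: coord_poly.induct)
  case (add f g)
  then show ?case using coord_poly.add by (force simp: distrib_right)
next
  case (coord f i)
  then show ?case using coord_poly.coord[of "\<lambda>w. f w * g w" i] by (simp add: mult.assoc)
qed (auto intro: coord_poly_scale)

lemma coord_poly_continuous: "f \<in> coord_poly ==> continuous_on UNIV f"
  by (induction rule: coord_poly.induct) (auto intro!: continuous_intros)

lemma compact_cube: "compact {w :: 'i \<Rightarrow> real. \<forall>i. \<bar>w i\<bar> \<le> B i}"
proof -
  have "compactin (product_topology (\<lambda>i::'i. euclideanreal) UNIV) (PiE UNIV (\<lambda>i. {- B i..B i}))"
    by (simp add: compactin_PiE)
  moreover have "PiE UNIV (\<lambda>i. {- B i..B i}) = {w :: 'i \<Rightarrow> real. \<forall>i. \<bar>w i\<bar> \<le> B i}"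
    by (auto simp: PiE_def Pi_def abs_le_iff) (metis minus_le_iff)+
  ultimately show ?thesis by (simp add: euclidean_product_topology)
qed

text \<open>The cube is compact by Tychonoff, and single coordinates separate its points.\<close>

lemma coord_poly_dense:
  fixes g :: "('i :: countable \<Rightarrow> real) \<Rightarrow> real"
  assumes "continuous_on {w. \<forall>i. \<bar>w i\<bar> \<le> B i} g" "e > 0"
  shows "\<exists>p\<in>coord_poly. \<forall>w. (\<forall>i. \<bar>w i\<bar> \<le> B i) \<longrightarrow> \<bar>g w - p w\<bar> < e"
proof -
  interpret function_ring_on "coord_poly :: (('i \<Rightarrow> real) \<Rightarrow> real) set" "{w. \<forall>i. \<bar>w i\<bar> \<le> B i}"
  proof
    fix x y :: "'i \<Rightarrow> real"
    assume "x \<noteq> y"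
    then obtain i where "x i \<noteq> y i" by auto
    moreover have "(\<lambda>w. w i * (\<lambda>_. 1) w) \<in> coord_poly"
      by (intro coord_poly.intros)
    ultimately show "\<exists>f\<in>coord_poly. f x \<noteq> f y"
      by (intro bexI[of _ "\<lambda>w. w i * 1"]) auto
  qed (auto intro: coord_poly.intros coord_poly_mult compact_cube
      continuous_on_subset[OF coord_poly_continuous])
  show ?thesis using Stone_Weierstrass_basic[OF assms] by auto
qed

text \<open>Continuity of all moments shall imply weak continuity of the kernel. \<open>B\<close>
  puts the range of \<open>h\<close> into a compact cube, and the empty list in
  \<open>monomials\<close> gives continuity of the total mass. \<open>Z\<close> is an arbitrary
  topological space, so limits are taken along the filters \<open>atin Z z\<close>.\<close>

locale weak_continuity =
  fixes A :: "'a set" and h :: "'a \<Rightarrow> 'i :: countable \<Rightarrow> real" and B :: "'i \<Rightarrow> real"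
    and Z :: "'z topology" and \<kappa> :: "'z \<Rightarrow> 'a measure"
  assumes h_bound: "\<And>x i. x \<in> A ==> \<bar>h x i\<bar> \<le> B i"
    and sets_\<kappa>: "\<And>z. z \<in> topspace Z ==> sets (\<kappa> z) = sets (borel_of (coord_topology A h))"
    and finite_\<kappa>: "\<And>z. z \<in> topspace Z ==> finite_measure (\<kappa> z)"
    and monomials: "\<And>l. continuous_map Z euclideanreal (\<lambda>z. \<integral>x. (\<Prod>i\<leftarrow>l. h x i) \<partial>\<kappa> z)"
begin

lemma space_\<kappa>: "z \<in> topspace Z ==> space (\<kappa> z) = A"
  using sets_eq_imp_space_eq[OF sets_\<kappa>] by simp

lemma h_measurable: "z \<in> topspace Z ==> h \<in> borel_measurable (\<kappa> z)"
proof -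
  assume z: "z \<in> topspace Z"
  have "(\<lambda>x. h x i) \<in> borel_measurable (borel_of (coord_topology A h))" for i
    by (intro continuous_map_real_borel_measurable continuous_map_coord)
  then have "(\<lambda>x. h ((\<lambda>x. x) x)) \<in> borel_measurable (borel_of (coord_topology A h))"
    by (intro measurable_coord_map)
  then show ?thesis using measurable_cong_sets[OF sets_\<kappa>[OF z] refl, of borel] by auto
qed

lemma integrable_bounded:
  assumes "z \<in> topspace Z" "f \<in> borel_measurable (\<kappa> z)" "\<And>x. x \<in> A ==> \<bar>f x\<bar> \<le> C"
  shows "integrable (\<kappa> z) (f :: 'a \<Rightarrow> real)"
proof -
  interpret finite_measure "\<kappa> z" using assms(1) by (rule finite_\<kappa>)
  show ?thesis
    by (rule integrable_const_bound[where B=C]) (use assms space_\<kappa>[OF assms(1)] in auto)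
qed

abbreviation "cube \<equiv> {w. \<forall>i. \<bar>w i\<bar> \<le> B i}"

lemma h_cube: "x \<in> A ==> h x \<in> cube"
  using h_bound by auto

lemma integrable_coord:
  assumes z: "z \<in> topspace Z" and g: "continuous_on UNIV g"
  shows "integrable (\<kappa> z) (\<lambda>x. g (h x) :: real)"
proof -
  have "compact (g ` cube)"
    by (intro compact_continuous_image continuous_on_subset[OF g] compact_cube) auto
  then obtain C where C: "\<And>w. w \<in> cube ==> \<bar>g w\<bar> \<le> C"
    using compact_imp_bounded[of "g ` cube"] unfolding bounded_iff by fastforce
  show ?thesis
  proof (rule integrable_bounded[OF z])
    show "(\<lambda>x. g (h x)) \<in> borel_measurable (\<kappa> z)"
      using h_measurable[OF z] borel_measurable_continuous_onI[OF g] by (rule measurable_compose)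
  qed (use C h_cube in blast)
qed

lemma mono_continuous: "continuous_on UNIV (\<lambda>w :: 'i \<Rightarrow> real. \<Prod>i\<leftarrow>l. w i)"
  by (induction l) (auto intro!: continuous_intros)

text \<open>The extra monomial \<open>l\<close> makes the induction work: a coordinate factor of the
  polynomial is moved into the list.\<close>

lemma poly_continuous:
  assumes "p \<in> coord_poly"
  shows "continuous_map Z euclideanreal (\<lambda>z. \<integral>x. p (h x) * (\<Prod>i\<leftarrow>l. h x i) \<partial>\<kappa> z)"
  using assms
proof (induction arbitrary: l rule: coord_poly.induct)
  case (const c)
  then show ?case using monomials[of l] by (auto intro!: continuous_intros)
next
  case (add f g)
  have "continuous_map Z euclideanreal (\<lambda>z. (\<integral>x. f (h x) * (\<Prod>i\<leftarrow>l. h x i) \<partial>\<kappa> z)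
      + (\<integral>x. g (h x) * (\<Prod>i\<leftarrow>l. h x i) \<partial>\<kappa> z))"
    using add.IH by (intro continuous_intros)
  moreover have "(\<integral>x. f (h x) * (\<Prod>i\<leftarrow>l. h x i) \<partial>\<kappa> z) + (\<integral>x. g (h x) * (\<Prod>i\<leftarrow>l. h x i) \<partial>\<kappa> z) =
      (\<integral>x. (f (h x) + g (h x)) * (\<Prod>i\<leftarrow>l. h x i) \<partial>\<kappa> z)"
    if "z \<in> topspace Z" for z
    unfolding distrib_right
    by (intro Bochner_Integration.integral_add[symmetric] integrable_coord[OF that] continuous_intros
        mono_continuous coord_poly_continuous add.hyps)
  ultimately show ?case
    by (rule continuous_map_eq)
next
  case (coord f i)
  then show ?case using coord.IH[of "i # l"] by (simp add: mult.assoc mult.left_commute)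
qed

lemma cube_continuous:
  assumes g: "continuous_on UNIV g"
  shows "continuous_map Z euclideanreal (\<lambda>z. \<integral>x. g (h x) \<partial>\<kappa> z)"
  unfolding continuous_map_real_iff_tendsto
proof (intro ballI tendstoI)
  fix z0 :: 'z and e :: real assume z0: "z0 \<in> topspace Z" and e: "e > 0"
  define c where "c z = measure (\<kappa> z) A" for z
  have c_cont: "continuous_map Z euclideanreal c"
    by (rule continuous_map_eq[OF monomials[of "[]"]]) (simp add: c_def space_\<kappa>)
  \<comment> \<open>Near \<open>z0\<close> the masses stay below \<open>c z0 + 1\<close>, so each of
    the two approximation errors is at most \<open>e / 4\<close>, and \<open>e / 2\<close> remains
    for the polynomial.\<close>
  define d where "d = e / (4 * (c z0 + 1))"
  have c0: "c z0 \<ge> 0" by (simp add: c_def)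
  then have d: "d > 0" using e by (simp add: d_def)
  obtain p where p: "p \<in> coord_poly" "\<And>w. w \<in> cube ==> \<bar>g w - p w\<bar> < d"
    using coord_poly_dense[OF continuous_on_subset[OF g] d, of B] by auto
  have P: "continuous_map Z euclideanreal (\<lambda>z. \<integral>x. p (h x) \<partial>\<kappa> z)"
    using poly_continuous[OF p(1), of "[]"] by simp
  have close: "\<bar>(\<integral>x. g (h x) \<partial>\<kappa> z) - (\<integral>x. p (h x) \<partial>\<kappa> z)\<bar> \<le> d * c z" if z: "z \<in> topspace Z" for z
  proof -
    note i = integrable_coord[OF z g] integrable_coord[OF z coord_poly_continuous[OF p(1)]]
    interpret finite_measure "\<kappa> z" using z by (rule finite_\<kappa>)
    have "\<bar>(\<integral>x. g (h x) \<partial>\<kappa> z) - (\<integral>x. p (h x) \<partial>\<kappa> z)\<bar> = \<bar>\<integral>x. g (h x) - p (h x) \<partial>\<kappa> z\<bar>"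
      using i by simp
    also have "\<dots> \<le> (\<integral>x. \<bar>g (h x) - p (h x)\<bar> \<partial>\<kappa> z)"
      by (rule integral_abs_bound)
    also have "\<dots> \<le> (\<integral>x. d \<partial>\<kappa> z)"
      using i p(2) h_cube by (intro integral_mono) (auto simp: space_\<kappa>[OF z] intro!: less_imp_le)
    also have "\<dots> = d * c z" by (simp add: c_def space_\<kappa>[OF z])
    finally show ?thesis .
  qed
  have "\<forall>\<^sub>F z in atin Z z0. c z < c z0 + 1"
    using c_cont z0 unfolding continuous_map_real_iff_tendsto by (auto intro: order_tendstoD)
  moreover have "\<forall>\<^sub>F z in atin Z z0. dist (\<integral>x. p (h x) \<partial>\<kappa> z) (\<integral>x. p (h x) \<partial>\<kappa> z0) < e / 2"
    using continuous_map_real_tendsto[OF P z0] by (rule tendstoD) (use e in simp)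
  moreover have "\<forall>\<^sub>F z in atin Z z0. z \<in> topspace Z"
    using z0 by (rule eventually_atin_topspace)
  ultimately show "\<forall>\<^sub>F z in atin Z z0. dist (\<integral>x. g (h x) \<partial>\<kappa> z) (\<integral>x. g (h x) \<partial>\<kappa> z0) < e"
  proof eventually_elim
    case (elim z)
    have "d * c z \<le> d * (c z0 + 1)" "d * c z0 < d * (c z0 + 1)" using elim d by auto
    moreover have "d * (c z0 + 1) = e / 4" using c0 by (simp add: d_def divide_simps)
    ultimately show ?case using close[OF elim(3)] close[OF z0] elim(2)
      unfolding dist_real_def by linarith
  qed
qed

text \<open>
  A nonnegative continuous function is the increasing limit of the Lipschitz functions
  \<open>x \<mapsto> inf\<^sub>y (f y + k dist x y)\<close>, which are defined on the whole cube.
\<close>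

lemma lower_semicontinuous:
  assumes f: "continuous_map (coord_topology A h) euclideanreal f"
    and f_bound: "\<And>x. x \<in> A ==> 0 \<le> f x" "\<And>x. x \<in> A ==> f x \<le> C"
    and z0: "z0 \<in> topspace Z" and e: "e > 0"
  shows "\<forall>\<^sub>F z in atin Z z0. (\<integral>x. f x \<partial>\<kappa> z) > (\<integral>x. f x \<partial>\<kappa> z0) - e"
proof (cases "A = {}")
  case True
  have "(\<integral>x. f x \<partial>\<kappa> z) = 0" if "z \<in> topspace Z" for z
    by (intro integral_eq_zero_AE AE_I2) (simp add: space_\<kappa>[OF that] True)
  moreover have "\<forall>\<^sub>F z in atin Z z0. z \<in> topspace Z"
    using z0 by (rule eventually_atin_topspace)
  ultimately show ?thesis using e z0 by (auto elim: eventually_mono)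
next
  case False
  \<comment> \<open>The distance on \<open>'i \<Rightarrow> real\<close> exists because
    \<open>'i\<close> is countable, and it induces the product topology.\<close>
  define g where "g k w = (INF y\<in>A. f y + real k * dist w (h y))" for k w
  have bdd: "bdd_below ((\<lambda>y. f y + real k * dist w (h y)) ` A)" for k w
    using f_bound by (intro bdd_belowI[of _ 0]) auto
  have lip: "g k w \<le> g k w' + real k * dist w w'" for k w w'
  proof -
    have "g k w - real k * dist w w' \<le> f y + real k * dist w' (h y)" if "y \<in> A" for y
    proof -
      have "g k w \<le> f y + real k * dist w (h y)" unfolding g_def
        using that by (intro cINF_lower bdd)
      also have "real k * dist w (h y) \<le> real k * (dist w w' + dist w' (h y))"
        by (intro mult_left_mono dist_triangle) auto
      finally show ?thesis by (simp add: algebra_simps)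
    qed
    then have "g k w - real k * dist w w' \<le> g k w'"
      unfolding g_def[of k w'] using False by (intro cINF_greatest) auto
    then show ?thesis by simp
  qed
  have g_cont: "continuous_on UNIV (g k)" for k
  proof -
    have "(real k)-lipschitz_on UNIV (g k)"
    proof (rule lipschitz_onI)
      fix w w' show "dist (g k w) (g k w') \<le> real k * dist w w'"
        using lip[of k w w'] lip[of k w' w] by (simp add: dist_real_def dist_commute abs_le_iff)
    qed auto
    then show ?thesis by (rule lipschitz_on_continuous_on)
  qed
  have g_le: "g k (h x) \<le> f x" if "x \<in> A" for k x
  proof -
    have "g k (h x) \<le> f x + real k * dist (h x) (h x)"
      unfolding g_def using that by (intro cINF_lower bdd)
    then show ?thesis by simp
  qed
  have g_nonneg: "0 \<le> g k (h x)" for k x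
    unfolding g_def using False f_bound by (intro cINF_greatest) auto
  have f_meas: "f \<in> borel_measurable (\<kappa> z)" if "z \<in> topspace Z" for z
    unfolding measurable_cong_sets[OF sets_\<kappa>[OF that] refl]
    by (rule continuous_map_real_borel_measurable[OF f])
  have f_int: "integrable (\<kappa> z) f" if "z \<in> topspace Z" for z
    by (rule integrable_bounded[OF that f_meas[OF that], of C]) (use f_bound in auto)
  have g_conv: "(\<lambda>k. g k (h x)) \<longlonglongrightarrow> f x" if x: "x \<in> A" for x
  proof (rule tendstoI)
    fix e :: real assume e: "e > 0"
    have "openin (coord_topology A h) {y \<in> A. f y \<in> {f x - e/2<..}}"
      using openin_continuous_map_preimage[OF f, of "{f x - e/2<..}"] by simp
    then obtain V where V: "open V" "{y \<in> A. f y \<in> {f x - e/2<..}} = h -` V \<inter> A"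
      by (auto simp: openin_coord_topology)
    have "h x \<in> V" using V x e by auto
    then obtain r where r: "r > 0" "ball (h x) r \<subseteq> V" using V(1) openE by blast
    obtain k0 :: nat where k0: "f x / r < real k0" using reals_Archimedean2 by blast
    show "\<forall>\<^sub>F k in sequentially. dist (g k (h x)) (f x) < e"
    proof (rule eventually_sequentiallyI)
      fix k assume k: "k \<ge> k0"
      have "f x - e/2 \<le> f y + real k * dist (h x) (h y)" if y: "y \<in> A" for y
      proof (cases "dist (h x) (h y) < r")
        case True
        then have "h y \<in> V" using r by auto
        then have "f y > f x - e/2" using V(2) y by auto
        moreover have "0 \<le> real k * dist (h x) (h y)" by simp
        ultimately show ?thesis by linarith
      next
        case False
        \<comment> \<open>Outside the ball the penalty alone exceeds \<open>f x\<close>; this is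
          where \<open>f\<close> has to be nonnegative.\<close>
        have "f x < real k0 * r" using k0 r by (simp add: field_simps)
        also have "\<dots> \<le> real k * dist (h x) (h y)" using k False r by (intro mult_mono) auto
        finally show ?thesis using f_bound(1)[OF y] e by linarith
      qed
      then have "f x - e/2 \<le> g k (h x)" unfolding g_def using False by (intro cINF_greatest) auto
      then show "dist (g k (h x)) (f x) < e" using g_le[OF x, of k] e by (simp add: dist_real_def)
    qed
  qed
  have "(\<lambda>k. \<integral>x. g k (h x) \<partial>\<kappa> z0) \<longlonglongrightarrow> (\<integral>x. f x \<partial>\<kappa> z0)"
  proof (rule integral_dominated_convergence)
    show "integrable (\<kappa> z0) (\<lambda>_. C)"
      by (rule integrable_bounded[OF z0, of _ "\<bar>C\<bar>"]) auto
    show "AE x in \<kappa> z0. norm (g k (h x)) \<le> C" for k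
      using g_le g_nonneg f_bound by (intro AE_I2) (force simp: space_\<kappa>[OF z0] intro: order_trans)
  qed (use f_meas[OF z0] integrable_coord[OF z0 g_cont] g_conv space_\<kappa>[OF z0] in auto)
  then have "\<forall>\<^sub>F k in sequentially. (\<integral>x. g k (h x) \<partial>\<kappa> z0) > (\<integral>x. f x \<partial>\<kappa> z0) - e"
    using e by (auto intro: order_tendstoD)
  then obtain k where k: "(\<integral>x. g k (h x) \<partial>\<kappa> z0) > (\<integral>x. f x \<partial>\<kappa> z0) - e"
    by (auto simp: eventually_sequentially)
  have "\<forall>\<^sub>F z in atin Z z0. (\<integral>x. g k (h x) \<partial>\<kappa> z) > (\<integral>x. f x \<partial>\<kappa> z0) - e"
    using cube_continuous[OF g_cont[of k]] z0 k unfolding continuous_map_real_iff_tendsto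
    by (auto intro: order_tendstoD)
  moreover have "\<forall>\<^sub>F z in atin Z z0. z \<in> topspace Z"
    using z0 by (rule eventually_atin_topspace)
  ultimately show ?thesis
  proof eventually_elim
    case (elim z)
    have "(\<integral>x. g k (h x) \<partial>\<kappa> z) \<le> (\<integral>x. f x \<partial>\<kappa> z)"
      using integrable_coord[OF elim(2) g_cont] f_int[OF elim(2)] g_le
      by (intro integral_mono) (auto simp: space_\<kappa>[OF elim(2)])
    with elim(1) show ?case by linarith
  qed
qed

text \<open>Lower semicontinuity for \<open>C + f\<close> gives the lower estimate and for
  \<open>C - f\<close> the upper one, because the total mass of \<open>\<kappa> z\<close> is
  continuous in \<open>z\<close>.\<close>

theorem weakly_continuous:
  assumes f: "f \<in> bounded_continuous (coord_topology A h)"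
  shows "continuous_map Z euclideanreal (\<lambda>z. \<integral>x. f x \<partial>\<kappa> z)"
  unfolding continuous_map_real_iff_tendsto
proof (intro ballI tendstoI)
  fix z0 :: 'z and e :: real assume z0: "z0 \<in> topspace Z" and e: "e > 0"
  have fc: "continuous_map (coord_topology A h) euclideanreal f"
    using f by (simp add: bounded_continuous_def)
  obtain C where C: "\<And>x. x \<in> A ==> \<bar>f x\<bar> \<le> C"
    using f unfolding bounded_continuous_def bounded_iff by auto
  define c where "c z = measure (\<kappa> z) A" for z
  have "continuous_map Z euclideanreal c"
    by (rule continuous_map_eq[OF monomials[of "[]"]]) (simp add: c_def space_\<kappa>)
  then have c_cont: "continuous_map Z euclideanreal (\<lambda>z. C * c z)"
    by (intro continuous_intros) auto
  have "continuous_map (coord_topology A h) euclideanreal (\<lambda>x. C + f x)"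
    "continuous_map (coord_topology A h) euclideanreal (\<lambda>x. C - f x)"
    using fc by (auto intro!: continuous_intros)
  note lower = this[THEN lower_semicontinuous, OF _ _ z0, of "2 * C" "e/2"]
  have "\<forall>\<^sub>F z in atin Z z0. (\<integral>x. C + f x \<partial>\<kappa> z) > (\<integral>x. C + f x \<partial>\<kappa> z0) - e/2"
    by (rule lower(1)) (use C e in \<open>auto simp: abs_le_iff dest!: C\<close>)
  moreover have "\<forall>\<^sub>F z in atin Z z0. (\<integral>x. C - f x \<partial>\<kappa> z) > (\<integral>x. C - f x \<partial>\<kappa> z0) - e/2"
    by (rule lower(2)) (use C e in \<open>auto simp: abs_le_iff dest!: C\<close>)
  moreover have "\<forall>\<^sub>F z in atin Z z0. dist (C * c z) (C * c z0) < e/2"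
    using continuous_map_real_tendsto[OF c_cont z0] by (rule tendstoD) (use e in simp)
  moreover have "\<forall>\<^sub>F z in atin Z z0. z \<in> topspace Z"
    using z0 by (rule eventually_atin_topspace)
  ultimately show "\<forall>\<^sub>F z in atin Z z0. dist (\<integral>x. f x \<partial>\<kappa> z) (\<integral>x. f x \<partial>\<kappa> z0) < e"
  proof eventually_elim
    case (elim z)
    have *: "integrable (\<kappa> z) f" "integrable (\<kappa> z) (\<lambda>_. C)" if "z \<in> topspace Z" for z
      using C continuous_map_real_borel_measurable[OF fc]
        measurable_cong_sets[OF sets_\<kappa>[OF that] refl, of borel]
      by (auto intro!: integrable_bounded[OF that])
    have eq: "(\<integral>x. C + f x \<partial>\<kappa> z) = C * c z + (\<integral>x. f x \<partial>\<kappa> z)"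
      "(\<integral>x. C - f x \<partial>\<kappa> z) = C * c z - (\<integral>x. f x \<partial>\<kappa> z)"
      if "z \<in> topspace Z" for z
      using *[OF that] by (simp_all add: c_def space_\<kappa>[OF that])
    show ?case using elim eq[OF elim(4)] eq[OF z0] unfolding dist_real_def by argo
  qed
qed

end

subsection \<open>Metric measure spaces\<close>

lemma openin_mdist_less: "x \<in> mspace T ==> openin (mtopology_of T) {y \<in> mspace T. mdist T x y < r}"
proof -
  assume x: "x \<in> mspace T"
  show ?thesis
    unfolding openin_mtopology_of_iff
  proof (intro conjI ballI)
    fix y assume y: "y \<in> {y \<in> mspace T. mdist T x y < r}"
    show "\<exists>s>0. \<forall>z\<in>mspace T. mdist T y z < s \<longrightarrow> z \<in> {y \<in> mspace T. mdist T x y < r}"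
    proof (intro exI[of _ "r - mdist T x y"] conjI ballI impI CollectI)
      fix z assume z: "z \<in> mspace T" "mdist T y z < r - mdist T x y"
      then show "mdist T x z < r" using mdist_triangle[of x T y z] x y by simp
    qed (use y in auto)
  qed auto
qed

lemma continuous_map_mdist:
  assumes x: "x \<in> mspace T"
  shows "continuous_map (mtopology_of T) euclideanreal (mdist T x)"
  unfolding continuous_map_def
proof (intro conjI allI impI)
  fix U :: "real set" assume "openin euclideanreal U"
  then have U: "open U" by simp
  show "openin (mtopology_of T) {y \<in> topspace (mtopology_of T). mdist T x y \<in> U}"
    unfolding openin_mtopology_of_iff
  proof (intro conjI ballI)
    fix y assume y: "y \<in> {y \<in> topspace (mtopology_of T). mdist T x y \<in> U}"
    then obtain r where r: "r > 0" "ball (mdist T x y) r \<subseteq> U"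
      using U openE by blast
    have "z \<in> {y \<in> topspace (mtopology_of T). mdist T x y \<in> U}"
      if z: "z \<in> mspace T" "mdist T y z < r" for z
    proof -
      have "\<bar>mdist T x y - mdist T x z\<bar> \<le> mdist T y z"
        using mdist_triangle[of x T y z] mdist_triangle[of x T z y] x y z(1) mdist_commute[of T y z]
        by auto
      then have "mdist T x z \<in> ball (mdist T x y) r" using z by (simp add: dist_real_def)
      then show ?thesis using r z by auto
    qed
    then show "\<exists>r>0. \<forall>z\<in>mspace T. mdist T y z < r \<longrightarrow> z \<in> {y \<in> topspace (mtopology_of T). mdist T x y \<in> U}"
      using r by auto
  qed auto
qed auto

lemma space_borel_on [simp]: "space (borel_on T) = mspace T"
  by (simp add: borel_on_def)

lemma mdist_borel_measurable [measurable]: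
  "x \<in> mspace T ==> mdist T x \<in> borel_measurable (borel_on T)"
  unfolding borel_on_def by (intro continuous_map_real_borel_measurable continuous_map_mdist)

lemma openin_sets_borel_on: "openin (mtopology_of T) U ==> U \<in> sets (borel_on T)"
  unfolding borel_on_def by (rule openin_in_sets_borel_of)

lemma singleton_sets_borel_on: "x \<in> mspace T ==> {x} \<in> sets (borel_on T)"
proof -
  assume x: "x \<in> mspace T"
  have "{y \<in> space (borel_on T). mdist T x y = 0} \<in> sets (borel_on T)"
    using x by measurable
  moreover have "{y \<in> space (borel_on T). mdist T x y = 0} = {x}" using x by auto
  ultimately show ?thesis by simp
qed

lemma countable_sets_borel_on: "countable A ==> A \<subseteq> mspace T ==> A \<in> sets (borel_on T)"
  by (rule sets.countable) (auto intro: singleton_sets_borel_on)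

lemma openin_compl_msupp: "openin (mtopology_of T) (mspace T - msupp T \<mu>)"
proof (subst openin_subopen, intro ballI)
  fix x assume "x \<in> mspace T - msupp T \<mu>"
  then obtain U where U: "openin (mtopology_of T) U" "x \<in> U" "\<not> 0 < emeasure \<mu> U"
    by (auto simp: msupp_def)
  then have "U \<subseteq> mspace T - msupp T \<mu>"
    using openin_subset[OF U(1)] by (auto simp: msupp_def)
  with U show "\<exists>U. openin (mtopology_of T) U \<and> x \<in> U \<and> U \<subseteq> mspace T - msupp T \<mu>" by blast
qed

lemma msupp_subset: "msupp T \<mu> \<subseteq> mspace T"
  by (auto simp: msupp_def)

lemma closedin_msupp: "closedin (mtopology_of T) (msupp T \<mu>)"
  using openin_compl_msupp msupp_subset by (auto simp: closedin_def)

lemma msupp_sets: "msupp T \<mu> \<in> sets (borel_on T)"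
  unfolding borel_on_def by (intro closedin_in_sets_borel_of closedin_msupp)

text \<open>Separability expressed by the ambient distance alone, so that it passes to subsets,
  unions and submetrics without forming subspaces.\<close>

definition sep_set :: "real metric \<Rightarrow> real set \<Rightarrow> bool" where
  "sep_set T A \<longleftrightarrow> (\<exists>Q. countable Q \<and> Q \<subseteq> A \<and> (\<forall>x\<in>A. \<forall>e>0. \<exists>q\<in>Q. mdist T x q < e))"

lemma sep_set_Union:
  assumes "countable I" "\<And>i. i \<in> I ==> sep_set T (A i)"
  shows "sep_set T (\<Union>i\<in>I. A i)"
proof -
  obtain Q where Q: "\<And>i. i \<in> I ==> countable (Q i) \<and> Q i \<subseteq> A i \<and> (\<forall>x\<in>A i. \<forall>e>0. \<exists>q\<in>Q i. mdist T x q < e)"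
    using assms(2) unfolding sep_set_def by metis
  show ?thesis unfolding sep_set_def
  proof (intro exI[of _ "\<Union>i\<in>I. Q i"] conjI ballI allI impI)
    show "countable (\<Union>i\<in>I. Q i)" using assms(1) Q by (intro countable_UN) auto
    show "(\<Union>i\<in>I. Q i) \<subseteq> (\<Union>i\<in>I. A i)" using Q by (intro UN_mono) auto
    fix x e :: real assume "x \<in> (\<Union>i\<in>I. A i)" "0 < e"
    then obtain i where "i \<in> I" "x \<in> A i" by blast
    then show "\<exists>q\<in>\<Union>i\<in>I. Q i. mdist T x q < e" using Q[of i] \<open>0 < e\<close> by blast
  qed
qed

lemma sep_set_Un: "sep_set T A ==> sep_set T B ==> sep_set T (A \<union> B)"
  using sep_set_Union[of "{True, False}" T "\<lambda>b. if b then A else B"] by (simp add: Un_commute)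

lemma sep_set_countable: "countable A ==> A \<subseteq> mspace T ==> sep_set T A"
  unfolding sep_set_def
  by (intro exI[of _ A] conjI ballI allI impI) (auto intro!: rev_bexI simp del: mdist_zero simp: mdist_self subset_iff)

text \<open>The dense sequence of \<open>A\<close> may miss \<open>B\<close>; therefore one point of
  \<open>B\<close> within \<open>1 / Suc n\<close> is chosen near each dense point, for every
  \<open>n\<close> for which there is one.\<close>

lemma sep_set_subset:
  assumes "sep_set T A" "B \<subseteq> A" "A \<subseteq> mspace T"
  shows "sep_set T B"
proof -
  obtain Q where Q: "countable Q" "Q \<subseteq> A" "\<And>x e. x \<in> A ==> e > 0 ==> \<exists>q\<in>Q. mdist T x q < e"
    using assms(1) unfolding sep_set_def by metis
  define f where "f = (\<lambda>(q, n :: nat). SOME b. b \<in> B \<and> mdist T b q < 1 / Suc n)"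
  define I where "I = {(q, n :: nat). q \<in> Q \<and> (\<exists>b. b \<in> B \<and> mdist T b q < 1 / Suc n)}"
  have f: "f (q, n) \<in> B \<and> mdist T (f (q, n)) q < 1 / Suc n" if "(q, n) \<in> I" for q n
    using that unfolding f_def I_def by (auto intro: someI2_ex)
  have "I \<subseteq> Q \<times> UNIV" by (auto simp: I_def)
  then have "countable I" by (rule countable_subset) (use Q(1) in simp)
  moreover have "\<exists>q\<in>f ` I. mdist T x q < e" if x: "x \<in> B" and e: "e > 0" for x e
  proof -
    obtain n :: nat where "inverse (real (Suc n)) < e / 2"
      using reals_Archimedean[of "e / 2"] e by auto
    then have n: "1 / real (Suc n) + 1 / real (Suc n) < e" by (simp add: inverse_eq_divide)
    obtain q where q: "q \<in> Q" "mdist T x q < 1 / Suc n"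
      using Q(3)[of x "1 / Suc n"] x assms(2) by auto
    then have I: "(q, n) \<in> I" using x by (auto simp: I_def)
    have "mdist T x (f (q, n)) \<le> mdist T x q + mdist T q (f (q, n))"
      using f[OF I] x q assms Q(2) by (intro mdist_triangle) auto
    also have "\<dots> < 1 / Suc n + 1 / Suc n"
      using q f[OF I] mdist_commute[of T q] by (intro add_strict_mono) auto
    finally have "mdist T x (f (q, n)) < e" using n by simp
    then show ?thesis using I by blast
  qed
  ultimately show ?thesis
    unfolding sep_set_def using f by (intro exI[of _ "f ` I"]) auto
qed

lemma sep_set_separable_space:
  "separable_space (mtopology_of (submetric T A)) \<longleftrightarrow> sep_set T (A \<inter> mspace T)"
proof -
  have *: "mtopology_of (submetric T A) closure_of Q = A \<inter> mspace T \<longleftrightarrow>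
      (\<forall>x\<in>A \<inter> mspace T. \<forall>e>0. \<exists>q\<in>Q. mdist T x q < e)" if "Q \<subseteq> A \<inter> mspace T" for Q
    unfolding mtopology_of_def Metric_space.metric_closure_of[OF Metric_space_mspace_mdist]
      Metric_space.mball_def[OF Metric_space_mspace_mdist]
    using that by (simp add: set_eq_iff subset_iff) blast
  show ?thesis
    unfolding separable_space_def sep_set_def
  proof (intro ex_cong1 conj_cong refl)
    show "Q \<subseteq> topspace (mtopology_of (submetric T A)) \<longleftrightarrow> Q \<subseteq> A \<inter> mspace T" for Q by simp
  next
    fix Q assume "Q \<subseteq> A \<inter> mspace T"
    from *[OF this] show "mtopology_of (submetric T A) closure_of Q = topspace (mtopology_of (submetric T A)) \<longleftrightarrow>
      (\<forall>x\<in>A \<inter> mspace T. \<forall>e>0. \<exists>q\<in>Q. mdist T x q < e)" by simp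
  qed
qed

text \<open>Lindelof: balls of rational radius around a countable dense set.\<close>

lemma emeasure_compl_msupp:
  assumes sep: "sep_set T K" and K: "K \<in> sets (borel_on T)" and sets: "sets \<mu> = sets (borel_on T)"
    and full: "emeasure \<mu> (mspace T - K) = 0"
  shows "emeasure \<mu> (mspace T - msupp T \<mu>) = 0"
proof -
  have KT: "K \<subseteq> mspace T" using sets.sets_into_space[OF K] by simp
  obtain Q where Q': "countable Q" "Q \<subseteq> K"
      "\<And>x e. x \<in> K ==> e > 0 ==> \<exists>q\<in>Q. mdist T x q < e"
    using sep unfolding sep_set_def by metis
  note Q = Q'(1) subset_trans[OF Q'(2) KT] Q'(3)
  define B where "B q n = {y \<in> mspace T. mdist T q y < 1 / real (Suc n)}" for q n
  define I where "I = {(q, n). q \<in> Q \<and> emeasure \<mu> (B q n) = 0}"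
  have op: "openin (mtopology_of T) (B q n)" if "q \<in> Q" for q n
    unfolding B_def by (rule openin_mdist_less) (use that Q(2) in auto)
  have "I \<subseteq> Q \<times> UNIV" by (auto simp: I_def)
  then have cI: "countable I" by (rule countable_subset) (use Q(1) in simp)
  have "(\<Union>(q, n)\<in>I. B q n) \<in> null_sets \<mu>"
  proof (rule null_sets_UN'[OF cI])
    fix i assume "i \<in> I"
    then show "(case i of (q, n) \<Rightarrow> B q n) \<in> null_sets \<mu>"
      by (auto simp: I_def null_sets_def sets intro: openin_sets_borel_on op)
  qed
  moreover have "mspace T - K \<in> null_sets \<mu>"
    using full sets.compl_sets[OF K] sets by (simp add: null_sets_def)
  ultimately have "(mspace T - K) \<union> (\<Union>(q, n)\<in>I. B q n) \<in> null_sets \<mu>" by (rule null_sets.Un[rotated])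
  moreover have "mspace T - msupp T \<mu> \<subseteq> (mspace T - K) \<union> (\<Union>(q, n)\<in>I. B q n)"
  proof
    fix x assume xm: "x \<in> mspace T - msupp T \<mu>"
    show "x \<in> (mspace T - K) \<union> (\<Union>(q, n)\<in>I. B q n)"
    proof (cases "x \<in> K")
    case False with xm show ?thesis by simp
    next
    case xK: True
    from xm obtain U where x: "x \<in> mspace T" and U: "openin (mtopology_of T) U" "x \<in> U" "emeasure \<mu> U = 0"
      by (auto simp: msupp_def)
    then obtain r where r: "r > 0" "\<And>y. y \<in> mspace T ==> mdist T x y < r ==> y \<in> U"
      unfolding openin_mtopology_of_iff by metis
    obtain n :: nat where n: "inverse (real (Suc n)) < r / 2"
      using reals_Archimedean[of "r/2"] r by auto
    obtain q where q: "q \<in> Q" "mdist T x q < 1 / Suc n"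
      using Q(3)[OF xK, of "1 / Suc n"] by auto
    have "B q n \<subseteq> U"
    proof
      fix y assume y: "y \<in> B q n"
      then have "mdist T x y \<le> mdist T x q + mdist T q y"
        using x q Q by (intro mdist_triangle) (auto simp: B_def)
      also have "\<dots> < 1 / Suc n + 1 / Suc n" using y q by (intro add_strict_mono) (auto simp: B_def)
      also have "\<dots> < r" using n by (simp add: inverse_eq_divide)
      finally show "y \<in> U" using r y by (auto simp: B_def)
    qed
    then have "emeasure \<mu> (B q n) \<le> emeasure \<mu> U"
      using U by (intro emeasure_mono) (auto simp: sets intro: openin_sets_borel_on)
    then have "(q, n) \<in> I" using q U by (auto simp: I_def)
    moreover have "x \<in> B q n" using q x mdist_commute[of T x q] by (auto simp: B_def)
    ultimately show ?thesis by blast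
    qed
  qed
  ultimately have "emeasure \<mu> (mspace T - msupp T \<mu>) \<le> 0"
    by (metis emeasure_mono null_setsD1 null_setsD2)
  then show ?thesis by simp
qed

lemma admissibleD:
  assumes "admissible_measure T \<mu>"
  shows "sets \<mu> = sets (borel_on T)" "finite_measure \<mu>" "sep_set T (msupp T \<mu>)"
    "emeasure \<mu> (mspace T - msupp T \<mu>) = 0" "mcomplete_of (submetric T (msupp T \<mu>))"
    "space \<mu> = mspace T"
  using assms sets_eq_imp_space_eq[of \<mu> "borel_on T"] msupp_subset[of T \<mu>]
  unfolding admissible_measure_def sep_set_separable_space by (auto simp: Int_absorb2)

text \<open>Equivalences are defined by partial maps on a \<open>restrict_space\<close>. A total
  measurable map on a \<open>density\<close> leaves the \<sigma>-algebra unchanged and is easier to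
  compose and to modify on null sets.\<close>

lemma distr_restrict_space_eq_distr_density:
  assumes A: "A \<in> sets M" and f: "f \<in> measurable (restrict_space M A) N" and g: "g \<in> measurable M N"
    and eq: "\<And>x. x \<in> A ==> f x = g x"
  shows "distr (restrict_space M A) N f = distr (density M (indicator A)) N g"
proof (rule measure_eqI)
  fix B assume "B \<in> sets (distr (restrict_space M A) N f)"
  then have B: "B \<in> sets N" by simp
  have [measurable]: "g \<in> measurable (density M (indicator A)) N" using g by simp
  have AM: "A \<inter> space M \<in> sets M" "A \<subseteq> space M" using A sets.sets_into_space by auto
  have gB: "g -` B \<inter> space M \<in> sets M" using g B by (rule measurable_sets)
  have "emeasure (distr (restrict_space M A) N f) B = emeasure (restrict_space M A) (f -` B \<inter> A)"
    using f B AM by (subst emeasure_distr) (auto simp: space_restrict_space Int_absorb2)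
  also have "f -` B \<inter> A = A \<inter> (g -` B \<inter> space M)" using eq AM by auto
  also have "emeasure (restrict_space M A) \<dots> = emeasure M \<dots>"
    using AM by (intro emeasure_restrict_space) auto
  also have "\<dots> = emeasure (density M (indicator A)) (g -` B \<inter> space M)"
    using emeasure_restricted[OF A gB] by simp
  also have "\<dots> = emeasure (distr (density M (indicator A)) N g) B"
    using B by (subst emeasure_distr) auto
  finally show "emeasure (distr (restrict_space M A) N f) B = \<dots>" .
qed simp

lemma density_indicator_full:
  assumes A: "A \<in> sets M" "emeasure M (space M - A) = 0"
  shows "density M (indicator A) = M"
proof (rule measure_eqI)
  fix B assume "B \<in> sets (density M (indicator A))"
  then have B: "B \<in> sets M" by simp
  have "AE x in M. x \<in> A"
    using A by (intro AE_I[of _ _ "space M - A"]) auto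
  then have "emeasure M (A \<inter> B) = emeasure M B"
    using A B by (intro emeasure_eq_AE) auto
  then show "emeasure (density M (indicator A)) B = emeasure M B"
    using emeasure_restricted[OF A(1) B] by simp
qed simp

section \<open>Pointed metric measure spaces and their classes\<close>

lemma pmm_supp_sets:
  assumes "X \<in> pmm_spaces n" shows "pmm_supp X \<in> sets (borel_on (pmm_space X))"
  using assms unfolding pmm_supp_def pmm_spaces_def
  by (intro sets.Un msupp_sets countable_sets_borel_on countable_finite) auto

lemma pmm_supp_subset: "X \<in> pmm_spaces n ==> pmm_supp X \<subseteq> mspace (pmm_space X)"
  using msupp_subset unfolding pmm_supp_def pmm_spaces_def by auto

lemma emeasure_compl_pmm_supp:
  assumes "X \<in> pmm_spaces n"
  shows "emeasure (pmm_measure X) (mspace (pmm_space X) - pmm_supp X) = 0"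
proof -
  have a: "admissible_measure (pmm_space X) (pmm_measure X)" using assms by (simp add: pmm_spaces_def)
  have "emeasure (pmm_measure X) (mspace (pmm_space X) - pmm_supp X)
      \<le> emeasure (pmm_measure X) (mspace (pmm_space X) - msupp (pmm_space X) (pmm_measure X))"
    using admissibleD(1)[OF a] openin_compl_msupp
    by (intro emeasure_mono) (auto simp: pmm_supp_def intro: openin_sets_borel_on)
  then show ?thesis using admissibleD(4)[OF a] by simp
qed

lemma sep_set_pmm_supp:
  assumes "X \<in> pmm_spaces n" shows "sep_set (pmm_space X) (pmm_supp X)"
proof -
  have "sep_set (pmm_space X) (insert (pmm_root X) (set (pmm_marks X)))"
    using assms by (intro sep_set_countable countable_finite) (auto simp: pmm_spaces_def)
  then show ?thesis
    using assms unfolding pmm_supp_def pmm_spaces_def by (intro sep_set_Un admissibleD(3)) auto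
qed

lemma pmm_equiv_refl: assumes X: "X \<in> pmm_spaces n" shows "pmm_equiv X X"
  unfolding pmm_equiv_def
proof (intro exI[of _ "\<lambda>x. x"] conjI)
  have a: "admissible_measure (pmm_space X) (pmm_measure X)" using X by (simp add: pmm_spaces_def)
  note s = admissibleD(1)[OF a] admissibleD(6)[OF a]
  show "isometric_on (pmm_supp X) (pmm_space X) (pmm_space X) (\<lambda>x. x)"
    using pmm_supp_subset[OF X] by (auto simp: isometric_on_def)
  have supp: "pmm_supp X \<in> sets (pmm_measure X)" using pmm_supp_sets[OF X] s by simp
  have id: "(\<lambda>x. x) \<in> measurable (pmm_measure X) (borel_on (pmm_space X))"
    using s by (simp add: measurable_ident_sets)
  have "distr (restrict_space (pmm_measure X) (pmm_supp X)) (borel_on (pmm_space X)) (\<lambda>x. x)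
    = distr (density (pmm_measure X) (indicator (pmm_supp X))) (borel_on (pmm_space X)) (\<lambda>x. x)"
    by (rule distr_restrict_space_eq_distr_density[OF supp measurable_restrict_space1[OF id] id refl])
  also have "density (pmm_measure X) (indicator (pmm_supp X)) = pmm_measure X"
    using emeasure_compl_pmm_supp[OF X] by (intro density_indicator_full supp) (simp add: s)
  also have "distr \<dots> (borel_on (pmm_space X)) (\<lambda>x. x) = pmm_measure X"
    using s by (simp add: distr_id2)
  finally show "distr (restrict_space (pmm_measure X) (pmm_supp X)) (borel_on (pmm_space X)) (\<lambda>x. x)
    = pmm_measure X" .
qed auto

text \<open>By reflexivity the class is nonempty, so that \<open>SOME\<close> picks one of its
  members.\<close>

lemma pmm_class_representative:
  assumes "X \<in> pmm_spaces n"
  shows "representative (pmm_class X) \<in> pmm_spaces n" "pmm_equiv X (representative (pmm_class X))"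
proof -
  have "X \<in> pmm_class X" using assms pmm_equiv_refl[OF assms] by (auto simp: pmm_class_def pmm_spaces_def)
  then have "representative (pmm_class X) \<in> pmm_class X"
    unfolding representative_def by (rule someI)
  then show "representative (pmm_class X) \<in> pmm_spaces n" "pmm_equiv X (representative (pmm_class X))"
    using assms by (auto simp: pmm_class_def pmm_spaces_def)
qed

lemma representative_hyp_classes: "C \<in> hyp_classes n ==> representative C \<in> pmm_spaces n"
  using pmm_class_representative by (auto simp: hyp_classes_def pmm_classes_def)

subsection \<open>Segments in trees\<close>

lemma seg_subset: "seg T x y \<subseteq> mspace T"
  by (auto simp: seg_def)

lemma root_in_seg: "x \<in> mspace T ==> y \<in> mspace T ==> x \<in> seg T x y"
  by (simp add: seg_def mdist_self)

lemma end_in_seg: "x \<in> mspace T ==> y \<in> mspace T ==> y \<in> seg T x y"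
  by (simp add: seg_def mdist_self)

lemma seg_sets: "x \<in> mspace T ==> y \<in> mspace T ==> seg T x y \<in> sets (borel_on T)"
proof -
  assume xy: "x \<in> mspace T" "y \<in> mspace T"
  have "{z \<in> space (borel_on T). mdist T x z + mdist T y z = mdist T x y} \<in> sets (borel_on T)"
    using xy by measurable
  then show ?thesis by (simp add: seg_def mdist_commute[of T y])
qed

lemma seg_trans:
  assumes "x \<in> seg T r y" "y \<in> seg T r z" "r \<in> mspace T" "z \<in> mspace T"
  shows "x \<in> seg T r z"
  using assms mdist_triangle[of x T y z] mdist_triangle[of r T x z] by (auto simp: seg_def)

text \<open>The four-point condition, applied to the pairs \<open>p\<close>, \<open>q\<close> and
  \<open>r\<close>, \<open>v\<close>, gives the upper bound; the triangle inequality gives the lower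
  one.\<close>

lemma seg_mdist:
  assumes h: "zero_hyperbolic T (mspace T)" and r: "r \<in> mspace T" "v \<in> mspace T"
    and p: "p \<in> seg T r v" "q \<in> seg T r v"
  shows "mdist T p q = \<bar>mdist T r p - mdist T r q\<bar>"
proof -
  have le: "mdist T p q \<le> \<bar>mdist T r p - mdist T r q\<bar>"
    if p: "p \<in> seg T r v" "q \<in> seg T r v" and ord: "mdist T r p \<le> mdist T r q" for p q
  proof -
    have "mdist T p q + mdist T r v \<le> max (mdist T p r + mdist T q v) (mdist T p v + mdist T q r)"
      using h r p unfolding zero_hyperbolic_def seg_def by blast
    then show ?thesis
      using p ord mdist_commute[of T p r] mdist_commute[of T q r] unfolding seg_def le_max_iff_disj
      by auto
  qed
  have "mdist T p q \<le> \<bar>mdist T r p - mdist T r q\<bar>"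
    using le[OF p] le[OF p(2,1)] mdist_commute[of T p q] by linarith
  moreover have "\<bar>mdist T r p - mdist T r q\<bar> \<le> mdist T p q"
    using mdist_triangle[of r T p q] mdist_triangle[of r T q p] mdist_commute[of T p q] r p
    by (auto simp: seg_def)
  ultimately show ?thesis by simp
qed

text \<open>An ancestor \<open>w\<close> of \<open>v\<close> remains a strict ancestor when
  \<open>v\<close> is moved by less than its distance from \<open>w\<close>. This lets a dense
  subset of the support span the same open part of the tree.\<close>

lemma seg_near:
  assumes h: "zero_hyperbolic T (mspace T)"
    and "r \<in> mspace T" "v \<in> mspace T" "v' \<in> mspace T" "w \<in> seg T r v" "mdist T v v' < mdist T w v"
  shows "w \<in> seg T r v' - {v'}"
proof -
  have w: "w \<in> mspace T" using assms by (simp add: seg_def)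
  have "mdist T w v' + mdist T r v \<le> max (mdist T w r + mdist T v' v) (mdist T w v + mdist T v' r)"
    using h w assms unfolding zero_hyperbolic_def by blast
  then have "mdist T r w + mdist T w v' \<le> mdist T r v'"
    using assms(5,6) mdist_nonneg[of T w v'] mdist_commute[of T w r] mdist_commute[of T v' v]
      mdist_commute[of T v' r]
    unfolding seg_def le_max_iff_disj mem_Collect_eq by linarith
  moreover have "w \<noteq> v'" using assms(6) mdist_commute[of T v v'] by auto
  ultimately show ?thesis using mdist_triangle[of r T w v'] assms w by (auto simp: seg_def)
qed

text \<open>A segment is an isometric image of a compact interval.\<close>

lemma compactin_seg:
  assumes T: "rooted_R_tree T r" and v: "v \<in> mspace T"
  shows "compactin (mtopology_of T) (seg T r v)"
proof -
  have h: "zero_hyperbolic T (mspace T)" and c: "connected_space (mtopology_of T)" and r: "r \<in> mspace T"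
    using T by (auto simp: rooted_R_tree_def)
  define L where "L = mdist T r v"
  have "\<exists>p. \<forall>a\<in>{0..L}. p a \<in> seg T r v \<and> mdist T r (p a) = a"
    by (intro bchoice ballI) (use seg_point_exists[OF h c r v] in \<open>force simp: L_def\<close>)
  then obtain p where p: "\<And>a. a \<in> {0..L} ==> p a \<in> seg T r v" "\<And>a. a \<in> {0..L} ==> mdist T r (p a) = a"
    by blast
  have pd: "mdist T (p a) (p b) = \<bar>a - b\<bar>" if "a \<in> {0..L}" "b \<in> {0..L}" for a b
    using seg_mdist[OF h r v p(1)[OF that(1)] p(1)[OF that(2)]] p(2) that by simp
  have "continuous_map (top_of_set {0..L}) (mtopology_of T) p"
    unfolding continuous_map_def
  proof (intro conjI allI impI)
    show "p \<in> topspace (top_of_set {0..L}) \<rightarrow> topspace (mtopology_of T)"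
      using p seg_subset by fastforce
    fix U assume U: "openin (mtopology_of T) U"
    show "openin (top_of_set {0..L}) {x \<in> topspace (top_of_set {0..L}). p x \<in> U}"
      unfolding openin_euclidean_subtopology_iff
    proof (intro conjI ballI)
      fix x assume x: "x \<in> {x \<in> topspace (top_of_set {0..L}). p x \<in> U}"
      then obtain e where e: "e > 0" "\<And>y. y \<in> mspace T ==> mdist T (p x) y < e ==> y \<in> U"
        using U unfolding openin_mtopology_of_iff by (metis (no_types, lifting) mem_Collect_eq)
      have "y \<in> {x \<in> topspace (top_of_set {0..L}). p x \<in> U}" if y: "y \<in> {0..L}" "dist y x < e" for y
        using y x e(2)[of "p y"] p(1)[of y] seg_subset[of T r v] pd[of x y]
        by (auto simp: dist_real_def abs_minus_commute)
      then show "\<exists>e>0. \<forall>x'\<in>{0..L}. dist x' x < e \<longrightarrow> x' \<in> {x \<in> topspace (top_of_set {0..L}). p x \<in> U}"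
        using e by blast
    qed auto
  qed
  moreover have "compactin (top_of_set {0..L}) {0..L}"
    by (simp add: compactin_subtopology)
  ultimately have "compactin (mtopology_of T) (p ` {0..L})"
    by (rule image_compactin[rotated])
  moreover have "p ` {0..L} = seg T r v"
  proof (intro set_eqI iffI)
    fix x assume x: "x \<in> seg T r v"
    define a where "a = mdist T r x"
    have "a + mdist T x v = L" using x by (simp add: seg_def a_def L_def)
    then have a: "a \<in> {0..L}" using mdist_nonneg[of T x v] mdist_nonneg[of T r x]
      unfolding a_def atLeastAtMost_iff by linarith
    have "mdist T x (p a) = 0"
      using seg_mdist[OF h r v x p(1)[OF a]] p(2)[OF a] by (simp add: a_def)
    then have "x = p a" using x p(1)[OF a] by (simp add: seg_def)
    then show "x \<in> p ` {0..L}" using a by blast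
  qed (use p in auto)
  ultimately show ?thesis by simp
qed

text \<open>Compactness settles both conditions on the support of a measure carried by
  \<open>S\<close>: closed parts are complete, and finite covers by balls of radius
  \<open>1 / Suc n\<close> yield a countable dense set.\<close>

lemma compactin_mcomplete_separable:
  assumes "compactin (mtopology_of T) S" "closedin (mtopology_of (submetric T S)) K"
  shows "mcomplete_of (submetric T K)" "sep_set T S"
proof -
  have ST: "S \<subseteq> mspace T" using compactin_subset_topspace[OF assms(1)] by simp
  have comp: "compact_space (mtopology_of (submetric T S))"
    using assms(1) ST by (simp add: mtopology_of_submetric compactin_subspace)
  have KS: "K \<subseteq> S" using closedin_subset[OF assms(2)] by auto
  have "compactin (mtopology_of (submetric T S)) K"
    using comp assms(2) by (rule closedin_compact_space)
  then have "compact_space (subtopology (subtopology (mtopology_of T) S) K)"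
    by (simp add: compactin_subspace mtopology_of_submetric)
  then have "compact_space (mtopology_of (submetric T K))"
    using KS by (simp add: mtopology_of_submetric subtopology_subtopology Int_absorb1)
  then show "mcomplete_of (submetric T K)"
    unfolding mcomplete_of_def mtopology_of_def
    by (intro Metric_space.compact_space_imp_mcomplete Metric_space_mspace_mdist)
  have "\<exists>F. finite F \<and> F \<subseteq> S \<and> (\<forall>x\<in>S. \<exists>q\<in>F. mdist T x q < 1 / Suc n)" for n :: nat
  proof -
    let ?B = "\<lambda>q. {y \<in> mspace T. mdist T q y < 1 / real (Suc n)}"
    have "\<exists>\<F>. finite \<F> \<and> \<F> \<subseteq> ?B ` S \<and> S \<subseteq> \<Union>\<F>"
    proof -
      have "x \<in> ?B x" if "x \<in> S" for x using that ST by (simp add: mdist_self subset_iff del: mdist_zero)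
      then have "S \<subseteq> \<Union>(?B ` S)" by blast
      moreover have "Ball (?B ` S) (openin (mtopology_of T))"
        using ST by (auto intro!: openin_mdist_less)
      ultimately show ?thesis
        using assms(1)[unfolded compactin_def, THEN conjunct2, rule_format, of "?B ` S"] by simp
    qed
    then obtain \<F> where "finite \<F>" "\<F> \<subseteq> ?B ` S" and cover: "S \<subseteq> \<Union>\<F>" by auto
    then obtain F where F': "F \<subseteq> S" "finite F" "\<F> = ?B ` F"
      using finite_subset_image[of \<F> ?B S] by auto
    have F: "finite F" "F \<subseteq> S" "S \<subseteq> \<Union>(?B ` F)" using F' cover by simp_all
    have "\<exists>q\<in>F. mdist T x q < 1 / Suc n" if "x \<in> S" for x
    proof -
      obtain q where "q \<in> F" "x \<in> ?B q" using F(3) \<open>x \<in> S\<close> by blast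
      then show ?thesis using mdist_commute[of T x q] by (intro bexI[of _ q]) simp_all
    qed
    then show ?thesis using F by blast
  qed
  then obtain F where F: "\<And>n :: nat. finite (F n) \<and> F n \<subseteq> S \<and> (\<forall>x\<in>S. \<exists>q\<in>F n. mdist T x q < 1 / Suc n)"
    by metis
  show "sep_set T S"
    unfolding sep_set_def
  proof (intro exI[of _ "\<Union>n. F n"] conjI ballI allI impI)
    fix x e :: real assume "x \<in> S" "e > 0"
    obtain n :: nat where "inverse (real (Suc n)) < e" using reals_Archimedean \<open>e > 0\<close> by blast
    moreover obtain q where "q \<in> F n" "mdist T x q < 1 / Suc n" using F[of n] \<open>x \<in> S\<close> by blast
    ultimately have "q \<in> (\<Union>n. F n)" "mdist T x q < e" by (auto simp: inverse_eq_divide)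
    then show "\<exists>q\<in>\<Union>n. F n. mdist T x q < e" by blast
  qed (use F in \<open>auto intro: countable_finite\<close>)
qed

subsection \<open>Product measures\<close>

lemma integral_scale_measure:
  fixes f :: "'a \<Rightarrow> real"
  assumes "f \<in> borel_measurable M" "r < \<infinity>"
  shows "(\<integral>x. f x \<partial>scale_measure r M) = enn2real r * (\<integral>x. f x \<partial>M)"
proof -
  have r: "ennreal (enn2real r) = r" using assms(2) by simp
  have "scale_measure r M = density M (\<lambda>_. ennreal (enn2real r))"
    unfolding r by (rule measure_eqI) (auto simp: emeasure_density_const)
  then show ?thesis using assms(1) by (simp add: integral_density)
qed

lemma space_normalise [simp]: "space (normalise M) = space M"
  by (simp add: normalise_def space_scale_measure)

lemma sets_normalise [simp, measurable_cong]: "sets (normalise M) = sets M"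
  by (simp add: normalise_def)

lemma total_mass_finite: "finite_measure M ==> total_mass M < \<infinity>"
  unfolding total_mass_def using finite_measure.emeasure_finite[of M "space M"] by (simp add: less_top)

lemma prob_space_normalise:
  assumes "finite_measure M" "total_mass M \<noteq> 0"
  shows "prob_space (normalise M)"
proof
  show "emeasure (normalise M) (space (normalise M)) = 1"
    using total_mass_finite[OF assms(1)] assms(2)
    by (simp add: normalise_def space_scale_measure total_mass_def[symmetric] ennreal_inverse_mult
        mult.commute ennreal_mult_divide_eq divide_ennreal_def[symmetric] ennreal_divide_self)
qed

lemma scale_normalise:
  assumes "finite_measure M" "total_mass M \<noteq> 0"
  shows "scale_measure (total_mass M) (normalise M) = M"
proof -
  have "total_mass M * inverse (total_mass M) = 1"
    using total_mass_finite[OF assms(1)] assms(2)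
    by (simp add: divide_ennreal_def[symmetric] ennreal_divide_self less_top)
  then show ?thesis unfolding normalise_def by simp
qed

lemma AE_normalise:
  assumes "finite_measure M" "total_mass M \<noteq> 0" "AE x in M. P x"
  shows "AE x in normalise M. P x"
proof -
  obtain N where N: "N \<in> null_sets M" "{x \<in> space M. \<not> P x} \<subseteq> N"
    using assms(3) by (auto elim: AE_E simp: null_sets_def)
  then show ?thesis
    by (intro AE_I[of _ _ N]) (auto simp: normalise_def space_scale_measure null_sets_def)
qed

lemma normalise_distr:
  assumes "f \<in> measurable M N"
  shows "normalise (distr M N f) = distr (normalise M) N f"
proof -
  have t: "total_mass (distr M N f) = total_mass M"
    using assms by (simp add: total_mass_def emeasure_distr measurable_space)
      (metis Int_absorb1 measurable_space subsetI vimageI)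
  have f: "f \<in> measurable (normalise M) N" using assms by simp
  show ?thesis
    by (rule measure_eqI) (simp_all add: normalise_def t emeasure_distr[OF assms]
        emeasure_distr[OF f[unfolded normalise_def]] space_scale_measure)
qed

lemma sigma_finite_density_indicator:
  assumes "sigma_finite_measure N" "S \<in> sets N"
  shows "sigma_finite_measure (density N (indicator S))"
proof -
  interpret sigma_finite_measure N by fact
  show ?thesis
    using sigma_finite_iff_density_finite[of "indicator S"] assms(2) by (auto simp: indicator_def)
qed

lemma PiM_density_indicator:
  assumes N: "sigma_finite_measure N" and S: "S \<in> sets N" and I: "finite I"
  shows "PiM I (\<lambda>_. density N (indicator S)) = density (PiM I (\<lambda>_. N)) (\<lambda>x. \<Prod>i\<in>I. indicator S (x i))"
proof -
  interpret N: product_sigma_finite "\<lambda>_ :: 'b. N"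
    using N by (simp add: product_sigma_finite_def)
  interpret D: product_sigma_finite "\<lambda>_ :: 'b. density N (indicator S)"
    using sigma_finite_density_indicator[OF N S] by (simp add: product_sigma_finite_def)
  have sets: "sets (PiM I (\<lambda>_. density N (indicator S))) = sets (PiM I (\<lambda>_. N))"
    by (intro sets_PiM_cong) auto
  have [measurable]: "S \<in> sets N" by fact
  show ?thesis
  proof (rule D.PiM_eqI[symmetric, OF I])
    show "sets (density (PiM I (\<lambda>_. N)) (\<lambda>x. \<Prod>i\<in>I. indicator S (x i))) = sets (PiM I (\<lambda>_. density N (indicator S)))"
      by (simp add: sets)
    fix A assume "\<And>i. i \<in> I ==> A i \<in> sets (density N (indicator S))"
    then have A: "A i \<in> sets N" if "i \<in> I" for i using that by auto
    have "emeasure (density (PiM I (\<lambda>_. N)) (\<lambda>x. \<Prod>i\<in>I. indicator S (x i))) (PiE I A)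
        = (\<integral>\<^sup>+x. (\<Prod>i\<in>I. indicator S (x i)) * indicator (PiE I A) x \<partial>PiM I (\<lambda>_. N))"
      using A I by (intro emeasure_density) auto
    also have "\<dots> = (\<integral>\<^sup>+x. (\<Prod>i\<in>I. indicator (S \<inter> A i) (x i)) \<partial>PiM I (\<lambda>_. N))"
    proof (rule nn_integral_cong)
      fix x assume x: "x \<in> space (PiM I (\<lambda>_. N))"
      show "(\<Prod>i\<in>I. indicator S (x i)) * indicator (PiE I A) x = (\<Prod>i\<in>I. indicator (S \<inter> A i) (x i) :: ennreal)"
      proof (cases "x \<in> PiE I A")
        case True
        then show ?thesis by (auto simp: indicator_def intro!: prod.cong)
      next
        case False
        then obtain i where "i \<in> I" "x i \<notin> A i" using x by (auto simp: space_PiM PiE_iff)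
        then have "(\<Prod>i\<in>I. indicator (S \<inter> A i) (x i) :: ennreal) = 0"
          using I by (intro prod_zero) (auto intro!: bexI[of _ i])
        then show ?thesis using False by simp
      qed
    qed
    also have "\<dots> = (\<Prod>i\<in>I. \<integral>\<^sup>+x. indicator (S \<inter> A i) x \<partial>N)"
      using A by (intro N.product_nn_integral_prod I) auto
    also have "\<dots> = (\<Prod>i\<in>I. emeasure (density N (indicator S)) (A i))"
      using A by (intro prod.cong refl) (auto simp: emeasure_restricted)
    finally show "emeasure (density (PiM I (\<lambda>_. N)) (\<lambda>x. \<Prod>i\<in>I. indicator S (x i))) (PiE I A) = \<dots>" .
  qed
qed

text \<open>An image of a \<sigma>-finite measure may fail to be \<sigma>-finite, hence the second
  premise.\<close>

lemma PiM_distr: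
  assumes N: "sigma_finite_measure N" "sigma_finite_measure (distr N N' f)"
    and f: "f \<in> measurable N N'" and I: "finite I"
  shows "PiM I (\<lambda>_. distr N N' f) = distr (PiM I (\<lambda>_. N)) (PiM I (\<lambda>_. N')) (\<lambda>x. \<lambda>i\<in>I. f (x i))"
proof -
  interpret N: product_sigma_finite "\<lambda>_ :: 'c. N"
    using N by (simp add: product_sigma_finite_def)
  interpret D: product_sigma_finite "\<lambda>_ :: 'c. distr N N' f"
    using N by (simp add: product_sigma_finite_def)
  note [measurable] = f
  have sets: "sets (PiM I (\<lambda>_. distr N N' f)) = sets (PiM I (\<lambda>_. N'))"
    by (intro sets_PiM_cong) auto
  show ?thesis
  proof (rule D.PiM_eqI[symmetric, OF I])
    fix A assume "\<And>i. i \<in> I ==> A i \<in> sets (distr N N' f)"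
    then have A: "A i \<in> sets N'" if "i \<in> I" for i using that by auto
    have "emeasure (distr (PiM I (\<lambda>_. N)) (PiM I (\<lambda>_. N')) (\<lambda>x. \<lambda>i\<in>I. f (x i))) (PiE I A) =
      emeasure (PiM I (\<lambda>_. N)) ((\<lambda>x. \<lambda>i\<in>I. f (x i)) -` PiE I A \<inter> space (PiM I (\<lambda>_. N)))"
      using A I by (intro emeasure_distr) auto
    also have "(\<lambda>x. \<lambda>i\<in>I. f (x i)) -` PiE I A \<inter> space (PiM I (\<lambda>_. N)) = PiE I (\<lambda>i. f -` A i \<inter> space N)"
      by (auto simp: space_PiM PiE_iff)
    also have "emeasure (PiM I (\<lambda>_. N)) \<dots> = (\<Prod>i\<in>I. emeasure N (f -` A i \<inter> space N))"
      using A f by (intro N.emeasure_PiM I) auto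
    also have "\<dots> = (\<Prod>i\<in>I. emeasure (distr N N' f) (A i))"
      using A f by (intro prod.cong refl) (auto simp: emeasure_distr)
    finally show "emeasure (distr (PiM I (\<lambda>_. N)) (PiM I (\<lambda>_. N')) (\<lambda>x. \<lambda>i\<in>I. f (x i))) (PiE I A) = \<dots>" .
  qed (simp add: sets)
qed

lemma PiM_scale_measure:
  assumes N: "sigma_finite_measure N" "sigma_finite_measure (scale_measure c N)" and I: "finite I"
  shows "PiM I (\<lambda>_. scale_measure c N) = scale_measure (c ^ card I) (PiM I (\<lambda>_. N))"
proof -
  interpret N: product_sigma_finite "\<lambda>_ :: 'b. N"
    using N by (simp add: product_sigma_finite_def)
  interpret D: product_sigma_finite "\<lambda>_ :: 'b. scale_measure c N"
    using N by (simp add: product_sigma_finite_def)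
  have sets: "sets (PiM I (\<lambda>_. scale_measure c N)) = sets (PiM I (\<lambda>_. N))"
    by (intro sets_PiM_cong) auto
  show ?thesis
    by (rule D.PiM_eqI[symmetric, OF I]) (simp_all add: sets N.emeasure_PiM[OF I] prod.distrib)
qed

text \<open>All functions on \<open>nat\<close> are compared, also those that are undefined from
  some index on. Thus one and the same \<open>f\<close> can be integrated over the infinite product
  and over \<open>PiM {..<n}\<close>.\<close>

definition depends_below :: "nat \<Rightarrow> ((nat \<Rightarrow> 'a) \<Rightarrow> 'b) \<Rightarrow> bool" where
  "depends_below n f \<longleftrightarrow> (\<forall>u v. (\<forall>i<n. u i = v i) \<longrightarrow> f u = f v)"

lemma depends_belowD: "depends_below n f ==> (\<And>i. i < n ==> u i = v i) ==> f u = f v"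
  unfolding depends_below_def by blast

lemma depends_below_measurable:
  assumes f: "f \<in> borel_measurable (PiM UNIV (\<lambda>_. M))" and n: "depends_below n (f :: _ \<Rightarrow> real)"
    and M: "space M \<noteq> {}"
  shows "f \<in> borel_measurable (PiM {..<n} (\<lambda>_. M))"
proof -
  obtain x0 where x0: "x0 \<in> space M" using M by auto
  \<comment> \<open>Entries from \<open>n\<close> on are replaced by a fixed point of the space,
    since they are undefined in the finite product.\<close>
  have "(\<lambda>u. f (\<lambda>i. if i < n then u i else x0)) \<in> borel_measurable (PiM {..<n} (\<lambda>_. M))"
  proof (rule measurable_compose[OF _ f], rule measurable_PiM_single')
    fix i show "(\<lambda>u. if i < n then u i else x0) \<in> measurable (PiM {..<n} (\<lambda>_. M)) M"
      using x0 by (cases "i < n") auto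
  qed (use x0 in \<open>auto simp: space_PiM PiE_iff\<close>)
  also have "(\<lambda>u. f (\<lambda>i. if i < n then u i else x0)) = f"
    by (intro ext depends_belowD[OF n]) auto
  finally show ?thesis .
qed

text \<open>The bridge between the infinite normalised samples in the definitions of
  \<open>upsilon\<close> and \<open>varpi\<close> and finite products of the unnormalised measure,
  where restriction is compatible with products.\<close>

lemma integral_PiM_normalise:
  assumes M: "finite_measure M" "total_mass M \<noteq> 0"
    and f: "f \<in> borel_measurable (PiM UNIV (\<lambda>_. M))" "depends_below n (f :: _ \<Rightarrow> real)"
  shows "measure M (space M) ^ n * (\<integral>u. f u \<partial>PiM UNIV (\<lambda>_. normalise M)) = (\<integral>u. f u \<partial>PiM {..<n} (\<lambda>_. M))"
proof -
  interpret M: finite_measure M by fact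
  interpret P: prob_space "normalise M" using M by (rule prob_space_normalise)
  interpret PP: product_prob_space "\<lambda>_ :: nat. normalise M" UNIV
    by unfold_locales
  have ne: "space M \<noteq> {}" using P.not_empty by simp
  have sc: "scale_measure (total_mass M) (normalise M) = M" using M by (rule scale_normalise)
  have s: "sets (PiM I (\<lambda>_. normalise M)) = sets (PiM I (\<lambda>_. M))" for I :: "nat set"
    by (intro sets_PiM_cong) auto
  have fm: "f \<in> borel_measurable (PiM {..<n} (\<lambda>_. normalise M))"
    unfolding measurable_cong_sets[OF s refl] by (rule depends_below_measurable[OF f ne])
  have "PiM {..<n} (\<lambda>_. M) = scale_measure (total_mass M ^ n) (PiM {..<n} (\<lambda>_. normalise M))"
    using PiM_scale_measure[of "normalise M" "total_mass M" "{..<n}"]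
    by (simp add: sc M.sigma_finite_measure_axioms P.sigma_finite_measure_axioms)
  then have "(\<integral>u. f u \<partial>PiM {..<n} (\<lambda>_. M)) =
      enn2real (total_mass M ^ n) * (\<integral>u. f u \<partial>PiM {..<n} (\<lambda>_. normalise M))"
    using integral_scale_measure[OF fm, of "total_mass M ^ n"] total_mass_finite[OF M(1)]
    by (simp add: power_less_top_ennreal)
  also have "enn2real (total_mass M ^ n) = measure M (space M) ^ n"
    by (simp add: total_mass_def M.emeasure_eq_measure ennreal_power)
  also have "PiM {..<n} (\<lambda>_. normalise M) = distr (PiM UNIV (\<lambda>_. normalise M)) (PiM {..<n} (\<lambda>_. normalise M)) (\<lambda>x. restrict x {..<n})"
    by (rule PP.distr_PiM_restrict_finite[symmetric]) auto
  also have "(\<integral>u. f u \<partial>\<dots>) = (\<integral>u. f (restrict u {..<n}) \<partial>PiM UNIV (\<lambda>_. normalise M))"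
    by (rule integral_distr[OF _ fm]) (auto intro: measurable_restrict_subset)
  also have "\<dots> = (\<integral>u. f u \<partial>PiM UNIV (\<lambda>_. normalise M))"
    by (intro Bochner_Integration.integral_cong refl depends_belowD[OF f(2)]) auto
  finally show ?thesis ..
qed

text \<open>Marks followed by independent points arise from an unmarked sample by a shift of the
  index. The case \<open>n = 0\<close> is the image law of an i.i.d. sequence.\<close>

lemma PiM_marked_distr:
  fixes u :: "nat \<Rightarrow> 'b"
  assumes M: "prob_space M" and f: "f \<in> measurable M B" and u: "\<And>k. k < n ==> u k \<in> space B"
  shows "PiM UNIV (\<lambda>k. if k < n then return B (u k) else distr M B f) =
    distr (PiM UNIV (\<lambda>_. M)) (PiM UNIV (\<lambda>_. B)) (\<lambda>x k. if k < n then u k else f (x (k - n)))"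
    (is "?P = distr ?M ?B ?t")
proof -
  note [measurable] = f
  let ?N = "\<lambda>k. if k < n then return B (u k) else distr M B f"
  have pN: "prob_space (?N k)" for k
    using u f M by (auto intro: prob_space_return prob_space.prob_space_distr)
  have sets: "sets ?P = sets ?B" by (intro sets_PiM_cong) auto
  have t: "?t \<in> measurable ?M ?B"
  proof (rule measurable_PiM_single')
    show "(\<lambda>x. if k < n then u k else f (x (k - n))) \<in> measurable ?M B" for k
      using u by (cases "k < n") auto
    show "?t \<in> space ?M \<rightarrow> (UNIV \<rightarrow>\<^sub>E space B)"
      using u measurable_space[OF f] by (auto simp: space_PiM PiE_iff)
  qed
  show ?thesis
  proof (rule measure_eqI_PiM_infinite[where I = UNIV and M = ?N])
    interpret prob_space ?P by (intro prob_space_PiM pN)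
    show "finite_measure ?P" by unfold_locales
    show "sets ?P = sets (PiM UNIV ?N)" ..
    show "sets (distr ?M ?B ?t) = sets (PiM UNIV ?N)" by (simp add: sets)
    fix A and J :: "nat set"
    assume J: "finite J" "J \<subseteq> UNIV" and A: "\<And>i. i \<in> J ==> A i \<in> sets (?N i)"
    then have A': "A i \<in> sets B" if "i \<in> J" for i using A[OF that] by (auto split: if_splits)
    let ?J2 = "{k \<in> J. n \<le> k}"
    let ?E = "prod_emb UNIV ?N J (PiE J A)"
    have E: "?E = {x \<in> space ?B. \<forall>k\<in>J. x k \<in> A k}"
      by (auto simp: prod_emb_def space_PiM PiE_iff split: if_splits)
    have Es: "?E \<in> sets ?B"
      unfolding E using J A' by measurable
    have "emeasure (distr ?M ?B ?t) ?E = emeasure ?M (?t -` ?E \<inter> space ?M)"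
      by (rule emeasure_distr[OF t Es])
    also have "\<dots> = (\<Prod>k\<in>J. emeasure (?N k) (A k))"
    proof (cases "\<forall>k\<in>J. k < n \<longrightarrow> u k \<in> A k")
      case False
      then obtain k where k: "k \<in> J" "k < n" "u k \<notin> A k" by auto
      then have "?t -` ?E \<inter> space ?M = {}" unfolding E by auto
      moreover have "emeasure (?N k) (A k) = 0" using k A'[OF k(1)] by simp
      then have "(\<Prod>k\<in>J. emeasure (?N k) (A k)) = 0" using k J by (intro prod_zero) auto
      ultimately show ?thesis by simp
    next
      case True
      have inj: "inj_on (\<lambda>k. k - n) ?J2" by (auto simp: inj_on_def)
      let ?A = "\<lambda>j. f -` A (j + n) \<inter> space M"
      have "?t -` ?E \<inter> space ?M = prod_emb UNIV (\<lambda>_. M) ((\<lambda>k. k - n) ` ?J2) (PiE ((\<lambda>k. k - n) ` ?J2) ?A)"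
        using True measurable_space[OF f] u unfolding E
        by (auto simp: prod_emb_def space_PiM PiE_iff split: if_splits)
      also have "emeasure ?M \<dots> = (\<Prod>j\<in>(\<lambda>k. k - n) ` ?J2. emeasure M (?A j))"
        using J A' M f by (intro emeasure_PiM_emb) auto
      also have "\<dots> = (\<Prod>k\<in>?J2. emeasure M (?A (k - n)))"
        using inj by (simp add: prod.reindex)
      also have "\<dots> = (\<Prod>k\<in>?J2. emeasure (?N k) (A k))"
        using A' f by (intro prod.cong refl) (auto simp: emeasure_distr)
      also have "\<dots> = (\<Prod>k\<in>J. emeasure (?N k) (A k))"
        using J True A' by (intro prod.mono_neutral_left) (auto simp: not_le)
      finally show ?thesis .
    qed
    also have "\<dots> = emeasure ?P ?E"
      using pN J A by (intro emeasure_PiM_emb[symmetric]) auto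
    finally show "emeasure ?P ?E = emeasure (distr ?M ?B ?t) ?E" ..
  qed
qed

text \<open>The first \<open>n\<close> terms of one i.i.d. sequence continued by an independent copy
  form again such a sequence. This yields independence of consecutive blocks and, with constant
  \<open>f\<close>, shift invariance.\<close>

lemma integral_comb_seq:
  fixes f g :: "(nat \<Rightarrow> 'a) \<Rightarrow> real"
  assumes M: "prob_space M"
    and f: "f \<in> borel_measurable (PiM UNIV (\<lambda>_. M))" "depends_below n f" "\<And>u. \<bar>f u\<bar> \<le> A"
    and g: "g \<in> borel_measurable (PiM UNIV (\<lambda>_. M))" "\<And>u. \<bar>g u\<bar> \<le> B"
  shows "(\<integral>u. f u * g (\<lambda>i. u (n + i)) \<partial>PiM UNIV (\<lambda>_. M)) =
    (\<integral>u. f u \<partial>PiM UNIV (\<lambda>_. M)) * (\<integral>u. g u \<partial>PiM UNIV (\<lambda>_. M))"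
proof -
  interpret M: prob_space M by fact
  interpret sequence_space M ..
  interpret SS: pair_prob_space S S ..
  have sh: "(\<lambda>u i. u (n + i)) \<in> measurable S S"
    by (rule measurable_PiM_single') (auto simp: space_PiM PiE_iff)
  have [measurable]: "f \<in> borel_measurable S" "g \<in> borel_measurable S" using f g by auto
  have [measurable]: "(\<lambda>u. g (\<lambda>i. u (n + i))) \<in> borel_measurable S"
    by (rule measurable_compose[OF sh g(1)])
  have fi: "integrable S f" by (rule P.integrable_const_bound[of _ A]) (use f in auto)
  have gi: "integrable S g" by (rule P.integrable_const_bound[of _ B]) (use g in auto)
  have "(\<integral>u. f u * g (\<lambda>i. u (n + i)) \<partial>S) =
      (\<integral>u. f u * g (\<lambda>i. u (n + i)) \<partial>distr (S \<Otimes>\<^sub>M S) S (\<lambda>(\<omega>, \<omega>'). comb_seq n \<omega> \<omega>'))"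
    by (simp add: PiM_comb_seq)
  also have "\<dots> = (\<integral>p. f (case p of (\<omega>, \<omega>') \<Rightarrow> comb_seq n \<omega> \<omega>') *
      g (\<lambda>i. (case p of (\<omega>, \<omega>') \<Rightarrow> comb_seq n \<omega> \<omega>') (n + i)) \<partial>(S \<Otimes>\<^sub>M S))"
    by (rule integral_distr[OF measurable_comb_seq]) measurable
  also have "\<dots> = (\<integral>p. f (fst p) * g (snd p) \<partial>(S \<Otimes>\<^sub>M S))"
  proof (intro Bochner_Integration.integral_cong refl, clarsimp)
    fix \<omega> \<omega>' :: "nat \<Rightarrow> 'a"
    have "f (comb_seq n \<omega> \<omega>') = f \<omega>" by (rule depends_belowD[OF f(2)]) (simp add: comb_seq_less)
    moreover have "(\<lambda>i. comb_seq n \<omega> \<omega>' (n + i)) = \<omega>'" by (simp add: comb_seq_def)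
    ultimately show "f (comb_seq n \<omega> \<omega>') * g (\<lambda>i. comb_seq n \<omega> \<omega>' (n + i)) = f \<omega> * g \<omega>'" by simp
  qed
  also have "\<dots> = (\<integral>\<omega>. \<integral>\<omega>'. f \<omega> * g \<omega>' \<partial>S \<partial>S)"
  proof -
    have "integrable (S \<Otimes>\<^sub>M S) (\<lambda>p. f (fst p) * g (snd p))"
    proof (rule SS.P.integrable_const_bound[of _ "A * B"])
      have "0 \<le> A" using f(3)[of undefined] by linarith
      then show "AE x in S \<Otimes>\<^sub>M S. norm (f (fst x) * g (snd x)) \<le> A * B"
        by (intro AE_I2) (auto simp: abs_mult intro!: mult_mono f g)
    qed measurable
    then show ?thesis by (subst SS.integral_fst'[symmetric]) auto
  qed
  also have "\<dots> = (\<integral>u. f u \<partial>S) * (\<integral>u. g u \<partial>S)" by simp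
  finally show ?thesis .
qed

lemma measurable_shift: "(\<lambda>u i. u (n + i)) \<in> measurable (PiM (UNIV :: nat set) (\<lambda>_. M)) (PiM UNIV (\<lambda>_. M))"
  by (rule measurable_PiM_single') (auto simp: space_PiM PiE_iff)

text \<open>\<open>F\<close> itself may fail to be measurable; its preimages differ from those of
  \<open>F'\<close> by subsets of a null set and so belong to the completion. Applied to distance
  matrices and to \<open>varsigma\<close>.\<close>

lemma push_ae_eq:
  assumes F': "F' \<in> measurable P N" and ae: "AE x in P. F x = F' x"
    and F: "\<And>x. x \<in> space P ==> F x \<in> space N"
  shows "push_ae P N F = distr P N F'"
proof -
  obtain N0 where N0: "N0 \<in> null_sets P" "{x \<in> space P. F x \<noteq> F' x} \<subseteq> N0"
    using ae by (auto elim: AE_E simp: null_sets_def)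
  have pre: "F -` A \<inter> space P \<in> sets (completion P)" if A: "A \<in> sets N" for A
  proof -
    have "F' -` A \<inter> space P \<in> sets P" using F' A by (rule measurable_sets)
    then have "(F' -` A \<inter> space P) - N0 \<in> sets (completion P)" using N0 by (intro sets_completionI_sets) auto
    moreover have "(F -` A \<inter> space P) \<inter> N0 \<in> sets (completion P)"
      using N0(1) by (rule null_sets_completion) auto
    moreover have "F -` A \<inter> space P = ((F' -` A \<inter> space P) - N0) \<union> ((F -` A \<inter> space P) \<inter> N0)"
      using N0(2) by auto
    ultimately show ?thesis by (metis sets.Un)
  qed
  have Fm: "F \<in> measurable (completion P) N"
    by (rule measurableI) (use F pre in auto)
  show ?thesis unfolding push_ae_def
  proof (rule measure_eqI)
    fix A assume "A \<in> sets (distr (completion P) N F)"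
    then have A: "A \<in> sets N" by simp
    have A': "F' -` A \<inter> space P \<in> sets P" using F' A by (rule measurable_sets)
    have "emeasure (distr (completion P) N F) A = emeasure (completion P) (F -` A \<inter> space P)"
      using emeasure_distr[OF Fm A] by simp
    also have "\<dots> = emeasure (completion P) (F' -` A \<inter> space P)"
    proof (rule emeasure_eq_AE)
      show "AE x in completion P. (x \<in> F -` A \<inter> space P) = (x \<in> F' -` A \<inter> space P)"
        using AE_completion[OF ae] by eventually_elim auto
    qed (use pre[OF A] A' in \<open>auto intro: sets_completionI_sets\<close>)
    also have "\<dots> = emeasure P (F' -` A \<inter> space P)" using A' by simp
    also have "\<dots> = emeasure (distr P N F') A" using emeasure_distr[OF F' A] by simp
    finally show "emeasure (distr (completion P) N F) A = emeasure (distr P N F') A" .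
  qed simp
qed

text \<open>Covers maps that are not measurable: \<open>distr\<close> either keeps the total mass of
  at most 1 or, if it would not be a measure, is the zero measure by convention.\<close>

lemma finite_measure_push_ae:
  assumes "prob_space P" shows "finite_measure (push_ae P N F)"
proof
  have "emeasure (distr (completion P) N F) (space N) \<le> 1"
    unfolding distr_def emeasure_measure_of_conv
    using prob_space.emeasure_le_1[OF prob_space.prob_space_completion[OF assms]] by auto
  then show "emeasure (push_ae P N F) (space (push_ae P N F)) \<noteq> \<infinity>"
    by (auto simp: push_ae_def top_unique)
qed

subsection \<open>Sampling from a pair of measures\<close>

text \<open>Names of the functionals that generate the pointed Gromov-weak topology. Their
  countability is what \<open>measurable_into_coord_topology\<close> and the distance on the
  function type rely on.\<close>

datatype gen = Mass | Poly "(nat \<times> nat) list" | Dist nat nat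

instance gen :: countable by countable_datatype

lemma abs_integral_le:
  fixes f :: "'a \<Rightarrow> real"
  assumes "integrable M f" "integrable M g" "\<And>x. x \<in> space M ==> \<bar>f x\<bar> \<le> g x"
  shows "\<bar>\<integral>x. f x \<partial>M\<bar> \<le> (\<integral>x. g x \<partial>M)"
proof -
  have "\<bar>\<integral>x. f x \<partial>M\<bar> \<le> (\<integral>x. \<bar>f x\<bar> \<partial>M)" by (rule integral_abs_bound)
  also have "\<dots> \<le> (\<integral>x. g x \<partial>M)" using assms by (intro integral_mono) auto
  finally show ?thesis .
qed

definition dmono :: "(nat \<times> nat) list \<Rightarrow> (nat \<times> nat \<Rightarrow> real) \<Rightarrow> real" where
  "dmono l D = (\<Prod>p\<leftarrow>l. if p \<in> all_pairs then arctan (D p) else 0)"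

text \<open>A crude strict bound for the indices in \<open>l\<close>. It is positive, so that one
  factor of the mass can be absorbed by \<open>upsilon\<close>.\<close>

definition msize :: "(nat \<times> nat) list \<Rightarrow> nat" where
  "msize l = Suc (\<Sum>(i, j)\<leftarrow>l. i + j)"

text \<open>Counterpart of \<open>dist_matrix\<close> for an arbitrary function \<open>d\<close>, so
  that distances modified off a separable set can be used.\<close>

definition dmat :: "('a \<Rightarrow> 'a \<Rightarrow> real) \<Rightarrow> 'a \<Rightarrow> (nat \<Rightarrow> 'a) \<Rightarrow> nat \<times> nat \<Rightarrow> real" where
  "dmat d \<rho> x = (\<lambda>(i, j)\<in>all_pairs. d (case_nat \<rho> x i) (case_nat \<rho> x j))"

definition pts :: "'a list \<Rightarrow> (nat \<Rightarrow> 'a) \<Rightarrow> nat \<Rightarrow> 'a" where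
  "pts us x k = (if k < length us then us ! k else x (k - length us))"

text \<open>For empty \<open>us\<close> this is empty, whereas \<open>span_tree\<close> always
  contains the root; hence the premises \<open>us \<noteq> []\<close> further on.\<close>

definition spanned :: "'a measure \<Rightarrow> ('a \<Rightarrow> 'a \<Rightarrow> real) \<Rightarrow> 'a \<Rightarrow> 'a list \<Rightarrow> 'a set" where
  "spanned N d \<rho> us = {x \<in> space N. \<exists>v\<in>set us. d \<rho> x + d x v = d \<rho> v}"

text \<open>On a set of infinite mass \<open>measure\<close> is 0, so that \<open>Mass\<close> takes
  the value 1. Together with the value 0 of \<open>Poly\<close> this agrees with \<open>tau\<close>,
  which replaces an infinite measure by the null measure.\<close>

fun gev :: "'a measure \<Rightarrow> ('a \<Rightarrow> 'a \<Rightarrow> real) \<Rightarrow> 'a \<Rightarrow> gen \<Rightarrow> 'a list \<Rightarrow> real" where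
  "gev N d \<rho> Mass us = exp (- measure N (spanned N d \<rho> us))"
| "gev N d \<rho> (Poly l) us = (if emeasure N (spanned N d \<rho> us) = \<infinity> then 0 else
     exp (- 2 * measure N (spanned N d \<rho> us)) *
     (\<integral>x. (\<Prod>i<msize l. indicator (spanned N d \<rho> us) (x i)) * dmono l (dmat d \<rho> (pts us x))
       \<partial>PiM {..<msize l} (\<lambda>_. N)))"
| "gev N d \<rho> (Dist i j) us = (if (i, j) \<in> pairs_upto (length us)
     then arctan (d (case_nat \<rho> ((!) us) i) (case_nat \<rho> ((!) us) j)) else 0)"

text \<open>The 2 bounds \<open>arctan\<close>, and the factorial comes from
  \<open>a ^ m \<le> fact m * exp a\<close>.\<close>

fun gbound :: "gen \<Rightarrow> real" where
  "gbound Mass = 1"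
| "gbound (Poly l) = 2 ^ length l * fact (msize l)"
| "gbound (Dist i j) = 2"

lemma abs_arctan_le: "\<bar>arctan x\<bar> \<le> 2"
  using arctan_lbound[of x] arctan_ubound[of x] pi_less_4 by linarith

lemma dmono_bound: "\<bar>dmono l D\<bar> \<le> 2 ^ length l"
proof (induction l)
  case (Cons p l)
  have "\<bar>dmono (p # l) D\<bar> = \<bar>if p \<in> all_pairs then arctan (D p) else 0\<bar> * \<bar>dmono l D\<bar>"
    by (simp add: dmono_def abs_mult)
  also have "\<dots> \<le> 2 * 2 ^ length l"
    using Cons abs_arctan_le by (intro mult_mono) auto
  finally show ?case by simp
qed (simp add: dmono_def)

lemma msize_le: "(i, j) \<in> set l ==> i < msize l \<and> j < msize l"
proof -
  assume "(i, j) \<in> set l"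
  then have "i + j \<le> (\<Sum>(i, j)\<leftarrow>l. i + j)"
    by (force intro: member_le_sum_list)
  then show ?thesis by (simp add: msize_def)
qed

text \<open>A single term of the exponential series.\<close>

lemma power_le_fact_exp: "0 \<le> a ==> a ^ m \<le> fact m * exp (a :: real)"
proof -
  assume a: "0 \<le> a"
  have "(\<Sum>n\<in>{m}. inverse (fact n) * a ^ n) \<le> (\<Sum>n. inverse (fact n) * a ^ n)"
    using a by (intro sum_le_suminf summable_exp) auto
  also have "\<dots> = exp a" by (simp add: exp_def scaleR_conv_of_real)
  finally show ?thesis by (simp add: field_simps)
qed

lemma power_exp_le: "0 \<le> a ==> exp (- 2 * a) * a ^ m \<le> fact m * exp (- a :: real)"
proof -
  assume a: "0 \<le> a"
  have "exp (- 2 * a) * a ^ m \<le> exp (- 2 * a) * (fact m * exp a)"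
    by (intro mult_left_mono power_le_fact_exp a) auto
  also have "\<dots> = fact m * exp (- a)" by (simp add: mult_exp_exp mult.left_commute)
  finally show ?thesis .
qed

lemma dmono_cong:
  assumes "\<And>i j. (i, j) \<in> set l ==> (i, j) \<in> all_pairs ==> D (i, j) = D' (i, j)"
  shows "dmono l D = dmono l D'"
  unfolding dmono_def using assms by (intro arg_cong[where f = prod_list] map_cong refl) auto

text \<open>Instances are a tree with its sampling measure and its skeleton measure, and a single
  finite measure in both roles. Product measurability of \<open>d\<close> is assumed because it can
  fail on non-separable spaces.\<close>

locale sampler =
  fixes M N :: "'a measure" and d :: "'a \<Rightarrow> 'a \<Rightarrow> real" and \<rho> :: 'a
  assumes sets_N: "sets N = sets M"
    and sigma_finite_N: "sigma_finite_measure N"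
    and finite_M: "finite_measure M"
    and d_measurable: "case_prod d \<in> borel_measurable (M \<Otimes>\<^sub>M M)"
    and root_space: "\<rho> \<in> space M"
begin

lemma space_N [simp]: "space N = space M"
  by (rule sets_eq_imp_space_eq[OF sets_N])

lemma d_measurable':
  assumes "f \<in> measurable K M" "g \<in> measurable K M"
  shows "(\<lambda>x. d (f x) (g x)) \<in> borel_measurable K"
  using measurable_compose[OF measurable_Pair[OF assms] d_measurable] by simp

lemma root_measurable: "(\<lambda>_. \<rho>) \<in> measurable K M"
  using root_space by simp

lemma spanned_sets:
  assumes "set us \<subseteq> space M" shows "spanned N d \<rho> us \<in> sets M"
proof -
  have 1: "{x \<in> space M. d \<rho> x + d x v = d \<rho> v} \<in> sets M" if v: "v \<in> set us" for v
  proof -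
    have 1: "(\<lambda>x. d \<rho> x + d x v) \<in> borel_measurable M"
      using assms v by (intro borel_measurable_add d_measurable' root_measurable) auto
    show ?thesis by (rule borel_measurable_eq[OF 1]) simp
  qed
  have "(\<Union>v\<in>set us. {x \<in> space M. d \<rho> x + d x v = d \<rho> v}) \<in> sets M"
    by (rule sets.finite_UN[OF finite_set 1])
  moreover have "spanned N d \<rho> us = (\<Union>v\<in>set us. {x \<in> space M. d \<rho> x + d x v = d \<rho> v})"
    by (auto simp: spanned_def)
  ultimately show ?thesis by (simp only:)
qed

lemma product_sigma_finite_N: "product_sigma_finite (\<lambda>_. N)"
  using sigma_finite_N by (simp add: product_sigma_finite_def)

text \<open>Matrix index 0 is the root and index \<open>i + 1\<close> the point \<open>i\<close>, so
  \<open>n\<close> points cover all indices below \<open>Suc n\<close>.\<close>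

lemma dmono_dmat_measurable:
  assumes "\<And>k. k < n ==> (\<lambda>w. y w k) \<in> measurable K M" "msize l \<le> Suc n"
  shows "(\<lambda>w. dmono l (dmat d \<rho> (y w))) \<in> borel_measurable K"
proof -
  have "(\<lambda>w. \<Prod>p\<leftarrow>l'. if p \<in> all_pairs then arctan (dmat d \<rho> (y w) p) else 0) \<in> borel_measurable K"
    if "set l' \<subseteq> set l" for l'
    using that
  proof (induction l')
    case (Cons p l')
    obtain i j where p: "p = (i, j)" by (cases p)
    have ij: "i \<le> n" "j \<le> n" using Cons.prems msize_le[of i j l] assms(2) p by auto
    have cn: "(\<lambda>w. case_nat \<rho> (y w) k) \<in> measurable K M" if "k \<le> n" for k
    proof (cases k)
      case (Suc k')
      then have "k' < n" using that by simp
      then show ?thesis using assms(1)[of k'] Suc by simp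
    qed (simp add: root_measurable)
    have "(\<lambda>w. arctan (d (case_nat \<rho> (y w) i) (case_nat \<rho> (y w) j))) \<in> borel_measurable K"
      by (rule measurable_compose[OF d_measurable' borel_measurable_arctan]) (rule cn ij)+
    then have "(\<lambda>w. if p \<in> all_pairs then arctan (dmat d \<rho> (y w) p) else 0) \<in> borel_measurable K"
      unfolding p dmat_def by (cases "(i, j) \<in> all_pairs") simp_all
    moreover have "(\<lambda>w. \<Prod>p\<leftarrow>l'. if p \<in> all_pairs then arctan (dmat d \<rho> (y w) p) else 0) \<in> borel_measurable K"
      using Cons by simp
    ultimately show ?case unfolding list.map prod_list.Cons by (rule borel_measurable_times)
  qed simp
  then show ?thesis unfolding dmono_def by blast
qed

lemma dmono_pts_measurable:
  assumes us: "set us \<subseteq> space M"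
  shows "(\<lambda>x. dmono l (dmat d \<rho> (pts us x))) \<in> borel_measurable (PiM {..<msize l} (\<lambda>_. N))"
proof (rule dmono_dmat_measurable[of "length us + msize l"])
  fix k assume k: "k < length us + msize l"
  show "(\<lambda>w. pts us w k) \<in> measurable (PiM {..<msize l} (\<lambda>_. N)) M"
  proof (cases "k < length us")
    case True
    then have "us ! k \<in> space M" using us by (simp add: subset_iff)
    then show ?thesis using True by (simp add: pts_def)
  next
    case False
    then have "k - length us < msize l" using k by simp
    then have "(\<lambda>w. w (k - length us)) \<in> measurable (PiM {..<msize l} (\<lambda>_. N)) N"
      by (intro measurable_component_singleton) simp
    then show ?thesis
      using False unfolding measurable_cong_sets[OF refl sets_N] by (simp add: pts_def)
  qed
qed simp

lemma gev_bound:
  assumes us: "set us \<subseteq> space M"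
  shows "\<bar>gev N d \<rho> g us\<bar> \<le> gbound g"
proof (cases g)
  case Mass then show ?thesis by simp
next
  case (Dist i j) then show ?thesis using abs_arctan_le by simp
next
  case (Poly l)
  let ?S = "spanned N d \<rho> us" and ?m = "msize l"
  show ?thesis
  proof (cases "emeasure N ?S = \<infinity>")
    case True then show ?thesis using Poly by simp
  next
    case False
    interpret PN: product_sigma_finite "\<lambda>_. N" by (rule product_sigma_finite_N)
    let ?P = "PiM {..<?m} (\<lambda>_. N)"
    define a where "a = measure N ?S"
    have S: "?S \<in> sets N" using spanned_sets[OF us] sets_N by simp
    have int1: "integrable N (indicator ?S :: _ \<Rightarrow> real)" using S False by (simp add: less_top[symmetric])
    have int: "integrable ?P (\<lambda>x. \<Prod>i<?m. indicator ?S (x i) :: real)"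
      by (rule PN.product_integrable_prod) (auto intro: int1)
    have I: "(\<integral>x. (\<Prod>i<?m. indicator ?S (x i)) \<partial>?P) = a ^ ?m"
      using PN.product_integral_prod[of "{..<?m}" "\<lambda>_. indicator ?S :: _ \<Rightarrow> real"] int1
        sets.sets_into_space[OF S] by (simp add: a_def Int_absorb2)
    have le: "\<bar>(\<Prod>i<?m. indicator ?S (x i)) * dmono l (dmat d \<rho> (pts us x))\<bar>
        \<le> (\<Prod>i<?m. indicator ?S (x i)) * 2 ^ length l" for x
      unfolding abs_mult
      by (intro mult_mono dmono_bound) (auto simp: abs_prod intro!: prod_nonneg)
    have int3: "integrable ?P (\<lambda>x. (\<Prod>i<?m. indicator ?S (x i)) * 2 ^ length l :: real)"
      using int by simp
    have meas: "(\<lambda>x. (\<Prod>i<?m. indicator ?S (x i)) * dmono l (dmat d \<rho> (pts us x))) \<in> borel_measurable ?P"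
      by (intro borel_measurable_times dmono_pts_measurable us borel_measurable_integrable[OF int])
    have int2: "integrable ?P (\<lambda>x. (\<Prod>i<?m. indicator ?S (x i)) * dmono l (dmat d \<rho> (pts us x)))"
      by (rule Bochner_Integration.integrable_bound[OF int3 meas]) (use le in \<open>force intro!: AE_I2 intro: order_trans[OF _ abs_ge_self]\<close>)
    have "\<bar>\<integral>x. (\<Prod>i<?m. indicator ?S (x i)) * dmono l (dmat d \<rho> (pts us x)) \<partial>?P\<bar>
        \<le> (\<integral>x. (\<Prod>i<?m. indicator ?S (x i)) * 2 ^ length l \<partial>?P)"
      by (rule abs_integral_le[OF int2 int3 le])
    also have "\<dots> = a ^ ?m * 2 ^ length l" using I by simp
    finally have "exp (- 2 * a) * \<bar>\<integral>x. (\<Prod>i<?m. indicator ?S (x i)) * dmono l (dmat d \<rho> (pts us x)) \<partial>?P\<bar>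
        \<le> exp (- 2 * a) * (a ^ ?m * 2 ^ length l)" by (intro mult_left_mono) auto
    also have "\<dots> = 2 ^ length l * (exp (- 2 * a) * a ^ ?m)" by simp
    also have "\<dots> \<le> 2 ^ length l * (fact ?m * exp (- a))"
      by (intro mult_left_mono power_exp_le) (auto simp: a_def)
    also have "\<dots> \<le> 2 ^ length l * (fact ?m * 1)"
      by (intro mult_left_mono) (auto simp: a_def)
    finally show ?thesis using Poly False by (simp add: abs_mult a_def)
  qed
qed

abbreviation "US \<equiv> PiM (UNIV :: nat set) (\<lambda>_. M)"

text \<open>The spanned sets are the sections of one measurable set in the product; their masses and
  moments therefore depend measurably on the sample.\<close>

lemma spanned_measurable:
  "{p \<in> space (US \<Otimes>\<^sub>M N). snd p \<in> spanned N d \<rho> (map (fst p) [0..<n])} \<in> sets (US \<Otimes>\<^sub>M N)"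
proof -
  have x: "snd \<in> measurable (US \<Otimes>\<^sub>M N) M"
    unfolding measurable_cong_sets[OF refl sets_N[symmetric]] by (rule measurable_snd)
  have u: "(\<lambda>p. fst p i) \<in> measurable (US \<Otimes>\<^sub>M N) M" for i
    by (rule measurable_compose[OF measurable_fst measurable_component_singleton]) simp
  have "{p \<in> space (US \<Otimes>\<^sub>M N). d \<rho> (snd p) + d (snd p) (fst p i) = d \<rho> (fst p i)} \<in> sets (US \<Otimes>\<^sub>M N)" for i
    by (intro borel_measurable_eq borel_measurable_add d_measurable' root_measurable x u)
  then have "(\<Union>i\<in>{..<n}. {p \<in> space (US \<Otimes>\<^sub>M N). d \<rho> (snd p) + d (snd p) (fst p i) = d \<rho> (fst p i)})
      \<in> sets (US \<Otimes>\<^sub>M N)"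
    by (intro sets.finite_UN) simp_all
  moreover have "{p \<in> space (US \<Otimes>\<^sub>M N). snd p \<in> spanned N d \<rho> (map (fst p) [0..<n])} =
      (\<Union>i\<in>{..<n}. {p \<in> space (US \<Otimes>\<^sub>M N). d \<rho> (snd p) + d (snd p) (fst p i) = d \<rho> (fst p i)})"
    by (auto simp: spanned_def space_pair_measure)
  ultimately show ?thesis by (simp only:)
qed

lemma emeasure_spanned_measurable:
  "(\<lambda>u. emeasure N (spanned N d \<rho> (map u [0..<n]))) \<in> borel_measurable US"
proof -
  interpret N: sigma_finite_measure N by (rule sigma_finite_N)
  have "(\<lambda>u. emeasure N (Pair u -` {p \<in> space (US \<Otimes>\<^sub>M N). snd p \<in> spanned N d \<rho> (map (fst p) [0..<n])}))
      \<in> borel_measurable US"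
    by (rule N.measurable_emeasure_Pair[OF spanned_measurable])
  moreover have "Pair u -` {p \<in> space (US \<Otimes>\<^sub>M N). snd p \<in> spanned N d \<rho> (map (fst p) [0..<n])} =
      spanned N d \<rho> (map u [0..<n])" if "u \<in> space US" for u
    using that by (auto simp: space_pair_measure spanned_def)
  ultimately show ?thesis by (simp cong: measurable_cong)
qed

lemma gev_measurable:
  "(\<lambda>u. gev N d \<rho> g (map u [0..<n])) \<in> borel_measurable US"
proof (cases g)
  case Mass
  note [measurable] = emeasure_spanned_measurable
  show ?thesis unfolding Mass gev.simps measure_def by measurable
next
  case (Dist i j)
  show ?thesis
  proof (cases "(i, j) \<in> pairs_upto n")
    case True
    have cn: "(\<lambda>u. case_nat \<rho> ((!) (map u [0..<n])) k) \<in> measurable US M" if "k \<le> n" for k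
    proof (cases k)
      case (Suc k')
      then show ?thesis using that by simp
    qed (simp add: root_measurable)
    have "(\<lambda>u. arctan (d (case_nat \<rho> ((!) (map u [0..<n])) i) (case_nat \<rho> ((!) (map u [0..<n])) j))) \<in> borel_measurable US"
      by (rule measurable_compose[OF d_measurable' borel_measurable_arctan])
        (use True cn in \<open>simp_all add: pairs_upto_def\<close>)
    then show ?thesis using True by (simp add: Dist)
  qed (simp add: Dist)
next
  case (Poly l)
  let ?m = "msize l"
  interpret PN: product_sigma_finite "\<lambda>_. N" by (rule product_sigma_finite_N)
  interpret P: sigma_finite_measure "PiM {..<?m} (\<lambda>_. N)" by (rule PN.sigma_finite) simp
  let ?K = "US \<Otimes>\<^sub>M PiM {..<?m} (\<lambda>_. N)"
  have 1: "(\<lambda>p. indicator (spanned N d \<rho> (map (fst p) [0..<n])) (snd p i) :: real) \<in> borel_measurable ?K"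
    if "i < ?m" for i
  proof -
    have "(\<lambda>p. snd p i) \<in> measurable ?K N"
      by (rule measurable_compose[OF measurable_snd measurable_component_singleton]) (use that in simp)
    then have t: "(\<lambda>p. (fst p, snd p i)) \<in> measurable ?K (US \<Otimes>\<^sub>M N)"
      by (intro measurable_Pair measurable_fst)
    have "(\<lambda>p. indicator {p \<in> space (US \<Otimes>\<^sub>M N). snd p \<in> spanned N d \<rho> (map (fst p) [0..<n])} (fst p, snd p i) :: real)
        \<in> borel_measurable ?K"
      by (rule measurable_compose[OF t borel_measurable_indicator[OF spanned_measurable]])
    then show ?thesis
      using measurable_space[OF t]
      by (subst measurable_cong) (auto simp: indicator_def)
  qed
  have 2: "(\<lambda>p. dmono l (dmat d \<rho> (pts (map (fst p) [0..<n]) (snd p)))) \<in> borel_measurable ?K"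
  proof (rule dmono_dmat_measurable[of "n + ?m"])
    fix k assume k: "k < n + ?m"
    show "(\<lambda>w. pts (map (fst w) [0..<n]) (snd w) k) \<in> measurable ?K M"
    proof (cases "k < n")
      case True
      have "(\<lambda>w. fst w k) \<in> measurable ?K M"
        by (rule measurable_compose[OF measurable_fst measurable_component_singleton]) simp
      then show ?thesis using True by (simp add: pts_def)
    next
      case False
      then have "k - n < ?m" using k by simp
      then have "(\<lambda>w. snd w (k - n)) \<in> measurable ?K N"
        by (intro measurable_compose[OF measurable_snd measurable_component_singleton]) simp
      then show ?thesis using False unfolding measurable_cong_sets[OF refl sets_N] by (simp add: pts_def)
    qed
  qed simp
  have "(\<lambda>p. (\<Prod>i<?m. indicator (spanned N d \<rho> (map (fst p) [0..<n])) (snd p i)) *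
      dmono l (dmat d \<rho> (pts (map (fst p) [0..<n]) (snd p)))) \<in> borel_measurable ?K"
    by (intro borel_measurable_times borel_measurable_prod 1 2) simp
  then have [measurable]: "(\<lambda>u. \<integral>x. (\<Prod>i<?m. indicator (spanned N d \<rho> (map u [0..<n])) (x i)) *
      dmono l (dmat d \<rho> (pts (map u [0..<n]) x)) \<partial>PiM {..<?m} (\<lambda>_. N)) \<in> borel_measurable US"
    by (intro P.borel_measurable_lebesgue_integral) (simp add: split_beta')
  note [measurable] = emeasure_spanned_measurable
  show ?thesis unfolding Poly gev.simps measure_def by measurable
qed

end

text \<open>As \<open>f\<close> preserves \<open>d\<close>, the preimage of the set spanned by the
  images is the spanned set itself, and all integrals are image integrals. This covers maps that are
  neither injective nor onto, such as \<open>carrier_map\<close>.\<close>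

lemma gev_transport:
  assumes "sampler M N d \<rho>" "sampler M' N' d' \<rho>'"
    and f: "f \<in> measurable N N'" and N': "N' = distr N N' f" and root: "f \<rho> = \<rho>'"
    and iso: "\<And>x y. x \<in> space M ==> y \<in> space M ==> d' (f x) (f y) = d x y"
    and us: "set us \<subseteq> space M"
  shows "gev N' d' \<rho>' g (map f us) = gev N d \<rho> g us"
proof -
  interpret A: sampler M N d \<rho> by fact
  interpret B: sampler M' N' d' \<rho>' by fact
  have fM: "f x \<in> space M'" if "x \<in> space M" for x
    using measurable_space[OF f] that by simp
  have us': "set (map f us) \<subseteq> space M'" using us fM by auto
  let ?S = "spanned N d \<rho> us" and ?S' = "spanned N' d' \<rho>' (map f us)"
  have S': "?S' \<in> sets N'" using B.spanned_sets[OF us'] B.sets_N by simp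
  have pre: "f -` ?S' \<inter> space N = ?S"
    using us fM iso A.root_space root[symmetric] by (auto simp: spanned_def subset_iff)
  have in_iff: "f x \<in> ?S' \<longleftrightarrow> x \<in> ?S" if "x \<in> space M" for x
    using pre that by auto
  have e: "emeasure N' ?S' = emeasure N ?S"
    by (subst N') (simp add: emeasure_distr[OF f S'] pre del: A.space_N)
  have D: "d' (case_nat \<rho>' (\<lambda>k. f (y k)) i) (case_nat \<rho>' (\<lambda>k. f (y k)) j) = d (case_nat \<rho> y i) (case_nat \<rho> y j)"
    if "case_nat \<rho> y i \<in> space M" "case_nat \<rho> y j \<in> space M" for y i j
    using iso[OF that] root by (cases i; cases j) auto
  show ?thesis
  proof (cases g)
    case Mass
    then show ?thesis by (simp add: measure_def e)
  next
    case (Dist i j)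
    show ?thesis
    proof (cases "(i, j) \<in> pairs_upto (length us)")
      case True
      have k: "case_nat \<rho> ((!) us) k \<in> space M \<and> case_nat \<rho>' ((!) (map f us)) k = case_nat \<rho>' (\<lambda>k. f (us ! k)) k"
        if "k \<le> length us" for k
        using that us A.root_space by (cases k) (auto simp: subset_iff)
      show ?thesis using True k[of i] k[of j] D[of "(!) us" i j] by (simp add: Dist pairs_upto_def)
    qed (simp add: Dist)
  next
    case (Poly l)
    let ?m = "msize l"
    let ?P = "PiM {..<?m} (\<lambda>_. N)" and ?P' = "PiM {..<?m} (\<lambda>_. N')"
    let ?F = "\<lambda>x. (\<Prod>i<?m. indicator ?S' (x i)) * dmono l (dmat d' \<rho>' (pts (map f us) x))"
    have sf: "sigma_finite_measure (distr N N' f)" using B.sigma_finite_N N' by simp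
    have P': "?P' = distr ?P ?P' (\<lambda>x. \<lambda>i\<in>{..<?m}. f (x i))"
      using PiM_distr[OF A.sigma_finite_N sf f, of "{..<?m}"] N' by simp
    have t: "(\<lambda>x. \<lambda>i\<in>{..<?m}. f (x i)) \<in> measurable ?P ?P'"
      using f by measurable
    have [measurable]: "?S' \<in> sets N'" by (rule S')
    have dm: "(\<lambda>x. dmono l (dmat d' \<rho>' (pts (map f us) x))) \<in> borel_measurable ?P'"
      by (rule B.dmono_pts_measurable[OF us'])
    have ind: "(\<lambda>x. indicator ?S' (x i) :: real) \<in> borel_measurable ?P'" if "i < ?m" for i
    proof -
      have "(\<lambda>x. x i) \<in> measurable ?P' N'"
        using that by (intro measurable_component_singleton) simp
      then show ?thesis
        by (rule measurable_compose[OF _ borel_measurable_indicator[OF S']])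
    qed
    have F: "?F \<in> borel_measurable ?P'"
      by (intro borel_measurable_times borel_measurable_prod dm ind) simp
    have "(\<integral>x. ?F x \<partial>?P') = (\<integral>x. ?F (\<lambda>i\<in>{..<?m}. f (x i)) \<partial>?P)"
      by (subst P') (rule integral_distr[OF t F])
    also have "\<dots> = (\<integral>x. (\<Prod>i<?m. indicator ?S (x i)) * dmono l (dmat d \<rho> (pts us x)) \<partial>?P)"
    proof (rule Bochner_Integration.integral_cong[OF refl])
      fix x assume "x \<in> space ?P"
      then have x: "x i \<in> space M" if "i < ?m" for i using that by (auto simp: space_PiM)
      have "(\<Prod>i<?m. indicator ?S' ((\<lambda>i\<in>{..<?m}. f (x i)) i) :: real) = (\<Prod>i<?m. indicator ?S (x i))"
        by (intro prod.cong refl) (auto simp: indicator_def in_iff x)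
      moreover have "dmono l (dmat d' \<rho>' (pts (map f us) (\<lambda>i\<in>{..<?m}. f (x i)))) = dmono l (dmat d \<rho> (pts us x))"
      proof (rule dmono_cong)
        fix i j assume ij: "(i, j) \<in> set l" "(i, j) \<in> all_pairs"
        have k: "case_nat \<rho> (pts us x) k \<in> space M \<and>
            case_nat \<rho>' (pts (map f us) (\<lambda>i\<in>{..<?m}. f (x i))) k = case_nat \<rho>' (\<lambda>k. f (pts us x k)) k"
          if "k < ?m" for k
          using that us x A.root_space by (cases k) (auto simp: pts_def subset_iff)
        show "dmat d' \<rho>' (pts (map f us) (\<lambda>i\<in>{..<?m}. f (x i))) (i, j) = dmat d \<rho> (pts us x) (i, j)"
          using ij k[of i] k[of j] msize_le[OF ij(1)] D[of "pts us x" i j] by (simp add: dmat_def)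
      qed
      ultimately show "?F (\<lambda>i\<in>{..<?m}. f (x i)) = (\<Prod>i<?m. indicator ?S (x i)) * dmono l (dmat d \<rho> (pts us x))"
        by simp
    qed
    finally show ?thesis by (simp add: Poly e measure_def)
  qed
qed

section \<open>Borel sets of subspaces and partial isometries\<close>

lemma sets_borel_on_submetric:
  assumes S: "S \<in> sets (borel_on T)"
  shows "sets (borel_on (submetric T S)) = sets (restrict_space (borel_on T) S)"
proof -
  have ST: "S \<subseteq> mspace T" using sets.sets_into_space[OF S] by simp
  have "sets (restrict_space (borel_on T) S) = (\<inter>) S ` sigma_sets (mspace T) {U. openin (mtopology_of T) U}"
    by (simp add: sets_restrict_space borel_on_def sets_borel_of)
  also have "\<dots> = sigma_sets S ((\<inter>) S ` {U. openin (mtopology_of T) U})"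
    using S ST by (intro sigma_sets_Int) (simp_all add: borel_on_def sets_borel_of)
  also have "(\<inter>) S ` {U. openin (mtopology_of T) U} = {U. openin (subtopology (mtopology_of T) S) U}"
    by (auto simp: openin_subtopology)
  finally show ?thesis
    using ST by (simp add: borel_on_def sets_borel_of mtopology_of_submetric Int_absorb1)
qed

text \<open>A partial isometry is continuous on \<open>A\<close>, and a constant value off
  \<open>A\<close> turns it into a total Borel map. With the identity as \<open>\<phi>\<close> this
  gives the maps that collapse the complement of \<open>A\<close> to a point.\<close>

lemma measurable_isometric_extension:
  assumes iso: "isometric_on A T T' \<phi>" and A: "A \<in> sets (borel_on T)" and c: "c \<in> mspace T'"
  shows "(\<lambda>x. if x \<in> A then \<phi> x else c) \<in> measurable (borel_on T) (borel_on T')"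
proof -
  have AT: "A \<subseteq> mspace T" using sets.sets_into_space[OF A] by simp
  have \<phi>: "\<phi> x \<in> mspace T'" "mdist T' (\<phi> x) (\<phi> y) = mdist T x y" if "x \<in> A" "y \<in> A" for x y
    using iso that by (auto simp: isometric_on_def)
  have open_pre: "\<exists>V. openin (mtopology_of T) V \<and> {x \<in> A. \<phi> x \<in> U} = A \<inter> V"
    if U: "openin (mtopology_of T') U" for U
  proof -
    define V where "V = \<Union>{B. openin (mtopology_of T) B \<and> A \<inter> B \<subseteq> {x \<in> A. \<phi> x \<in> U}}"
    have "x \<in> V" if x: "x \<in> A" "\<phi> x \<in> U" for x
    proof -
      obtain e where e: "e > 0" "\<And>y. y \<in> mspace T' ==> mdist T' (\<phi> x) y < e ==> y \<in> U"
        using U x(2) unfolding openin_mtopology_of_iff by metis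
      have "openin (mtopology_of T) {y \<in> mspace T. mdist T x y < e}"
        using x AT by (intro openin_mdist_less) auto
      moreover have "A \<inter> {y \<in> mspace T. mdist T x y < e} \<subseteq> {x \<in> A. \<phi> x \<in> U}"
        using e(2) \<phi> x(1) by auto
      moreover have "mdist T x x = 0" using x(1) AT by (intro mdist_self) auto
      ultimately show ?thesis
        unfolding V_def using x(1) AT e(1)
        by (intro UnionI[of "{y \<in> mspace T. mdist T x y < e}"]) auto
    qed
    then have "{x \<in> A. \<phi> x \<in> U} = A \<inter> V" by (auto simp: V_def)
    moreover have "openin (mtopology_of T) V" unfolding V_def by (rule openin_Union) auto
    ultimately show ?thesis by blast
  qed
  show ?thesis
    unfolding borel_on_def[of T'] borel_of_def
  proof (rule measurable_measure_of)
    show "(\<lambda>x. if x \<in> A then \<phi> x else c) \<in> space (borel_on T) \<rightarrow> topspace (mtopology_of T')"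
      using \<phi>(1) c by auto
    fix U assume "U \<in> {U. openin (mtopology_of T') U}"
    then obtain V where V: "openin (mtopology_of T) V" "{x \<in> A. \<phi> x \<in> U} = A \<inter> V"
      using open_pre by blast
    have "(\<lambda>x. if x \<in> A then \<phi> x else c) -` U \<inter> space (borel_on T) =
        (A \<inter> V) \<union> (if c \<in> U then mspace T - A else {})"
      unfolding V(2)[symmetric] using AT by (auto split: if_splits)
    also have "\<dots> \<in> sets (borel_on T)"
      using A openin_sets_borel_on[OF V(1)] sets.compl_sets[OF A] by auto
    finally show "(\<lambda>x. if x \<in> A then \<phi> x else c) -` U \<inter> space (borel_on T) \<in> sets (borel_on T)" .
  qed (use openin_subset in fastforce)
qed

text \<open>On a separable set two points have distance less than \<open>a\<close> iff some point of
  a countable dense set has distances to them that add up to less than \<open>a\<close>.\<close>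

lemma mdist_retract_measurable:
  assumes sep: "sep_set T A" and A: "A \<subseteq> mspace T"
    and r: "r \<in> measurable M (borel_on T)" "\<And>x. x \<in> space M ==> r x \<in> A"
  shows "(\<lambda>(x, y). mdist T (r x) (r y)) \<in> borel_measurable (M \<Otimes>\<^sub>M M)"
proof -
  obtain Q where Q: "countable Q" "Q \<subseteq> A" "\<And>x e. x \<in> A ==> e > 0 ==> \<exists>q\<in>Q. mdist T x q < e"
    using sep unfolding sep_set_def by metis
  show ?thesis
  proof (subst borel_measurable_iff_less, intro allI)
    fix a :: real
    have 1: "{p \<in> space (M \<Otimes>\<^sub>M M). mdist T q (r (fst p)) + mdist T q (r (snd p)) < a} \<in> sets (M \<Otimes>\<^sub>M M)"
      if q: "q \<in> Q" for q
    proof -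
      have "mdist T q \<in> borel_measurable (borel_on T)"
        using q Q A by (intro mdist_borel_measurable) auto
      then have "(\<lambda>x. mdist T q (r x)) \<in> borel_measurable M"
        by (rule measurable_compose[OF r(1)])
      then have [measurable]: "(\<lambda>p. mdist T q (r (fst p))) \<in> borel_measurable (M \<Otimes>\<^sub>M M)"
        "(\<lambda>p. mdist T q (r (snd p))) \<in> borel_measurable (M \<Otimes>\<^sub>M M)"
        by (auto intro: measurable_compose[OF measurable_fst] measurable_compose[OF measurable_snd])
      show ?thesis by measurable
    qed
    have "{p \<in> space (M \<Otimes>\<^sub>M M). (case p of (x, y) \<Rightarrow> mdist T (r x) (r y)) < a} =
      (\<Union>q\<in>Q. {p \<in> space (M \<Otimes>\<^sub>M M). mdist T q (r (fst p)) + mdist T q (r (snd p)) < a})"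
    proof (intro set_eqI iffI)
      fix p assume p: "p \<in> {p \<in> space (M \<Otimes>\<^sub>M M). (case p of (x, y) \<Rightarrow> mdist T (r x) (r y)) < a}"
      obtain x y where xy: "p = (x, y)" by (cases p)
      have rA: "r x \<in> A" "r y \<in> A" using p xy r(2) by (auto simp: space_pair_measure)
      have lt: "mdist T (r x) (r y) < a" using p xy by simp
      \<comment> \<open>Half of the gap, because the distance from \<open>q\<close> to
        \<open>r x\<close> enters twice: once directly and once in the triangle inequality for
        \<open>r y\<close>.\<close>
      obtain q where q: "q \<in> Q" "mdist T (r x) q < (a - mdist T (r x) (r y)) / 2"
        using Q(3)[OF rA(1), of "(a - mdist T (r x) (r y)) / 2"] lt by auto
      have "mdist T q (r y) \<le> mdist T q (r x) + mdist T (r x) (r y)"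
        using q Q A rA by (intro mdist_triangle) auto
      then have "mdist T q (r x) + mdist T q (r y) < a"
        using q(2) mdist_commute[of T q "r x"] by (simp add: field_simps)
      then show "p \<in> (\<Union>q\<in>Q. {p \<in> space (M \<Otimes>\<^sub>M M). mdist T q (r (fst p)) + mdist T q (r (snd p)) < a})"
        using p q(1) xy by auto
    next
      fix p assume "p \<in> (\<Union>q\<in>Q. {p \<in> space (M \<Otimes>\<^sub>M M). mdist T q (r (fst p)) + mdist T q (r (snd p)) < a})"
      then obtain q where q: "q \<in> Q" "p \<in> space (M \<Otimes>\<^sub>M M)" "mdist T q (r (fst p)) + mdist T q (r (snd p)) < a"
        by auto
      have rA: "r (fst p) \<in> A" "r (snd p) \<in> A" using q(2) r(2) by (auto simp: space_pair_measure)
      have "mdist T (r (fst p)) (r (snd p)) \<le> mdist T (r (fst p)) q + mdist T q (r (snd p))"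
        using q Q A rA by (intro mdist_triangle) auto
      then show "p \<in> {p \<in> space (M \<Otimes>\<^sub>M M). (case p of (x, y) \<Rightarrow> mdist T (r x) (r y)) < a}"
        using q(2,3) mdist_commute[of T q "r (fst p)"] by (auto simp: split_beta)
    qed
    then show "{p \<in> space (M \<Otimes>\<^sub>M M). (case p of (x, y) \<Rightarrow> mdist T (r x) (r y)) < a} \<in> sets (M \<Otimes>\<^sub>M M)"
      using Q(1) 1 by (auto intro: sets.countable_UN')
  qed
qed

subsection \<open>Bi-measure trees\<close>

lemma bitreesD:
  assumes "X \<in> bitrees"
  shows "rooted_R_tree (tree X) (rt X)" "admissible_measure (tree X) (mu X)"
    "sets (nu X) = sets (borel_on (tree X))" "sigma_finite_measure (nu X)"
    "AE u in mu X. emeasure (nu X) (seg (tree X) (rt X) u) < \<infinity>"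
    "emeasure (nu X) (leaves X) = 0"
    "rt X \<in> mspace (tree X)" "zero_hyperbolic (tree X) (mspace (tree X))"
    "sets (mu X) = sets (borel_on (tree X))" "finite_measure (mu X)"
    "sep_set (tree X) (msupp (tree X) (mu X))"
    "space (mu X) = mspace (tree X)" "space (nu X) = mspace (tree X)"
  using assms sets_eq_imp_space_eq[of "nu X" "borel_on (tree X)"] admissibleD[of "tree X" "mu X"]
  unfolding bitrees_def rooted_R_tree_def by auto

text \<open>The part of the skeleton spanned by \<open>K\<close>, by \<open>seg_near\<close> a countable union.\<close>

definition open_span :: "real metric \<Rightarrow> real \<Rightarrow> real set \<Rightarrow> real set" where
  "open_span T \<rho> K = (\<Union>v\<in>K. seg T \<rho> v - {v})"

lemma open_span_dense:
  assumes h: "zero_hyperbolic T (mspace T)" and \<rho>: "\<rho> \<in> mspace T" and K: "K \<subseteq> mspace T" and Q: "Q \<subseteq> K"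
    and dense: "\<And>x e. x \<in> K ==> e > 0 ==> \<exists>q\<in>Q. mdist T x q < e"
  shows "open_span T \<rho> K = open_span T \<rho> Q"
proof
  show "open_span T \<rho> K \<subseteq> open_span T \<rho> Q"
  proof
    fix w assume "w \<in> open_span T \<rho> K"
    then obtain v where v: "v \<in> K" "w \<in> seg T \<rho> v" "w \<noteq> v" by (auto simp: open_span_def)
    have "w \<in> mspace T" using v(2) by (simp add: seg_def)
    then have "0 < mdist T w v"
      using v K mdist_nonneg[of T w v] mdist_zero[of w T v] by (metis less_eq_real_def subsetD)
    then obtain q where q: "q \<in> Q" "mdist T v q < mdist T w v" using dense[OF v(1)] by blast
    have "w \<in> seg T \<rho> q - {q}" using q Q K v by (intro seg_near[OF h \<rho>, of v]) auto
    then show "w \<in> open_span T \<rho> Q" using q(1) by (auto simp: open_span_def)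
  qed
  show "open_span T \<rho> Q \<subseteq> open_span T \<rho> K" using Q by (auto simp: open_span_def)
qed

lemma open_span_sets:
  assumes h: "zero_hyperbolic T (mspace T)" and \<rho>: "\<rho> \<in> mspace T" and K: "K \<subseteq> mspace T" and sep: "sep_set T K"
  shows "open_span T \<rho> K \<in> sets (borel_on T)"
proof -
  obtain Q where Q: "countable Q" "Q \<subseteq> K" "\<And>x e. x \<in> K ==> e > 0 ==> \<exists>q\<in>Q. mdist T x q < e"
    using sep unfolding sep_set_def by metis
  have "open_span T \<rho> K = open_span T \<rho> Q" using h \<rho> K Q(2,3) by (rule open_span_dense)
  moreover have "open_span T \<rho> Q \<in> sets (borel_on T)"
    unfolding open_span_def
  proof (rule sets.countable_UN'[OF Q(1)], clarify)
    fix q assume "q \<in> Q"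
    then have "q \<in> mspace T" using Q(2) K by blast
    then show "seg T \<rho> q - {q} \<in> sets (borel_on T)"
      by (intro sets.Diff seg_sets singleton_sets_borel_on \<rho>)
  qed
  ultimately show ?thesis by simp
qed

lemma supp_tree_eq:
  assumes "rt X \<in> mspace (tree X)"
  shows "supp_tree X = insert (rt X) (msupp (tree X) (mu X)) \<union> open_span (tree X) (rt X) (msupp (tree X) (mu X))"
proof -
  have "v \<in> seg (tree X) (rt X) v" if "v \<in> msupp (tree X) (mu X)" for v
    by (rule end_in_seg[OF assms subsetD[OF msupp_subset that]])
  then show ?thesis unfolding supp_tree_def span_tree_def open_span_def by blast
qed

lemma supp_tree_subset: "rt X \<in> mspace (tree X) ==> supp_tree X \<subseteq> mspace (tree X)"
  using seg_subset by (auto simp: supp_tree_def span_tree_def)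

lemma rt_in_supp_tree: "rt X \<in> supp_tree X"
  by (simp add: supp_tree_def span_tree_def)

lemma msupp_subset_supp_tree: "rt X \<in> mspace (tree X) ==> msupp (tree X) (mu X) \<subseteq> supp_tree X"
  by (auto simp: supp_tree_eq)

lemma seg_subset_supp_tree:
  assumes "rt X \<in> mspace (tree X)" "u \<in> supp_tree X"
  shows "seg (tree X) (rt X) u \<subseteq> supp_tree X"
proof
  fix x assume x: "x \<in> seg (tree X) (rt X) u"
  show "x \<in> supp_tree X"
  proof (cases "u = rt X")
    case True
    then have "x \<in> mspace (tree X)" "mdist (tree X) (rt X) x + mdist (tree X) x (rt X) = 0"
      using x assms by (auto simp: seg_def mdist_self)
    then have "mdist (tree X) (rt X) x = 0"
      using mdist_commute[of "tree X" x "rt X"] by linarith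
    then have "x = rt X" using \<open>x \<in> mspace (tree X)\<close> assms(1) by simp
    then show ?thesis by (simp add: rt_in_supp_tree)
  next
    case False
    then obtain v where v: "v \<in> msupp (tree X) (mu X)" "u \<in> seg (tree X) (rt X) v"
      using assms by (auto simp: supp_tree_def span_tree_def)
    then have "x \<in> seg (tree X) (rt X) v"
      by (intro seg_trans[OF x _ assms(1)] subsetD[OF msupp_subset])
    then show ?thesis using v by (auto simp: supp_tree_def span_tree_def)
  qed
qed

lemma atoms_subset_msupp:
  assumes "sets \<mu> = sets (borel_on T)" "v \<in> mspace T" "0 < emeasure \<mu> {v}"
  shows "v \<in> msupp T \<mu>"
  unfolding msupp_def
proof (intro CollectI conjI allI impI assms(2))
  fix U assume U: "openin (mtopology_of T) U \<and> v \<in> U"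
  then have "emeasure \<mu> {v} \<le> emeasure \<mu> U"
    using assms(1) by (intro emeasure_mono) (auto intro: openin_sets_borel_on)
  then show "0 < emeasure \<mu> U" using assms(3) by order
qed

lemma skeleton_eq:
  "skeleton X = open_span (tree X) (rt X) (msupp (tree X) (mu X)) \<union> {v \<in> mspace (tree X). 0 < emeasure (mu X) {v}}"
  by (simp add: skeleton_def open_span_def)

lemma countable_atoms:
  assumes "finite_measure \<mu>" shows "countable {v. 0 < emeasure \<mu> {v}}"
proof -
  interpret finite_measure \<mu> by fact
  show ?thesis
    by (rule countable_subset[OF _ countable_support])
      (auto simp: emeasure_eq_measure)
qed

lemma bitree_sets:
  assumes X: "X \<in> bitrees"
  shows "skeleton X \<in> sets (borel_on (tree X))" "supp_tree X \<in> sets (borel_on (tree X))"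
    "skeleton X \<subseteq> supp_tree X"
proof -
  note D = bitreesD[OF X]
  have o: "open_span (tree X) (rt X) (msupp (tree X) (mu X)) \<in> sets (borel_on (tree X))"
    by (rule open_span_sets[OF D(8,7) msupp_subset D(11)])
  have at: "{v \<in> mspace (tree X). 0 < emeasure (mu X) {v}} \<in> sets (borel_on (tree X))"
    by (rule countable_sets_borel_on) (auto intro: countable_subset[OF _ countable_atoms[OF D(10)]])
  show "skeleton X \<in> sets (borel_on (tree X))"
    unfolding skeleton_eq using o at by (rule sets.Un)
  have "{rt X} \<union> msupp (tree X) (mu X) \<in> sets (borel_on (tree X))"
    using D(7) by (intro sets.Un singleton_sets_borel_on msupp_sets)
  then show "supp_tree X \<in> sets (borel_on (tree X))"
    unfolding supp_tree_eq[OF D(7)] using o by (intro sets.Un) simp_all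
  show "skeleton X \<subseteq> supp_tree X"
    unfolding supp_tree_eq[OF D(7)] skeleton_eq using atoms_subset_msupp[OF D(9)] by auto
qed

lemma sep_set_seg:
  assumes "rooted_R_tree T r" "v \<in> mspace T" shows "sep_set T (seg T r v)"
  by (rule compactin_mcomplete_separable(2)[OF compactin_seg[OF assms], of "{}"]) simp

text \<open>Apart from the root and the support, the segments to a countable dense subset of the
  support exhaust the tree, and each of them is compact.\<close>

lemma sep_set_supp_tree:
  assumes X: "X \<in> bitrees" shows "sep_set (tree X) (supp_tree X)"
proof -
  note D = bitreesD[OF X]
  let ?K = "msupp (tree X) (mu X)"
  obtain Q where Q: "countable Q" "Q \<subseteq> ?K" "\<And>x e. x \<in> ?K ==> e > 0 ==> \<exists>q\<in>Q. mdist (tree X) x q < e"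
    using D(11) unfolding sep_set_def by metis
  have QT: "Q \<subseteq> mspace (tree X)" using Q(2) msupp_subset by blast
  have "sep_set (tree X) (seg (tree X) (rt X) q)" if "q \<in> Q" for q
    using D(1) that QT by (intro sep_set_seg) auto
  then have "sep_set (tree X) (\<Union>q\<in>Q. seg (tree X) (rt X) q)"
    by (rule sep_set_Union[OF Q(1)])
  moreover have "sep_set (tree X) {rt X}"
    using D(7) by (intro sep_set_countable) auto
  ultimately have "sep_set (tree X) ({rt X} \<union> ?K \<union> (\<Union>q\<in>Q. seg (tree X) (rt X) q))"
    using D(11) by (intro sep_set_Un)
  then show ?thesis
  proof (rule sep_set_subset)
    show "supp_tree X \<subseteq> {rt X} \<union> ?K \<union> (\<Union>q\<in>Q. seg (tree X) (rt X) q)"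
    proof -
      have "open_span (tree X) (rt X) ?K = open_span (tree X) (rt X) Q"
        by (rule open_span_dense[OF D(8,7) msupp_subset Q(2,3)])
      then show ?thesis unfolding supp_tree_eq[OF D(7)] by (auto simp: open_span_def)
    qed
    show "{rt X} \<union> ?K \<union> (\<Union>q\<in>Q. seg (tree X) (rt X) q) \<subseteq> mspace (tree X)"
      using D(7) msupp_subset[of "tree X" "mu X"] seg_subset[of "tree X" "rt X"]
      by (intro Un_least UN_least) auto
  qed
qed

definition carrier_map :: "bitree \<Rightarrow> real \<Rightarrow> real" where
  "carrier_map X x = (if x \<in> supp_tree X then x else rt X)"

text \<open>
  Off the separable set \<open>supp_tree X\<close> the metric need not be measurable for the product
  \<open>\<sigma>\<close>-algebra; this set carries both measures, and the rest is collapsed to the root.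
\<close>

definition tree_dist :: "bitree \<Rightarrow> real \<Rightarrow> real \<Rightarrow> real" where
  "tree_dist X x y = mdist (tree X) (carrier_map X x) (carrier_map X y)"

text \<open>Equivalence of bi-measure trees sees \<open>nu X\<close> only on the skeleton. Within
  \<open>supp_tree X\<close> nothing is lost, since the leaves are null; mass of \<open>nu X\<close>
  outside \<open>supp_tree X\<close> is discarded.\<close>

definition skel_measure :: "bitree \<Rightarrow> real measure" where
  "skel_measure X = density (nu X) (indicator (skeleton X))"

abbreviation "tree_gev X \<equiv> gev (skel_measure X) (tree_dist X) (rt X)"
abbreviation "tree_spanned X \<equiv> spanned (skel_measure X) (tree_dist X) (rt X)"

lemma carrier_map_in: "carrier_map X x \<in> supp_tree X"
  by (simp add: carrier_map_def rt_in_supp_tree)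

lemma carrier_map_measurable:
  assumes X: "X \<in> bitrees"
  shows "carrier_map X \<in> measurable (borel_on (tree X)) (borel_on (tree X))"
proof -
  note D = bitreesD[OF X]
  have "isometric_on (supp_tree X) (tree X) (tree X) (\<lambda>x. x)"
    using supp_tree_subset[OF D(7)] by (auto simp: isometric_on_def)
  from measurable_isometric_extension[OF this bitree_sets(2)[OF X] D(7)]
  show ?thesis by (simp add: carrier_map_def[abs_def])
qed

lemma sampler_bitree:
  assumes X: "X \<in> bitrees"
  shows "sampler (mu X) (skel_measure X) (tree_dist X) (rt X)"
proof (rule sampler.intro)
  note D = bitreesD[OF X]
  show "sets (skel_measure X) = sets (mu X)" unfolding skel_measure_def sets_density D(3) D(9) ..
  show "sigma_finite_measure (skel_measure X)"
    unfolding skel_measure_def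
    by (rule sigma_finite_density_indicator[OF D(4)]) (use bitree_sets(1)[OF X] D(3) in simp)
  show "finite_measure (mu X)" by (rule D(10))
  show "rt X \<in> space (mu X)" using D(7,12) by simp
  have "carrier_map X \<in> measurable (mu X) (borel_on (tree X))"
    using carrier_map_measurable[OF X] measurable_cong_sets[OF D(9) refl] by blast
  from mdist_retract_measurable[OF sep_set_supp_tree[OF X] supp_tree_subset[OF D(7)] this carrier_map_in]
  show "case_prod (tree_dist X) \<in> borel_measurable (mu X \<Otimes>\<^sub>M mu X)"
    by (simp add: tree_dist_def[abs_def])
qed

lemma bitree_equiv_refl:
  assumes X: "X \<in> bitrees" shows "bitree_equiv X X"
  unfolding bitree_equiv_def
proof (intro exI[of _ "\<lambda>x. x"] conjI)
  note D = bitreesD[OF X]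
  show "isometric_on (supp_tree X) (tree X) (tree X) (\<lambda>x. x)"
    using supp_tree_subset[OF D(7)] by (auto simp: isometric_on_def)
  have id: "(\<lambda>x. x) \<in> measurable (mu X) (borel_on (tree X))" "(\<lambda>x. x) \<in> measurable (nu X) (borel_on (tree X))"
    using D(3,9) by (simp_all add: measurable_ident_sets)
  have s: "supp_tree X \<in> sets (mu X)" "skeleton X \<in> sets (nu X)" using bitree_sets[OF X] D(3,9) by simp_all
  have "emeasure (mu X) (mspace (tree X) - supp_tree X) \<le> emeasure (mu X) (mspace (tree X) - msupp (tree X) (mu X))"
    using msupp_subset_supp_tree[OF D(7)] openin_compl_msupp D(9)
    by (intro emeasure_mono) (auto intro: openin_sets_borel_on)
  then have 0: "emeasure (mu X) (space (mu X) - supp_tree X) = 0"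
    using admissibleD(4)[OF D(2)] D(12) by simp
  show "distr (restrict_space (mu X) (supp_tree X)) (borel_on (tree X)) (\<lambda>x. x) = mu X"
    using distr_restrict_space_eq_distr_density[OF s(1) measurable_restrict_space1[OF id(1)] id(1) refl]
      density_indicator_full[OF s(1) 0] D(9) by (simp add: distr_id2)
  show "distr (restrict_space (nu X) (skeleton X)) (borel_on (tree X)) (\<lambda>x. x) = density (nu X) (indicator (skeleton X))"
    using distr_restrict_space_eq_distr_density[OF s(2) measurable_restrict_space1[OF id(2)] id(2) refl] D(3)
    by (simp add: distr_id2)
qed simp

lemma bitree_class_representative:
  assumes "X \<in> bitrees"
  shows "representative (bitree_class X) \<in> bitrees" "bitree_equiv X (representative (bitree_class X))"
    "representative (bitree_class X) \<in> bitree_class X"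
proof -
  have "X \<in> bitree_class X" using assms bitree_equiv_refl[OF assms] by (auto simp: bitree_class_def)
  then show *: "representative (bitree_class X) \<in> bitree_class X"
    unfolding representative_def by (rule someI)
  then show "representative (bitree_class X) \<in> bitrees" "bitree_equiv X (representative (bitree_class X))"
    by (auto simp: bitree_class_def)
qed

lemma representative_bitree_classes: "C \<in> bitree_classes ==> representative C \<in> bitrees \<and> representative C \<in> C"
  using bitree_class_representative by (auto simp: bitree_classes_def)

lemma AE_supp_tree:
  assumes X: "X \<in> bitrees"
  shows "AE x in mu X. x \<in> msupp (tree X) (mu X)" "AE x in skel_measure X. x \<in> skeleton X"
proof -
  note D = bitreesD[OF X]
  show "AE x in mu X. x \<in> msupp (tree X) (mu X)"
    using admissibleD(4)[OF D(2)] D(9,12) openin_compl_msupp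
    by (intro AE_I[of _ _ "mspace (tree X) - msupp (tree X) (mu X)"]) (auto intro: openin_sets_borel_on)
  have "skeleton X \<in> sets (nu X)" using bitree_sets(1)[OF X] D(3) by simp
  then show "AE x in skel_measure X. x \<in> skeleton X"
    unfolding skel_measure_def by (subst AE_density) (auto simp: indicator_def)
qed

subsection \<open>Generators of the topologies\<close>

lemma topspace_weak_topology:
  "topspace (weak_topology E) = {M. sets M = sets (borel_of E) \<and> finite_measure M}"
  unfolding weak_topology_def topspace_pullback_topology by auto

lemma continuous_map_into_weak_topology:
  assumes "\<And>z. z \<in> topspace Z ==> sets (\<kappa> z) = sets (borel_of E)" "\<And>z. z \<in> topspace Z ==> finite_measure (\<kappa> z)"
    and "\<And>f. f \<in> bounded_continuous E ==> continuous_map Z euclideanreal (\<lambda>z. \<integral>x. f x \<partial>\<kappa> z)"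
  shows "continuous_map Z (weak_topology E) \<kappa>"
  unfolding weak_topology_def
proof (rule continuous_map_pullback')
  show "continuous_map Z (product_topology (\<lambda>_. euclideanreal) (bounded_continuous E))
     ((\<lambda>M. \<lambda>f\<in>bounded_continuous E. \<integral>x. f x \<partial>M) \<circ> \<kappa>)"
    using assms(3) by (auto simp: continuous_map_componentwise)
qed (use assms in auto)

lemma continuous_map_weak_integral:
  assumes f: "f \<in> bounded_continuous E"
  shows "continuous_map (weak_topology E) euclideanreal (\<lambda>M. \<integral>x. f x \<partial>M)"
proof -
  have "continuous_map (product_topology (\<lambda>_. euclideanreal) (bounded_continuous E)) euclideanreal (\<lambda>w. w f)"
    using f by (rule continuous_map_product_projection)
  then have "continuous_map (weak_topology E) euclideanreal
      ((\<lambda>w. w f) \<circ> (\<lambda>M. \<lambda>f\<in>bounded_continuous E. \<integral>x. f x \<partial>M))"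
    unfolding weak_topology_def by (rule continuous_map_pullback)
  then show ?thesis using f by (simp add: o_def)
qed

lemma continuous_map_arctan_cancel:
  "continuous_map Z euclideanreal (\<lambda>z. arctan (f z)) ==> continuous_map Z euclideanreal f"
proof -
  assume a: "continuous_map Z euclideanreal (\<lambda>z. arctan (f z))"
  show ?thesis
    unfolding continuous_map_real_iff_tendsto
  proof
    fix z assume "z \<in> topspace Z"
    then have "((\<lambda>z. arctan (f z)) \<longlongrightarrow> arctan (f z)) (atin Z z)"
      by (rule continuous_map_real_tendsto[OF a])
    then have "((\<lambda>z. tan (arctan (f z))) \<longlongrightarrow> tan (arctan (f z))) (atin Z z)"
      by (rule isCont_tendsto_compose[rotated]) (simp add: isCont_tan)
    then show "(f \<longlongrightarrow> f z) (atin Z z)" by (simp add: tan_arctan)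
  qed
qed

lemma continuous_map_arctan:
  assumes "continuous_map Z euclideanreal f" shows "continuous_map Z euclideanreal (\<lambda>z. arctan (f z))"
  unfolding continuous_map_real_iff_tendsto
  using continuous_map_real_tendsto[OF assms] by (auto intro: tendsto_arctan)

lemma continuous_map_exp:
  assumes "continuous_map Z euclideanreal f" shows "continuous_map Z euclideanreal (\<lambda>z. exp (f z :: real))"
  unfolding continuous_map_real_iff_tendsto
  using continuous_map_real_tendsto[OF assms] by (auto intro: tendsto_exp)

lemma continuous_map_exp_cancel:
  "continuous_map Z euclideanreal (\<lambda>z. exp (- f z)) ==> continuous_map Z euclideanreal (f :: _ \<Rightarrow> real)"
proof -
  assume a: "continuous_map Z euclideanreal (\<lambda>z. exp (- f z))"
  show ?thesis
    unfolding continuous_map_real_iff_tendsto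
  proof
    fix z assume "z \<in> topspace Z"
    then have "((\<lambda>z. exp (- f z)) \<longlongrightarrow> exp (- f z)) (atin Z z)"
      by (rule continuous_map_real_tendsto[OF a])
    then have "((\<lambda>z. - ln (exp (- f z))) \<longlongrightarrow> - ln (exp (- f z))) (atin Z z)"
      by (intro tendsto_minus tendsto_ln) simp_all
    then show "(f \<longlongrightarrow> f z) (atin Z z)" by simp
  qed
qed

text \<open>
  Passing between functionals of normalised and of unnormalised samples: where \<open>a\<close> vanishes, \<open>v\<close>
  is continuous by the bound.
\<close>

lemma continuous_map_cancel_power:
  fixes a v :: "'z \<Rightarrow> real"
  assumes a: "continuous_map Z euclideanreal a" and av: "continuous_map Z euclideanreal (\<lambda>z. a z ^ k * v z)"
    and nonneg: "\<And>z. z \<in> topspace Z ==> 0 \<le> a z"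
    and bound: "\<And>z. z \<in> topspace Z ==> \<bar>v z\<bar> \<le> B * a z"
  shows "continuous_map Z euclideanreal v"
  unfolding continuous_map_real_iff_tendsto
proof
  fix z assume z: "z \<in> topspace Z"
  have az: "(a \<longlongrightarrow> a z) (atin Z z)" by (rule continuous_map_real_tendsto[OF a z])
  show "(v \<longlongrightarrow> v z) (atin Z z)"
  proof (cases "a z = 0")
    case True
    then have "v z = 0" using bound[OF z] by simp
    moreover have "((\<lambda>z. B * a z) \<longlongrightarrow> B * 0) (atin Z z)"
      using az True by (intro tendsto_mult_left) simp
    then have "(v \<longlongrightarrow> 0) (atin Z z)"
      by (intro Lim_null_comparison[where f = v and g = "\<lambda>z. B * a z"])
        (use eventually_atin_topspace[OF z] bound in \<open>auto elim!: eventually_mono\<close>)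
    ultimately show ?thesis by simp
  next
    case False
    then have pos: "a z > 0" using nonneg[OF z] by simp
    have "((\<lambda>z. (a z ^ k * v z) / a z ^ k) \<longlongrightarrow> (a z ^ k * v z) / a z ^ k) (atin Z z)"
      by (intro tendsto_divide tendsto_power az continuous_map_real_tendsto[OF av z]) (use pos in simp)
    moreover have "\<forall>\<^sub>F y in atin Z z. (a y ^ k * v y) / a y ^ k = v y"
      using order_tendstoD(1)[OF az pos] by eventually_elim simp
    ultimately have "(v \<longlongrightarrow> (a z ^ k * v z) / a z ^ k) (atin Z z)"
      by (rule Lim_transform_eventually)
    then show ?thesis using pos by simp
  qed
qed

section \<open>Bounded coordinates for the pointed Gromov-weak topology\<close>

definition mcoord :: "(nat \<times> nat \<Rightarrow> real) \<Rightarrow> nat \<times> nat \<Rightarrow> real" where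
  "mcoord D p = (if p \<in> all_pairs then arctan (D p) else 0)"

lemma dmono_mcoord: "dmono l D = (\<Prod>p\<leftarrow>l. mcoord D p)"
  by (simp add: dmono_def mcoord_def)

lemma continuous_map_entry:
  "p \<in> I ==> continuous_map (matrix_topology I) euclideanreal (\<lambda>D. D p)"
  unfolding matrix_topology_def by (rule continuous_map_product_projection)

lemma continuous_map_mcoord: "continuous_map (matrix_topology all_pairs) euclideanreal (\<lambda>D. mcoord D p)"
  unfolding mcoord_def by (cases "p \<in> all_pairs") (auto intro: continuous_map_arctan continuous_map_entry)

text \<open>\<open>arctan\<close> is inverted by \<open>tan\<close>, so the bounded coordinates
  generate the same topology as the entries.\<close>

lemma matrix_topology_coord:
  "matrix_topology all_pairs = coord_topology (topspace (matrix_topology all_pairs)) mcoord"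
proof (rule coord_topology_eqI[OF continuous_map_mcoord])
  let ?Z = "coord_topology (topspace (matrix_topology all_pairs)) mcoord"
  have "continuous_map ?Z euclideanreal (\<lambda>D. D p)" if p: "p \<in> all_pairs" for p
  proof (rule continuous_map_arctan_cancel)
    show "continuous_map ?Z euclideanreal (\<lambda>D. arctan (D p))"
      using continuous_map_coord[of "topspace (matrix_topology all_pairs)" mcoord p] p
      by (simp add: mcoord_def)
  qed
  then show "continuous_map ?Z (matrix_topology all_pairs) (\<lambda>x. x)"
    unfolding matrix_topology_def[of all_pairs] continuous_map_componentwise
    by (auto simp: matrix_topology_def PiE_def)
qed

lemma dmono_bounded_continuous: "dmono l \<in> bounded_continuous (matrix_topology all_pairs)"
proof -
  have "continuous_map (matrix_topology all_pairs) euclideanreal (\<lambda>D. \<Prod>p\<leftarrow>l. mcoord D p)"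
    by (induction l) (auto intro!: continuous_map_real_mult continuous_map_mcoord)
  then show ?thesis
    using dmono_bound unfolding bounded_continuous_def bounded_iff dmono_mcoord[abs_def, symmetric]
    by (auto simp: dmono_mcoord[symmetric])
qed

definition ups :: "(nat \<times> nat) list \<Rightarrow> pmm set \<Rightarrow> real" where
  "ups l C = (\<integral>D. dmono l D \<partial>upsilon (representative C))"

definition mark_dist :: "pmm set \<Rightarrow> nat \<times> nat \<Rightarrow> real" where
  "mark_dist C = (\<lambda>(i, j). let X = representative C in
     mdist (pmm_space X) (case_nat (pmm_root X) ((!) (pmm_marks X)) i) (case_nat (pmm_root X) ((!) (pmm_marks X)) j))"

lemma sets_upsilon [simp]: "sets (upsilon X) = sets (matrix_borel)"
  by (simp add: upsilon_def Let_def push_ae_def)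

lemma finite_measure_null: "finite_measure (null_measure M)"
  by (rule finite_measureI) simp

lemma finite_measure_scale:
  assumes "finite_measure M" "r < \<infinity>" shows "finite_measure (scale_measure r M)"
proof
  show "emeasure (scale_measure r M) (space (scale_measure r M)) \<noteq> \<infinity>"
    using finite_measure.emeasure_finite[OF assms(1)] assms(2)
    by (auto simp: space_scale_measure ennreal_mult_eq_top_iff)
qed

lemma finite_measure_upsilon:
  assumes "X \<in> pmm_spaces n" shows "finite_measure (upsilon X)"
proof (cases "total_mass (pmm_measure X) = 0")
  case True
  then show ?thesis by (simp add: upsilon_def finite_measure_null)
next
  case False
  have a: "admissible_measure (pmm_space X) (pmm_measure X)" using assms by (simp add: pmm_spaces_def)
  have "prob_space (\<Pi>\<^sub>M k\<in>UNIV. if k < length (pmm_marks X) then return (borel_on (pmm_space X)) (pmm_marks X ! k)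
      else normalise (pmm_measure X))"
  proof (rule prob_space_PiM)
    fix k
    have "pmm_marks X ! k \<in> mspace (pmm_space X)" if "k < length (pmm_marks X)"
      using assms nth_mem[OF that] by (auto simp: pmm_spaces_def)
    then show "prob_space (if k < length (pmm_marks X) then return (borel_on (pmm_space X)) (pmm_marks X ! k)
      else normalise (pmm_measure X))"
      using prob_space_normalise[OF admissibleD(2)[OF a] False] by (auto intro: prob_space_return)
  qed
  from finite_measure_push_ae[OF this] show ?thesis
    using False total_mass_finite[OF admissibleD(2)[OF a]]
    by (auto simp: upsilon_def Let_def intro!: finite_measure_scale)
qed

lemma upsilon_in_weak: "C \<in> hyp_classes n ==> upsilon (representative C) \<in> topspace (weak_topology (matrix_topology all_pairs))"
  unfolding topspace_weak_topology by (auto intro: finite_measure_upsilon representative_hyp_classes)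

lemma topspace_pGw: "topspace (pGw_topology n) = hyp_classes n"
proof -
  have "dist_matrix (pairs_upto n) T \<rho> x \<in> topspace (matrix_topology (pairs_upto n))" for T \<rho> x
    by (simp add: matrix_topology_def dist_matrix_def)
  then show ?thesis
    unfolding pGw_topology_def topspace_pullback_topology using upsilon_in_weak
    by (auto simp: Let_def)
qed

lemma continuous_map_pGw_projections:
  "continuous_map (pGw_topology n) (weak_topology (matrix_topology all_pairs)) (\<lambda>C. upsilon (representative C))"
  "p \<in> pairs_upto n ==> continuous_map (pGw_topology n) euclideanreal (\<lambda>C. mark_dist C p)"
proof -
  let ?P = "prod_topology (weak_topology (matrix_topology all_pairs)) (matrix_topology (pairs_upto n))"
  let ?f = "\<lambda>C. let X = representative C in
          (upsilon X, dist_matrix (pairs_upto n) (pmm_space X) (pmm_root X) (\<lambda>k. pmm_marks X ! k))"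
  have "continuous_map (pGw_topology n) (weak_topology (matrix_topology all_pairs)) (fst \<circ> ?f)"
    unfolding pGw_topology_def by (rule continuous_map_pullback[OF continuous_map_fst])
  then show "continuous_map (pGw_topology n) (weak_topology (matrix_topology all_pairs)) (\<lambda>C. upsilon (representative C))"
    by (simp add: o_def Let_def)
  assume p: "p \<in> pairs_upto n"
  have "continuous_map ?P euclideanreal ((\<lambda>D. D p) \<circ> snd)"
    by (rule continuous_map_compose[OF continuous_map_snd continuous_map_entry[OF p]])
  then have "continuous_map (pGw_topology n) euclideanreal (((\<lambda>D. D p) \<circ> snd) \<circ> ?f)"
    unfolding pGw_topology_def by (rule continuous_map_pullback)
  then show "continuous_map (pGw_topology n) euclideanreal (\<lambda>C. mark_dist C p)"
    using p by (simp add: o_def Let_def dist_matrix_def mark_dist_def split_beta')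
qed

lemma upsilon_integral_continuous:
  assumes "f \<in> bounded_continuous (matrix_topology all_pairs)"
  shows "continuous_map (pGw_topology n) euclideanreal (\<lambda>C. \<integral>D. f D \<partial>upsilon (representative C))"
  using continuous_map_compose[OF continuous_map_pGw_projections(1) continuous_map_weak_integral[OF assms]]
  by (simp add: o_def)

lemma ups_continuous: "continuous_map (pGw_topology n) euclideanreal (ups l)"
  unfolding ups_def by (rule upsilon_integral_continuous[OF dmono_bounded_continuous])

lemma continuous_map_into_pGw:
  assumes c: "\<And>z. z \<in> topspace Z ==> c z \<in> hyp_classes n"
    and u: "\<And>l. continuous_map Z euclideanreal (\<lambda>z. ups l (c z))"
    and m: "\<And>p. p \<in> pairs_upto n ==> continuous_map Z euclideanreal (\<lambda>z. mark_dist (c z) p)"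
  shows "continuous_map Z (pGw_topology n) c"
  unfolding pGw_topology_def
proof (rule continuous_map_pullback')
  have "continuous_map Z (weak_topology (matrix_topology all_pairs)) (\<lambda>z. upsilon (representative (c z)))"
  proof (rule continuous_map_into_weak_topology)
    fix f assume f: "f \<in> bounded_continuous (matrix_topology all_pairs)"
    let ?A = "topspace (matrix_topology all_pairs)"
    interpret weak_continuity ?A mcoord "\<lambda>_. 2" Z "\<lambda>z. upsilon (representative (c z))"
    proof (rule weak_continuity.intro)
      show "\<bar>mcoord x i\<bar> \<le> 2" for x i by (simp add: mcoord_def abs_arctan_le)
      show "sets (upsilon (representative (c z))) = sets (borel_of (coord_topology ?A mcoord))" for z
        by (simp add: matrix_topology_coord[symmetric])
      show "finite_measure (upsilon (representative (c z)))" if "z \<in> topspace Z" for z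
        by (rule finite_measure_upsilon[OF representative_hyp_classes[OF c[OF that]]])
      show "continuous_map Z euclideanreal (\<lambda>z. \<integral>x. (\<Prod>i\<leftarrow>l. mcoord x i) \<partial>upsilon (representative (c z)))" for l
        using u[of l] by (simp add: ups_def dmono_mcoord)
    qed
    show "continuous_map Z euclideanreal (\<lambda>z. \<integral>x. f x \<partial>upsilon (representative (c z)))"
      by (rule weakly_continuous) (use f matrix_topology_coord in simp)
  next
    show "finite_measure (upsilon (representative (c z)))" if "z \<in> topspace Z" for z
      by (rule finite_measure_upsilon[OF representative_hyp_classes[OF c[OF that]]])
  qed simp
  moreover have "continuous_map Z (matrix_topology (pairs_upto n))
      (\<lambda>z. dist_matrix (pairs_upto n) (pmm_space (representative (c z))) (pmm_root (representative (c z)))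
        (\<lambda>k. pmm_marks (representative (c z)) ! k))"
    using m unfolding matrix_topology_def continuous_map_componentwise
    by (auto simp: dist_matrix_def mark_dist_def Let_def split_beta')
  ultimately show "continuous_map Z (prod_topology (weak_topology (matrix_topology all_pairs)) (matrix_topology (pairs_upto n)))
     ((\<lambda>C. let X = representative C in (upsilon X,
           dist_matrix (pairs_upto n) (pmm_space X) (pmm_root X) (\<lambda>k. pmm_marks X ! k))) \<circ> c)"
    by (simp add: o_def Let_def continuous_map_paired)
qed (use c in auto)

lemma ups_bound:
  assumes "C \<in> hyp_classes n"
  shows "\<bar>ups l C\<bar> \<le> 2 ^ length l * ups [] C" "0 \<le> ups [] C"
proof -
  interpret finite_measure "upsilon (representative C)"
    by (rule finite_measure_upsilon[OF representative_hyp_classes[OF assms]])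
  have i: "integrable (upsilon (representative C)) (dmono l)"
  proof (rule integrable_const_bound[of _ "2 ^ length l"])
    have "dmono l \<in> borel_measurable (matrix_borel)"
      using dmono_bounded_continuous by (intro continuous_map_real_borel_measurable) (simp add: bounded_continuous_def)
    then show "dmono l \<in> borel_measurable (upsilon (representative C))"
      using measurable_cong_sets[OF sets_upsilon refl] by blast
  qed (simp add: dmono_bound)
  have "\<bar>ups l C\<bar> \<le> (\<integral>D. 2 ^ length l \<partial>upsilon (representative C))"
    unfolding ups_def by (rule abs_integral_le[OF i]) (simp_all add: dmono_bound)
  then show "\<bar>ups l C\<bar> \<le> 2 ^ length l * ups [] C" by (simp add: ups_def dmono_def mult.commute)
  show "0 \<le> ups [] C" by (simp add: ups_def dmono_def)
qed

text \<open>Counterpart of \<open>gev\<close> that depends only on the class. \<open>ups l\<close>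
  carries one factor of the mass and samples from the normalised measure; the power
  \<open>msize l - 1\<close> makes it the moment under the \<open>msize l\<close>-fold product of
  the unnormalised measure.\<close>

fun gen_val :: "nat \<Rightarrow> pmm set \<Rightarrow> gen \<Rightarrow> real" where
  "gen_val n C Mass = exp (- ups [] C)"
| "gen_val n C (Poly l) = exp (- 2 * ups [] C) * (ups [] C ^ (msize l - 1) * ups l C)"
| "gen_val n C (Dist i j) = (if (i, j) \<in> pairs_upto n then arctan (mark_dist C (i, j)) else 0)"

lemma gen_val_bound:
  assumes "C \<in> hyp_classes n" shows "\<bar>gen_val n C g\<bar> \<le> gbound g"
proof (cases g)
  case (Poly l)
  define a where "a = ups [] C"
  have a: "0 \<le> a" "\<bar>ups l C\<bar> \<le> 2 ^ length l * a" using ups_bound[OF assms] by (simp_all add: a_def)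
  obtain m where m: "msize l = Suc m" by (simp add: msize_def)
  have "exp (- 2 * a) * (a ^ m * \<bar>ups l C\<bar>) \<le> exp (- 2 * a) * (a ^ m * (2 ^ length l * a))"
    using a by (intro mult_left_mono) auto
  also have "\<dots> = 2 ^ length l * (exp (- 2 * a) * a ^ Suc m)" by simp
  also have "\<dots> \<le> 2 ^ length l * (fact (Suc m) * exp (- a))"
    by (intro mult_left_mono power_exp_le a) auto
  also have "\<dots> \<le> 2 ^ length l * (fact (Suc m) * 1)"
    using a by (intro mult_left_mono) auto
  finally show ?thesis using a by (simp add: Poly m abs_mult a_def)
qed (use ups_bound[OF assms] abs_arctan_le in auto)

lemma gen_val_continuous: "continuous_map (pGw_topology n) euclideanreal (\<lambda>C. gen_val n C g)"
proof (cases g)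
  case Mass
  then show ?thesis by (auto intro!: continuous_map_exp continuous_map_minus ups_continuous)
next
  case (Poly l)
  then show ?thesis
    by (auto intro!: continuous_map_exp continuous_map_minus continuous_map_real_mult continuous_map_real_pow
        continuous_map_real_mult_left ups_continuous)
next
  case (Dist i j)
  then show ?thesis
    by (cases "(i, j) \<in> pairs_upto n") (auto intro!: continuous_map_arctan continuous_map_pGw_projections(2))
qed

text \<open>The logarithm of the \<open>Mass\<close> coordinate gives the mass. \<open>Poly\<close>
  then gives \<open>ups l\<close> times a power of the mass, which
  \<open>continuous_map_cancel_power\<close> removes also where the mass vanishes.\<close>

lemma continuous_map_into_pGw_gen:
  assumes c: "\<And>z. z \<in> topspace Z ==> c z \<in> hyp_classes n"
    and g: "\<And>g. continuous_map Z euclideanreal (\<lambda>z. gen_val n (c z) g)"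
  shows "continuous_map Z (pGw_topology n) c"
proof (rule continuous_map_into_pGw[OF c])
  have a: "continuous_map Z euclideanreal (\<lambda>z. ups [] (c z))"
    by (rule continuous_map_exp_cancel) (use g[of Mass] in simp)
  show "continuous_map Z euclideanreal (\<lambda>z. ups l (c z))" for l
  proof (rule continuous_map_cancel_power[OF a])
    have "continuous_map Z euclideanreal (\<lambda>z. exp (2 * ups [] (c z)) * gen_val n (c z) (Poly l))"
      by (intro continuous_map_real_mult continuous_map_exp continuous_map_real_mult_left a g)
    also have "(\<lambda>z. exp (2 * ups [] (c z)) * gen_val n (c z) (Poly l)) = (\<lambda>z. ups [] (c z) ^ (msize l - 1) * ups l (c z))"
      by (simp add: mult.assoc[symmetric] mult_exp_exp)
    finally show "continuous_map Z euclideanreal (\<lambda>z. ups [] (c z) ^ (msize l - 1) * ups l (c z))" .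
    show "0 \<le> ups [] (c z)" "\<bar>ups l (c z)\<bar> \<le> 2 ^ length l * ups [] (c z)" if "z \<in> topspace Z" for z
      using ups_bound[OF c[OF that]] by blast+
  qed
  fix p assume "p \<in> pairs_upto n"
  then have "continuous_map Z euclideanreal (\<lambda>z. arctan (mark_dist (c z) p))"
    using g[of "Dist (fst p) (snd p)"] by simp
  then show "continuous_map Z euclideanreal (\<lambda>z. mark_dist (c z) p)"
    by (rule continuous_map_arctan_cancel)
qed

text \<open>Components of the sequences start at 1; the index \<open>k\<close> therefore stands for
  component \<open>Suc k\<close>, the subtree spanned by \<open>k + 1\<close> points.\<close>

definition tau_val :: "(nat \<Rightarrow> pmm set) \<Rightarrow> nat \<times> gen \<Rightarrow> real" where
  "tau_val c = (\<lambda>(k, g). gen_val (Suc k) (c (Suc k)) g)"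

lemma topspace_tau: "topspace tau_topology = PiE {1..} hyp_classes"
  by (simp add: tau_topology_def topspace_pGw)

lemma continuous_map_tau_component:
  assumes "continuous_map (pGw_topology (Suc k)) Z f"
  shows "continuous_map tau_topology Z (\<lambda>c. f (c (Suc k)))"
proof -
  have "continuous_map tau_topology (pGw_topology (Suc k)) (\<lambda>c. c (Suc k))"
    unfolding tau_topology_def by (rule continuous_map_product_projection) simp
  from continuous_map_compose[OF this assms] show ?thesis by (simp add: o_def)
qed

lemma tau_val_continuous: "continuous_map tau_topology euclideanreal (\<lambda>c. tau_val c i)"
  unfolding tau_val_def
  by (cases i) (auto intro: continuous_map_tau_component[where f = "\<lambda>C. gen_val (Suc k) C g" for k g] gen_val_continuous)

lemma tau_topology_coord: "tau_topology = coord_topology (topspace tau_topology) tau_val"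
proof (rule coord_topology_eqI[OF tau_val_continuous])
  let ?Z = "coord_topology (topspace tau_topology) tau_val"
  show "continuous_map ?Z tau_topology (\<lambda>x. x)"
    unfolding tau_topology_def[THEN arg_cong[where f = "continuous_map ?Z"]] continuous_map_componentwise
  proof (intro conjI ballI)
    show "(\<lambda>x. x) ` topspace ?Z \<subseteq> extensional {1..}"
      by (auto simp: topspace_tau PiE_def)
    fix n :: nat assume "n \<in> {1..}"
    then obtain k where n: "n = Suc k" by (cases n) auto
    show "continuous_map ?Z (pGw_topology n) (\<lambda>x. x n)"
    proof (rule continuous_map_into_pGw_gen)
      show "continuous_map ?Z euclideanreal (\<lambda>z. gen_val n (z n) g)" for g
        using continuous_map_coord[of "topspace tau_topology" tau_val "(k, g)"] by (simp add: tau_val_def n)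
    qed (auto simp: topspace_tau n)
  qed
qed

lemma tau_val_bound: "c \<in> topspace tau_topology ==> \<bar>tau_val c (k, g)\<bar> \<le> gbound g"
  unfolding tau_val_def by (auto intro: gen_val_bound simp: topspace_tau)

subsection \<open>Invariance under equivalence\<close>

lemma measurable_PiM_map:
  assumes f: "f \<in> measurable M N"
  shows "(\<lambda>x k. f (x k)) \<in> measurable (PiM UNIV (\<lambda>_. M)) (PiM UNIV (\<lambda>_. N))"
proof (rule measurable_PiM_single')
  fix k :: 'c
  have "(\<lambda>x. x k) \<in> measurable (PiM UNIV (\<lambda>_. M)) M" by (rule measurable_component_singleton) simp
  from measurable_compose[OF this f] show "(\<lambda>x. f (x k)) \<in> measurable (PiM UNIV (\<lambda>_. M)) N" .
qed (use measurable_space[OF f] in \<open>auto simp: space_PiM PiE_iff\<close>)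

lemma isometric_msupp:
  assumes iso: "isometric_on A T T' f" and A: "A \<in> sets (borel_on T)"
    and f: "f \<in> measurable (borel_on T) (borel_on T')"
    and \<mu>: "sets \<mu> = sets (borel_on T)" "emeasure \<mu> (mspace T - A) = 0"
    and \<mu>': "\<mu>' = distr \<mu> (borel_on T') f"
    and v: "v \<in> msupp T \<mu>" "v \<in> A"
  shows "f v \<in> msupp T' \<mu>'"
  unfolding msupp_def
proof (intro CollectI conjI allI impI)
  show fv: "f v \<in> mspace T'" using iso v(2) by (auto simp: isometric_on_def)
  fix U assume U: "openin (mtopology_of T') U \<and> f v \<in> U"
  then obtain e where e: "e > 0" "\<And>y. y \<in> mspace T' ==> mdist T' (f v) y < e ==> y \<in> U"
    unfolding openin_mtopology_of_iff by metis
  let ?B = "{y \<in> mspace T. mdist T v y < e}"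
  have vT: "v \<in> mspace T" using v(1) msupp_subset by blast
  have B: "openin (mtopology_of T) ?B" by (rule openin_mdist_less[OF vT])
  have fm: "f \<in> measurable \<mu> (borel_on T')" using f measurable_cong_sets[OF \<mu>(1) refl] by blast
  have Us: "U \<in> sets (borel_on T')" using U openin_sets_borel_on by blast
  have sp: "space \<mu> = mspace T" using sets_eq_imp_space_eq[OF \<mu>(1)] by simp
  have "0 < emeasure \<mu> ?B"
    using v(1) B vT e(1) unfolding msupp_def by (auto simp: mdist_self simp del: mdist_zero)
  also have "emeasure \<mu> ?B \<le> emeasure \<mu> (f -` U \<inter> space \<mu>)"
  proof (rule emeasure_mono_AE)
    have "AE x in \<mu>. x \<in> A"
      using \<mu> sp sets.compl_sets[OF A] by (intro AE_I[of _ _ "mspace T - A"]) auto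
    then show "AE x in \<mu>. x \<in> ?B \<longrightarrow> x \<in> f -` U \<inter> space \<mu>"
    proof eventually_elim
      case (elim x)
      have "f x \<in> U" if "x \<in> ?B"
        using iso elim v(2) that by (intro e(2)) (auto simp: isometric_on_def)
      then show ?case using sp by auto
    qed
    show "f -` U \<inter> space \<mu> \<in> sets \<mu>" by (rule measurable_sets[OF fm Us])
  qed
  also have "emeasure \<mu> (f -` U \<inter> space \<mu>) = emeasure \<mu>' U"
    unfolding \<mu>' by (rule emeasure_distr[OF fm Us, symmetric])
  finally show "0 < emeasure \<mu>' U" .
qed

text \<open>The partial isometry is extended by sending everything outside
  \<open>supp_tree X\<close> to the root. Since \<open>tree_dist\<close> collapses the same points,
  the extension preserves \<open>tree_dist\<close> everywhere.\<close>

lemma bitree_equiv_map: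
  assumes X: "X \<in> bitrees" and Y: "Y \<in> bitrees" and "bitree_equiv X Y"
  obtains f where "f \<in> measurable (borel_on (tree X)) (borel_on (tree Y))" "f (rt X) = rt Y"
    "mu Y = distr (mu X) (borel_on (tree Y)) f"
    "skel_measure Y = distr (skel_measure X) (borel_on (tree Y)) f"
    "\<And>x y. tree_dist Y (f x) (f y) = tree_dist X x y"
proof -
  note DX = bitreesD[OF X] and DY = bitreesD[OF Y]
  obtain \<phi> where iso: "isometric_on (supp_tree X) (tree X) (tree Y) \<phi>" and root: "\<phi> (rt X) = rt Y"
    and m: "distr (restrict_space (mu X) (supp_tree X)) (borel_on (tree Y)) \<phi> = mu Y"
    and n: "distr (restrict_space (nu X) (skeleton X)) (borel_on (tree Y)) \<phi> = skel_measure Y"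
    using assms(3) unfolding bitree_equiv_def skel_measure_def by auto
  note SX = bitree_sets[OF X]
  define f where "f x = \<phi> (carrier_map X x)" for x
  have f_eq: "f = (\<lambda>x. if x \<in> supp_tree X then \<phi> x else rt Y)"
    by (auto simp: f_def carrier_map_def root)
  have f: "f \<in> measurable (borel_on (tree X)) (borel_on (tree Y))"
    unfolding f_eq by (rule measurable_isometric_extension[OF iso SX(2) DY(7)])
  have f\<phi>: "f x = \<phi> x" if "x \<in> supp_tree X" for x using that by (simp add: f_eq)
  have isof: "isometric_on (supp_tree X) (tree X) (tree Y) f"
    using iso by (auto simp: isometric_on_def f\<phi>)
  have fm: "f \<in> measurable (mu X) (borel_on (tree Y))" "f \<in> measurable (nu X) (borel_on (tree Y))"
    using f measurable_cong_sets[OF DX(9) refl] measurable_cong_sets[OF DX(3) refl] by blast+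
  have phim: "\<phi> \<in> measurable (restrict_space M A) (borel_on (tree Y))"
    if "f \<in> measurable M (borel_on (tree Y))" "A \<subseteq> supp_tree X" for M A
    using measurable_restrict_space1[OF that(1), of A]
    by (rule measurable_cong[THEN iffD1, rotated]) (use that f\<phi> in \<open>auto simp: space_restrict_space\<close>)
  have s: "supp_tree X \<in> sets (mu X)" "skeleton X \<in> sets (nu X)" using SX DX(3,9) by simp_all
  have "AE x in mu X. x \<in> supp_tree X"
    using AE_supp_tree(1)[OF X] msupp_subset_supp_tree[OF DX(7)] by (auto elim: eventually_mono)
  then have full: "emeasure (mu X) (space (mu X) - supp_tree X) = 0"
    using AE_iff_null_sets[OF sets.compl_sets[OF s(1)]] by (auto elim: eventually_mono)
  have mY: "mu Y = distr (mu X) (borel_on (tree Y)) f"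
    using distr_restrict_space_eq_distr_density[OF s(1) phim[OF fm(1) subset_refl] fm(1) f\<phi>[symmetric]] m
      density_indicator_full[OF s(1) full] by simp
  have nY: "skel_measure Y = distr (skel_measure X) (borel_on (tree Y)) f"
  proof -
    have "\<phi> x = f x" if "x \<in> skeleton X" for x using f\<phi>[OF subsetD[OF SX(3) that]] by simp
    from distr_restrict_space_eq_distr_density[OF s(2) phim[OF fm(2) SX(3)] fm(2) this]
    show ?thesis by (simp add: n skel_measure_def[of X])
  qed
  \<comment> \<open>Support points go to support points, so \<open>f\<close> maps
    \<open>supp_tree X\<close> into \<open>supp_tree Y\<close> and commutes with the two carrier
    maps.\<close>
  have supp: "f v \<in> msupp (tree Y) (mu Y)" if v: "v \<in> msupp (tree X) (mu X)" for v
    using isometric_msupp[OF isof SX(2) f DX(9) _ mY v] full DX(12) msupp_subset_supp_tree[OF DX(7)] v by auto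
  have fst: "f x \<in> supp_tree Y" if x: "x \<in> supp_tree X" for x
  proof (cases "x = rt X")
    case True
    then show ?thesis using root f\<phi>[OF rt_in_supp_tree] by (simp add: rt_in_supp_tree)
  next
    case False
    then obtain v where v: "v \<in> msupp (tree X) (mu X)" "x \<in> seg (tree X) (rt X) v"
      using x by (auto simp: supp_tree_def span_tree_def)
    have vs: "v \<in> supp_tree X" using v msupp_subset_supp_tree[OF DX(7)] by auto
    have "f x \<in> seg (tree Y) (rt Y) (f v)"
      using isof x vs rt_in_supp_tree[of X] v(2) f\<phi>[OF rt_in_supp_tree] root
      unfolding isometric_on_def seg_def by force
    then show ?thesis using supp[OF v(1)] by (auto simp: supp_tree_def span_tree_def)
  qed
  have "tree_dist Y (f x) (f y) = tree_dist X x y" for x y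
  proof -
    have c: "carrier_map Y (f x) = f (carrier_map X x)" for x
    proof -
      have "f (carrier_map X x) = f x" by (simp add: f_def carrier_map_def)
      moreover have "f (carrier_map X x) \<in> supp_tree Y" by (rule fst[OF carrier_map_in])
      ultimately show ?thesis by (simp add: carrier_map_def[of Y])
    qed
    show ?thesis
      unfolding tree_dist_def c using isof carrier_map_in[of X] by (simp add: isometric_on_def)
  qed
  moreover have "f (rt X) = rt Y" using f\<phi>[OF rt_in_supp_tree] root by simp
  ultimately show ?thesis using that f mY nY by blast
qed

section \<open>The coordinates of the LWV topology\<close>

definition samp :: "bitree \<Rightarrow> (nat \<times> gen) list \<Rightarrow> (nat \<Rightarrow> real) \<Rightarrow> real" where
  "samp X q u = (\<Prod>(k, g)\<leftarrow>q. tree_gev X g (map u [0..<Suc k]))"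

text \<open>Larger than every index in \<open>q\<close>, so that \<open>samp X q\<close> depends
  only on the first \<open>qdeg q\<close> points; and at least 1, so that \<open>Psi X q\<close>
  vanishes for mass 0.\<close>

definition qdeg :: "(nat \<times> gen) list \<Rightarrow> nat" where
  "qdeg q = Suc (\<Sum>(k, g)\<leftarrow>q. k)"

definition mass :: "bitree \<Rightarrow> real" where
  "mass X = measure (mu X) (space (mu X))"

definition sampling :: "bitree \<Rightarrow> (nat \<Rightarrow> real) measure" where
  "sampling X = PiM UNIV (\<lambda>_. normalise (mu X))"

text \<open>The power of the mass turns the expectation into an integral over the
  \<open>qdeg q\<close>-fold product of the unnormalised \<open>mu X\<close>. In such an integral,
  passing to a pruned tree amounts to inserting indicators of survival.\<close>

definition Psi :: "bitree \<Rightarrow> (nat \<times> gen) list \<Rightarrow> real" where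
  "Psi X q = mass X ^ qdeg q * (\<integral>u. samp X q u \<partial>sampling X)"

lemma total_mass_mass: "X \<in> bitrees ==> total_mass (mu X) = ennreal (mass X)"
  using bitreesD(10)[of X] by (simp add: total_mass_def mass_def finite_measure.emeasure_eq_measure)

lemma mass_nonneg: "0 \<le> mass X" by (simp add: mass_def)

lemma qdeg_less: "(k, g) \<in> set q ==> k < qdeg q"
proof -
  assume "(k, g) \<in> set q"
  then have "k \<le> (\<Sum>(k, g)\<leftarrow>q. k)"
    by (force intro: member_le_sum_list)
  then show ?thesis by (simp add: qdeg_def)
qed

lemma prob_space_sampling:
  assumes X: "X \<in> bitrees" and "mass X \<noteq> 0" shows "prob_space (sampling X)"
  unfolding sampling_def using total_mass_mass[OF X] assms mass_nonneg[of X]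
  by (intro prob_space_PiM prob_space_normalise bitreesD(10)) (simp_all add: ennreal_eq_0_iff)

lemma sets_sampling: "sets (sampling X) = sets (PiM UNIV (\<lambda>_. mu X))"
  unfolding sampling_def by (intro sets_PiM_cong) auto

lemma space_sampling: "space (sampling X) = UNIV \<rightarrow>\<^sub>E space (mu X)"
  by (simp add: sampling_def space_PiM)

lemma gev_tree_measurable:
  assumes "X \<in> bitrees"
  shows "(\<lambda>u. tree_gev X g (map u [0..<n])) \<in> borel_measurable (sampling X)"
  using sampler.gev_measurable[OF sampler_bitree[OF assms]] measurable_cong_sets[OF sets_sampling refl] by blast

lemma samp_measurable: "X \<in> bitrees ==> samp X q \<in> borel_measurable (sampling X)"
proof (induction q)
  case (Cons a q)
  obtain k g where a: "a = (k, g)" by (cases a)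
  have "samp X (a # q) = (\<lambda>u. tree_gev X g (map u [0..<Suc k]) * samp X q u)"
    by (simp add: samp_def a fun_eq_iff)
  then show ?case using Cons gev_tree_measurable[of X g "Suc k"] by simp
qed (simp add: samp_def[abs_def])

lemma samp_bound:
  assumes X: "X \<in> bitrees" and u: "u \<in> space (sampling X)"
  shows "\<bar>samp X q u\<bar> \<le> (\<Prod>(k, g)\<leftarrow>q. gbound g)"
proof (induction q)
  case (Cons a q)
  obtain k g where a: "a = (k, g)" by (cases a)
  have "\<bar>tree_gev X g (map u [0..<Suc k])\<bar> \<le> gbound g"
    by (rule sampler.gev_bound[OF sampler_bitree[OF X]]) (use u in \<open>auto simp: space_sampling\<close>)
  then show ?case using Cons unfolding samp_def a by (auto simp: abs_mult intro!: mult_mono)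
qed (simp add: samp_def)

lemma samp_depends_below: "depends_below (qdeg q) (samp X q)"
  unfolding depends_below_def
proof (intro allI impI)
  fix u v :: "nat \<Rightarrow> real" assume uv: "\<forall>i<qdeg q. u i = v i"
  have "(case p of (k, g) \<Rightarrow> tree_gev X g (map u [0..<Suc k])) =
      (case p of (k, g) \<Rightarrow> tree_gev X g (map v [0..<Suc k]))" if "p \<in> set q" for p
  proof (cases p)
    case (Pair k g)
    then have "map u [0..<Suc k] = map v [0..<Suc k]" using qdeg_less[of k g q] that uv by auto
    then show ?thesis by (simp only: Pair prod.case)
  qed
  then show "samp X q u = samp X q v"
    unfolding samp_def by (intro arg_cong[where f = prod_list] map_cong refl)
qed

lemma samp_transport:
  assumes X: "X \<in> bitrees" and Y: "Y \<in> bitrees"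
    and f: "f \<in> measurable (borel_on (tree X)) (borel_on (tree Y))" "f (rt X) = rt Y"
      "skel_measure Y = distr (skel_measure X) (borel_on (tree Y)) f"
      "\<And>x y. tree_dist Y (f x) (f y) = tree_dist X x y"
    and u: "\<And>k. u k \<in> mspace (tree X)"
  shows "samp Y q (\<lambda>k. f (u k)) = samp X q u"
proof -
  note DX = bitreesD[OF X] and DY = bitreesD[OF Y]
  have "sets (skel_measure X) = sets (borel_on (tree X))" "sets (skel_measure Y) = sets (borel_on (tree Y))"
    by (simp_all add: skel_measure_def DX(3) DY(3))
  then have fm: "f \<in> measurable (skel_measure X) (skel_measure Y)" and
    n: "skel_measure Y = distr (skel_measure X) (skel_measure Y) f"
    using f(1,3) measurable_cong_sets[of "skel_measure X" "borel_on (tree X)" "skel_measure Y" "borel_on (tree Y)"]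
      distr_cong[of "skel_measure X" "skel_measure X" "skel_measure Y" "borel_on (tree Y)" f f] by simp_all
  have "tree_gev Y g (map (\<lambda>k. f (u k)) [0..<n])
      = tree_gev X g (map u [0..<n])" for g n
  proof -
    have us: "set (map u [0..<n]) \<subseteq> space (mu X)" using u DX(12) by auto
    show ?thesis
      using gev_transport[OF sampler_bitree[OF X] sampler_bitree[OF Y] fm n f(2) f(4) us, of g]
      by (simp add: o_def)
  qed
  then show ?thesis by (simp add: samp_def del: upt_Suc)
qed

lemma mass_transport:
  assumes X: "X \<in> bitrees" and f: "f \<in> measurable (borel_on (tree X)) (borel_on (tree Y))"
    and m: "mu Y = distr (mu X) (borel_on (tree Y)) f"
  shows "mass X = mass Y"
proof -
  have fm: "f \<in> measurable (mu X) (borel_on (tree Y))"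
    using f measurable_cong_sets[OF bitreesD(9)[OF X] refl] by blast
  have "f -` space (borel_on (tree Y)) \<inter> space (mu X) = space (mu X)"
    using measurable_space[OF fm] by auto
  then show ?thesis
    using measure_distr[OF fm sets.top] by (simp add: mass_def m)
qed

lemma integral_sampling_transport:
  fixes H :: "(nat \<Rightarrow> real) \<Rightarrow> real"
  assumes X: "X \<in> bitrees" and mX: "mass X \<noteq> 0"
    and f: "f \<in> measurable (borel_on (tree X)) (borel_on (tree Y))"
    and m: "mu Y = distr (mu X) (borel_on (tree Y)) f"
    and H: "H \<in> borel_measurable (sampling Y)"
    and eq: "\<And>u. u \<in> space (sampling X) ==> H (\<lambda>k. f (u k)) = G u"
  shows "(\<integral>u. H u \<partial>sampling Y) = (\<integral>u. G u \<partial>sampling X)"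
proof -
  note DX = bitreesD[OF X]
  have fm: "f \<in> measurable (mu X) (borel_on (tree Y))"
    using f measurable_cong_sets[OF DX(9) refl] by blast
  have tm: "total_mass (mu X) \<noteq> 0" using total_mass_mass[OF X] mX mass_nonneg[of X] by simp
  have P: "prob_space (normalise (mu X))" by (rule prob_space_normalise[OF DX(10) tm])
  have fn: "f \<in> measurable (normalise (mu X)) (borel_on (tree Y))" using fm by simp
  have S: "sampling Y = distr (sampling X) (PiM UNIV (\<lambda>_. borel_on (tree Y))) (\<lambda>x k. f (x k))"
    using PiM_marked_distr[OF P fn, of 0] normalise_distr[OF fm] m by (simp add: sampling_def)
  have t: "(\<lambda>x k. f (x k)) \<in> measurable (sampling X) (PiM UNIV (\<lambda>_. borel_on (tree Y)))"
    unfolding sampling_def by (rule measurable_PiM_map[OF fn])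
  have "sets (sampling Y) = sets (PiM UNIV (\<lambda>_. borel_on (tree Y)))" by (subst S) simp
  then have Hm: "H \<in> borel_measurable (PiM UNIV (\<lambda>_. borel_on (tree Y)))"
    using H measurable_cong_sets[OF _ refl, of "sampling Y"] by blast
  have "(\<integral>u. H u \<partial>sampling Y) = (\<integral>u. H (\<lambda>k. f (u k)) \<partial>sampling X)"
    by (subst S) (rule integral_distr[OF t Hm])
  also have "\<dots> = (\<integral>u. G u \<partial>sampling X)"
    by (rule Bochner_Integration.integral_cong[OF refl eq])
  finally show ?thesis .
qed

lemma Psi_transport:
  assumes X: "X \<in> bitrees" and Y: "Y \<in> bitrees" and eq: "bitree_equiv X Y"
  shows "Psi X q = Psi Y q" "mass X = mass Y"
proof -
  obtain f where f: "f \<in> measurable (borel_on (tree X)) (borel_on (tree Y))" "f (rt X) = rt Y"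
    "skel_measure Y = distr (skel_measure X) (borel_on (tree Y)) f"
    "\<And>x y. tree_dist Y (f x) (f y) = tree_dist X x y"
    and m: "mu Y = distr (mu X) (borel_on (tree Y)) f"
    using bitree_equiv_map[OF X Y eq] by metis
  show ms: "mass X = mass Y" by (rule mass_transport[OF X f(1) m])
  show "Psi X q = Psi Y q"
  proof (cases "mass X = 0")
    case True
    then show ?thesis using ms by (simp add: Psi_def qdeg_def)
  next
    case False
    have "(\<integral>u. samp Y q u \<partial>sampling Y) = (\<integral>u. samp X q u \<partial>sampling X)"
      by (rule integral_sampling_transport[OF X False f(1) m samp_measurable[OF Y]])
        (rule samp_transport[OF X Y f], auto simp: space_sampling bitreesD(12)[OF X])
    then show ?thesis using ms by (simp add: Psi_def)
  qed
qed

subsection \<open>The sampling measures in terms of functionals\<close>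

lemma (in sampler) dmat_measurable:
  assumes "\<And>k. (\<lambda>w. y w k) \<in> measurable K M"
  shows "(\<lambda>w. dmat d \<rho> (y w)) \<in> measurable K (matrix_borel)"
proof (subst matrix_topology_coord, rule measurable_into_coord_topology)
  show "dmat d \<rho> (y w) \<in> topspace (matrix_topology all_pairs)" for w
    by (simp add: matrix_topology_def dmat_def)
  fix p
  have "(\<lambda>w. dmono [p] (dmat d \<rho> (y w))) \<in> borel_measurable K"
    by (rule dmono_dmat_measurable[of "msize [p]"]) (use assms in auto)
  then show "(\<lambda>w. mcoord (dmat d \<rho> (y w)) p) \<in> borel_measurable K"
    by (simp add: dmono_mcoord)
qed

lemma integral_PiM_density:
  fixes f :: "('b \<Rightarrow> 'a) \<Rightarrow> real"
  assumes N: "sigma_finite_measure N" and S: "S \<in> sets N" and I: "finite I"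
    and f: "f \<in> borel_measurable (PiM I (\<lambda>_. N))"
  shows "(\<integral>x. f x \<partial>PiM I (\<lambda>_. density N (indicator S))) = (\<integral>x. (\<Prod>i\<in>I. indicator S (x i)) * f x \<partial>PiM I (\<lambda>_. N))"
proof -
  have e: "(\<Prod>i\<in>I. indicator S (x i) :: ennreal) = ennreal (\<Prod>i\<in>I. indicator S (x i))" for x :: "'b \<Rightarrow> 'a"
    by (subst prod_ennreal[symmetric]) (auto simp: indicator_def intro!: prod.cong)
  have [measurable]: "S \<in> sets N" by fact
  have m: "(\<lambda>x. \<Prod>i\<in>I. indicator S (x i) :: real) \<in> borel_measurable (PiM I (\<lambda>_. N))"
    by measurable
  show ?thesis
    unfolding PiM_density_indicator[OF N S I] e
    by (subst integral_density[OF f m]) (auto intro!: AE_I2 prod_nonneg)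
qed

lemma integral_zero_space:
  "emeasure M (space M) = 0 ==> (\<integral>x. f x \<partial>M) = (0 :: real)"
  by (rule integral_eq_zero_AE) (auto intro!: AE_I[of _ _ "space M"])

text \<open>\<open>\<psi>\<close> maps the set \<open>B\<close>, which carries \<open>NS\<close>,
  isometrically into the support of \<open>q\<close>, so sampling from \<open>q\<close> amounts to
  sampling from \<open>NS\<close>. This makes the sampling measure of a class computable although
  its representative is an arbitrary choice.\<close>

lemma upsilon_integral:
  fixes NS :: "real measure" and d :: "real \<Rightarrow> real \<Rightarrow> real"
  assumes q: "q \<in> pmm_spaces n" and S: "sampler NS NS d \<rho>"
    and \<psi>: "\<psi> \<in> measurable NS (borel_on (pmm_space q))"
    and mq: "pmm_measure q = distr NS (borel_on (pmm_space q)) \<psi>"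
    and us: "map \<psi> us = pmm_marks q" "\<psi> \<rho> = pmm_root q"
    and B: "AE x in NS. x \<in> B" "set us \<subseteq> B" "\<rho> \<in> B" "\<psi> ` B \<subseteq> pmm_supp q"
    and iso: "\<And>x y. x \<in> B ==> y \<in> B ==> mdist (pmm_space q) (\<psi> x) (\<psi> y) = d x y"
    and uB: "set us \<subseteq> space NS"
    and tm: "total_mass NS \<noteq> 0"
    and f: "f \<in> borel_measurable (matrix_borel)"
  shows "(\<integral>D. f D \<partial>upsilon q) = enn2real (total_mass NS) *
    (\<integral>x. f (dmat d \<rho> (pts us x)) \<partial>PiM UNIV (\<lambda>_. normalise NS))"
proof -
  interpret S: sampler NS NS d \<rho> by fact
  note [simp del] = S.space_N
  let ?K = "borel_on (pmm_space q)" and ?root = "pmm_root q" and ?marks = "pmm_marks q"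
  let ?N = "matrix_borel" and ?supp = "pmm_supp q"
  \<comment> \<open>Off its separable support the distance of \<open>q\<close> may fail to be
    product measurable; \<open>r\<close> collapses the complement of the support to the
    root.\<close>
  define r where "r x = (if x \<in> ?supp then x else ?root)" for x
  define d' where "d' x y = mdist (pmm_space q) (r x) (r y)" for x y
  let ?P = "\<Pi>\<^sub>M k\<in>UNIV. if k < length ?marks then return ?K (?marks ! k) else normalise (pmm_measure q)"
  have a: "admissible_measure (pmm_space q) (pmm_measure q)" using q by (simp add: pmm_spaces_def)
  note A = admissibleD[OF a]
  have root_supp: "?root \<in> ?supp" by (simp add: pmm_supp_def)
  have marks_supp: "?marks ! k \<in> ?supp" if "k < length ?marks" for k
    using that by (simp add: pmm_supp_def)
  have rin: "r x \<in> ?supp" for x using root_supp by (simp add: r_def)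
  have root_sp: "?root \<in> mspace (pmm_space q)" using q by (simp add: pmm_spaces_def)
  have "r \<in> measurable ?K ?K"
    unfolding r_def
    by (rule measurable_isometric_extension[of _ _ _ "\<lambda>x. x"])
      (use pmm_supp_sets[OF q] pmm_supp_subset[OF q] root_sp in \<open>auto simp: isometric_on_def\<close>)
  then have rm: "r \<in> measurable (pmm_measure q) ?K" using measurable_cong_sets[OF A(1) refl] by blast
  have dm: "(\<lambda>(x, y). mdist (pmm_space q) (r x) (r y)) \<in> borel_measurable (pmm_measure q \<Otimes>\<^sub>M pmm_measure q)"
    by (rule mdist_retract_measurable[OF sep_set_pmm_supp[OF q] pmm_supp_subset[OF q] rm rin])
  interpret Q: sampler "pmm_measure q" "pmm_measure q" d' ?root
  proof (rule sampler.intro)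
    show "sigma_finite_measure (pmm_measure q)" using A(2) by (rule finite_measure.axioms(1))
    show "case_prod d' \<in> borel_measurable (pmm_measure q \<Otimes>\<^sub>M pmm_measure q)"
      using dm by (simp only: d'_def[abs_def])
    show "?root \<in> space (pmm_measure q)" unfolding A(6) by (rule root_sp)
  qed (rule refl A(2))+
  note [simp del] = Q.space_N
  have tmq: "total_mass (pmm_measure q) = total_mass NS"
  proof -
    have "\<psi> -` space ?K \<inter> space NS = space NS"
      by (rule Int_absorb1) (rule subsetI, rule vimageI2, rule measurable_space[OF \<psi>])
    then show ?thesis unfolding total_mass_def mq using emeasure_distr[OF \<psi> sets.top] by simp
  qed
  have len: "length ?marks = length us" using us(1) by (metis length_map)
  have PN: "prob_space (normalise NS)" by (rule prob_space_normalise[OF S.finite_M tm])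
  have \<psi>n: "\<psi> \<in> measurable (normalise NS) ?K" using \<psi> by simp
  have mk: "?marks ! k \<in> space ?K" if "k < length ?marks" for k
    using subsetD[OF pmm_supp_subset[OF q] marks_supp[OF that]] by simp
  have P: "?P = distr (PiM UNIV (\<lambda>_. normalise NS)) (PiM UNIV (\<lambda>_. ?K))
      (\<lambda>x k. if k < length ?marks then ?marks ! k else \<psi> (x (k - length ?marks)))"
  proof -
    have nq: "normalise (pmm_measure q) = distr (normalise NS) ?K \<psi>"
      using normalise_distr[OF \<psi>] mq by simp
    show ?thesis unfolding nq by (rule PiM_marked_distr[OF PN \<psi>n mk])
  qed
  have setsP: "sets ?P = sets (PiM UNIV (\<lambda>_. ?K))" by (subst P) simp
  have compP: "(\<lambda>x. x k) \<in> measurable ?P (pmm_measure q)" for k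
    unfolding measurable_cong_sets[OF setsP A(1)] by (rule measurable_component_singleton) simp
  have spP: "space ?P = UNIV \<rightarrow>\<^sub>E mspace (pmm_space q)"
    using sets_eq_imp_space_eq[OF setsP] by (simp add: space_PiM)
  have pP: "prob_space (if k < length ?marks then return ?K (?marks ! k) else normalise (pmm_measure q))" for k
    using mk prob_space_normalise[OF A(2)] tm tmq by (auto intro: prob_space_return)
  have "AE x in ?P. x k \<in> ?supp" for k
  proof (rule AE_PiM_component[OF pP])
    have "AE x in pmm_measure q. x \<in> ?supp"
      using emeasure_compl_pmm_supp[OF q] pmm_supp_sets[OF q] A(1,6)
      by (intro AE_I[of _ _ "mspace (pmm_space q) - ?supp"]) (auto intro: sets.compl_sets[of _ ?K, simplified])
    moreover have "Measurable.pred ?K (\<lambda>x. x \<in> ?supp)" using pmm_supp_sets[OF q] by simp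
    ultimately show "AE x in if k < length ?marks then return ?K (?marks ! k) else normalise (pmm_measure q). x \<in> ?supp"
      using mk marks_supp AE_normalise[OF A(2)] tm tmq by (auto simp: AE_return)
  qed simp
  then have AEP: "AE x in ?P. \<forall>k. x k \<in> ?supp" by (simp add: AE_all_countable)
  have F: "(\<lambda>x. dmat d' ?root x) \<in> measurable ?P ?N"
    by (rule Q.dmat_measurable[OF compP])
  \<comment> \<open>Almost every sample lies in the support, where \<open>r\<close> is the
    identity.\<close>
  have "push_ae ?P ?N (dist_matrix all_pairs (pmm_space q) ?root) = distr ?P ?N (dmat d' ?root)"
  proof (rule push_ae_eq[OF F])
    show "AE x in ?P. dist_matrix all_pairs (pmm_space q) ?root x = dmat d' ?root x"
      using AEP
    proof eventually_elim
      case (elim x)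
      have "r (case_nat ?root x i) = case_nat ?root x i" for i
        using elim root_supp by (auto simp: r_def split: nat.split)
      then show ?case by (auto simp: dist_matrix_def dmat_def d'_def fun_eq_iff)
    qed
  qed (simp add: dist_matrix_def matrix_topology_def)
  then have "upsilon q = scale_measure (total_mass NS) (distr ?P ?N (dmat d' ?root))"
    using tm tmq by (simp add: upsilon_def Let_def)
  then have "(\<integral>D. f D \<partial>upsilon q) = enn2real (total_mass NS) * (\<integral>D. f D \<partial>distr ?P ?N (dmat d' ?root))"
    using integral_scale_measure[of f "distr ?P ?N (dmat d' ?root)" "total_mass NS"] f total_mass_finite[OF S.finite_M]
    by simp
  also have "(\<integral>D. f D \<partial>distr ?P ?N (dmat d' ?root)) = (\<integral>x. f (dmat d' ?root x) \<partial>?P)"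
    by (rule integral_distr[OF F f])
  also have "\<dots> = (\<integral>x. f (dmat d' ?root (\<lambda>k. if k < length ?marks then ?marks ! k else \<psi> (x (k - length ?marks))))
      \<partial>PiM UNIV (\<lambda>_. normalise NS))"
  proof (subst P, rule integral_distr)
    show "(\<lambda>x k. if k < length ?marks then ?marks ! k else \<psi> (x (k - length ?marks)))
        \<in> measurable (PiM UNIV (\<lambda>_. normalise NS)) (PiM UNIV (\<lambda>_. ?K))"
    proof (rule measurable_PiM_single')
      fix k
      have "(\<lambda>x. x (k - length ?marks)) \<in> measurable (PiM UNIV (\<lambda>_. normalise NS)) (normalise NS)"
        by (rule measurable_component_singleton) simp
      from measurable_compose[OF this \<psi>n]
      show "(\<lambda>x. if k < length ?marks then ?marks ! k else \<psi> (x (k - length ?marks))) \<in> measurable (PiM UNIV (\<lambda>_. normalise NS)) ?K"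
        using mk by (cases "k < length ?marks") simp_all
    qed (use mk measurable_space[OF \<psi>] in \<open>auto simp: space_PiM PiE_iff\<close>)
    show "(\<lambda>x. f (dmat d' ?root x)) \<in> borel_measurable (PiM UNIV (\<lambda>_. ?K))"
      using measurable_compose[OF F f] measurable_cong_sets[OF setsP refl] by blast
  qed
  also have "\<dots> = (\<integral>x. f (dmat d \<rho> (pts us x)) \<partial>PiM UNIV (\<lambda>_. normalise NS))"
  proof (rule integral_cong_AE)
    have sn: "sets (PiM UNIV (\<lambda>_. normalise NS)) = sets (PiM UNIV (\<lambda>_ :: nat. NS))" by (intro sets_PiM_cong) auto
    show "(\<lambda>x. f (dmat d \<rho> (pts us x))) \<in> borel_measurable (PiM UNIV (\<lambda>_. normalise NS))"
    proof (rule measurable_compose[OF S.dmat_measurable f])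
      fix k
      have "(\<lambda>x. x (k - length us)) \<in> measurable (PiM UNIV (\<lambda>_. NS)) NS"
        by (rule measurable_component_singleton) simp
      then have "(\<lambda>w. pts us w k) \<in> measurable (PiM UNIV (\<lambda>_. NS)) NS"
        using uB by (cases "k < length us") (auto simp: pts_def subset_iff)
      then show "(\<lambda>w. pts us w k) \<in> measurable (PiM UNIV (\<lambda>_. normalise NS)) NS"
        using measurable_cong_sets[OF sn refl] by blast
    qed
    show "(\<lambda>x. f (dmat d' ?root (\<lambda>k. if k < length ?marks then ?marks ! k else \<psi> (x (k - length ?marks)))))
        \<in> borel_measurable (PiM UNIV (\<lambda>_. normalise NS))"
    proof (rule measurable_compose[OF Q.dmat_measurable f])
      fix k
      have "(\<lambda>x. x (k - length ?marks)) \<in> measurable (PiM UNIV (\<lambda>_. normalise NS)) (normalise NS)"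
        by (rule measurable_component_singleton) simp
      from measurable_compose[OF this \<psi>n]
      show "(\<lambda>x. if k < length ?marks then ?marks ! k else \<psi> (x (k - length ?marks))) \<in> measurable (PiM UNIV (\<lambda>_. normalise NS)) (pmm_measure q)"
        unfolding measurable_cong_sets[OF refl A(1)] using mk by (cases "k < length ?marks") simp_all
    qed
    have "AE x in PiM UNIV (\<lambda>_. normalise NS). x k \<in> B" for k :: nat
      by (rule AE_PiM_component[OF PN _ AE_normalise[OF S.finite_M tm B(1)]]) simp
    then have "AE x in PiM UNIV (\<lambda>_. normalise NS). \<forall>k :: nat. x k \<in> B" by (simp add: AE_all_countable)
    then show "AE x in PiM UNIV (\<lambda>_. normalise NS).
      f (dmat d' ?root (\<lambda>k. if k < length ?marks then ?marks ! k else \<psi> (x (k - length ?marks)))) = f (dmat d \<rho> (pts us x))"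
    proof eventually_elim
      case (elim x)
      let ?y = "\<lambda>k. if k < length ?marks then ?marks ! k else \<psi> (x (k - length ?marks))"
      have c: "case_nat \<rho> (pts us x) i \<in> B \<and> case_nat ?root ?y i = \<psi> (case_nat \<rho> (pts us x) i)" for i
        using elim B(2,3) us(2) len us(1)[symmetric] by (cases i) (auto simp: pts_def subset_iff)
      have "d' (case_nat ?root ?y i) (case_nat ?root ?y j) = d (case_nat \<rho> (pts us x) i) (case_nat \<rho> (pts us x) j)" for i j
      proof -
        have "\<psi> (case_nat \<rho> (pts us x) i) \<in> ?supp" for i using c[of i] B(4) by blast
        then show ?thesis using c[of i] c[of j] iso by (simp add: d'_def r_def)
      qed
      then have "dmat d' ?root ?y = dmat d \<rho> (pts us x)"
        by (auto simp: dmat_def fun_eq_iff)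
      then show ?case by simp
    qed
  qed
  finally show ?thesis .
qed

section \<open>Sampled subtrees and their sampling measures\<close>

definition tau_pmm :: "bitree \<Rightarrow> real list \<Rightarrow> pmm" where
  "tau_pmm X us = (let S = tree_span X (set us); \<nu> = restrict_space (nu X) S in
    \<lparr>pmm_space = submetric (tree X) S, pmm_root = rt X, pmm_marks = us,
     pmm_measure = (if emeasure (nu X) S < \<infinity> then \<nu> else null_measure \<nu>)\<rparr>)"

lemma tau_eq: "tau X us = pmm_class (tau_pmm X us)"
  by (simp add: tau_def tau_pmm_def Let_def)

lemma span_tree_props:
  assumes X: "X \<in> bitrees" and us: "set us \<subseteq> mspace (tree X)"
  shows "compactin (mtopology_of (tree X)) (tree_span X (set us))"
    "tree_span X (set us) \<subseteq> mspace (tree X)"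
    "tree_span X (set us) \<in> sets (borel_on (tree X))"
    "rt X \<in> tree_span X (set us)" "set us \<subseteq> tree_span X (set us)"
proof -
  note D = bitreesD[OF X]
  let ?S = "tree_span X (set us)"
  have "tree_span X (set us) = \<Union>(insert {rt X} (seg (tree X) (rt X) ` set us))"
    by (auto simp: span_tree_def)
  moreover have "compactin (mtopology_of (tree X)) (\<Union>(insert {rt X} (seg (tree X) (rt X) ` set us)))"
  proof (rule compactin_Union)
    show "compactin (mtopology_of (tree X)) K" if K: "K \<in> insert {rt X} (seg (tree X) (rt X) ` set us)" for K
    proof (cases "K = {rt X}")
      case True
      then show ?thesis using D(7) by (simp add: finite_imp_compactin)
    next
      case False
      then obtain v where "v \<in> set us" "K = seg (tree X) (rt X) v" using K by auto
      then show ?thesis using compactin_seg[OF D(1), of v] us by auto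
    qed
  qed simp
  ultimately show "compactin (mtopology_of (tree X)) ?S" by simp
  show "?S \<subseteq> mspace (tree X)" using D(7) seg_subset by (auto simp: span_tree_def)
  have "(\<Union>v\<in>set us. seg (tree X) (rt X) v) \<in> sets (borel_on (tree X))"
    using us D(7) by (intro sets.finite_UN) (auto intro: seg_sets)
  then have "{rt X} \<union> (\<Union>v\<in>set us. seg (tree X) (rt X) v) \<in> sets (borel_on (tree X))"
    using singleton_sets_borel_on[OF D(7)] by (rule sets.Un[rotated])
  then show "?S \<in> sets (borel_on (tree X))" by (simp add: span_tree_def)
  show "rt X \<in> ?S" by (simp add: span_tree_def)
  show "set us \<subseteq> ?S" using us D(7) end_in_seg by (fastforce simp: span_tree_def)
qed

text \<open>The span of finitely many points is compact, so the support of the measure restricted to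
  it is complete and separable.\<close>

lemma tau_pmm_space:
  assumes X: "X \<in> bitrees" and us: "set us \<subseteq> mspace (tree X)"
  shows "tau_pmm X us \<in> pmm_spaces (length us)"
proof -
  note D = bitreesD[OF X]
  define S where "S = tree_span X (set us)"
  note P = span_tree_props[OF X us, folded S_def]
  let ?T = "submetric (tree X) S"
  define m where "m = (if emeasure (nu X) S < \<infinity> then restrict_space (nu X) S else null_measure (restrict_space (nu X) S))"
  have msp: "mspace ?T = S" using P(2) by auto
  have SN: "S \<inter> space (nu X) \<in> sets (nu X)" using P(2,3) D(3,13) by (simp add: Int_absorb2)
  have "sets m = sets (restrict_space (nu X) S)" by (simp add: m_def)
  also have "\<dots> = sets (restrict_space (borel_on (tree X)) S)"
    using D(3) by (simp add: sets_restrict_space)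
  also have "\<dots> = sets (borel_on ?T)" by (rule sets_borel_on_submetric[OF P(3), symmetric])
  finally have sm: "sets m = sets (borel_on ?T)" .
  have fin: "finite_measure m"
  proof (cases "emeasure (nu X) S < \<infinity>")
    case True
    then have "emeasure (restrict_space (nu X) S) (space (restrict_space (nu X) S)) \<noteq> \<infinity>"
      using SN P(2) D(13) by (simp add: space_restrict_space Int_absorb2 emeasure_restrict_space)
    then show ?thesis using True by (simp add: m_def finite_measureI)
  qed (simp add: m_def finite_measure_null)
  have sepS: "sep_set (tree X) S" by (rule compactin_mcomplete_separable(2)[OF P(1), of "{}"]) simp
  have sepT: "sep_set ?T = sep_set (tree X)" by (simp add: sep_set_def fun_eq_iff)
  have K: "msupp ?T m \<subseteq> S" using msupp_subset[of ?T m] msp by simp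
  have "admissible_measure ?T m"
    unfolding admissible_measure_def
  proof (intro conjI sm fin)
    show "mcomplete_of (submetric ?T (msupp ?T m))"
      using compactin_mcomplete_separable(1)[OF P(1) closedin_msupp[of ?T m]] K by (simp add: Int_absorb1)
    show "separable_space (mtopology_of (submetric ?T (msupp ?T m)))"
      unfolding sep_set_separable_space sepT using sepS K P(2) by (intro sep_set_subset[OF sepS]) auto
    show "emeasure m (mspace ?T - msupp ?T m) = 0"
    proof (rule emeasure_compl_msupp)
      show "sep_set ?T (mspace ?T)" using sepS by (simp only: sepT msp)
      show "mspace ?T \<in> sets (borel_on ?T)" using sets.top[of "borel_on ?T"] by simp
    qed (simp_all add: sm)
  qed
  then show ?thesis
    using P(2,4,5) D(7) us by (auto simp: pmm_spaces_def tau_pmm_def Let_def S_def[symmetric] m_def)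
qed

lemma tau_hyp_classes:
  assumes X: "X \<in> bitrees" and us: "set us \<subseteq> mspace (tree X)"
  shows "tau X us \<in> hyp_classes (length us)"
proof -
  note D = bitreesD[OF X]
  note p = tau_pmm_space[OF X us]
  have "zero_hyperbolic (pmm_space Z) (pmm_supp Z)" if Z: "Z \<in> pmm_class (tau_pmm X us)" for Z
  proof -
    obtain \<phi> where iso: "isometric_on (pmm_supp (tau_pmm X us)) (pmm_space (tau_pmm X us)) (pmm_space Z) \<phi>"
      and img: "pmm_supp Z = \<phi> ` pmm_supp (tau_pmm X us)"
      using Z by (auto simp: pmm_class_def pmm_equiv_def)
    have sub: "pmm_supp (tau_pmm X us) \<subseteq> mspace (tree X)"
      using pmm_supp_subset[OF p] by (auto simp: tau_pmm_def Let_def)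
    have md: "mdist (pmm_space (tau_pmm X us)) = mdist (tree X)" by (simp add: tau_pmm_def Let_def)
    show ?thesis
      unfolding zero_hyperbolic_def
    proof (intro ballI)
      fix a' b' c' e' assume "a' \<in> pmm_supp Z" "b' \<in> pmm_supp Z" "c' \<in> pmm_supp Z" "e' \<in> pmm_supp Z"
      then obtain a b c e where m: "a \<in> pmm_supp (tau_pmm X us)" "b \<in> pmm_supp (tau_pmm X us)"
        "c \<in> pmm_supp (tau_pmm X us)" "e \<in> pmm_supp (tau_pmm X us)"
        and eq: "a' = \<phi> a" "b' = \<phi> b" "c' = \<phi> c" "e' = \<phi> e"
        unfolding img by (elim imageE)
      have "mdist (tree X) a b + mdist (tree X) c e \<le> max (mdist (tree X) a c + mdist (tree X) b e)
          (mdist (tree X) a e + mdist (tree X) b c)"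
        using D(8) m sub unfolding zero_hyperbolic_def by blast
      then show "mdist (pmm_space Z) a' b' + mdist (pmm_space Z) c' e'
          \<le> max (mdist (pmm_space Z) a' c' + mdist (pmm_space Z) b' e')
             (mdist (pmm_space Z) a' e' + mdist (pmm_space Z) b' c')"
        unfolding eq using iso m unfolding isometric_on_def md by simp
    qed
  qed
  then show ?thesis
    using p unfolding hyp_classes_def pmm_classes_def tau_eq by auto
qed

lemma tau_representative:
  assumes "X \<in> bitrees" "set us \<subseteq> mspace (tree X)"
  shows "representative (tau X us) \<in> pmm_spaces (length us)" "pmm_equiv (tau_pmm X us) (representative (tau X us))"
  using pmm_class_representative[OF tau_pmm_space[OF assms]] by (simp_all add: tau_eq)

lemma tau_pmm_simps:
  "pmm_space (tau_pmm X us) = submetric (tree X) (tree_span X (set us))"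
  "pmm_root (tau_pmm X us) = rt X" "pmm_marks (tau_pmm X us) = us"
  "pmm_measure (tau_pmm X us) = (if emeasure (nu X) (tree_span X (set us)) < \<infinity>
     then restrict_space (nu X) (tree_span X (set us))
     else null_measure (restrict_space (nu X) (tree_span X (set us))))"
  by (simp_all add: tau_pmm_def Let_def)

lemma mark_dist_tau:
  assumes X: "X \<in> bitrees" and us: "set us \<subseteq> mspace (tree X)" and ij: "i \<le> length us" "j \<le> length us"
  shows "mark_dist (tau X us) (i, j) = mdist (tree X) (case_nat (rt X) ((!) us) i) (case_nat (rt X) ((!) us) j)"
proof -
  let ?p = "tau_pmm X us" and ?q = "representative (tau X us)"
  obtain \<phi> where iso: "isometric_on (pmm_supp ?p) (pmm_space ?p) (pmm_space ?q) \<phi>"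
    and r: "\<phi> (rt X) = pmm_root ?q" and m: "map \<phi> us = pmm_marks ?q"
    using tau_representative(2)[OF X us] by (auto simp: pmm_equiv_def tau_pmm_simps)
  have "case_nat (rt X) ((!) us) k \<in> pmm_supp ?p \<and>
      case_nat (pmm_root ?q) ((!) (pmm_marks ?q)) k = \<phi> (case_nat (rt X) ((!) us) k)" if "k \<le> length us" for k
    using that r m[symmetric] by (cases k) (auto simp: pmm_supp_def tau_pmm_simps)
  from this[OF ij(1)] this[OF ij(2)] show ?thesis
    using iso by (simp add: mark_dist_def Let_def isometric_on_def tau_pmm_simps)
qed

lemma leaves_null:
  assumes X: "X \<in> bitrees"
  shows "leaves X \<in> null_sets (nu X)"
  using bitree_sets[OF X] bitreesD(3,6)[OF X] by (auto simp: null_sets_def leaves_def)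

lemma spanned_span_tree:
  assumes X: "X \<in> bitrees" and us: "us \<noteq> []" "set us \<subseteq> supp_tree X" and x: "x \<in> supp_tree X"
  shows "x \<in> tree_spanned X us \<longleftrightarrow> x \<in> tree_span X (set us)"
proof -
  note D = bitreesD[OF X]
  have sp: "space (skel_measure X) = mspace (tree X)" by (simp add: skel_measure_def D(13))
  have xT: "x \<in> mspace (tree X)" using x supp_tree_subset[OF D(7)] by auto
  have "v \<in> mspace (tree X)" if "v \<in> set us" for v using that us supp_tree_subset[OF D(7)] by auto
  then have r: "rt X \<in> seg (tree X) (rt X) (hd us)" using us(1) D(7) by (intro root_in_seg) auto
  have c: "carrier_map X y = y" if "y \<in> supp_tree X" for y using that by (simp add: carrier_map_def)
  have "x \<in> tree_spanned X us \<longleftrightarrow> (\<exists>v\<in>set us. x \<in> seg (tree X) (rt X) v)"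
    using us(2) x xT c rt_in_supp_tree[of X] unfolding spanned_def sp tree_dist_def seg_def
    by (auto simp: subset_iff)
  also have "\<dots> \<longleftrightarrow> x \<in> tree_span X (set us)"
    using bexI[of "\<lambda>v. rt X \<in> seg (tree X) (rt X) v", OF r hd_in_set[OF us(1)]]
    by (auto simp: span_tree_def)
  finally show ?thesis .
qed

lemma span_tree_subset_supp_tree:
  assumes X: "X \<in> bitrees" and us: "set us \<subseteq> supp_tree X"
  shows "tree_span X (set us) \<subseteq> supp_tree X"
  using seg_subset_supp_tree[OF bitreesD(7)[OF X]] us rt_in_supp_tree[of X] by (auto simp: span_tree_def)

lemma spanned_tree_sets:
  assumes X: "X \<in> bitrees" and us: "set us \<subseteq> mspace (tree X)"
  shows "tree_spanned X us \<in> sets (borel_on (tree X))"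
  using sampler.spanned_sets[OF sampler_bitree[OF X], of us] us bitreesD(9,12)[OF X] by simp

text \<open>The leaves are a null set of \<open>nu X\<close>, so restricting to the skeleton does
  not change masses inside \<open>supp_tree X\<close>.\<close>

lemma emeasure_spanned:
  assumes X: "X \<in> bitrees" and us: "us \<noteq> []" "set us \<subseteq> supp_tree X"
  shows "emeasure (skel_measure X) (tree_spanned X us)
    = emeasure (nu X) (tree_span X (set us))"
proof -
  note D = bitreesD[OF X]
  have usT: "set us \<subseteq> mspace (tree X)" using us(2) supp_tree_subset[OF D(7)] by auto
  let ?sp = "tree_spanned X us" and ?S = "tree_span X (set us)"
  have s: "?sp \<in> sets (nu X)" "?S \<in> sets (nu X)" "skeleton X \<in> sets (nu X)"
    using spanned_tree_sets[OF X usT] span_tree_props(3)[OF X usT] bitree_sets[OF X] D(3) by simp_all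
  have "emeasure (skel_measure X) ?sp = emeasure (nu X) (skeleton X \<inter> ?sp)"
    unfolding skel_measure_def[of X, THEN arg_cong[where f = emeasure]] by (rule emeasure_restricted[OF s(3,1)])
  also have "\<dots> = emeasure (nu X) ?S"
  proof (rule emeasure_eq_AE)
    show "AE x in nu X. x \<in> skeleton X \<inter> ?sp \<longleftrightarrow> x \<in> ?S"
      using AE_not_in[OF leaves_null[OF X]]
    proof eventually_elim
      case (elim x)
      then show ?case
        using spanned_span_tree[OF X us, of x] bitree_sets(3)[OF X] span_tree_subset_supp_tree[OF X us(2)]
        by (auto simp: leaves_def)
    qed
  qed (use s in auto)
  finally show ?thesis .
qed

text \<open>For finite mass the representative carries an image of \<open>nu X\<close> restricted to
  the support \<open>B\<close> of \<open>tau_pmm X us\<close>, and \<open>B\<close> differs from the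
  spanned set within the skeleton only by null sets. Infinite mass gives the null measure by the
  convention in \<open>tau\<close>, zero mass by the case distinction in
  \<open>upsilon\<close>.\<close>

lemma tau_upsilon:
  assumes X: "X \<in> bitrees" and us: "us \<noteq> []" "set us \<subseteq> supp_tree X"
  defines "sp \<equiv> tree_spanned X us"
  defines "NS \<equiv> density (skel_measure X) (indicator sp)"
  shows "emeasure (skel_measure X) sp = 0 \<or> emeasure (skel_measure X) sp = \<infinity> ==>
      upsilon (representative (tau X us)) = null_measure (matrix_borel)"
    and "emeasure (skel_measure X) sp \<noteq> 0 ==> emeasure (skel_measure X) sp \<noteq> \<infinity> ==>
      f \<in> borel_measurable (matrix_borel) ==>
      (\<integral>D. f D \<partial>upsilon (representative (tau X us))) = measure (skel_measure X) sp *
        (\<integral>x. f (dmat (tree_dist X) (rt X) (pts us x)) \<partial>PiM UNIV (\<lambda>_. normalise NS))"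
proof -
  note D = bitreesD[OF X]
  interpret S: sampler "mu X" "skel_measure X" "tree_dist X" "rt X" by (rule sampler_bitree[OF X])
  have usT: "set us \<subseteq> mspace (tree X)" using us(2) supp_tree_subset[OF D(7)] by auto
  define S where "S = tree_span X (set us)"
  note P = span_tree_props[OF X usT, folded S_def]
  let ?p = "tau_pmm X us"
  define q where "q = representative (tau X us)"
  define B where "B = pmm_supp ?p"
  have p: "?p \<in> pmm_spaces (length us)" by (rule tau_pmm_space[OF X usT])
  have q: "q \<in> pmm_spaces (length us)" unfolding q_def by (rule tau_representative[OF X usT])
  obtain \<phi> where iso: "isometric_on B (pmm_space ?p) (pmm_space q) \<phi>" and img: "\<phi> ` B = pmm_supp q"
    and r: "\<phi> (rt X) = pmm_root q" and m: "map \<phi> us = pmm_marks q"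
    and mq: "distr (restrict_space (pmm_measure ?p) B) (borel_on (pmm_space q)) \<phi> = pmm_measure q"
    using tau_representative(2)[OF X usT] by (auto simp: pmm_equiv_def tau_pmm_simps q_def B_def)
  have msp: "mspace (pmm_space ?p) = S" using P(2) by (auto simp: tau_pmm_simps S_def)
  have BS: "B \<subseteq> S" using pmm_supp_subset[OF p] msp B_def by simp
  have "B \<in> sets (borel_on (submetric (tree X) S))" using pmm_supp_sets[OF p] by (simp add: B_def tau_pmm_simps S_def)
  then have Bs: "B \<in> sets (borel_on (tree X))"
    unfolding sets_borel_on_submetric[OF P(3)] using P(2,3)
    by (subst (asm) sets_restrict_space_iff) (auto simp: Int_absorb2)
  have rB: "rt X \<in> B" "set us \<subseteq> B" by (auto simp: B_def pmm_supp_def tau_pmm_simps)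
  have SA: "S \<subseteq> supp_tree X" unfolding S_def by (rule span_tree_subset_supp_tree[OF X us(2)])
  define \<psi> where "\<psi> x = (if x \<in> B then \<phi> x else pmm_root q)" for x
  have isoT: "isometric_on B (tree X) (pmm_space q) \<phi>"
    using iso by (simp add: isometric_on_def tau_pmm_simps)
  have root_sp: "pmm_root q \<in> mspace (pmm_space q)" using q by (simp add: pmm_spaces_def)
  have \<psi>T: "\<psi> \<in> measurable (borel_on (tree X)) (borel_on (pmm_space q))"
    unfolding \<psi>_def by (rule measurable_isometric_extension[OF isoT Bs root_sp])
  \<comment> \<open>Carries the case distinction of \<open>tau\<close> over to the whole tree, so
    that all maps are treated on the \<sigma>-algebra of the tree.\<close>
  define \<nu>' where "\<nu>' = (if emeasure (nu X) S < \<infinity> then nu X else null_measure (nu X))"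
  have s\<nu>: "sets \<nu>' = sets (borel_on (tree X))" by (simp add: \<nu>'_def D(3))
  have mp: "restrict_space (pmm_measure ?p) B = restrict_space \<nu>' B"
  proof (cases "emeasure (nu X) S < \<infinity>")
    case True
    then show ?thesis
      using P(3) D(3,13) P(2) BS Bs subset_trans[OF BS P(2)]
      by (simp add: tau_pmm_simps S_def[symmetric] \<nu>'_def restrict_restrict_space Int_absorb1 Int_absorb2)
  next
    case False
    have "sets (restrict_space (null_measure (restrict_space (nu X) S)) B) = sets (restrict_space (null_measure (nu X)) B)"
      using BS by (simp add: sets_restrict_space image_image Int_assoc[symmetric] Int_absorb2)
    moreover have "emeasure (restrict_space (null_measure K) B) A = 0" for K A
      by (cases "A \<in> sets (restrict_space (null_measure K) B)")
        (auto simp: emeasure_notin_sets restrict_space_def emeasure_measure_of_conv)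
    ultimately show ?thesis
      using False by (intro measure_eqI) (simp_all add: tau_pmm_simps S_def[symmetric] \<nu>'_def)
  qed
  have \<psi>\<nu>: "\<psi> \<in> measurable \<nu>' (borel_on (pmm_space q))"
    using \<psi>T measurable_cong_sets[OF s\<nu> refl] by blast
  have \<phi>\<nu>: "\<phi> \<in> measurable (restrict_space \<nu>' B) (borel_on (pmm_space q))"
    using measurable_restrict_space1[OF \<psi>\<nu>, of B]
    by (rule measurable_cong[THEN iffD1, rotated]) (simp add: space_restrict_space \<psi>_def)
  have mq': "pmm_measure q = distr (density \<nu>' (indicator B)) (borel_on (pmm_space q)) \<psi>"
    unfolding mq[symmetric] mp
    by (rule distr_restrict_space_eq_distr_density[OF _ \<phi>\<nu> \<psi>\<nu>]) (use Bs s\<nu> in \<open>auto simp: \<psi>_def\<close>)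
  have esp: "emeasure (skel_measure X) sp = emeasure (nu X) S"
    unfolding sp_def S_def by (rule emeasure_spanned[OF X us])
  have spS: "sp \<in> sets (skel_measure X)"
    using spanned_tree_sets[OF X usT] by (simp add: sp_def skel_measure_def D(3))
  \<comment> \<open>Both measures restrict \<open>nu X\<close>, one to skeleton and spanned set, the
    other to \<open>B\<close>. The sets differ only by leaves and by the part of the span outside
    the support, and both of these are null.\<close>
  have NSeq: "NS = density \<nu>' (indicator B)" if fin: "emeasure (nu X) S < \<infinity>"
  proof (rule measure_eqI)
    have "emeasure (pmm_measure ?p) (S - B) = 0"
      using emeasure_compl_pmm_supp[OF p] msp by (simp add: B_def)
    then have "emeasure (nu X) (S - B) = 0"
      using fin P(2,3) D(3,13) by (subst (asm) tau_pmm_simps)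
        (simp add: S_def[symmetric] emeasure_restrict_space Int_absorb2)
    then have SB: "S - B \<in> null_sets (nu X)" using P(3) Bs D(3) by (auto simp: null_sets_def)
    show sNS: "sets NS = sets (density \<nu>' (indicator B))" by (simp add: NS_def skel_measure_def s\<nu> D(3))
    fix A assume "A \<in> sets NS"
    then have A: "A \<in> sets (nu X)" by (simp add: NS_def skel_measure_def)
    have sk: "skeleton X \<in> sets (nu X)" using bitree_sets[OF X] D(3) by simp
    have sp': "sp \<in> sets (nu X)" using spS by (simp add: skel_measure_def)
    have "emeasure NS A = emeasure (nu X) (skeleton X \<inter> (sp \<inter> A))"
      unfolding NS_def using emeasure_restricted[OF spS, of A] emeasure_restricted[OF sk, of "sp \<inter> A"] A sp'
      by (simp add: skel_measure_def)
    also have "\<dots> = emeasure (nu X) (B \<inter> A)"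
    proof (rule emeasure_eq_AE)
      show "AE x in nu X. x \<in> skeleton X \<inter> (sp \<inter> A) \<longleftrightarrow> x \<in> B \<inter> A"
        using AE_not_in[OF leaves_null[OF X]] AE_not_in[OF SB]
      proof eventually_elim
        case (elim x)
        then show ?case
          using spanned_span_tree[OF X us, of x, folded sp_def S_def] bitree_sets(3)[OF X] SA BS
          by (auto simp: leaves_def)
      qed
    qed (use sk sp' A Bs D(3) in auto)
    also have "\<dots> = emeasure (density \<nu>' (indicator B)) A"
      using emeasure_restricted[of B "nu X" A] Bs D(3) A fin by (simp add: \<nu>'_def)
    finally show "emeasure NS A = emeasure (density \<nu>' (indicator B)) A" .
  qed
  have tmNS: "total_mass NS = emeasure (skel_measure X) sp"
    using emeasure_restricted[OF spS sets.top] sets.sets_into_space[OF spS]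
    by (simp add: total_mass_def NS_def Int_absorb2 del: S.space_N)
  have \<psi>den: "\<psi> \<in> measurable (density \<nu>' (indicator B)) (borel_on (pmm_space q))" using \<psi>\<nu> by simp
  have tmq: "total_mass (pmm_measure q) = total_mass (density \<nu>' (indicator B))"
  proof -
    have "\<psi> -` space (borel_on (pmm_space q)) \<inter> space (density \<nu>' (indicator B)) = space (density \<nu>' (indicator B))"
      by (rule Int_absorb1) (rule subsetI, rule vimageI2, rule measurable_space[OF \<psi>den])
    then show ?thesis unfolding total_mass_def mq' using emeasure_distr[OF \<psi>den sets.top] by simp
  qed
  {
    assume z: "emeasure (skel_measure X) sp = 0 \<or> emeasure (skel_measure X) sp = \<infinity>"
    have "total_mass (density \<nu>' (indicator B)) = 0"
    proof (cases "emeasure (nu X) S < \<infinity>")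
      case True
      then show ?thesis using z esp tmNS NSeq by auto
    next
      case False
      then have "total_mass (density \<nu>' (indicator B)) = emeasure (null_measure (nu X)) (B \<inter> space (nu X))"
        unfolding total_mass_def \<nu>'_def using Bs D(3)
        by (subst emeasure_restricted[symmetric]) auto
      then show ?thesis by simp
    qed
    then show "upsilon (representative (tau X us)) = null_measure (matrix_borel)"
      using tmq by (simp add: upsilon_def q_def Let_def)
  }
  assume nz: "emeasure (skel_measure X) sp \<noteq> 0" and fin: "emeasure (skel_measure X) sp \<noteq> \<infinity>"
    and f: "f \<in> borel_measurable (matrix_borel)"
  have fin': "emeasure (nu X) S < \<infinity>" using fin esp by (simp add: less_top)
  note NSe = NSeq[OF fin']
  have sNS: "sets NS = sets (mu X)" by (simp add: NSe s\<nu> D(9))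
  have SNS: "sampler NS NS (tree_dist X) (rt X)"
  proof (rule sampler.intro)
    show fm: "finite_measure NS"
      using tmNS fin by (intro finite_measureI) (simp add: total_mass_def)
    then show "sigma_finite_measure NS" by (rule finite_measure.axioms(1))
    show "case_prod (tree_dist X) \<in> borel_measurable (NS \<Otimes>\<^sub>M NS)"
      using S.d_measurable measurable_cong_sets[OF sets_pair_measure_cong[OF sNS sNS] refl] by blast
    show "rt X \<in> space NS" using S.root_space sets_eq_imp_space_eq[OF sNS] by simp
  qed simp
  have AEB: "AE x in NS. x \<in> B"
    unfolding NSe using Bs s\<nu> by (subst AE_density) (auto simp: indicator_def)
  have "(\<integral>D. f D \<partial>upsilon q) = enn2real (total_mass NS) *
    (\<integral>x. f (dmat (tree_dist X) (rt X) (pts us x)) \<partial>PiM UNIV (\<lambda>_. normalise NS))"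
  proof (rule upsilon_integral[OF q SNS _ _ _ _ AEB rB(2,1)])
    show "\<psi> \<in> measurable NS (borel_on (pmm_space q))" unfolding NSe by (rule \<psi>den)
    show "pmm_measure q = distr NS (borel_on (pmm_space q)) \<psi>" unfolding NSe by (rule mq')
    show "map \<psi> us = pmm_marks q" unfolding m[symmetric] using rB(2) by (auto simp: \<psi>_def)
    show "\<psi> (rt X) = pmm_root q" using rB(1) r by (simp add: \<psi>_def)
    show "\<psi> ` B \<subseteq> pmm_supp q" unfolding img[symmetric] by (auto simp: \<psi>_def)
    show "mdist (pmm_space q) (\<psi> x) (\<psi> y) = tree_dist X x y" if "x \<in> B" "y \<in> B" for x y
      using isoT that BS SA by (auto simp: \<psi>_def isometric_on_def tree_dist_def carrier_map_def)
    show "set us \<subseteq> space NS" using usT sets_eq_imp_space_eq[OF sNS] D(12) by simp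
    show "total_mass NS \<noteq> 0" using tmNS nz by simp
  qed (rule f)
  then show "(\<integral>D. f D \<partial>upsilon (representative (tau X us))) = measure (skel_measure X) sp *
        (\<integral>x. f (dmat (tree_dist X) (rt X) (pts us x)) \<partial>PiM UNIV (\<lambda>_. normalise NS))"
    by (simp add: q_def tmNS measure_def)
qed

text \<open>Of the \<open>m\<close> masses in the unnormalised product one is already contained in
  \<open>upsilon\<close>; the indicators restrict \<open>skel_measure X\<close> to the spanned
  set.\<close>

lemma tau_upsilon_power:
  assumes X: "X \<in> bitrees" and us: "us \<noteq> []" "set us \<subseteq> supp_tree X"
  defines "sp \<equiv> tree_spanned X us"
  assumes fin: "emeasure (skel_measure X) sp \<noteq> \<infinity>"
    and f: "f \<in> borel_measurable (matrix_borel)"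
    and m: "0 < m" "depends_below m (\<lambda>x. f (dmat (tree_dist X) (rt X) (pts us x)) :: real)"
  shows "measure (skel_measure X) sp ^ (m - 1) * (\<integral>D. f D \<partial>upsilon (representative (tau X us))) =
    (\<integral>x. (\<Prod>i<m. indicator sp (x i)) * f (dmat (tree_dist X) (rt X) (pts us x)) \<partial>PiM {..<m} (\<lambda>_. skel_measure X))"
proof -
  note D = bitreesD[OF X]
  interpret S: sampler "mu X" "skel_measure X" "tree_dist X" "rt X" by (rule sampler_bitree[OF X])
  note [simp del] = S.space_N
  have usT: "set us \<subseteq> mspace (tree X)" using us(2) supp_tree_subset[OF D(7)] by auto
  have spS: "sp \<in> sets (skel_measure X)"
    using spanned_tree_sets[OF X usT] by (simp add: sp_def skel_measure_def D(3))
  let ?NS = "density (skel_measure X) (indicator sp)" and ?g = "\<lambda>x. f (dmat (tree_dist X) (rt X) (pts us x))"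
  have tm: "total_mass ?NS = emeasure (skel_measure X) sp"
    using emeasure_restricted[OF spS sets.top] sets.sets_into_space[OF spS]
    by (simp add: total_mass_def Int_absorb2)
  have fm: "finite_measure ?NS" using tm fin by (intro finite_measureI) (simp add: total_mass_def)
  have sN: "sets (PiM UNIV (\<lambda>_ :: nat. skel_measure X)) = sets (PiM UNIV (\<lambda>_. mu X))"
    "sets (PiM UNIV (\<lambda>_ :: nat. ?NS)) = sets (PiM UNIV (\<lambda>_. mu X))"
    by (intro sets_PiM_cong; simp add: S.sets_N)+
  have g: "?g \<in> borel_measurable (PiM UNIV (\<lambda>_. mu X))"
  proof (rule measurable_compose[OF S.dmat_measurable f])
    fix k
    have "(\<lambda>x. x (k - length us)) \<in> measurable (PiM UNIV (\<lambda>_. mu X)) (mu X)"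
      by (rule measurable_component_singleton) simp
    then show "(\<lambda>w. pts us w k) \<in> measurable (PiM UNIV (\<lambda>_. mu X)) (mu X)"
      using usT D(12) by (cases "k < length us") (auto simp: pts_def subset_iff)
  qed
  have gN: "?g \<in> borel_measurable (PiM UNIV (\<lambda>_. skel_measure X))" "?g \<in> borel_measurable (PiM UNIV (\<lambda>_. ?NS))"
    using g measurable_cong_sets[OF sN(1) refl] measurable_cong_sets[OF sN(2) refl] by blast+
  have ne: "space (skel_measure X) \<noteq> {}" using S.root_space S.space_N by auto
  have gm: "?g \<in> borel_measurable (PiM {..<m} (\<lambda>_. skel_measure X))"
    by (rule depends_below_measurable[OF gN(1) m(2) ne])
  have R: "(\<integral>x. (\<Prod>i<m. indicator sp (x i)) * ?g x \<partial>PiM {..<m} (\<lambda>_. skel_measure X)) = (\<integral>x. ?g x \<partial>PiM {..<m} (\<lambda>_. ?NS))"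
    by (rule integral_PiM_density[symmetric, OF S.sigma_finite_N spS _ gm]) simp
  show ?thesis
  proof (cases "emeasure (skel_measure X) sp = 0")
    case True
    interpret PN: product_sigma_finite "\<lambda>_ :: nat. ?NS"
      using finite_measure.axioms(1)[OF fm] by (simp add: product_sigma_finite_def)
    have "emeasure (PiM {..<m} (\<lambda>_. ?NS)) (space (PiM {..<m} (\<lambda>_. ?NS))) = (\<Prod>i<m. emeasure ?NS (space ?NS))"
      unfolding space_PiM by (rule PN.emeasure_PiM) auto
    also have "\<dots> = 0" using True tm m(1) by (simp add: total_mass_def)
    finally have "(\<integral>x. ?g x \<partial>PiM {..<m} (\<lambda>_. ?NS)) = 0" by (rule integral_zero_space)
    then show ?thesis
      unfolding R using tau_upsilon(1)[OF X us] True by (simp add: sp_def)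
  next
    case False
    have "measure ?NS (space ?NS) = measure (skel_measure X) sp"
      using tm by (simp add: total_mass_def measure_def)
    then have "measure (skel_measure X) sp ^ m * (\<integral>x. ?g x \<partial>PiM UNIV (\<lambda>_. normalise ?NS)) = (\<integral>x. ?g x \<partial>PiM {..<m} (\<lambda>_. ?NS))"
      using integral_PiM_normalise[OF fm _ gN(2) m(2)] tm False by simp
    moreover have "measure (skel_measure X) sp ^ m = measure (skel_measure X) sp ^ (m - 1) * measure (skel_measure X) sp"
      using m(1) by (cases m) simp_all
    ultimately show ?thesis
      unfolding R using tau_upsilon(2)[OF X us _ _ f] False fin by (simp add: sp_def mult.assoc)
  qed
qed

lemma ups_Nil_tau:
  assumes X: "X \<in> bitrees" and us: "us \<noteq> []" "set us \<subseteq> supp_tree X"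
  shows "ups [] (tau X us) = measure (skel_measure X) (tree_spanned X us)"
proof -
  let ?e = "emeasure (skel_measure X) (tree_spanned X us)"
  let ?NS = "density (skel_measure X) (indicator (tree_spanned X us))"
  interpret S: sampler "mu X" "skel_measure X" "tree_dist X" "rt X" by (rule sampler_bitree[OF X])
  have one: "dmono [] = (\<lambda>_. 1)" by (simp add: dmono_def fun_eq_iff)
  show ?thesis
  proof (cases "?e = 0 \<or> ?e = \<infinity>")
    case True
    then show ?thesis using tau_upsilon(1)[OF X us True] by (auto simp: ups_def measure_def)
  next
    case False
    note D = bitreesD[OF X]
    have usT: "set us \<subseteq> mspace (tree X)" using us(2) supp_tree_subset[OF D(7)] by auto
    have spS: "tree_spanned X us \<in> sets (skel_measure X)"
      using spanned_tree_sets[OF X usT] by (simp add: skel_measure_def D(3))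
    have tm: "total_mass ?NS = ?e"
      using emeasure_restricted[OF spS sets.top] sets.sets_into_space[OF spS]
      by (simp add: total_mass_def Int_absorb2 del: S.space_N)
    have fm: "finite_measure ?NS" using tm False by (intro finite_measureI) (simp add: total_mass_def)
    interpret prob_space "PiM UNIV (\<lambda>_ :: nat. normalise ?NS)"
      using fm tm False by (intro prob_space_PiM prob_space_normalise) auto
    show ?thesis
      using tau_upsilon(2)[OF X us, of "dmono []"] False by (simp add: ups_def one prob_space)
  qed
qed

lemma dmono_dmat_depends_below:
  "msize l \<le> m + length us ==> depends_below m (\<lambda>x. dmono l (dmat d \<rho> (pts us x)))"
  unfolding depends_below_def
proof (intro allI impI dmono_cong)
  fix u v :: "nat \<Rightarrow> 'a" and i j
  assume m: "msize l \<le> m + length us" and uv: "\<forall>i<m. u i = v i" and ij: "(i, j) \<in> set l"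
  have "case_nat \<rho> (pts us u) k = case_nat \<rho> (pts us v) k" if "k < msize l" for k
    using that m uv by (cases k) (auto simp: pts_def)
  then show "dmat d \<rho> (pts us u) (i, j) = dmat d \<rho> (pts us v) (i, j)"
    using msize_le[OF ij] by (simp add: dmat_def)
qed

text \<open>Expresses the coordinates through \<open>skel_measure X\<close> and
  \<open>tree_dist X\<close>, without reference to the chosen representative of
  \<open>tau X us\<close>.\<close>

lemma gen_val_tau:
  assumes X: "X \<in> bitrees" and us: "us \<noteq> []" "set us \<subseteq> supp_tree X"
  shows "gen_val (length us) (tau X us) g = tree_gev X g us"
proof (cases g)
  case Mass
  then show ?thesis using ups_Nil_tau[OF X us] by simp
next
  case (Dist i j)
  note D = bitreesD[OF X]
  have usT: "set us \<subseteq> mspace (tree X)" using us(2) supp_tree_subset[OF D(7)] by auto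
  have "carrier_map X (case_nat (rt X) ((!) us) k) = case_nat (rt X) ((!) us) k" if "k \<le> length us" for k
    using that us(2) rt_in_supp_tree[of X] by (cases k) (auto simp: carrier_map_def subset_iff)
  then show ?thesis
    using mark_dist_tau[OF X usT, of i j] by (auto simp: Dist pairs_upto_def tree_dist_def)
next
  case (Poly l)
  let ?sp = "tree_spanned X us"
  show ?thesis
  proof (cases "emeasure (skel_measure X) ?sp = \<infinity>")
    case True
    then show ?thesis using tau_upsilon(1)[OF X us] by (simp add: Poly ups_def)
  next
    case False
    have f: "dmono l \<in> borel_measurable (matrix_borel)"
      using dmono_bounded_continuous by (intro continuous_map_real_borel_measurable) (simp add: bounded_continuous_def)
    have m: "0 < msize l" by (simp add: msize_def)
    show ?thesis
      using tau_upsilon_power[OF X us False f m dmono_dmat_depends_below] False ups_Nil_tau[OF X us]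
      by (simp add: Poly ups_def)
  qed
qed

text \<open>\<open>gev\<close> sees points only through \<open>tree_dist\<close>, which
  \<open>carrier_map\<close> preserves, and \<open>skel_measure X\<close> lives on
  \<open>supp_tree X\<close>, where \<open>carrier_map\<close> is the identity.\<close>

lemma gev_carrier_map:
  assumes X: "X \<in> bitrees" and us: "set us \<subseteq> mspace (tree X)"
  shows "tree_gev X g (map (carrier_map X) us) = tree_gev X g us"
proof -
  note D = bitreesD[OF X]
  have s: "sets (skel_measure X) = sets (borel_on (tree X))" by (simp add: skel_measure_def D(3))
  have c: "carrier_map X \<in> measurable (skel_measure X) (skel_measure X)"
    using carrier_map_measurable[OF X] measurable_cong_sets[OF s s] by blast
  have "distr (skel_measure X) (skel_measure X) (carrier_map X) = distr (skel_measure X) (skel_measure X) (\<lambda>x. x)"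
  proof (rule distr_cong_AE)
    show "AE x in skel_measure X. carrier_map X x = x"
      using AE_supp_tree(2)[OF X] bitree_sets(3)[OF X] by (auto simp: carrier_map_def elim!: eventually_mono)
  qed (use c in auto)
  then have N: "skel_measure X = distr (skel_measure X) (skel_measure X) (carrier_map X)" by (simp add: distr_id2)
  show ?thesis
  proof (rule gev_transport[OF sampler_bitree[OF X] sampler_bitree[OF X] c N])
    show "carrier_map X (rt X) = rt X" by (simp add: carrier_map_def)
    show "tree_dist X (carrier_map X x) (carrier_map X y) = tree_dist X x y" for x y
      by (simp add: tree_dist_def carrier_map_def rt_in_supp_tree)
    show "set us \<subseteq> space (mu X)" using us D(12) by simp
  qed
qed

text \<open>A measurable modification of \<open>varsigma X\<close> that agrees with it for almost
  every sample. \<open>gen_val_tau\<close> needs points in \<open>supp_tree X\<close>, and here all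
  points have been moved there.\<close>

definition carried :: "bitree \<Rightarrow> (nat \<Rightarrow> real) \<Rightarrow> nat \<Rightarrow> pmm set" where
  "carried X u = varsigma X (\<lambda>k. carrier_map X (u k))"

lemma varsigma_topspace:
  assumes X: "X \<in> bitrees" and u: "\<And>k. u k \<in> mspace (tree X)"
  shows "varsigma X u \<in> topspace tau_topology"
  unfolding topspace_tau varsigma_def
proof (rule restrict_PiE_iff[THEN iffD2], intro ballI)
  fix n :: nat
  have "set (map u [0..<n]) \<subseteq> mspace (tree X)" using u by auto
  from tau_hyp_classes[OF X this] show "tau X (map u [0..<n]) \<in> hyp_classes n" by simp
qed

lemma carrier_map_mspace: "X \<in> bitrees ==> carrier_map X x \<in> mspace (tree X)"
  using carrier_map_in[of X x] supp_tree_subset[of X] bitreesD(7)[of X] by auto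

lemma carried_topspace: "X \<in> bitrees ==> carried X u \<in> topspace tau_topology"
  unfolding carried_def by (intro varsigma_topspace carrier_map_mspace)

lemma tau_val_carried:
  assumes X: "X \<in> bitrees" and u: "\<And>k. u k \<in> mspace (tree X)"
  shows "tau_val (carried X u) (k, g) = tree_gev X g (map u [0..<Suc k])"
proof -
  let ?us = "map (carrier_map X) (map u [0..<Suc k])"
  have "tau_val (carried X u) (k, g) = gen_val (length ?us) (tau X ?us) g"
    by (simp add: tau_val_def carried_def varsigma_def o_def del: upt_Suc)
  also have "\<dots> = tree_gev X g ?us"
    by (rule gen_val_tau[OF X]) (auto simp: carrier_map_in)
  also have "\<dots> = tree_gev X g (map u [0..<Suc k])"
    by (rule gev_carrier_map[OF X]) (use u in auto)
  finally show ?thesis .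
qed

lemma sampling_mspace: "X \<in> bitrees ==> u \<in> space (sampling X) ==> u k \<in> mspace (tree X)"
  by (auto simp: space_sampling bitreesD(12))

lemma carried_measurable:
  assumes X: "X \<in> bitrees"
  shows "carried X \<in> measurable (sampling X) (borel_of tau_topology)"
proof (subst tau_topology_coord, rule measurable_into_coord_topology)
  show "carried X u \<in> topspace tau_topology" for u by (rule carried_topspace[OF X])
  fix i :: "nat \<times> gen"
  obtain k g where i: "i = (k, g)" by (cases i)
  show "(\<lambda>u. tau_val (carried X u) i) \<in> borel_measurable (sampling X)"
    using gev_tree_measurable[OF X, of g "Suc k"]
    by (rule measurable_cong[THEN iffD1, rotated])
       (simp add: i tau_val_carried[OF X] sampling_mspace[OF X] del: upt_Suc)
qed

lemma samp_carried:
  assumes X: "X \<in> bitrees" and u: "u \<in> space (sampling X)"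
  shows "(\<Prod>i\<leftarrow>q. tau_val (carried X u) i) = samp X q u"
  unfolding samp_def
  by (intro arg_cong[where f = prod_list] map_cong refl)
     (auto simp: tau_val_carried[OF X sampling_mspace[OF X u]] simp del: upt_Suc)

section \<open>The law of the sampled subtrees and the LWV topology\<close>

lemma AE_sampling:
  assumes X: "X \<in> bitrees" and m: "mass X \<noteq> 0" and P: "AE x in mu X. P x"
  shows "AE u in sampling X. \<forall>k. P (u k)"
proof -
  have tm: "total_mass (mu X) \<noteq> 0" using total_mass_mass[OF X] m mass_nonneg[of X] by simp
  have "AE u in sampling X. P (u k)" for k
    unfolding sampling_def using bitreesD(10)[OF X] tm P
    by (intro AE_PiM_component prob_space_normalise AE_normalise) auto
  then show ?thesis by (simp add: AE_all_countable)
qed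

lemma varpi_eq:
  assumes X: "X \<in> bitrees" and m: "mass X \<noteq> 0"
  shows "varpi X = scale_measure (total_mass (mu X)) (distr (sampling X) (borel_of tau_topology) (carried X))"
proof -
  have tm: "total_mass (mu X) \<noteq> 0" using total_mass_mass[OF X] m mass_nonneg[of X] by simp
  have "push_ae (sampling X) (borel_of tau_topology) (varsigma X) = distr (sampling X) (borel_of tau_topology) (carried X)"
  proof (rule push_ae_eq[OF carried_measurable[OF X]])
    have "AE x in mu X. carrier_map X x = x"
      using AE_supp_tree(1)[OF X] msupp_subset_supp_tree[OF bitreesD(7)[OF X]]
      by (auto simp: carrier_map_def elim!: eventually_mono)
    from AE_sampling[OF X m this]
    show "AE u in sampling X. varsigma X u = carried X u"
      by eventually_elim (simp add: carried_def)
  qed (simp add: varsigma_topspace[OF X] sampling_mspace[OF X])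
  then show ?thesis using tm by (simp add: varpi_def Let_def sampling_def)
qed

lemma varpi_zero:
  assumes X: "X \<in> bitrees" and m: "mass X = 0"
  shows "varpi X = null_measure (borel_of tau_topology)"
  using total_mass_mass[OF X] m by (simp add: varpi_def Let_def)

lemma varpi_integral:
  assumes X: "X \<in> bitrees" and f: "f \<in> borel_measurable (borel_of tau_topology)"
  shows "(\<integral>c. f c \<partial>varpi X) = mass X * (\<integral>u. f (carried X u) \<partial>sampling X)"
proof (cases "mass X = 0")
  case True
  then show ?thesis using varpi_zero[OF X] by simp
next
  case False
  have "(\<integral>c. f c \<partial>varpi X) = enn2real (total_mass (mu X)) *
      (\<integral>c. f c \<partial>distr (sampling X) (borel_of tau_topology) (carried X))"
    unfolding varpi_eq[OF X False] using f total_mass_mass[OF X]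
    by (intro integral_scale_measure) auto
  then show ?thesis
    using total_mass_mass[OF X] integral_distr[OF carried_measurable[OF X] f] mass_nonneg[of X] by simp
qed

lemma sets_varpi: "sets (varpi X) = sets (borel_of tau_topology)"
  by (simp add: varpi_def Let_def push_ae_def)

lemma finite_measure_varpi:
  assumes X: "X \<in> bitrees" shows "finite_measure (varpi X)"
proof (cases "mass X = 0")
  case True
  then show ?thesis by (simp add: varpi_zero[OF X] finite_measure_null)
next
  case False
  interpret prob_space "sampling X" by (rule prob_space_sampling[OF X False])
  have "finite_measure (distr (sampling X) (borel_of tau_topology) (carried X))"
    by (rule finite_measure_distr[OF carried_measurable[OF X]])
  then show ?thesis
    unfolding varpi_eq[OF X False] using total_mass_mass[OF X] by (intro finite_measure_scale) auto
qed

lemma topspace_LWV: "topspace LWV_topology = bitree_classes"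
  unfolding LWV_topology_def topspace_pullback_topology topspace_weak_topology
  using sets_varpi finite_measure_varpi representative_bitree_classes by auto

lemma continuous_map_varpi: "continuous_map LWV_topology (weak_topology tau_topology) (\<lambda>C. varpi (representative C))"
proof -
  have "continuous_map (weak_topology tau_topology) (weak_topology tau_topology) (\<lambda>x. x)" by simp
  from continuous_map_pullback[OF this] show ?thesis
    unfolding LWV_topology_def by (simp add: o_def)
qed

lemma varpi_integral_continuous:
  assumes "f \<in> bounded_continuous tau_topology"
  shows "continuous_map LWV_topology euclideanreal (\<lambda>C. \<integral>c. f c \<partial>varpi (representative C))"
  using continuous_map_compose[OF continuous_map_varpi continuous_map_weak_integral[OF assms]]
  by (simp add: o_def)

lemma bounded_continuous_borel: "f \<in> bounded_continuous E ==> f \<in> borel_measurable (borel_of E)"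
  by (auto simp: bounded_continuous_def intro: continuous_map_real_borel_measurable)

lemma tau_monomial_bounded_continuous:
  "(\<lambda>c. \<Prod>i\<leftarrow>q. tau_val c i) \<in> bounded_continuous tau_topology"
proof -
  have "continuous_map tau_topology euclideanreal (\<lambda>c. \<Prod>i\<leftarrow>q. tau_val c i)"
    by (induction q) (auto intro!: continuous_map_real_mult tau_val_continuous)
  moreover have "\<bar>\<Prod>i\<leftarrow>q. tau_val c i\<bar> \<le> (\<Prod>(k, g)\<leftarrow>q. gbound g)" if c: "c \<in> topspace tau_topology" for c
  proof (induction q)
    case (Cons i q)
    then show ?case using tau_val_bound[OF c, of "fst i" "snd i"]
      by (auto simp: abs_mult split_beta' intro!: mult_mono order_trans[OF abs_ge_zero])
  qed simp
  ultimately show ?thesis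
    unfolding bounded_continuous_def bounded_iff by auto
qed

lemma varpi_monomial:
  assumes X: "X \<in> bitrees"
  shows "(\<integral>c. (\<Prod>i\<leftarrow>q. tau_val c i) \<partial>varpi X) = mass X * (\<integral>u. samp X q u \<partial>sampling X)"
  unfolding varpi_integral[OF X bounded_continuous_borel[OF tau_monomial_bounded_continuous]]
  by (intro arg_cong2[where f = "(*)"] Bochner_Integration.integral_cong refl samp_carried[OF X])

text \<open>One factor of the mass is contained in \<open>varpi\<close>; the remaining power of the
  mass is continuous itself.\<close>

lemma Psi_varpi:
  assumes X: "X \<in> bitrees"
  shows "Psi X q = mass X ^ (qdeg q - 1) * (\<integral>c. (\<Prod>i\<leftarrow>q. tau_val c i) \<partial>varpi X)"
  unfolding varpi_monomial[OF X] Psi_def by (simp add: qdeg_def)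

lemma mass_varpi:
  assumes X: "X \<in> bitrees" shows "mass X = (\<integral>c. 1 \<partial>varpi X)"
proof (cases "mass X = 0")
  case True
  then show ?thesis using varpi_zero[OF X] by simp
next
  case False
  interpret prob_space "sampling X" by (rule prob_space_sampling[OF X False])
  show ?thesis using varpi_integral[OF X, of "\<lambda>_. 1"] by (simp add: prob_space)
qed

lemma Psi_Nil: "X \<in> bitrees ==> Psi X [] = mass X"
  using Psi_varpi[of X "[]"] mass_varpi[of X] by (simp add: qdeg_def)

lemma gbound_nonneg: "0 \<le> gbound g"
  by (cases g) simp_all

lemma samp_integral_bound:
  assumes X: "X \<in> bitrees"
  shows "mass X * \<bar>\<integral>u. samp X q u \<partial>sampling X\<bar> \<le> mass X * (\<Prod>(k, g)\<leftarrow>q. gbound g)"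
proof (cases "mass X = 0")
  case False
  interpret prob_space "sampling X" by (rule prob_space_sampling[OF X False])
  have i: "integrable (sampling X) (samp X q)"
    using samp_measurable[OF X] samp_bound[OF X] by (intro integrable_const_bound[of _ "\<Prod>(k, g)\<leftarrow>q. gbound g"]) auto
  have "\<bar>\<integral>u. samp X q u \<partial>sampling X\<bar> \<le> (\<integral>u. (\<Prod>(k, g)\<leftarrow>q. gbound g) \<partial>sampling X)"
    by (rule abs_integral_le[OF i]) (auto intro: samp_bound[OF X])
  then show ?thesis by (intro mult_left_mono) (simp_all add: prob_space mass_nonneg)
qed simp

lemma mass_continuous: "continuous_map LWV_topology euclideanreal (\<lambda>C. mass (representative C))"
proof -
  have "(\<lambda>c. 1) \<in> bounded_continuous tau_topology" using tau_monomial_bounded_continuous[of "[]"] by simp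
  from varpi_integral_continuous[OF this] show ?thesis
    by (rule continuous_map_eq) (use mass_varpi representative_bitree_classes in \<open>auto simp: topspace_LWV\<close>)
qed

lemma Psi_continuous: "continuous_map LWV_topology euclideanreal (\<lambda>C. Psi (representative C) q)"
proof -
  have "continuous_map LWV_topology euclideanreal (\<lambda>C. mass (representative C) ^ (qdeg q - 1) *
      (\<integral>c. (\<Prod>i\<leftarrow>q. tau_val c i) \<partial>varpi (representative C)))"
    by (intro continuous_map_real_mult continuous_map_real_pow mass_continuous varpi_integral_continuous
        tau_monomial_bounded_continuous)
  then show ?thesis
    by (rule continuous_map_eq) (use Psi_varpi representative_bitree_classes in \<open>auto simp: topspace_LWV\<close>)
qed

text \<open>The mass is \<open>Psi\<close> at the empty list. Moments of \<open>varpi\<close> are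
  \<open>Psi\<close> divided by a power of the mass; where the mass vanishes they are continuous
  because they are bounded by a multiple of it.\<close>

lemma continuous_map_into_LWV:
  assumes c: "\<And>z. z \<in> topspace Z ==> c z \<in> bitree_classes"
    and P: "\<And>q. continuous_map Z euclideanreal (\<lambda>z. Psi (representative (c z)) q)"
  shows "continuous_map Z LWV_topology c"
  unfolding LWV_topology_def
proof (rule continuous_map_pullback')
  have B: "representative (c z) \<in> bitrees" if "z \<in> topspace Z" for z
    using representative_bitree_classes[OF c[OF that]] by blast
  have m: "continuous_map Z euclideanreal (\<lambda>z. mass (representative (c z)))"
    by (rule continuous_map_eq[OF P[of "[]"]]) (simp add: Psi_Nil B)
  have v: "continuous_map Z euclideanreal (\<lambda>z. \<integral>x. (\<Prod>i\<leftarrow>q. tau_val x i) \<partial>varpi (representative (c z)))" for q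
  proof (rule continuous_map_cancel_power[OF m])
    show "continuous_map Z euclideanreal (\<lambda>z. mass (representative (c z)) ^ (qdeg q - 1) *
        (\<integral>x. (\<Prod>i\<leftarrow>q. tau_val x i) \<partial>varpi (representative (c z))))"
      by (rule continuous_map_eq[OF P[of q]]) (simp add: Psi_varpi B)
    show "0 \<le> mass (representative (c z))" for z by (rule mass_nonneg)
    show "\<bar>\<integral>x. (\<Prod>i\<leftarrow>q. tau_val x i) \<partial>varpi (representative (c z))\<bar> \<le> (\<Prod>(k, g)\<leftarrow>q. gbound g) * mass (representative (c z))"
      if "z \<in> topspace Z" for z
      using samp_integral_bound[OF B[OF that], of q] mass_nonneg[of "representative (c z)"]
      by (simp add: varpi_monomial[OF B[OF that]] abs_mult mult.commute)
  qed
  have "continuous_map Z (weak_topology tau_topology) (\<lambda>z. varpi (representative (c z)))"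
  proof (rule continuous_map_into_weak_topology)
    fix f assume f: "f \<in> bounded_continuous tau_topology"
    let ?B = "\<lambda>(k :: nat, g). gbound g"
    interpret weak_continuity "topspace tau_topology" tau_val ?B Z "\<lambda>z. varpi (representative (c z))"
    proof (rule weak_continuity.intro)
      show "\<bar>tau_val x i\<bar> \<le> ?B i" if "x \<in> topspace tau_topology" for x i
        using tau_val_bound[OF that] by (cases i) auto
      show "sets (varpi (representative (c z))) = sets (borel_of (coord_topology (topspace tau_topology) tau_val))" for z
        unfolding tau_topology_coord[symmetric] by (rule sets_varpi)
    qed (use B v in \<open>auto intro: finite_measure_varpi\<close>)
    show "continuous_map Z euclideanreal (\<lambda>z. \<integral>x. f x \<partial>varpi (representative (c z)))"
      by (rule weakly_continuous) (use f tau_topology_coord in simp)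
  qed (use B in \<open>auto intro: finite_measure_varpi simp: sets_varpi\<close>)
  then show "continuous_map Z (weak_topology tau_topology) ((\<lambda>C. varpi (representative C)) \<circ> c)"
    by (simp add: o_def)
qed (use c in auto)

lemma LWV_coord: "LWV_topology = coord_topology bitree_classes (\<lambda>C. Psi (representative C))"
proof -
  have "LWV_topology = coord_topology (topspace LWV_topology) (\<lambda>C. Psi (representative C))"
    by (rule coord_topology_eqI[OF Psi_continuous], rule continuous_map_into_LWV)
      (use continuous_map_coord[of bitree_classes "\<lambda>C. Psi (representative C)"] in \<open>auto simp: topspace_LWV\<close>)
  then show ?thesis by (simp add: topspace_LWV)
qed

lemma Psi_bound:
  assumes X: "X \<in> bitrees" shows "\<bar>Psi X q\<bar> \<le> mass X ^ qdeg q * (\<Prod>(k, g)\<leftarrow>q. gbound g)"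
proof -
  have "\<bar>Psi X q\<bar> = mass X ^ (qdeg q - 1) * (mass X * \<bar>\<integral>u. samp X q u \<partial>sampling X\<bar>)"
    by (simp add: Psi_def qdeg_def abs_mult mass_nonneg)
  also have "\<dots> \<le> mass X ^ (qdeg q - 1) * (mass X * (\<Prod>(k, g)\<leftarrow>q. gbound g))"
    by (intro mult_left_mono samp_integral_bound[OF X]) (simp add: mass_nonneg)
  finally show ?thesis by (simp add: qdeg_def mult.assoc mult.left_commute)
qed

subsection \<open>Completion of a subtree\<close>

lemma mcomplete_of_closed_subset:
  assumes c: "mcomplete_of (submetric T K)" and cl: "closedin (mtopology_of T) L" and LK: "L \<subseteq> K"
  shows "mcomplete_of (submetric T L)"
proof -
  have LT: "L \<subseteq> mspace T" using closedin_subset[OF cl] by simp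
  interpret Submetric "mspace (submetric T K)" "mdist T" L
    using Metric_space_mspace_mdist[of "submetric T K"] LT LK
    by (intro Submetric.intro Submetric_axioms.intro) auto
  have "closedin (mtopology_of (submetric T K)) L"
    using cl LK by (simp add: mtopology_of_submetric closedin_subset_topspace)
  then have "closedin mtopology L" by (simp add: mtopology_of_def)
  moreover have "mcomplete" using c by (simp add: mcomplete_of_def)
  ultimately have "sub.mcomplete" by (rule closedin_mcomplete_imp_mcomplete)
  then show ?thesis using LT by (simp add: mcomplete_of_def Int_absorb2)
qed

text \<open>Images of points of \<open>B\<close> approaching \<open>x\<close> form a Cauchy sequence
  in the complete set \<open>K\<close>. Closeness to \<open>x\<close> and to the limit is stated for
  the same \<open>p\<close>, which is what makes the extended map isometric.\<close>

lemma complete_limit_exists: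
  assumes c: "mcomplete_of (submetric T' K)" and KT: "K \<subseteq> mspace T'"
    and iso: "isometric_on A T T' \<phi>" and AT: "A \<subseteq> mspace T" and BA: "B \<subseteq> A" and \<phi>B: "\<phi> ` B \<subseteq> K"
    and x: "x \<in> mspace T" "\<And>e. e > 0 ==> \<exists>p\<in>B. mdist T x p < e"
  shows "\<exists>z\<in>mspace T'. \<forall>e>0. \<exists>p\<in>A. mdist T x p < e \<and> mdist T' (\<phi> p) z < e"
proof -
  interpret M: Metric_space K "mdist T'"
    using Metric_space_mspace_mdist[of "submetric T' K"] KT by (simp add: Int_absorb2)
  have "\<exists>p. p \<in> B \<and> mdist T x p < inverse (real (Suc n))" for n
    using x(2)[of "inverse (real (Suc n))"] by auto
  then obtain p where p: "\<And>n. p n \<in> B" "\<And>n. mdist T x (p n) < inverse (real (Suc n))" by metis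
  have pT: "p n \<in> mspace T" for n using p(1) BA AT by blast
  have small: "\<exists>N. \<forall>n\<ge>N. mdist T x (p n) < e" if e: "e > 0" for e
  proof -
    obtain N where N: "inverse (real (Suc N)) < e" using reals_Archimedean[OF e] by blast
    have "mdist T x (p n) < e" if "n \<ge> N" for n
    proof -
      have "inverse (real (Suc n)) \<le> inverse (real (Suc N))" using that by (intro le_imp_inverse_le) auto
      then show ?thesis using p(2)[of n] N by linarith
    qed
    then show ?thesis by blast
  qed
  have "M.MCauchy (\<lambda>n. \<phi> (p n))"
    unfolding M.MCauchy_def
  proof (intro conjI allI impI)
    show "range (\<lambda>n. \<phi> (p n)) \<subseteq> K" using p(1) \<phi>B by auto
    fix e :: real assume "e > 0"
    then obtain N where N: "\<And>n. n \<ge> N ==> mdist T x (p n) < e / 2" using small[of "e / 2"] by auto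
    show "\<exists>N. \<forall>n n'. N \<le> n \<longrightarrow> N \<le> n' \<longrightarrow> mdist T' (\<phi> (p n)) (\<phi> (p n')) < e"
    proof (intro exI allI impI)
      fix n n' assume n: "N \<le> n" "N \<le> n'"
      have "mdist T' (\<phi> (p n)) (\<phi> (p n')) = mdist T (p n) (p n')"
        using iso p(1) BA by (auto simp: isometric_on_def subset_iff)
      also have "\<dots> \<le> mdist T (p n) x + mdist T x (p n')" by (intro mdist_triangle pT x(1))
      also have "\<dots> < e" using N[OF n(1)] N[OF n(2)] mdist_commute[of T "p n" x] by linarith
      finally show "mdist T' (\<phi> (p n)) (\<phi> (p n')) < e" .
    qed
  qed
  moreover have "M.mcomplete" using c KT by (simp add: mcomplete_of_def Int_absorb2)
  ultimately obtain z where "limitin M.mtopology (\<lambda>n. \<phi> (p n)) z sequentially"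
    unfolding M.mcomplete_def by blast
  then have z: "z \<in> K" "\<And>e. e > 0 ==> \<exists>N. \<forall>n\<ge>N. mdist T' (\<phi> (p n)) z < e"
    unfolding M.limit_metric_sequentially by blast+
  show ?thesis
  proof (rule bexI[of _ z], intro allI impI)
    fix e :: real assume e: "e > 0"
    obtain N1 where N1: "\<And>n. n \<ge> N1 ==> mdist T x (p n) < e" using small[OF e] by blast
    obtain N2 where N2: "\<And>n. n \<ge> N2 ==> mdist T' (\<phi> (p n)) z < e" using z(2)[OF e] by blast
    show "\<exists>p\<in>A. mdist T x p < e \<and> mdist T' (\<phi> p) z < e"
      using N1[of "max N1 N2"] N2[of "max N1 N2"] p(1) BA by (intro bexI[of _ "p (max N1 N2)"]) auto
  qed (use z KT in auto)
qed

lemma measurable_restrict_isometric: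
  assumes iso: "isometric_on A T T' \<phi>" and A: "A \<in> sets (borel_on T)" and c: "c \<in> mspace T'"
    and M: "sets M = sets (borel_on T)"
  shows "\<phi> \<in> measurable (restrict_space M A) (borel_on T')"
    "(\<lambda>x. if x \<in> A then \<phi> x else c) \<in> measurable M (borel_on T')"
proof -
  show 1: "(\<lambda>x. if x \<in> A then \<phi> x else c) \<in> measurable M (borel_on T')"
    using measurable_isometric_extension[OF iso A c] measurable_cong_sets[OF M refl] by blast
  show "\<phi> \<in> measurable (restrict_space M A) (borel_on T')"
    using measurable_restrict_space1[OF 1, of A]
    by (rule measurable_cong[THEN iffD1, rotated]) (simp add: space_restrict_space)
qed

lemma distr_restrict_full:
  assumes iso: "isometric_on A T T' \<phi>" and A: "A \<in> sets (borel_on T)" and c: "c \<in> mspace T'"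
    and M: "sets M = sets (borel_on T)" "emeasure M (mspace T - A) = 0"
  shows "distr (restrict_space M A) (borel_on T') \<phi> = distr M (borel_on T') (\<lambda>x. if x \<in> A then \<phi> x else c)"
proof -
  note m = measurable_restrict_isometric[OF iso A c M(1)]
  have "space M = mspace T" using sets_eq_imp_space_eq[OF M(1)] by simp
  then have "density M (indicator A) = M"
    using M A by (intro density_indicator_full) simp_all
  then show ?thesis
    using distr_restrict_space_eq_distr_density[OF _ m, of] A M(1) by simp
qed

text \<open>
  \<open>P\<close> is a dense part of \<open>Y\<close>, lacking at most points of the support of \<open>mu Y\<close>; isometries defined
  on \<open>P\<close> extend to \<open>Y\<close> by completeness.
\<close>

lemma bitree_class_completion:
  assumes Y: "Y \<in> bitrees"
    and T: "mdist (tree P) = mdist (tree Y)" "rt P = rt Y"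
    and sub: "supp_tree P \<subseteq> supp_tree Y" "supp_tree P \<in> sets (borel_on (tree Y))"
    and dense: "\<And>x e. x \<in> supp_tree Y - supp_tree P ==> e > 0 ==>
        \<exists>p\<in>msupp (tree Y) (mu Y) \<inter> supp_tree P. mdist (tree Y) x p < e"
    and skel: "skeleton P = skeleton Y" "skeleton Y \<subseteq> supp_tree P"
    and m: "restrict_space (mu P) (supp_tree P) = restrict_space (mu Y) (supp_tree P)"
      "emeasure (mu Y) (mspace (tree Y) - supp_tree P) = 0"
    and n: "restrict_space (nu P) (skeleton P) = restrict_space (nu Y) (skeleton Y)"
  shows "bitree_class P = bitree_class Y"
proof -
  note D = bitreesD[OF Y]
  let ?A = "supp_tree P"
  have AT: "?A \<subseteq> mspace (tree Y)" using sub(1) supp_tree_subset[OF D(7)] by auto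
  note SY = bitree_sets[OF Y]
  have full: "emeasure (mu Y) (mspace (tree Y) - supp_tree Y) = 0"
  proof -
    have "emeasure (mu Y) (mspace (tree Y) - supp_tree Y) \<le> emeasure (mu Y) (mspace (tree Y) - ?A)"
      using sub D(9) sets.compl_sets[of ?A "borel_on (tree Y)"] by (intro emeasure_mono) auto
    then show ?thesis using m(2) by simp
  qed
  have "bitree_equiv P Z \<longleftrightarrow> bitree_equiv Y Z" if Z: "Z \<in> bitrees" for Z
  proof
    note DZ = bitreesD[OF Z]
    assume "bitree_equiv Y Z"
    then obtain \<phi> where iso: "isometric_on (supp_tree Y) (tree Y) (tree Z) \<phi>" and r: "\<phi> (rt Y) = rt Z"
      and mZ: "distr (restrict_space (mu Y) (supp_tree Y)) (borel_on (tree Z)) \<phi> = mu Z"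
      and nZ: "distr (restrict_space (nu Y) (skeleton Y)) (borel_on (tree Z)) \<phi> = density (nu Z) (indicator (skeleton Z))"
      unfolding bitree_equiv_def by auto
    have isoA: "isometric_on ?A (tree Y) (tree Z) \<phi>" using iso sub by (auto simp: isometric_on_def)
    have "distr (restrict_space (mu P) ?A) (borel_on (tree Z)) \<phi> = distr (mu Y) (borel_on (tree Z)) (\<lambda>x. if x \<in> ?A then \<phi> x else rt Z)"
      unfolding m(1) by (rule distr_restrict_full[OF isoA sub(2) DZ(7) D(9) m(2)])
    also have "\<dots> = distr (mu Y) (borel_on (tree Z)) (\<lambda>x. if x \<in> supp_tree Y then \<phi> x else rt Z)"
    proof (rule distr_cong_AE)
      have "AE x in mu Y. x \<in> ?A"
        using m(2) sub(2) D(9,12) sets.compl_sets[of ?A "borel_on (tree Y)"]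
        by (intro AE_I[of _ _ "mspace (tree Y) - ?A"]) auto
      then show "AE x in mu Y. (if x \<in> ?A then \<phi> x else rt Z) = (if x \<in> supp_tree Y then \<phi> x else rt Z)"
        by eventually_elim (use sub in auto)
    qed (use measurable_restrict_isometric(2)[OF isoA sub(2) DZ(7) D(9)]
          measurable_restrict_isometric(2)[OF iso SY(2) DZ(7) D(9)] in auto)
    also have "\<dots> = mu Z"
      unfolding mZ[symmetric] by (rule distr_restrict_full[OF iso SY(2) DZ(7) D(9) full, symmetric])
    finally have "distr (restrict_space (mu P) ?A) (borel_on (tree Z)) \<phi> = mu Z" .
    moreover have "isometric_on ?A (tree P) (tree Z) \<phi>" using isoA by (simp add: isometric_on_def T)
    ultimately show "bitree_equiv P Z"
      unfolding bitree_equiv_def using r T(2) nZ n by (intro exI[of _ \<phi>]) auto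
  next
    note DZ = bitreesD[OF Z]
    assume "bitree_equiv P Z"
    then obtain \<phi> where iso': "isometric_on ?A (tree P) (tree Z) \<phi>" and r: "\<phi> (rt Y) = rt Z"
      and mZ: "distr (restrict_space (mu Y) ?A) (borel_on (tree Z)) \<phi> = mu Z"
      and nZ: "distr (restrict_space (nu Y) (skeleton Y)) (borel_on (tree Z)) \<phi> = density (nu Z) (indicator (skeleton Z))"
      unfolding bitree_equiv_def m(1) n T(2) by auto
    have iso: "isometric_on ?A (tree Y) (tree Z) \<phi>" using iso' by (simp add: isometric_on_def T)
    have mZ': "mu Z = distr (mu Y) (borel_on (tree Z)) (\<lambda>x. if x \<in> ?A then \<phi> x else rt Z)"
      unfolding mZ[symmetric] by (rule distr_restrict_full[OF iso sub(2) DZ(7) D(9) m(2)])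
    have isoe: "isometric_on ?A (tree Y) (tree Z) (\<lambda>x. if x \<in> ?A then \<phi> x else rt Z)"
      using iso by (auto simp: isometric_on_def)
    have supp: "\<phi> v \<in> msupp (tree Z) (mu Z)" if v: "v \<in> msupp (tree Y) (mu Y) \<inter> ?A" for v
      using isometric_msupp[OF isoe sub(2) measurable_isometric_extension[OF iso sub(2) DZ(7)] D(9) m(2) mZ', of v] v
      by simp
    \<comment> \<open>The point \<open>z\<close> is the limit of \<open>\<phi> p\<close> as
      \<open>p\<close> tends to \<open>x\<close> within \<open>?A\<close>.\<close>
    define lim where "lim x z \<longleftrightarrow> z \<in> mspace (tree Z) \<and>
      (\<forall>e>0. \<exists>p\<in>?A. mdist (tree Y) x p < e \<and> mdist (tree Z) (\<phi> p) z < e)" for x z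
    have lim_ex: "\<exists>z. lim x z" if x: "x \<in> supp_tree Y" "x \<notin> ?A" for x
    proof -
      have "\<exists>z\<in>mspace (tree Z). \<forall>e>0. \<exists>p\<in>?A. mdist (tree Y) x p < e \<and> mdist (tree Z) (\<phi> p) z < e"
      proof (rule complete_limit_exists[OF admissibleD(5)[OF DZ(2)] msupp_subset iso AT])
        show "msupp (tree Y) (mu Y) \<inter> ?A \<subseteq> ?A" by simp
        show "\<phi> ` (msupp (tree Y) (mu Y) \<inter> ?A) \<subseteq> msupp (tree Z) (mu Z)" using supp by blast
        show "x \<in> mspace (tree Y)" using x supp_tree_subset[OF D(7)] by auto
        show "\<exists>p\<in>msupp (tree Y) (mu Y) \<inter> ?A. mdist (tree Y) x p < e" if "e > 0" for e
          using dense[of x e] x that by simp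
      qed
      then show ?thesis unfolding lim_def by blast
    qed
    define \<phi>' where "\<phi>' x = (if x \<in> ?A then \<phi> x else SOME z. lim x z)" for x
    have lim: "lim x (\<phi>' x)" if x: "x \<in> supp_tree Y" for x
    proof (cases "x \<in> ?A")
      case True
      then have "\<phi> x \<in> mspace (tree Z)" using iso by (auto simp: isometric_on_def)
      then show ?thesis using True AT by (auto simp: lim_def \<phi>'_def mdist_self intro!: bexI[of _ x] simp del: mdist_zero)
    next
      case False
      then show ?thesis using someI_ex[OF lim_ex[OF x False]] by (simp add: \<phi>'_def)
    qed
    have isoY: "isometric_on (supp_tree Y) (tree Y) (tree Z) \<phi>'"
      unfolding isometric_on_def
    proof (intro conjI ballI)
      show "\<phi>' ` supp_tree Y \<subseteq> mspace (tree Z)" using lim by (auto simp: lim_def)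
      fix x y assume xy: "x \<in> supp_tree Y" "y \<in> supp_tree Y"
      \<comment> \<open>Two approximating points, each with an error below \<open>e\<close> in
        either tree, add up to \<open>4 * e\<close>.\<close>
      have close: "\<bar>mdist (tree Z) (\<phi>' x) (\<phi>' y) - mdist (tree Y) x y\<bar> \<le> 4 * e" if e: "e > 0" for e
      proof -
        obtain p where p: "p \<in> ?A" "mdist (tree Y) x p < e" "mdist (tree Z) (\<phi> p) (\<phi>' x) < e"
          using lim[OF xy(1)] e unfolding lim_def by blast
        obtain q where q: "q \<in> ?A" "mdist (tree Y) y q < e" "mdist (tree Z) (\<phi> q) (\<phi>' y) < e"
          using lim[OF xy(2)] e unfolding lim_def by blast
        have sp: "\<phi>' x \<in> mspace (tree Z)" "\<phi>' y \<in> mspace (tree Z)" "\<phi> p \<in> mspace (tree Z)" "\<phi> q \<in> mspace (tree Z)"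
          using lim xy iso p(1) q(1) by (auto simp: lim_def isometric_on_def)
        have sY: "x \<in> mspace (tree Y)" "y \<in> mspace (tree Y)" "p \<in> mspace (tree Y)" "q \<in> mspace (tree Y)"
          using xy p q AT supp_tree_subset[OF D(7)] by auto
        have eq: "mdist (tree Z) (\<phi> p) (\<phi> q) = mdist (tree Y) p q" using iso p(1) q(1) by (auto simp: isometric_on_def)
        have Z1: "mdist (tree Z) (\<phi>' x) (\<phi>' y) \<le> mdist (tree Z) (\<phi> p) (\<phi>' x) + mdist (tree Y) p q + mdist (tree Z) (\<phi> q) (\<phi>' y)"
          using mdist_triangle[OF sp(1,3,2)] mdist_triangle[OF sp(3,4,2)] eq mdist_commute[of "tree Z" "\<phi>' x" "\<phi> p"]
          by linarith
        have Z2: "mdist (tree Y) p q \<le> mdist (tree Z) (\<phi> p) (\<phi>' x) + mdist (tree Z) (\<phi>' x) (\<phi>' y) + mdist (tree Z) (\<phi> q) (\<phi>' y)"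
          using mdist_triangle[OF sp(3,1,4)] mdist_triangle[OF sp(1,2,4)] eq mdist_commute[of "tree Z" "\<phi>' y" "\<phi> q"]
          by linarith
        have Y1: "mdist (tree Y) x y \<le> mdist (tree Y) x p + mdist (tree Y) p q + mdist (tree Y) y q"
          using mdist_triangle[OF sY(1,3,2)] mdist_triangle[OF sY(3,4,2)] mdist_commute[of "tree Y" q y] by linarith
        have Y2: "mdist (tree Y) p q \<le> mdist (tree Y) x p + mdist (tree Y) x y + mdist (tree Y) y q"
          using mdist_triangle[OF sY(3,1,4)] mdist_triangle[OF sY(1,2,4)] mdist_commute[of "tree Y" p x] by linarith
        show ?thesis
          unfolding abs_le_iff using p(2,3) q(2,3) Z1 Z2 Y1 Y2 by (intro conjI) linarith+
      qed
      have "\<bar>mdist (tree Z) (\<phi>' x) (\<phi>' y) - mdist (tree Y) x y\<bar> \<le> 0"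
      proof (rule field_le_epsilon)
        fix e :: real assume "0 < e"
        then show "\<bar>mdist (tree Z) (\<phi>' x) (\<phi>' y) - mdist (tree Y) x y\<bar> \<le> 0 + e"
          using close[of "e / 4"] by simp
      qed
      then show "mdist (tree Z) (\<phi>' x) (\<phi>' y) = mdist (tree Y) x y" by simp
    qed
    have "distr (restrict_space (mu Y) (supp_tree Y)) (borel_on (tree Z)) \<phi>' = distr (mu Y) (borel_on (tree Z)) (\<lambda>x. if x \<in> supp_tree Y then \<phi>' x else rt Z)"
      by (rule distr_restrict_full[OF isoY SY(2) DZ(7) D(9) full])
    also have "\<dots> = distr (mu Y) (borel_on (tree Z)) (\<lambda>x. if x \<in> ?A then \<phi> x else rt Z)"
    proof (rule distr_cong_AE)
      have "AE x in mu Y. x \<in> ?A"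
        using m(2) sub(2) D(9,12) sets.compl_sets[of ?A "borel_on (tree Y)"]
        by (intro AE_I[of _ _ "mspace (tree Y) - ?A"]) auto
      then show "AE x in mu Y. (if x \<in> supp_tree Y then \<phi>' x else rt Z) = (if x \<in> ?A then \<phi> x else rt Z)"
        by eventually_elim (use sub in \<open>auto simp: \<phi>'_def\<close>)
    qed (use measurable_restrict_isometric(2)[OF iso sub(2) DZ(7) D(9)]
          measurable_restrict_isometric(2)[OF isoY SY(2) DZ(7) D(9)] in auto)
    also have "\<dots> = mu Z" by (rule mZ'[symmetric])
    finally have 1: "distr (restrict_space (mu Y) (supp_tree Y)) (borel_on (tree Z)) \<phi>' = mu Z" .
    \<comment> \<open>The extension agrees with \<open>\<phi>\<close> on the skeleton, which lies in
      \<open>?A\<close>.\<close>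
    have 2: "distr (restrict_space (nu Y) (skeleton Y)) (borel_on (tree Z)) \<phi>' = density (nu Z) (indicator (skeleton Z))"
      unfolding nZ[symmetric] by (rule distr_cong) (use skel(2) in \<open>auto simp: space_restrict_space \<phi>'_def\<close>)
    have "\<phi>' (rt Y) = rt Z" using r rt_in_supp_tree[of P] T(2) by (simp add: \<phi>'_def)
    then show "bitree_equiv Y Z"
      unfolding bitree_equiv_def using isoY 1 2 by blast
  qed
  then show ?thesis by (auto simp: bitree_class_def)
qed

subsection \<open>Pruned trees\<close>

text \<open>
  A representative of the pruned tree that keeps the whole ambient tree, so that no completion is
  needed and the leaves of the pruned tree are not charged.
\<close>

definition pruned :: "bitree \<Rightarrow> real set \<Rightarrow> bitree" where
  "pruned X A =
     (let Y = X\<lparr>mu := density (mu X) (indicator (prune_set X A))\<rparr>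
      in Y\<lparr>nu := density (nu X) (indicator (skeleton Y))\<rparr>)"

lemma pruned_simps [simp]:
  "tree (pruned X A) = tree X" "rt (pruned X A) = rt X"
  "mu (pruned X A) = density (mu X) (indicator (prune_set X A))"
  "nu (pruned X A) = density (nu X) (indicator (skeleton (pruned X A)))"
  by (simp_all add: pruned_def Let_def skeleton_def)

lemma prune_set_subset: "prune_set X A \<subseteq> mspace (tree X)"
  by (auto simp: prune_set_def)

lemma prune_set_sets:
  assumes X: "X \<in> bitrees" and A: "countable A" "A \<subseteq> mspace (tree X)"
  shows "prune_set X A \<in> sets (borel_on (tree X))"
proof -
  note D = bitreesD[OF X]
  have "{w \<in> mspace (tree X). v \<in> seg (tree X) (rt X) w} \<in> sets (borel_on (tree X))" if v: "v \<in> A" for v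
  proof -
    have vT: "v \<in> mspace (tree X)" using v A by auto
    note [measurable] = mdist_borel_measurable[OF vT] mdist_borel_measurable[OF D(7)]
    have "{w \<in> space (borel_on (tree X)). mdist (tree X) (rt X) v + mdist (tree X) v w = mdist (tree X) (rt X) w} \<in> sets (borel_on (tree X))"
      by measurable
    then show ?thesis using vT by (simp add: seg_def)
  qed
  then have "(\<Union>v\<in>A. {w \<in> mspace (tree X). v \<in> seg (tree X) (rt X) w}) \<in> sets (borel_on (tree X))"
    using A(1) by (intro sets.countable_UN') auto
  from sets.compl_sets[OF this]
  have "mspace (tree X) - (\<Union>v\<in>A. {w \<in> mspace (tree X). v \<in> seg (tree X) (rt X) w}) \<in> sets (borel_on (tree X))"
    by simp
  moreover have "mspace (tree X) - (\<Union>v\<in>A. {w \<in> mspace (tree X). v \<in> seg (tree X) (rt X) w}) = prune_set X A"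
    by (auto simp: prune_set_def)
  ultimately show ?thesis by simp
qed

lemma prune_set_seg:
  assumes X: "X \<in> bitrees" and w: "w \<in> prune_set X A" and x: "x \<in> seg (tree X) (rt X) w"
  shows "x \<in> prune_set X A"
  using w x seg_trans[of _ "tree X" "rt X" x w] bitreesD(7)[OF X] by (auto simp: prune_set_def seg_def[of _ "rt X" w])

lemma emeasure_restrict_twice:
  assumes S: "S \<in> sets M" and A: "A \<in> sets M" "A \<subseteq> S" and B: "B \<subseteq> A"
  shows "emeasure (restrict_space (restrict_space M S) A) B = emeasure M B"
proof -
  have sp: "S \<subseteq> space M" "A \<subseteq> space M" using sets.sets_into_space S A(1) by auto
  have "restrict_space (restrict_space M S) A = restrict_space M A"
    using restrict_restrict_space[of S M A] S A sp by (simp add: Int_absorb1 Int_absorb2)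
  then show ?thesis using A(1) B sp by (simp add: emeasure_restrict_space Int_absorb2)
qed

section \<open>Pruning at a fixed countable set of cuts\<close>

locale pruning =
  fixes X :: bitree and A :: "real set"
  assumes X: "X \<in> bitrees" and A: "countable A" "A \<subseteq> mspace (tree X)"
begin

abbreviation "T \<equiv> tree X"
abbreviation "S \<equiv> prune_set X A"
abbreviation "Y \<equiv> pruned X A"
abbreviation "K \<equiv> msupp T (mu Y)"

lemmas D = bitreesD[OF X]

lemma S_sets: "S \<in> sets (borel_on T)" "S \<in> sets (mu X)" "S \<in> sets (nu X)"
  using prune_set_sets[OF X A] D(3,9) by simp_all

lemma emeasure_mu: "B \<in> sets (borel_on T) ==> emeasure (mu Y) B = emeasure (mu X) (S \<inter> B)"
  using emeasure_restricted[OF S_sets(2), of B] D(9) by simp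

lemma sets_mu: "sets (mu Y) = sets (borel_on T)" "space (mu Y) = mspace T"
  using D(9,12) by simp_all

lemma finite_mu: "finite_measure (mu Y)"
proof (rule finite_measureI)
  have "emeasure (mu Y) (space (mu Y)) = emeasure (mu X) (S \<inter> mspace T)"
    using emeasure_mu[of "mspace T"] sets.top[of "borel_on T"] sets_mu(2) by simp
  then show "emeasure (mu Y) (space (mu Y)) \<noteq> \<infinity>"
    using finite_measure.emeasure_finite[OF D(10)] by simp
qed

lemma K_subset: "K \<subseteq> msupp T (mu X)"
proof
  fix x assume x: "x \<in> K"
  show "x \<in> msupp T (mu X)"
    unfolding msupp_def
  proof (intro CollectI conjI allI impI)
    show "x \<in> mspace T" using x msupp_subset by blast
    fix U assume U: "openin (mtopology_of T) U \<and> x \<in> U"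
    then have "0 < emeasure (mu Y) U" using x by (auto simp: msupp_def)
    also have "\<dots> \<le> emeasure (mu X) U"
      using U S_sets(2) D(9) openin_sets_borel_on[of T U] emeasure_mu[of U] by (auto intro: emeasure_mono)
    finally show "0 < emeasure (mu X) U" .
  qed
qed

lemma sep_K: "sep_set T K"
  by (rule sep_set_subset[OF D(11) K_subset msupp_subset])

lemma full_K: "emeasure (mu Y) (mspace T - K) = 0"
proof (rule emeasure_compl_msupp[OF D(11) msupp_sets sets_mu(1)])
  have "mspace T - msupp T (mu X) \<in> sets (borel_on T)" by (intro openin_sets_borel_on openin_compl_msupp)
  then have "emeasure (mu Y) (mspace T - msupp T (mu X)) \<le> emeasure (mu X) (mspace T - msupp T (mu X))"
    using S_sets(2) D(9) emeasure_mu by (auto intro: emeasure_mono)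
  then show "emeasure (mu Y) (mspace T - msupp T (mu X)) = 0"
    using admissibleD(4)[OF D(2)] by simp
qed

lemma admissible_mu: "admissible_measure T (mu Y)"
  unfolding admissible_measure_def sep_set_separable_space
  using sets_mu(1) finite_mu full_K sep_K msupp_subset[of T "mu Y"]
    mcomplete_of_closed_subset[OF admissibleD(5)[OF D(2)] closedin_msupp K_subset]
  by (simp add: Int_absorb2 del: pruned_simps)

text \<open>The surviving set need not be closed, so the support \<open>K\<close> may leave it; but
  the pruned measure gives no mass to the complement of \<open>S\<close>, so every ball around a
  point of \<open>K\<close> meets \<open>K \<inter> S\<close>.\<close>

lemma KS_dense:
  assumes x: "x \<in> K" and e: "e > 0" shows "\<exists>q\<in>K \<inter> S. mdist T x q < e"
proof (rule ccontr)
  assume n: "\<not> (\<exists>q\<in>K \<inter> S. mdist T x q < e)"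
  have xT: "x \<in> mspace T" using x msupp_subset by blast
  let ?B = "{y \<in> mspace T. mdist T x y < e}"
  have B: "openin (mtopology_of T) ?B" by (rule openin_mdist_less[OF xT])
  have "x \<in> ?B" using e xT by (simp add: mdist_self del: mdist_zero)
  then have "0 < emeasure (mu Y) ?B" using x B unfolding msupp_def by blast
  also have "emeasure (mu Y) ?B = emeasure (mu Y) (S \<inter> ?B)"
    using emeasure_mu[OF openin_sets_borel_on[OF B]] emeasure_mu[of "S \<inter> ?B"] S_sets(1) openin_sets_borel_on[OF B]
    by (simp add: Int_assoc[symmetric] del: pruned_simps)
  also have "\<dots> \<le> emeasure (mu Y) (mspace T - K)"
    using n sets_mu(1) openin_compl_msupp
    by (intro emeasure_mono) (auto intro: openin_sets_borel_on simp del: pruned_simps)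
  finally show False using full_K by simp
qed

lemma open_span_K: "open_span T (rt X) K = open_span T (rt X) (K \<inter> S)"
  by (rule open_span_dense[OF D(8,7) msupp_subset _ KS_dense]) auto

text \<open>By density the points of \<open>K \<inter> S\<close> span the same open part, and
  \<open>S\<close> contains with a point its whole path to the root. Hence a point of
  \<open>K\<close> outside \<open>S\<close> can only be an end of the pruned tree.\<close>

lemma open_span_S: "open_span T (rt X) K \<subseteq> S"
  unfolding open_span_K using prune_set_seg[OF X] by (auto simp: open_span_def)

lemma atoms_S: "{v \<in> mspace T. 0 < emeasure (mu Y) {v}} = {v \<in> S. 0 < emeasure (mu X) {v}}"
proof -
  have "emeasure (mu Y) {v} = (if v \<in> S then emeasure (mu X) {v} else 0)" if "v \<in> mspace T" for v
    using emeasure_mu[OF singleton_sets_borel_on[OF that]] by (simp del: pruned_simps)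
  then show ?thesis using prune_set_subset[of X A] by (auto simp del: pruned_simps split: if_splits)
qed

lemma skeleton_S: "skeleton Y \<subseteq> S"
  using open_span_S atoms_S by (auto simp: skeleton_eq[of Y] simp del: pruned_simps(3,4))

lemma skeleton_sets: "skeleton Y \<in> sets (borel_on T)"
proof -
  have "open_span T (rt X) K \<in> sets (borel_on T)"
    by (rule open_span_sets[OF D(8,7) msupp_subset sep_K])
  moreover have "{v \<in> mspace T. 0 < emeasure (mu Y) {v}} \<in> sets (borel_on T)"
    by (rule countable_sets_borel_on) (auto intro: countable_subset[OF _ countable_atoms[OF finite_mu]] simp del: pruned_simps)
  ultimately show ?thesis by (simp add: skeleton_eq[of Y] sets.Un del: pruned_simps(3,4))
qed

lemma emeasure_nu_le:
  assumes "B \<in> sets (borel_on T)" shows "emeasure (nu Y) B \<le> emeasure (nu X) B"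
  using emeasure_restricted[of "skeleton Y" "nu X" B] skeleton_sets assms D(3)
  by (subst pruned_simps) (auto intro: emeasure_mono simp del: pruned_simps)

lemma sets_nu: "sets (nu Y) = sets (borel_on T)"
  by (subst pruned_simps) (simp add: D(3) del: pruned_simps)

lemma pruned_bitree: "Y \<in> bitrees"
  unfolding bitrees_def
proof (intro CollectI conjI)
  show "rooted_R_tree (tree Y) (rt Y)" using D(1) by simp
  show "admissible_measure (tree Y) (mu Y)" using admissible_mu by (simp del: pruned_simps(3,4))
  show "sets (nu Y) = sets (borel_on (tree Y))" using sets_nu by (simp del: pruned_simps(3,4))
  show "sigma_finite_measure (nu Y)"
    by (subst pruned_simps, rule sigma_finite_density_indicator[OF D(4)]) (use skeleton_sets D(3) in simp)
  have "AE u in mu X. emeasure (nu Y) (seg T (rt X) u) < \<infinity>"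
    using D(5) AE_space[of "mu X"]
  proof eventually_elim
    case (elim u)
    then have "seg T (rt X) u \<in> sets (borel_on T)" using D(7,12) by (intro seg_sets) auto
    from emeasure_nu_le[OF this] show ?case using elim by (auto simp del: pruned_simps)
  qed
  then have "AE u in mu Y. emeasure (nu Y) (seg T (rt X) u) < \<infinity>"
    unfolding pruned_simps(3) using S_sets(2) by (subst AE_density) (auto elim: eventually_mono simp del: pruned_simps(4))
  then show "AE u in mu Y. emeasure (nu Y) (seg (tree Y) (rt Y) u) < \<infinity>" by (simp del: pruned_simps(3,4))
  show "emeasure (nu Y) (leaves Y) = 0"
  \<comment> \<open>The measure of a non-measurable set is 0 by convention, so only measurable
    leaves have to be considered.\<close>
  proof (cases "leaves Y \<in> sets (nu Y)")
    case True
    then have "leaves Y \<in> sets (nu X)" using sets_nu D(3) by simp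
    moreover have "skeleton Y \<inter> leaves Y = {}" by (auto simp: leaves_def)
    ultimately show ?thesis
      using emeasure_restricted[of "skeleton Y" "nu X" "leaves Y"] skeleton_sets D(3)
      by (subst pruned_simps) (simp del: pruned_simps)
  qed (rule emeasure_notin_sets)
qed

lemma supp_tree_Y: "supp_tree Y = insert (rt X) K \<union> open_span T (rt X) K"
  using supp_tree_eq[of Y] D(7) by (simp del: pruned_simps(3,4))

text \<open>\<open>prune X A\<close> may have an incomplete support and may charge its leaves. Its
  spanned tree lacks only points of \<open>K\<close> outside \<open>S\<close>, which is the
  situation of \<open>bitree_class_completion\<close>.\<close>

lemma prune_class: "bitree_class (prune X A) = bitree_class Y"
proof -
  define P where "P = prune X A"
  have Sp: "S \<inter> space (mu X) = S" "S \<inter> space (nu X) = S" using prune_set_subset[of X A] D(12,13) by auto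
  have main: "mdist (tree P) = mdist T \<and> rt P = rt X \<and>
      supp_tree P = insert (rt X) (K \<inter> S) \<union> open_span T (rt X) K \<and> skeleton P = skeleton Y \<and>
      restrict_space (mu P) (supp_tree P) = restrict_space (mu Y) (supp_tree P) \<and>
      restrict_space (nu P) (skeleton P) = restrict_space (nu Y) (skeleton Y)"
  proof (cases "S = {}")
    \<comment> \<open>The root has been cut. \<open>prune\<close> then yields the one-point tree and
      \<open>pruned\<close> the old tree with vanishing measures; both have the root as their
      \<open>supp_tree\<close>.\<close>
    case True
    have P: "P = \<lparr>tree = submetric T {rt X}, rt = rt X, mu = null_measure (borel_on (submetric T {rt X})),
        nu = null_measure (borel_on (submetric T {rt X}))\<rparr>"
      by (simp add: P_def prune_def Let_def True)
    have mY0: "emeasure (mu Y) B = 0" if "B \<in> sets (borel_on T)" for B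
      using emeasure_mu[OF that] True by (simp del: pruned_simps)
    have K0: "K = {}"
      using mY0[OF openin_sets_borel_on[OF openin_topspace]] by (auto simp: msupp_def openin_sets_borel_on mY0)
    have o: "open_span T (rt X) K = {}" unfolding K0 by (simp add: open_span_def)
    have skY: "skeleton Y = {}" using skeleton_S True by auto
    have "msupp (tree P) (mu P) = {}"
      unfolding msupp_def P by (auto intro: exI[of _ "topspace (mtopology_of (submetric T {rt X}))"])
    then have sP: "supp_tree P = {rt X}" by (simp add: supp_tree_def span_tree_def P)
    have skP: "skeleton P = {}" using \<open>msupp (tree P) (mu P) = {}\<close> by (simp add: skeleton_def P)
    have root: "{rt X} \<in> sets (borel_on T)" by (rule singleton_sets_borel_on[OF D(7)])
    have setsP: "sets (borel_on (submetric T {rt X})) = sets (restrict_space (borel_on T) {rt X})"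
      by (rule sets_borel_on_submetric[OF root])
    have m: "restrict_space (mu P) {rt X} = restrict_space (mu Y) {rt X}"
    proof (rule measure_eqI)
      show s: "sets (restrict_space (mu P) {rt X}) = sets (restrict_space (mu Y) {rt X})"
        using setsP sets_mu(1) by (simp add: P sets_restrict_space image_image del: pruned_simps)
      fix B assume B: "B \<in> sets (restrict_space (mu P) {rt X})"
      then have "B \<subseteq> {rt X}" using sets.sets_into_space[OF B] by (simp add: space_restrict_space)
      then have "B \<in> sets (borel_on T)" "{rt X} \<inter> space (mu Y) \<in> sets (mu Y)"
        using root sets_mu D(7) by (auto simp: subset_singleton_iff simp del: pruned_simps)
      then have "emeasure (restrict_space (mu Y) {rt X}) B = 0"
        using \<open>B \<subseteq> {rt X}\<close> mY0 by (subst emeasure_restrict_space) auto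
      moreover have "emeasure (restrict_space (mu P) {rt X}) B = 0"
        using \<open>B \<subseteq> {rt X}\<close> sets.top[of "borel_on (submetric T {rt X})"] D(7)
        by (subst emeasure_restrict_space) (auto simp: P)
      ultimately show "emeasure (restrict_space (mu P) {rt X}) B = emeasure (restrict_space (mu Y) {rt X}) B" by simp
    qed
    have n: "restrict_space (nu P) {} = restrict_space (nu Y) {}"
      by (rule measure_eqI) (auto simp: sets_restrict_space simp del: pruned_simps)
    have "supp_tree P = insert (rt X) (K \<inter> S) \<union> open_span T (rt X) K" unfolding sP o unfolding K0 by simp
    moreover have "mdist (tree P) = mdist T" "rt P = rt X" by (simp_all add: P)
    ultimately show ?thesis using m n sP skP skY by (simp only: simp_thms)
  next
    case False
    have P: "P = \<lparr>tree = submetric T S, rt = rt X, mu = restrict_space (mu X) S, nu = restrict_space (nu X) S\<rparr>"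
      using False by (simp add: P_def prune_def Let_def)
    have rS: "rt X \<in> S"
      using False prune_set_seg[OF X] root_in_seg[OF D(7)] prune_set_subset[of X A] by blast
    have eP: "emeasure (mu P) (S \<inter> B) = emeasure (mu Y) B" if "B \<in> sets (borel_on T)" for B
      using emeasure_mu[OF that] S_sets(2) Sp by (simp add: P emeasure_restrict_space del: pruned_simps)
    have suppP: "msupp (tree P) (mu P) = K \<inter> S"
    proof (intro set_eqI iffI)
      fix x assume x: "x \<in> msupp (tree P) (mu P)"
      then have xS: "x \<in> S" "x \<in> mspace T" using msupp_subset[of "tree P" "mu P"] by (auto simp: P)
      have "0 < emeasure (mu Y) U" if U: "openin (mtopology_of T) U" "x \<in> U" for U
      proof -
        have "openin (mtopology_of (tree P)) (S \<inter> U)"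
          using U by (auto simp: P mtopology_of_submetric openin_subtopology)
        then have "0 < emeasure (mu P) (S \<inter> U)" using x xS U unfolding msupp_def by blast
        then show ?thesis using eP[OF openin_sets_borel_on[OF U(1)]] by simp
      qed
      then show "x \<in> K \<inter> S" using xS by (auto simp: msupp_def)
    next
      fix x assume x: "x \<in> K \<inter> S"
      then have xT: "x \<in> mspace T" using msupp_subset by blast
      have "0 < emeasure (mu P) U" if U: "openin (mtopology_of (tree P)) U" "x \<in> U" for U
      proof -
        obtain V where V: "openin (mtopology_of T) V" "U = S \<inter> V"
          using U(1) by (auto simp: P mtopology_of_submetric openin_subtopology)
        then have "0 < emeasure (mu Y) V" using x U(2) unfolding msupp_def by blast
        then show ?thesis using eP[OF openin_sets_borel_on[OF V(1)]] V(2) by simp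
      qed
      then show "x \<in> msupp (tree P) (mu P)" using x xT by (auto simp: msupp_def P)
    qed
    have segP: "seg (tree P) (rt P) v = seg T (rt X) v" if "v \<in> S" for v
      using prune_set_seg[OF X that] seg_subset by (auto simp: seg_def P)
    have osP: "open_span (tree P) (rt P) (K \<inter> S) = open_span T (rt X) K"
    proof -
      have "open_span (tree P) (rt P) (K \<inter> S) = open_span T (rt X) (K \<inter> S)"
        unfolding open_span_def using segP by auto
      then show ?thesis by (rule trans[OF _ open_span_K[symmetric]])
    qed
    have rP: "rt P \<in> mspace (tree P)" using rS D(7) by (simp add: P)
    have sP: "supp_tree P = insert (rt X) (K \<inter> S) \<union> open_span T (rt X) K"
      using supp_tree_eq[OF rP] suppP osP by (simp add: P)
    have atP: "{v \<in> mspace (tree P). 0 < emeasure (mu P) {v}} = {v \<in> mspace T. 0 < emeasure (mu Y) {v}}"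
    proof -
      have "emeasure (mu P) {v} = emeasure (mu X) {v}" if "v \<in> S" for v
        using that S_sets(2) Sp by (simp add: P emeasure_restrict_space)
      then show ?thesis unfolding atoms_S using prune_set_subset[of X A] by (auto simp: P)
    qed
    have skP: "skeleton P = skeleton Y"
      unfolding skeleton_eq[of P] suppP osP atP by (simp add: skeleton_eq[of Y] del: pruned_simps(3,4))
    have sPS: "supp_tree P \<subseteq> S" using sP rS open_span_S by auto
    have "K \<inter> S \<in> sets (borel_on T)" using msupp_sets S_sets(1) by (intro sets.Int)
    then have sPs: "supp_tree P \<in> sets (borel_on T)"
      unfolding sP using singleton_sets_borel_on[OF D(7)] open_span_sets[OF D(8,7) msupp_subset sep_K]
      by (metis insert_is_Un sets.Un)
    have m: "restrict_space (mu P) (supp_tree P) = restrict_space (mu Y) (supp_tree P)"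
    proof (rule measure_eqI)
      show "sets (restrict_space (mu P) (supp_tree P)) = sets (restrict_space (mu Y) (supp_tree P))"
        using sPS by (simp add: P sets_restrict_space image_image Int_assoc[symmetric] Int_absorb2)
      fix B assume B: "B \<in> sets (restrict_space (mu P) (supp_tree P))"
      have Bs: "B \<subseteq> supp_tree P" using sets.sets_into_space[OF B] by (auto simp: space_restrict_space)
      have Bm: "B \<in> sets (borel_on T)"
        using B sPS sPs D(9,12) Sp S_sets(2) prune_set_subset[of X A]
        by (auto simp: P sets_restrict_space)
      have "emeasure (restrict_space (mu P) (supp_tree P)) B = emeasure (mu X) B"
      proof -
        have "supp_tree P \<in> sets (mu X)" using sPs D(9) by simp
        from emeasure_restrict_twice[OF S_sets(2) this sPS Bs] show ?thesis by (simp add: P)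
      qed
      also have "\<dots> = emeasure (restrict_space (mu Y) (supp_tree P)) B"
        using Bs sPS sPs sets_mu emeasure_mu[OF Bm] sets.sets_into_space[OF sPs]
        by (subst emeasure_restrict_space) (auto simp: Int_absorb1 Int_absorb2 simp del: pruned_simps intro!: arg_cong[where f = "emeasure (mu X)"])
      finally show "emeasure (restrict_space (mu P) (supp_tree P)) B = emeasure (restrict_space (mu Y) (supp_tree P)) B" .
    qed
    have n: "restrict_space (nu P) (skeleton P) = restrict_space (nu Y) (skeleton Y)"
      unfolding skP
    proof (rule measure_eqI)
      show "sets (restrict_space (nu P) (skeleton Y)) = sets (restrict_space (nu Y) (skeleton Y))"
        using skeleton_S sets_nu D(3) by (simp add: P sets_restrict_space image_image Int_assoc[symmetric] Int_absorb2 del: pruned_simps)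
      fix B assume B: "B \<in> sets (restrict_space (nu P) (skeleton Y))"
      have Bs: "B \<subseteq> skeleton Y" using sets.sets_into_space[OF B] by (auto simp: space_restrict_space)
      have sk: "skeleton Y \<in> sets (nu X)" using skeleton_sets D(3) by simp
      have Bm: "B \<in> sets (nu X)"
        using B skeleton_S sk Sp S_sets(3) by (auto simp: P sets_restrict_space)
      have "emeasure (restrict_space (nu P) (skeleton Y)) B = emeasure (nu X) B"
        using emeasure_restrict_twice[OF S_sets(3) sk skeleton_S Bs] by (simp add: P del: pruned_simps)
      also have "\<dots> = emeasure (nu Y) B"
        unfolding pruned_simps(4) using emeasure_restricted[OF sk Bm] Bs by (simp add: Int_absorb1)
      also have "\<dots> = emeasure (restrict_space (nu Y) (skeleton Y)) B"
        using Bs sk sets_nu D(3) sets.sets_into_space[OF sk] bitreesD(13)[OF pruned_bitree]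
        by (subst emeasure_restrict_space) (auto simp: Int_absorb2 D(13) simp del: pruned_simps(3,4))
      finally show "emeasure (restrict_space (nu P) (skeleton Y)) B = emeasure (restrict_space (nu Y) (skeleton Y)) B" .
    qed
    show ?thesis using sP skP m n by (simp add: P del: pruned_simps)
  qed
  have KS: "K \<inter> S \<in> sets (borel_on T)" using msupp_sets S_sets(1) by (intro sets.Int)
  have sPs: "supp_tree P \<in> sets (borel_on T)"
    using main singleton_sets_borel_on[OF D(7)] open_span_sets[OF D(8,7) msupp_subset sep_K] KS
    by (metis insert_is_Un sets.Un)
  have "bitree_class P = bitree_class Y"
  proof (rule bitree_class_completion[OF pruned_bitree])
    show "mdist (tree P) = mdist (tree Y)" "rt P = rt Y" using main by simp_all
    show "supp_tree P \<subseteq> supp_tree Y" using main supp_tree_Y by auto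
    show "supp_tree P \<in> sets (borel_on (tree Y))" using sPs by simp
    show "\<exists>p\<in>msupp (tree Y) (mu Y) \<inter> supp_tree P. mdist (tree Y) x p < e"
      if x: "x \<in> supp_tree Y - supp_tree P" and e: "e > 0" for x e
    proof -
      have "x \<in> K" using x main supp_tree_Y by auto
      from KS_dense[OF this e] show ?thesis using main by auto
    qed
    show "skeleton P = skeleton Y" using main by simp
    show "skeleton Y \<subseteq> supp_tree P"
    proof -
      have "{v \<in> mspace T. 0 < emeasure (mu Y) {v}} \<subseteq> K \<inter> S"
        using atoms_subset_msupp[OF sets_mu(1)] atoms_S by blast
      then show ?thesis using main by (auto simp: skeleton_eq[of Y] simp del: pruned_simps(3,4))
    qed
    show "restrict_space (mu P) (supp_tree P) = restrict_space (mu Y) (supp_tree P)"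
      using main by (elim conjE)
    show "restrict_space (nu P) (skeleton P) = restrict_space (nu Y) (skeleton Y)"
      using main by (elim conjE)
    show "emeasure (mu Y) (mspace (tree Y) - supp_tree P) = 0"
    proof -
      have "emeasure (mu Y) (mspace T - supp_tree P) = emeasure (mu Y) (S \<inter> (mspace T - supp_tree P))"
        using emeasure_mu[of "mspace T - supp_tree P"] emeasure_mu[of "S \<inter> (mspace T - supp_tree P)"]
          sets.compl_sets[OF sPs] S_sets(1) by (simp add: Int_assoc[symmetric] sets.Int del: pruned_simps)
      also have "\<dots> \<le> emeasure (mu Y) (mspace T - K)"
        using main sets_mu(1) openin_compl_msupp
        by (intro emeasure_mono) (auto intro: openin_sets_borel_on simp del: pruned_simps)
      finally show ?thesis using full_K by (simp del: pruned_simps(3,4))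
    qed
  qed
  then show ?thesis by (simp add: P_def)
qed

end

lemma countable_atoms_sigma_finite:
  assumes "sigma_finite_measure \<nu>" shows "countable {v \<in> space \<nu>. {v} \<in> sets \<nu> \<and> 0 < emeasure \<nu> {v}}"
proof -
  interpret sigma_finite_measure \<nu> by fact
  obtain B :: "nat \<Rightarrow> 'a set" where B: "range B \<subseteq> sets \<nu>" "(\<Union>i. B i) = space \<nu>" "\<And>i. emeasure \<nu> (B i) \<noteq> \<infinity>"
    using sigma_finite by metis
  have "{v \<in> space \<nu>. {v} \<in> sets \<nu> \<and> 0 < emeasure \<nu> {v}} \<subseteq> (\<Union>i. {v. 0 < emeasure (density \<nu> (indicator (B i))) {v}})"
  proof
    fix v assume v: "v \<in> {v \<in> space \<nu>. {v} \<in> sets \<nu> \<and> 0 < emeasure \<nu> {v}}"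
    then obtain i where i: "v \<in> B i" using B(2) by blast
    have "emeasure (density \<nu> (indicator (B i))) {v} = emeasure \<nu> (B i \<inter> {v})"
      using B(1) v by (intro emeasure_restricted) auto
    then show "v \<in> (\<Union>i. {v. 0 < emeasure (density \<nu> (indicator (B i))) {v}})" using i v by (auto intro!: exI[of _ i])
  qed
  moreover have "countable (\<Union>i. {v. 0 < emeasure (density \<nu> (indicator (B i))) {v}})"
  proof (intro countable_UN countable_atoms finite_measureI)
    fix i
    have "B i \<in> sets \<nu>" using B(1) by auto
    then show "emeasure (density \<nu> (indicator (B i))) (space (density \<nu> (indicator (B i)))) \<noteq> \<infinity>"
      using emeasure_restricted[of "B i" \<nu> "space \<nu>"] sets.sets_into_space[of "B i" \<nu>] B(3)[of i]
      by (simp add: Int_absorb2)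
  qed auto
  ultimately show ?thesis by (rule countable_subset)
qed

section \<open>Sampled subtrees of the pruned tree\<close>

context pruning
begin

lemma open_span_skeleton: "open_span T (rt X) K \<subseteq> skeleton Y"
  by (auto simp: skeleton_eq[of Y] simp del: pruned_simps(3,4))

text \<open>A point of the span that is not in \<open>us\<close> lies strictly below a support
  point, hence in the new skeleton. By \<open>null\<close> the points of \<open>us\<close> do not
  contribute to the difference either, so both trees induce the same measure on the span.\<close>

lemma tau_pruned:
  assumes us: "us \<noteq> []" "set us \<subseteq> K \<inter> S"
    and null: "\<And>u. u \<in> set us ==> emeasure (nu X) ({u} - skeleton Y) = 0"
  shows "tau Y us = tau X us"
proof -
  define R where "R = span_tree T (rt X) (set us)"
  have usT: "set us \<subseteq> mspace T" using us(2) prune_set_subset[of X A] by blast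
  have R: "R \<in> sets (nu X)" "R \<subseteq> mspace T"
    using span_tree_props[OF X usT] D(3) by (simp_all add: R_def)
  have sk: "skeleton Y \<in> sets (nu X)" using skeleton_sets D(3) by simp
  have "R - skeleton Y \<subseteq> (\<Union>u\<in>set us. {u} - skeleton Y)"
  proof
    fix x assume x: "x \<in> R - skeleton Y"
    have "hd us \<in> set us" using us(1) by simp
    then have "rt X \<in> seg T (rt X) (hd us)" using usT D(7) by (intro root_in_seg) auto
    then obtain u where u: "u \<in> set us" "x \<in> seg T (rt X) u"
      using x \<open>hd us \<in> set us\<close> by (auto simp: R_def span_tree_def)
    have "x = u"
    proof (rule ccontr)
      assume "x \<noteq> u"
      then have "x \<in> open_span T (rt X) K" using u us(2) unfolding open_span_def by blast
      then show False using x open_span_skeleton by blast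
    qed
    then show "x \<in> (\<Union>u\<in>set us. {u} - skeleton Y)" using x u(1) by blast
  qed
  moreover have "(\<Union>u\<in>set us. {u} - skeleton Y) \<in> null_sets (nu X)"
  proof (rule null_sets_UN'[OF countable_finite[OF finite_set]])
    fix u assume u: "u \<in> set us"
    have "u \<in> mspace T" using usT u by (rule subsetD)
    then have "{u} \<in> sets (nu X)" unfolding D(3) by (rule singleton_sets_borel_on)
    then have "{u} - skeleton Y \<in> sets (nu X)" using sk by (rule sets.Diff)
    then show "{u} - skeleton Y \<in> null_sets (nu X)" using null[OF u] by (rule null_setsI[rotated])
  qed
  ultimately have RN: "R - skeleton Y \<in> null_sets (nu X)"
    by (rule null_sets_subset[OF _ sets.Diff[OF R(1) sk], rotated])
  have eq: "emeasure (nu Y) B = emeasure (nu X) B" if B: "B \<in> sets (nu X)" "B \<subseteq> R" for B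
  proof -
    have "emeasure (nu Y) B = emeasure (nu X) (skeleton Y \<inter> B)"
      unfolding pruned_simps(4) by (rule emeasure_restricted[OF sk B(1)])
    also have "\<dots> = emeasure (nu X) B"
      using AE_not_in[OF RN] B sk by (intro emeasure_eq_AE) (auto elim!: eventually_mono)
    finally show ?thesis .
  qed
  have RsY: "R \<inter> space (nu Y) \<in> sets (nu Y)" "R \<inter> space (nu X) \<in> sets (nu X)"
    using R D(3,13) sets_nu bitreesD(13)[OF pruned_bitree] by (simp_all add: Int_absorb2 del: pruned_simps(3,4))
  have "restrict_space (nu Y) R = restrict_space (nu X) R"
  proof (rule measure_eqI)
    show s: "sets (restrict_space (nu Y) R) = sets (restrict_space (nu X) R)"
      using sets_nu D(3) by (simp add: sets_restrict_space del: pruned_simps(3,4))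
    fix B assume B: "B \<in> sets (restrict_space (nu Y) R)"
    have "B \<subseteq> R" using sets.sets_into_space[OF B] by (auto simp: space_restrict_space)
    moreover have "B \<in> sets (nu X)"
      using B unfolding s using RsY(2) by (simp add: sets_restrict_space_iff)
    ultimately show "emeasure (restrict_space (nu Y) R) B = emeasure (restrict_space (nu X) R) B"
      using RsY eq by (simp add: emeasure_restrict_space del: pruned_simps(3,4))
  qed
  then show ?thesis
    using eq[OF R(1) subset_refl] by (simp add: tau_def Let_def R_def[symmetric] del: pruned_simps(3,4))
qed

text \<open>A surviving atom of \<open>nu X\<close> may have become a leaf, where the new
  \<open>nu\<close> forgets it. There are only countably many such atoms, and none is an atom of the
  pruned \<open>mu\<close>, because atoms of \<open>mu\<close> belong to the skeleton.\<close>

lemma AE_pruned: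
  "AE x in mu X. x \<in> S \<longrightarrow> x \<in> K \<and> emeasure (nu X) ({x} - skeleton Y) = 0"
proof -
  define B where "B = {v \<in> mspace T. 0 < emeasure (nu X) {v}} - skeleton Y"
  have "countable {v \<in> mspace T. 0 < emeasure (nu X) {v}}"
    by (rule countable_subset[OF _ countable_atoms_sigma_finite[OF D(4)]])
      (use D(3,13) singleton_sets_borel_on in auto)
  then have cB: "countable B" unfolding B_def by (rule countable_Diff)
  have "(\<Union>v\<in>B. {v}) \<in> null_sets (mu Y)"
  proof (rule null_sets_UN'[OF cB])
    fix v assume v: "v \<in> B"
    then have vT: "v \<in> mspace T" by (simp add: B_def)
    have "\<not> 0 < emeasure (mu Y) {v}" using v vT by (auto simp: B_def skeleton_eq[of Y] simp del: pruned_simps(3,4))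
    then show "{v} \<in> null_sets (mu Y)"
      using singleton_sets_borel_on[OF vT] sets_mu(1) by (auto simp: null_sets_def simp del: pruned_simps)
  qed
  then have "AE x in mu Y. x \<notin> B" using AE_not_in by fastforce
  moreover have "AE x in mu Y. x \<in> K"
    using AE_supp_tree(1)[OF pruned_bitree] by (simp del: pruned_simps(3,4))
  moreover have "AE x in mu Y. x \<in> mspace T" using AE_space[of "mu Y"] sets_mu(2) by simp
  ultimately have "AE x in mu Y. x \<in> K \<and> emeasure (nu X) ({x} - skeleton Y) = 0"
  proof eventually_elim
    case (elim x)
    then show ?case by (cases "x \<in> skeleton Y") (auto simp: B_def insert_Diff_if simp del: pruned_simps)
  qed
  then show ?thesis
    unfolding pruned_simps(3) using S_sets(2)
    by (subst (asm) AE_density) (auto simp: indicator_def elim!: eventually_mono simp del: pruned_simps)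
qed

text \<open>By \<open>tau_pruned\<close> the sampled subtrees of both trees have the same class, and
  \<open>gen_val_tau\<close> translates this into equality of \<open>gev\<close>.\<close>

lemma samp_pruned:
  assumes u: "\<And>i. i < qdeg q ==> u i \<in> S" "\<And>i. u i \<in> S ==> u i \<in> K \<and> emeasure (nu X) ({u i} - skeleton Y) = 0"
  shows "samp Y q u = samp X q u"
proof -
  have "(case p of (k, g) \<Rightarrow> tree_gev Y g (map u [0..<Suc k])) =
      (case p of (k, g) \<Rightarrow> tree_gev X g (map u [0..<Suc k]))" if p: "p \<in> set q" for p
  proof (cases p)
    case (Pair k g)
    let ?us = "map u [0..<Suc k]"
    have k: "k < qdeg q" using p Pair qdeg_less by auto
    have ne: "?us \<noteq> []" by simp
    have us: "set ?us \<subseteq> K \<inter> S" using u k by (auto simp del: pruned_simps)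
    have t: "tau Y ?us = tau X ?us"
      by (rule tau_pruned[OF ne us]) (use u k in \<open>auto simp del: pruned_simps\<close>)
    have KY: "K \<subseteq> supp_tree Y" using supp_tree_Y by auto
    have KX: "K \<subseteq> supp_tree X" using K_subset msupp_subset_supp_tree[OF D(7)] by blast
    have "tree_gev Y g ?us = gen_val (length ?us) (tau Y ?us) g"
      using us KY by (intro gen_val_tau[OF pruned_bitree ne, symmetric]) auto
    also have "\<dots> = tree_gev X g ?us"
      unfolding t using us KX by (intro gen_val_tau[OF X ne]) auto
    finally show ?thesis by (simp only: Pair prod.case)
  qed
  then have "map (\<lambda>(k, g). tree_gev Y g (map u [0..<Suc k])) q =
      map (\<lambda>(k, g). tree_gev X g (map u [0..<Suc k])) q"
    by (rule map_cong[OF refl])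
  then show ?thesis unfolding samp_def by (rule arg_cong)
qed

end

text \<open>Reduces the error in a moment to the error in the mass. Up to a constant the derivative
  of \<open>exp (- 2 s) * s ^ m\<close> is dominated by \<open>exp (- s)\<close>, which is up to
  sign the derivative of the mass functional; this is where the factor 2 in \<open>gev\<close> is
  used.\<close>

lemma exp_power_diff:
  fixes x y I J B :: real
  assumes xy: "0 \<le> x" "x \<le> y" and B: "0 \<le> B"
    and I: "\<bar>I\<bar> \<le> B * x ^ m" and IJ: "\<bar>I - J\<bar> \<le> B * (y ^ m - x ^ m)"
  shows "\<bar>exp (- 2 * x) * I - exp (- 2 * y) * J\<bar> \<le> 3 * fact m * B * (exp (- x) - exp (- y))"
proof -
  have e: "exp (- y) \<le> exp (- x)" using xy by simp
  have 1: "(exp (- 2 * x) - exp (- 2 * y)) * x ^ m \<le> 2 * fact m * (exp (- x) - exp (- y))"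
  proof -
    have "(exp (- 2 * x) - exp (- 2 * y)) * x ^ m = (exp (- x) - exp (- y)) * ((exp (- x) + exp (- y)) * x ^ m)"
      by (simp add: mult_exp_exp algebra_simps)
    also have "\<dots> \<le> (exp (- x) - exp (- y)) * (2 * fact m)"
    proof (intro mult_left_mono)
      have "(exp (- x) + exp (- y)) * x ^ m \<le> (2 * exp (- x)) * x ^ m"
        using e xy by (intro mult_right_mono) auto
      also have "\<dots> \<le> 2 * (exp (- x) * (fact m * exp x))"
        using power_le_fact_exp[OF xy(1), of m] by (simp add: mult_left_mono)
      also have "\<dots> = 2 * fact m" by (simp add: mult_exp_exp mult.left_commute)
      finally show "(exp (- x) + exp (- y)) * x ^ m \<le> 2 * fact m" .
    qed (use e in simp)
    finally show ?thesis by (simp add: mult.commute)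
  qed
  have 2: "exp (- 2 * y) * (y ^ m - x ^ m) \<le> fact m * (exp (- x) - exp (- y))"
  proof -
    \<comment> \<open>Monotonicity in \<open>s\<close> with the prefactor
      \<open>exp (- 2 * y)\<close> frozen; on the interval it is at most
      \<open>exp (- 2 * s)\<close>.\<close>
    have "exp (- 2 * y) * y ^ m + fact m * exp (- y) \<le> exp (- 2 * y) * x ^ m + fact m * exp (- x)"
    proof (rule DERIV_nonpos_imp_nonincreasing[OF xy(2)])
      fix s assume s: "x \<le> s" "s \<le> y"
      have "exp (- 2 * y) * (real m * s ^ (m - 1)) \<le> fact m * exp (- s)"
      proof (cases m)
        case (Suc k)
        have "exp (- 2 * y) * (real m * s ^ (m - 1)) \<le> exp (- 2 * s) * (real m * (fact k * exp s))"
          using s xy power_le_fact_exp[of s k] Suc by (intro mult_mono) auto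
        also have "\<dots> = fact m * exp (- s)" by (simp add: Suc mult_exp_exp algebra_simps)
        finally show ?thesis .
      qed simp
      then have "exp (- 2 * y) * (real m * s ^ (m - 1)) - fact m * exp (- s) \<le> 0" by simp
      moreover have "((\<lambda>s. exp (- 2 * y) * s ^ m + fact m * exp (- s)) has_real_derivative
          exp (- 2 * y) * (real m * s ^ (m - 1)) - fact m * exp (- s)) (at s)"
        by (auto intro!: derivative_eq_intros)
      ultimately show "\<exists>D. ((\<lambda>s. exp (- 2 * y) * s ^ m + fact m * exp (- s)) has_real_derivative D) (at s) \<and> D \<le> 0"
        by blast
    qed
    then show ?thesis by (simp add: algebra_simps)
  qed
  have "exp (- 2 * x) * I - exp (- 2 * y) * J = (exp (- 2 * x) - exp (- 2 * y)) * I + exp (- 2 * y) * (I - J)"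
    by (simp add: algebra_simps)
  then have "\<bar>exp (- 2 * x) * I - exp (- 2 * y) * J\<bar> \<le> \<bar>(exp (- 2 * x) - exp (- 2 * y)) * I\<bar> + \<bar>exp (- 2 * y) * (I - J)\<bar>"
    by linarith
  also have "\<dots> = (exp (- 2 * x) - exp (- 2 * y)) * \<bar>I\<bar> + exp (- 2 * y) * \<bar>I - J\<bar>"
    using xy by (simp add: abs_mult)
  also have "\<dots> \<le> (exp (- 2 * x) - exp (- 2 * y)) * (B * x ^ m) + exp (- 2 * y) * (B * (y ^ m - x ^ m))"
    using I IJ xy by (intro add_mono mult_left_mono) auto
  also have "\<dots> = B * ((exp (- 2 * x) - exp (- 2 * y)) * x ^ m) + B * (exp (- 2 * y) * (y ^ m - x ^ m))"
    by (simp add: algebra_simps)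
  also have "\<dots> \<le> B * (2 * fact m * (exp (- x) - exp (- y))) + B * (fact m * (exp (- x) - exp (- y)))"
    using 1 2 B by (intro add_mono mult_left_mono) auto
  finally show ?thesis by (simp add: algebra_simps)
qed

subsection \<open>Subtrees spanned by a block of the sample\<close>

text \<open>Keeps the root and drops the first \<open>a\<close> points. The block ends the list of
  marked points, so the points sampled from the measure follow it directly and one shift serves
  both.\<close>

definition reindex :: "nat \<Rightarrow> (nat \<times> nat \<Rightarrow> real) \<Rightarrow> nat \<times> nat \<Rightarrow> real" where
  "reindex a D = (\<lambda>(i, j). D (if i = 0 then 0 else a + i, if j = 0 then 0 else a + j))"

text \<open>
  In terms of distance matrices: the point with index \<open>p\<close> lies on the path from the root to the
  point with index \<open>i\<close> iff \<open>D (0, p) + D (i, p) = D (0, i)\<close>. The function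
  \<open>near j a k p\<close> approximates, as \<open>j\<close> tends to infinity, the indicator of the event that this
  happens for some \<open>i\<close> in the block \<open>{a + 1..a + k + 1}\<close>.
\<close>

definition bump :: "nat \<Rightarrow> real \<Rightarrow> real" where
  "bump j x = max 0 (min 1 (1 - real j * x))"

definition near :: "nat \<Rightarrow> nat \<Rightarrow> nat \<Rightarrow> nat \<Rightarrow> (nat \<times> nat \<Rightarrow> real) \<Rightarrow> real" where
  "near j a k p D = 1 - (\<Prod>i\<in>{a..a + k}. 1 - bump j (D (0, p) + D (Suc i, p) - D (0, Suc i)))"

text \<open>Index 0 is the root and the indices up to \<open>a + k + 1\<close> are the marked
  points; \<open>Suc (Suc (a + k))\<close> is the first point sampled from the measure.\<close>

definition mass_approx :: "nat \<Rightarrow> nat \<Rightarrow> nat \<Rightarrow> pmm set \<Rightarrow> real" where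
  "mass_approx j a k C = (\<integral>D. near j a k (Suc (Suc (a + k))) D \<partial>upsilon (representative C))"

text \<open>The power of the mass undoes the normalisation in \<open>upsilon\<close>, as in
  \<open>gen_val\<close>.\<close>

definition poly_approx :: "nat \<Rightarrow> nat \<Rightarrow> nat \<Rightarrow> (nat \<times> nat) list \<Rightarrow> pmm set \<Rightarrow> real" where
  "poly_approx j a k l C = ups [] C ^ (msize l - 1) *
     (\<integral>D. (\<Prod>i<msize l. near j a k (Suc (Suc (a + k)) + i) D) * dmono l (reindex a D) \<partial>upsilon (representative C))"

lemma bump_range: "0 \<le> bump j x" "bump j x \<le> 1"
  by (simp_all add: bump_def)

lemma near_range: "0 \<le> near j a k p D" "near j a k p D \<le> 1"
  unfolding near_def using bump_range by (auto intro!: prod_le_1 prod_nonneg)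

lemma near_bounded_continuous:
  assumes p: "Suc (a + k) < p"
  shows "near j a k p \<in> bounded_continuous (matrix_topology all_pairs)"
proof -
  have "continuous_map (matrix_topology all_pairs) euclideanreal (near j a k p)"
    unfolding near_def bump_def using p
    by (intro continuous_map_diff continuous_map_prod continuous_map_real_max continuous_map_real_min
        continuous_map_real_mult_left continuous_map_add continuous_map_entry)
      (auto simp: all_pairs_def)
  then show ?thesis
    using near_range by (auto simp: bounded_continuous_def bounded_iff intro!: exI[of _ 1])
qed

lemma reindex_continuous:
  "continuous_map (matrix_topology all_pairs) euclideanreal (\<lambda>D. dmono l (reindex a D))"
proof (induction l)
  case (Cons p l)
  have "continuous_map (matrix_topology all_pairs) euclideanreal (\<lambda>D. if p \<in> all_pairs then arctan (reindex a D p) else 0)"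
  proof (cases "p \<in> all_pairs")
    case True
    then show ?thesis
      by (cases p) (auto simp: reindex_def all_pairs_def intro!: continuous_map_arctan continuous_map_entry)
  qed simp
  from continuous_map_real_mult[OF this Cons.IH] show ?case by (simp add: dmono_def)
qed (simp add: dmono_def)

lemma poly_integrand_bounded_continuous:
  "(\<lambda>D. (\<Prod>i<m. near j a k (Suc (Suc (a + k)) + i) D) * dmono l (reindex a D))
     \<in> bounded_continuous (matrix_topology all_pairs)"
proof -
  have "continuous_map (matrix_topology all_pairs) euclideanreal
      (\<lambda>D. (\<Prod>i<m. near j a k (Suc (Suc (a + k)) + i) D) * dmono l (reindex a D))"
    using near_bounded_continuous
    by (intro continuous_map_real_mult continuous_map_prod reindex_continuous) (auto simp: bounded_continuous_def)
  moreover have "\<bar>(\<Prod>i<m. near j a k (Suc (Suc (a + k)) + i) D) * dmono l (reindex a D)\<bar> \<le> 1 * 2 ^ length l" for D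
    unfolding abs_mult using near_range
    by (intro mult_mono dmono_bound) (auto simp: abs_prod intro!: prod_le_1)
  ultimately show ?thesis by (auto simp: bounded_continuous_def bounded_iff)
qed

lemma mass_approx_continuous: "continuous_map (pGw_topology n) euclideanreal (mass_approx j a k)"
  unfolding mass_approx_def by (intro upsilon_integral_continuous near_bounded_continuous) simp

lemma poly_approx_continuous: "continuous_map (pGw_topology n) euclideanreal (poly_approx j a k l)"
  unfolding poly_approx_def
  by (intro continuous_map_real_mult continuous_map_real_pow ups_continuous upsilon_integral_continuous
      poly_integrand_bounded_continuous)

lemma mass_approx_nonneg: "0 \<le> mass_approx j a k C"
  unfolding mass_approx_def using near_range by (intro Bochner_Integration.integral_nonneg) simp

lemma tree_dist_commute: "tree_dist X x y = tree_dist X y x"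
  by (simp add: tree_dist_def mdist_commute)

lemma tree_dist_triangle:
  "X \<in> bitrees ==> tree_dist X x z \<le> tree_dist X x y + tree_dist X y z"
  unfolding tree_dist_def by (rule mdist_triangle) (rule carrier_map_mspace, assumption)+

text \<open>The assumptions on the sample hold almost surely. Below, \<open>sp\<close> is the
  subtree of all points up to the end of the block and \<open>sb\<close> that of the block.\<close>

locale block =
  fixes X u a k
  assumes X: "X \<in> bitrees"
    and us: "\<And>i. i \<le> a + k ==> u i \<in> supp_tree X"
    and fin: "emeasure (skel_measure X) (tree_spanned X (map u [0..<Suc (a + k)])) \<noteq> \<infinity>"
begin

declare upt_Suc [simp del]

abbreviation "N \<equiv> skel_measure X"
abbreviation "d \<equiv> tree_dist X"
abbreviation "all \<equiv> map u [0..<Suc (a + k)]"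
abbreviation "blk \<equiv> map u [a..<a + Suc k]"
definition sp where "sp = spanned N d (rt X) all"
definition sb where "sb = spanned N d (rt X) blk"

text \<open>The approximate indicator \<open>near j\<close> as a function of a single sampled point.
  It equals 1 on \<open>sb\<close>, so that masses are approximated from above.\<close>

definition v :: "nat \<Rightarrow> real \<Rightarrow> real" where
  "v j x = 1 - (\<Prod>i\<in>{a..a + k}. 1 - bump j (d (rt X) x + d (u i) x - d (rt X) (u i)))"

lemma sampler_X: "sampler (mu X) N d (rt X)" by (rule sampler_bitree[OF X])

lemma usT: "i \<le> a + k ==> u i \<in> space (mu X)"
  using us[of i] supp_tree_subset[of X] bitreesD(7,12)[OF X] by auto

lemma sets_N: "sets N = sets (mu X)" using sampler.sets_N[OF sampler_X] .

lemma sp_sets: "sp \<in> sets N" "sb \<in> sets N"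
  unfolding sets_N sp_def sb_def by (rule sampler.spanned_sets[OF sampler_X], use usT in auto)+

lemma sb_subset: "sb \<subseteq> sp" by (auto simp: spanned_def sp_def sb_def)

lemma fin_sp: "emeasure N sp \<noteq> \<infinity>" "emeasure N sb \<noteq> \<infinity>"
  using emeasure_mono[OF sb_subset sp_sets(1)] fin by (auto simp: top_unique sp_def[symmetric])

lemma v_range: "0 \<le> v j x" "v j x \<le> 1"
  unfolding v_def using bump_range by (auto intro!: prod_le_1 prod_nonneg)

lemma in_sb: "x \<in> space N ==> x \<in> sb \<longleftrightarrow> (\<exists>i\<in>{a..a + k}. d (rt X) x + d (u i) x - d (rt X) (u i) = 0)"
  by (auto simp: sb_def spanned_def tree_dist_commute[of X x] simp del: upt_Suc)

lemma gap_nonneg: "0 \<le> d (rt X) x + d (u i) x - d (rt X) (u i)"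
  using tree_dist_triangle[OF X, of "rt X" "u i" x] tree_dist_commute[of X x "u i"] by simp

lemma v_sb: "x \<in> sb ==> v j x = 1"
proof -
  assume x: "x \<in> sb"
  then have "x \<in> space N" by (simp add: sb_def spanned_def)
  from x[unfolded in_sb[OF this]] obtain i where i: "i \<in> {a..a + k}" "d (rt X) x + d (u i) x - d (rt X) (u i) = 0" ..
  have "bump j (d (rt X) x + d (u i) x - d (rt X) (u i)) = 1" unfolding i(2) by (simp add: bump_def)
  then have "(\<Prod>i\<in>{a..a + k}. 1 - bump j (d (rt X) x + d (u i) x - d (rt X) (u i))) = 0"
    using i(1) by (intro prod_zero) auto
  then show ?thesis unfolding v_def by simp
qed

lemma v_limit:
  assumes x: "x \<in> space N" "x \<notin> sb" shows "(\<lambda>j. v j x) \<longlonglongrightarrow> 0"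
proof (rule tendsto_eventually)
  have "\<forall>\<^sub>F j in sequentially. bump j (d (rt X) x + d (u i) x - d (rt X) (u i)) = 0" if i: "i \<in> {a..a + k}" for i
  proof -
    let ?g = "d (rt X) x + d (u i) x - d (rt X) (u i)"
    have g: "0 < ?g" using x(2) in_sb[OF x(1)] i gap_nonneg[of x i] by force
    obtain J :: nat where "1 / ?g < real J" using reals_Archimedean2 by blast
    then have J: "1 < real J * ?g" by (simp add: pos_divide_less_eq[OF g])
    have "bump j ?g = 0" if "J \<le> j" for j
    proof -
      have "real J * ?g \<le> real j * ?g" using that g by (intro mult_right_mono) auto
      then have "1 - real j * ?g \<le> 0" using J by linarith
      then have "min 1 (1 - real j * ?g) \<le> 0" by (rule min.coboundedI2)
      then show ?thesis unfolding bump_def by (rule max_absorb1)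
    qed
    then show ?thesis by (rule eventually_sequentiallyI)
  qed
  then have "\<forall>\<^sub>F j in sequentially. \<forall>i\<in>{a..a + k}. bump j (d (rt X) x + d (u i) x - d (rt X) (u i)) = 0"
    by (intro eventually_ball_finite) auto
  then show "\<forall>\<^sub>F j in sequentially. v j x = 0"
  proof eventually_elim
    case (elim j)
    then have "(\<Prod>i\<in>{a..a + k}. 1 - bump j (d (rt X) x + d (u i) x - d (rt X) (u i))) = 1"
      by (intro prod.neutral) simp
    then show ?case unfolding v_def by simp
  qed
qed

lemma v_measurable: "v j \<in> borel_measurable N"
proof -
  interpret S: sampler "mu X" N d "rt X" by (rule sampler_X)
  have "(\<lambda>x. d (rt X) x) \<in> borel_measurable N" "(\<lambda>x. d (u i) x) \<in> borel_measurable N" if "i \<in> {a..a + k}" for i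
    using that usT[of i] unfolding measurable_cong_sets[OF sets_N refl]
    by (intro S.d_measurable' S.root_measurable measurable_const measurable_ident; simp)+
  then show ?thesis
    unfolding v_def bump_def
    by (intro borel_measurable_diff borel_measurable_prod borel_measurable_max borel_measurable_min
        borel_measurable_times borel_measurable_add borel_measurable_const) auto
qed

abbreviation "f j x \<equiv> indicator sp x * v j x :: real"

lemma int_sp: "integrable N (indicator sp :: _ \<Rightarrow> real)" "integrable N (indicator sb :: _ \<Rightarrow> real)"
proof -
  show "integrable N (indicator sp :: _ \<Rightarrow> real)" "integrable N (indicator sb :: _ \<Rightarrow> real)"
    using sp_sets fin_sp by (simp_all add: less_top[symmetric])
qed

lemma int_f: "integrable N (f j)"
  by (rule Bochner_Integration.integrable_bound[OF int_sp(1)])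
    (use v_measurable[of j] sp_sets(1) v_range[of j] in \<open>auto simp: abs_mult indicator_def intro!: borel_measurable_times\<close>)

lemma sb_le_f: "indicator sb x \<le> f j x"
  using sb_subset v_sb[of x j] v_range[of j x] by (auto simp: indicator_def subset_iff simp del: upt_Suc)

text \<open>\<open>A\<close> is the mass of the block subtree and \<open>Bj j\<close> its
  overestimate by a quantity that is continuous in the whole subtree.\<close>

definition A :: real where "A = measure N sb"
definition Bj :: "nat \<Rightarrow> real" where "Bj j = (\<integral>x. f j x \<partial>N)"

lemma A_integral: "A = (\<integral>x. indicator sb x \<partial>N)"
  using sets.sets_into_space[OF sp_sets(2)] by (simp add: A_def Int_absorb2 del: upt_Suc)

lemma A_le: "0 \<le> A" "A \<le> Bj j"
proof -
  show "0 \<le> A" by (simp add: A_def)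
  show "A \<le> Bj j" unfolding A_integral Bj_def by (rule integral_mono[OF int_sp(2) int_f sb_le_f])
qed

lemma B_limit: "Bj \<longlonglongrightarrow> A"
  unfolding A_integral Bj_def
proof (rule integral_dominated_convergence[where w = "indicator sp"])
  show "AE x in N. (\<lambda>j. f j x) \<longlonglongrightarrow> indicator sb x"
  proof (rule AE_I2)
    fix x assume x: "x \<in> space N"
    show "(\<lambda>j. f j x) \<longlonglongrightarrow> indicator sb x"
    proof (cases "x \<in> sb")
      case True
      then show ?thesis using sb_subset by (simp add: v_sb subset_iff del: upt_Suc)
    next
      case False
      from tendsto_mult_left[OF v_limit[OF x this], of "indicator sp x"] False show ?thesis by simp
    qed
  qed
  show "AE x in N. norm (f j x) \<le> indicator sp x" for j
    using v_range[of j] by (auto simp: indicator_def)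
qed (use int_f int_sp in auto)

lemma near_v: "near j a k (Suc (Suc (a + k)) + i) (dmat d (rt X) (pts all x)) = v j (x i)"
proof -
  have n: "pts all x (Suc (a + k) + i) = x i" by (simp add: pts_def)
  have e: "dmat d (rt X) (pts all x) (0, Suc (Suc (a + k)) + i) = d (rt X) (x i)"
    using n by (simp add: dmat_def all_pairs_def)
  have "dmat d (rt X) (pts all x) (Suc i', Suc (Suc (a + k)) + i) = d (u i') (x i) \<and>
      dmat d (rt X) (pts all x) (0, Suc i') = d (rt X) (u i')" if "i' \<in> {a..a + k}" for i'
    using n that by (simp add: dmat_def all_pairs_def pts_def del: upt_Suc)
  then show ?thesis unfolding near_def v_def e by (intro arg_cong2[where f = "(-)"] prod.cong refl) simp
qed

lemma reindex_blk: "dmono l (reindex a (dmat d (rt X) (pts all x))) = dmono l (dmat d (rt X) (pts blk x))"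
proof (rule dmono_cong)
  fix i j assume ij: "(i, j) \<in> all_pairs"
  have "case_nat (rt X) (pts all x) (if i = 0 then 0 else a + i) = case_nat (rt X) (pts blk x) i" for i
  proof (cases i)
    case (Suc i')
    then show ?thesis by (simp add: pts_def del: upt_Suc)
  qed simp
  moreover have "(if i = 0 then 0 else a + i, if j = 0 then 0 else a + j) \<in> all_pairs"
    using ij by (auto simp: all_pairs_def)
  ultimately show "reindex a (dmat d (rt X) (pts all x)) (i, j) = dmat d (rt X) (pts blk x) (i, j)"
    using ij by (simp only: reindex_def dmat_def prod.case restrict_apply if_True)
qed

lemma mass_approx_eval: "mass_approx j a k (tau X all) = Bj j"
proof -
  interpret PN: product_sigma_finite "\<lambda>_ :: nat. N" by (rule sampler.product_sigma_finite_N[OF sampler_X])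
  have n: "all \<noteq> []" "set all \<subseteq> supp_tree X" using us by auto
  have nv: "near j a k (Suc (Suc (a + k))) (dmat d (rt X) (pts all x)) = v j (x 0)" for x
    using near_v[of j 0 x] by simp
  have bc: "near j a k (Suc (Suc (a + k))) \<in> bounded_continuous (matrix_topology all_pairs)"
    by (rule near_bounded_continuous) simp
  have "mass_approx j a k (tau X all) =
      (\<integral>x. (\<Prod>i<1. indicator sp (x i)) * near j a k (Suc (Suc (a + k))) (dmat d (rt X) (pts all x)) \<partial>PiM {..<1} (\<lambda>_. N))"
    unfolding mass_approx_def
    using tau_upsilon_power[OF X n fin bounded_continuous_borel[OF bc], of 1] unfolding nv
    by (simp add: depends_below_def sp_def[symmetric] del: upt_Suc)
  also have "\<dots> = (\<integral>x. (\<Prod>i<1. f j (x i)) \<partial>PiM {..<1 :: nat} (\<lambda>_. N))"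
    unfolding nv by (intro Bochner_Integration.integral_cong refl) simp
  also have "\<dots> = Bj j"
    using PN.product_integral_prod[of "{..<1}" "\<lambda>_. f j"] int_f by (simp add: Bj_def del: upt_Suc)
  finally show ?thesis .
qed

definition Ib :: "(nat \<times> nat) list \<Rightarrow> real" where
  "Ib l = (\<integral>x. (\<Prod>i<msize l. indicator sb (x i)) * dmono l (dmat d (rt X) (pts blk x)) \<partial>PiM {..<msize l} (\<lambda>_. N))"

definition Jb :: "nat \<Rightarrow> (nat \<times> nat) list \<Rightarrow> real" where
  "Jb j l = (\<integral>x. (\<Prod>i<msize l. f j (x i)) * dmono l (dmat d (rt X) (pts blk x)) \<partial>PiM {..<msize l} (\<lambda>_. N))"

lemma poly_approx_eval: "poly_approx j a k l (tau X all) = Jb j l"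
proof -
  let ?f = "\<lambda>D. (\<Prod>i<msize l. near j a k (Suc (Suc (a + k)) + i) D) * dmono l (reindex a D)"
  have n: "all \<noteq> []" "set all \<subseteq> supp_tree X" using us by auto
  have fe: "?f (dmat d (rt X) (pts all x)) = (\<Prod>i<msize l. v j (x i)) * dmono l (dmat d (rt X) (pts blk x))" for x
    unfolding near_v reindex_blk ..
  have dp: "depends_below (msize l) (\<lambda>x. ?f (dmat d (rt X) (pts all x)))"
    unfolding fe depends_below_def
  proof (intro allI impI)
    fix x y :: "nat \<Rightarrow> real" assume xy: "\<forall>i<msize l. x i = y i"
    have "dmono l (dmat d (rt X) (pts blk x)) = dmono l (dmat d (rt X) (pts blk y))"
      by (rule depends_belowD[OF dmono_dmat_depends_below[of l "msize l"]]) (use xy in simp_all)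
    moreover have "(\<Prod>i<msize l. v j (x i)) = (\<Prod>i<msize l. v j (y i))"
      by (rule prod.cong) (use xy in simp_all)
    ultimately show "(\<Prod>i<msize l. v j (x i)) * dmono l (dmat d (rt X) (pts blk x)) =
        (\<Prod>i<msize l. v j (y i)) * dmono l (dmat d (rt X) (pts blk y))" by (simp only:)
  qed
  have m: "0 < msize l" by (simp add: msize_def)
  have "poly_approx j a k l (tau X all) =
      (\<integral>x. (\<Prod>i<msize l. indicator sp (x i)) * ?f (dmat d (rt X) (pts all x)) \<partial>PiM {..<msize l} (\<lambda>_. N))"
    unfolding poly_approx_def ups_Nil_tau[OF X n] sp_def
    by (rule tau_upsilon_power[OF X n fin bounded_continuous_borel[OF poly_integrand_bounded_continuous] m dp])
  also have "\<dots> = Jb j l"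
    unfolding fe Jb_def prod.distrib by (simp only: mult.assoc)
  finally show ?thesis .
qed

text \<open>Since \<open>indicator sb \<le> f j\<close>, the difference of the two product weights
  is nonnegative, and its integral is a difference of powers.\<close>

lemma poly_bounds:
  shows "\<bar>Ib l\<bar> \<le> 2 ^ length l * A ^ msize l"
    and "\<bar>Ib l - Jb j l\<bar> \<le> 2 ^ length l * (Bj j ^ msize l - A ^ msize l)"
proof -
  let ?m = "msize l"
  let ?P = "PiM {..<?m} (\<lambda>_ :: nat. N)" and ?d = "\<lambda>x. dmono l (dmat d (rt X) (pts blk x))"
  let ?pi = "\<lambda>x. \<Prod>i<?m. indicator sb (x i) :: real" and ?pf = "\<lambda>x. \<Prod>i<?m. f j (x i)"
  interpret PN: product_sigma_finite "\<lambda>_ :: nat. N" by (rule sampler.product_sigma_finite_N[OF sampler_X])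
  have blkM: "set blk \<subseteq> space (mu X)" using usT by auto
  have dm: "?d \<in> borel_measurable ?P" by (rule sampler.dmono_pts_measurable[OF sampler_X blkM])
  have ip: "integrable ?P ?pi" "integrable ?P ?pf"
    by (rule PN.product_integrable_prod; use int_f int_sp in simp)+
  have vp: "(\<integral>x. ?pi x \<partial>?P) = A ^ ?m" "(\<integral>x. ?pf x \<partial>?P) = Bj j ^ ?m"
    using PN.product_integral_prod[of "{..<?m}" "\<lambda>_. indicator sb :: _ \<Rightarrow> real"] int_sp
      PN.product_integral_prod[of "{..<?m}" "\<lambda>_. f j"] int_f
    unfolding A_integral Bj_def by (simp_all del: upt_Suc)
  have bd: "\<bar>g x * ?d x\<bar> \<le> 2 ^ length l * g x" if "0 \<le> g x" for g x
    using that dmono_bound[of l "dmat d (rt X) (pts blk x)"]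
    by (simp add: abs_mult mult.commute mult_left_mono del: upt_Suc)
  have p0: "0 \<le> ?pi x" "0 \<le> ?pf x - ?pi x" for x
  proof -
    show "0 \<le> ?pi x" by (intro prod_nonneg) simp
    have "?pi x \<le> ?pf x" by (intro prod_mono) (use sb_le_f in auto)
    then show "0 \<le> ?pf x - ?pi x" by simp
  qed
  have idm: "integrable ?P (\<lambda>x. g x * ?d x)" if g: "integrable ?P g" "\<And>x. 0 \<le> g x" for g
  proof (rule Bochner_Integration.integrable_bound[OF integrable_mult_right[OF g(1), of "2 ^ length l"]])
    show "(\<lambda>x. g x * ?d x) \<in> borel_measurable ?P"
      using g(1) dm by (intro borel_measurable_times) auto
    show "AE x in ?P. norm (g x * ?d x) \<le> norm (2 ^ length l * g x)"
      using bd[of g, OF g(2)] g(2) by (auto simp: abs_mult simp del: upt_Suc)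
  qed
  have "\<bar>Ib l\<bar> \<le> (\<integral>x. 2 ^ length l * ?pi x \<partial>?P)"
    unfolding Ib_def by (rule abs_integral_le[OF idm[OF ip(1) p0(1)] integrable_mult_right[OF ip(1)] bd[of ?pi, OF p0(1)]])
  then show "\<bar>Ib l\<bar> \<le> 2 ^ length l * A ^ ?m" using vp by simp
  have iq: "integrable ?P (\<lambda>x. ?pf x - ?pi x)" using ip by (rule Bochner_Integration.integrable_diff[rotated])
  have pf0: "0 \<le> ?pf x" for x using p0[of x] by linarith
  have "Jb j l - Ib l = (\<integral>x. (?pf x - ?pi x) * ?d x \<partial>?P)"
    unfolding Jb_def Ib_def left_diff_distrib
    by (rule Bochner_Integration.integral_diff[symmetric, OF idm[OF ip(2) pf0] idm[OF ip(1) p0(1)]])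
  moreover have "\<bar>\<integral>x. (?pf x - ?pi x) * ?d x \<partial>?P\<bar> \<le> (\<integral>x. 2 ^ length l * (?pf x - ?pi x) \<partial>?P)"
    by (rule abs_integral_le[OF idm[OF iq p0(2)] integrable_mult_right[OF iq] bd[of "\<lambda>x. ?pf x - ?pi x", OF p0(2)]])
  moreover have "(\<integral>x. 2 ^ length l * (?pf x - ?pi x) \<partial>?P) = 2 ^ length l * (Bj j ^ ?m - A ^ ?m)"
    using vp Bochner_Integration.integral_diff[OF ip(2,1)] by simp
  ultimately show "\<bar>Ib l - Jb j l\<bar> \<le> 2 ^ length l * (Bj j ^ ?m - A ^ ?m)" by (simp add: abs_minus_commute)
qed

lemma gev_mass_approx:
  "gev N d (rt X) Mass blk - exp (- mass_approx j a k (tau X all)) = exp (- A) - exp (- Bj j)"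
  unfolding mass_approx_eval by (simp add: A_def sb_def del: upt_Suc)

lemma gev_poly_approx:
  "\<bar>gev N d (rt X) (Poly l) blk -
      exp (- 2 * mass_approx j a k (tau X all)) * poly_approx j a k l (tau X all)\<bar>
    \<le> 3 * fact (msize l) * 2 ^ length l * (exp (- A) - exp (- Bj j))"
proof -
  have "gev N d (rt X) (Poly l) blk = exp (- 2 * A) * Ib l"
    using fin_sp(2) by (simp add: A_def Ib_def sb_def del: upt_Suc)
  then show ?thesis
    unfolding mass_approx_eval poly_approx_eval
    using exp_power_diff[OF A_le _ poly_bounds, of l j] by simp
qed

end

section \<open>Coordinates of the pruned tree as integrals over samples from the original
  tree\<close>

context pruning
begin

lemma PiM_pruned: "PiM {..<n :: nat} (\<lambda>_. mu Y) = PiM {..<n} (\<lambda>_. density (mu X) (indicator S))"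
  by (simp only: pruned_simps(3))

lemma integral_PiM_pruned:
  fixes f :: "(nat \<Rightarrow> real) \<Rightarrow> real"
  assumes m: "f \<in> borel_measurable (PiM {..<n} (\<lambda>_. mu X))"
  shows "(\<integral>u. f u \<partial>PiM {..<n} (\<lambda>_. mu Y)) = (\<integral>u. (\<Prod>i<n. indicator S (u i)) * f u \<partial>PiM {..<n} (\<lambda>_. mu X))"
proof -
  have sfX: "sigma_finite_measure (mu X)" using D(10) by (rule finite_measure.axioms(1))
  show ?thesis unfolding PiM_pruned by (rule integral_PiM_density[OF sfX S_sets(2) finite_lessThan m])
qed

text \<open>Where all relevant points survive, the integrands for both trees agree almost surely;
  elsewhere the indicators vanish.\<close>

lemma Psi_pruned:
  assumes m: "mass X \<noteq> 0"
  shows "Psi Y q = mass X ^ qdeg q * (\<integral>u. (\<Prod>i<qdeg q. indicator S (u i)) * samp X q u \<partial>sampling X)"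
proof -
  let ?n = "qdeg q"
  have n0: "0 < ?n" by (simp add: qdeg_def)
  have sP: "sets (PiM UNIV (\<lambda>_ :: nat. mu Y)) = sets (PiM UNIV (\<lambda>_. mu X))"
    by (intro sets_PiM_cong) (use sets_mu D(9) in auto)
  have sY: "samp Y q \<in> borel_measurable (PiM UNIV (\<lambda>_. mu Y))"
    using samp_measurable[OF pruned_bitree] measurable_cong_sets[OF sets_sampling refl] by blast
  then have sYX: "samp Y q \<in> borel_measurable (PiM UNIV (\<lambda>_. mu X))"
    using measurable_cong_sets[OF sP refl] by blast
  have ind: "(\<lambda>u. \<Prod>i<?n. indicator S (u i) :: real) \<in> borel_measurable (PiM UNIV (\<lambda>_. mu X))"
    using S_sets(2) by measurable
  have prY: "(\<lambda>u. (\<Prod>i<?n. indicator S (u i)) * samp Y q u) \<in> borel_measurable (PiM UNIV (\<lambda>_. mu X))"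
    using ind sYX by (rule borel_measurable_times)
  have tmX: "total_mass (mu X) \<noteq> 0" using total_mass_mass[OF X] m mass_nonneg[of X] by simp
  have ne: "space (mu X) \<noteq> {}" using D(7,12) by auto
  show ?thesis
  proof (cases "mass Y = 0")
    case True
    have "emeasure (mu Y) (space (mu Y)) = 0"
      using True finite_measure.emeasure_eq_measure[OF finite_mu] by (simp add: mass_def del: pruned_simps)
    then have "emeasure (mu X) S = 0"
      using emeasure_mu[OF sets.top] sets_mu(2) prune_set_subset[of X A] by (simp add: Int_absorb2 del: pruned_simps)
    then have "S \<in> null_sets (mu X)" using S_sets(2) by auto
    from AE_sampling[OF X m AE_not_in[OF this]]
    have "AE u in sampling X. (\<Prod>i<?n. indicator S (u i)) * samp X q u = 0"
    proof eventually_elim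
      case (elim u)
      then have "(\<Prod>i<?n. indicator S (u i) :: real) = 0" using n0 by (intro prod_zero) auto
      then show ?case by simp
    qed
    then have "(\<integral>u. (\<Prod>i<?n. indicator S (u i)) * samp X q u \<partial>sampling X) = 0"
      by (rule integral_eq_zero_AE)
    then show ?thesis using True n0 by (simp add: Psi_def del: pruned_simps)
  next
    case False
    then have tmY: "total_mass (mu Y) \<noteq> 0"
      using total_mass_mass[OF pruned_bitree] mass_nonneg[of Y] by (simp del: pruned_simps)
    have mY: "samp Y q \<in> borel_measurable (PiM {..<?n} (\<lambda>_. mu X))"
      by (rule depends_below_measurable[OF sYX samp_depends_below ne])
    have e1: "Psi Y q = (\<integral>u. samp Y q u \<partial>PiM {..<?n} (\<lambda>_. mu Y))"
      unfolding Psi_def mass_def sampling_def by (rule integral_PiM_normalise[OF finite_mu tmY sY samp_depends_below])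
    have e2: "(\<integral>u. samp Y q u \<partial>PiM {..<?n} (\<lambda>_. mu Y)) =
        (\<integral>u. (\<Prod>i<?n. indicator S (u i)) * samp Y q u \<partial>PiM {..<?n} (\<lambda>_. mu X))"
      using integral_PiM_pruned[OF mY] .
    have dp: "depends_below ?n (\<lambda>u. (\<Prod>i<?n. indicator S (u i)) * samp Y q u)"
      unfolding depends_below_def
    proof (intro allI impI)
      fix u w :: "nat \<Rightarrow> real" assume uw: "\<forall>i<?n. u i = w i"
      have "samp Y q u = samp Y q w" by (rule depends_belowD[OF samp_depends_below]) (use uw in blast)
      moreover have "(\<Prod>i<?n. indicator S (u i) :: real) = (\<Prod>i<?n. indicator S (w i))"
        by (rule prod.cong[OF refl]) (use uw in simp)
      ultimately show "(\<Prod>i<?n. indicator S (u i)) * samp Y q u = (\<Prod>i<?n. indicator S (w i)) * samp Y q w"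
        by (simp only:)
    qed
    have e3: "(\<integral>u. (\<Prod>i<?n. indicator S (u i)) * samp Y q u \<partial>PiM {..<?n} (\<lambda>_. mu X)) =
        mass X ^ ?n * (\<integral>u. (\<Prod>i<?n. indicator S (u i)) * samp Y q u \<partial>sampling X)"
      unfolding mass_def sampling_def using integral_PiM_normalise[OF D(10) tmX prY dp] by (rule sym)
    have e4: "(\<integral>u. (\<Prod>i<?n. indicator S (u i)) * samp Y q u \<partial>sampling X) = (\<integral>u. (\<Prod>i<?n. indicator S (u i)) * samp X q u \<partial>sampling X)"
    proof (rule integral_cong_AE)
      show "(\<lambda>u. (\<Prod>i<?n. indicator S (u i)) * samp Y q u) \<in> borel_measurable (sampling X)"
        using prY measurable_cong_sets[OF sets_sampling refl] by blast
      show "(\<lambda>u. (\<Prod>i<?n. indicator S (u i)) * samp X q u) \<in> borel_measurable (sampling X)"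
        using ind samp_measurable[OF X] measurable_cong_sets[OF sets_sampling refl]
        by (intro borel_measurable_times) blast+
      show "AE u in sampling X. (\<Prod>i<?n. indicator S (u i)) * samp Y q u = (\<Prod>i<?n. indicator S (u i)) * samp X q u"
        using AE_sampling[OF X m AE_pruned]
      proof eventually_elim
        case (elim u)
        show ?case
        proof (cases "\<forall>i<?n. u i \<in> S")
          case True
          then show ?thesis using samp_pruned[of q u] elim by (simp del: pruned_simps)
        next
          case False
          then obtain i where "i < ?n" "u i \<notin> S" by blast
          then have "(\<Prod>i<?n. indicator S (u i) :: real) = 0" by (intro prod_zero bexI[of _ i]) auto
          then show ?thesis by simp
        qed
      qed
    qed
    show ?thesis unfolding e1 e2 e3 e4 ..
  qed
qed

lemma mass_pruned_le: "mass Y \<le> mass X"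
proof -
  have "emeasure (mu Y) (space (mu Y)) = emeasure (mu X) (S \<inter> space (mu X))"
    using emeasure_mu[OF sets.top] sets_mu(2) D(12) by (simp del: pruned_simps)
  also have "\<dots> \<le> emeasure (mu X) (space (mu X))" by (rule emeasure_mono) auto
  finally show ?thesis
    unfolding mass_def measure_def using finite_measure.emeasure_finite[OF D(10)]
    by (intro enn2real_mono) (simp_all add: less_top[symmetric] del: pruned_simps)
qed

lemma Psi_pruned_zero: "mass X = 0 ==> Psi Y q = 0"
  using mass_pruned_le mass_nonneg[of Y] by (simp add: Psi_def qdeg_def del: pruned_simps)

end

subsection \<open>Functionals that are approximated by continuous functions of the sampled subtrees\<close>

text \<open>The law of the sample times the mass. For mass 0 it is the null measure, which spares
  case distinctions.\<close>

definition sampling_mass :: "bitree \<Rightarrow> (nat \<Rightarrow> real) measure" where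
  "sampling_mass X = density (sampling X) (\<lambda>_. ennreal (mass X))"

lemma sets_sampling_mass: "sets (sampling_mass X) = sets (sampling X)"
  by (simp add: sampling_mass_def)

lemma measurable_sampling_mass: "measurable (sampling_mass X) N = measurable (sampling X) N"
  by (rule measurable_cong_sets[OF sets_sampling_mass refl])

lemma space_sampling_mass: "space (sampling_mass X) = space (sampling X)"
  by (simp add: sampling_mass_def)

lemma finite_sampling_mass:
  assumes X: "X \<in> bitrees" shows "finite_measure (sampling_mass X)"
proof (rule finite_measureI)
  have "emeasure (sampling_mass X) (space (sampling_mass X)) = ennreal (mass X) * emeasure (sampling X) (space (sampling X))"
    unfolding sampling_mass_def by (subst emeasure_density_const) auto
  also have "\<dots> \<noteq> \<infinity>"
  proof (cases "mass X = 0")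
    case False
    then show ?thesis using prob_space.emeasure_space_1[OF prob_space_sampling[OF X False]] by simp
  qed simp
  finally show "emeasure (sampling_mass X) (space (sampling_mass X)) \<noteq> \<infinity>" .
qed

lemma integral_sampling_mass:
  fixes f :: "_ \<Rightarrow> real"
  assumes "f \<in> borel_measurable (sampling X)"
  shows "(\<integral>u. f u \<partial>sampling_mass X) = mass X * (\<integral>u. f u \<partial>sampling X)"
  unfolding sampling_mass_def using assms mass_nonneg[of X] by (subst integral_density) auto

lemma AE_sampling_mass:
  assumes X: "X \<in> bitrees" and P: "AE x in mu X. P x"
  shows "AE u in sampling_mass X. \<forall>k. P (u k)"
proof (cases "mass X = 0")
  case True
  then show ?thesis unfolding sampling_mass_def by (subst AE_density) simp_all
next
  case False
  from AE_sampling[OF X this P] show ?thesis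
    unfolding sampling_mass_def by (subst AE_density) (auto elim: eventually_mono)
qed

lemma integrable_sampling_mass:
  fixes f :: "_ \<Rightarrow> real"
  assumes "X \<in> bitrees" "f \<in> borel_measurable (sampling X)" "\<And>u. u \<in> space (sampling X) ==> \<bar>f u\<bar> \<le> B"
  shows "integrable (sampling_mass X) f"
proof -
  interpret finite_measure "sampling_mass X" by (rule finite_sampling_mass[OF assms(1)])
  show ?thesis
    using assms(2,3) by (intro integrable_const_bound[of _ B]) (auto simp: measurable_sampling_mass space_sampling_mass)
qed

lemma carried_function:
  assumes X: "X \<in> bitrees" and g: "g \<in> bounded_continuous tau_topology"
  shows "(\<lambda>u. g (carried X u)) \<in> borel_measurable (sampling X)"
  by (rule measurable_compose[OF carried_measurable[OF X] bounded_continuous_borel[OF g]])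

lemma bounded_continuous_bound:
  assumes "g \<in> bounded_continuous E"
  obtains b where "0 \<le> b" "\<And>x. x \<in> topspace E ==> \<bar>g x\<bar> \<le> b"
proof -
  obtain b where "\<And>x. x \<in> topspace E ==> \<bar>g x\<bar> \<le> b"
    using assms by (auto simp: bounded_continuous_def bounded_iff)
  then show ?thesis by (intro that[of "max 0 b"]) (auto simp: max.coboundedI2)
qed

lemma carried_integrable:
  assumes X: "X \<in> bitrees" and g: "g \<in> bounded_continuous tau_topology"
  shows "integrable (sampling_mass X) (\<lambda>u. g (carried X u))"
proof -
  obtain b where b: "\<And>x. x \<in> topspace tau_topology ==> \<bar>g x\<bar> \<le> b" using bounded_continuous_bound[OF g] by metis
  show ?thesis
    by (rule integrable_sampling_mass[OF X carried_function[OF X g]]) (rule b[OF carried_topspace[OF X]])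
qed

lemma carried_integral_continuous:
  assumes g: "g \<in> bounded_continuous tau_topology"
  shows "continuous_map LWV_topology euclideanreal
    (\<lambda>C. \<integral>u. g (carried (representative C) u) \<partial>sampling_mass (representative C))"
proof (rule continuous_map_eq[OF varpi_integral_continuous[OF g]])
  fix C assume "C \<in> topspace LWV_topology"
  then have X: "representative C \<in> bitrees" using representative_bitree_classes by (auto simp: topspace_LWV)
  show "(\<integral>c. g c \<partial>varpi (representative C)) = (\<integral>u. g (carried (representative C) u) \<partial>sampling_mass (representative C))"
    unfolding varpi_integral[OF X bounded_continuous_borel[OF g]] integral_sampling_mass[OF carried_function[OF X g]] ..
qed

lemma continuous_map_real_local:
  "continuous_map Z euclideanreal f \<longleftrightarrow>
    (\<forall>z\<in>topspace Z. \<forall>e>0. \<exists>U. openin Z U \<and> z \<in> U \<and> (\<forall>y\<in>U. \<bar>f y - f z\<bar> < e))"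
proof
  assume f: "continuous_map Z euclideanreal f"
  show "\<forall>z\<in>topspace Z. \<forall>e>0. \<exists>U. openin Z U \<and> z \<in> U \<and> (\<forall>y\<in>U. \<bar>f y - f z\<bar> < e)"
  proof (intro ballI allI impI)
    fix z and e :: real assume z: "z \<in> topspace Z" "e > 0"
    have "openin Z {y \<in> topspace Z. f y \<in> ball (f z) e}"
      by (rule openin_continuous_map_preimage[OF f]) simp
    then show "\<exists>U. openin Z U \<and> z \<in> U \<and> (\<forall>y\<in>U. \<bar>f y - f z\<bar> < e)"
      using z by (intro exI[of _ "{y \<in> topspace Z. f y \<in> ball (f z) e}"]) (auto simp: dist_real_def abs_minus_commute)
  qed
next
  assume *: "\<forall>z\<in>topspace Z. \<forall>e>0. \<exists>U. openin Z U \<and> z \<in> U \<and> (\<forall>y\<in>U. \<bar>f y - f z\<bar> < e)"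
  show "continuous_map Z euclideanreal f"
    unfolding continuous_map_real_iff_tendsto
  proof (intro ballI tendstoI)
    fix z and e :: real assume z: "z \<in> topspace Z" "e > 0"
    then obtain U where "openin Z U" "z \<in> U" "\<forall>y\<in>U. \<bar>f y - f z\<bar> < e" using * by meson
    then show "\<forall>\<^sub>F y in atin Z z. dist (f y) (f z) < e"
      unfolding eventually_atin dist_real_def by blast
  qed
qed

text \<open>Closure of the functionals \<open>g (carried X u)\<close> in mean, uniformly near each
  class. Integrals of such functionals are continuous, and boundedness makes the family closed under
  products.\<close>

definition approximable :: "(bitree \<Rightarrow> (nat \<Rightarrow> real) \<Rightarrow> real) \<Rightarrow> bool" where
  "approximable F \<longleftrightarrow>
     (\<forall>X\<in>bitrees. F X \<in> borel_measurable (sampling X)) \<and>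
     (\<exists>B. \<forall>X\<in>bitrees. \<forall>u\<in>space (sampling X). \<bar>F X u\<bar> \<le> B) \<and>
     (\<forall>C\<in>bitree_classes. \<forall>e>0. \<exists>g\<in>bounded_continuous tau_topology. \<exists>U. openin LWV_topology U \<and> C \<in> U \<and>
       (\<forall>C'\<in>U. (\<integral>u. \<bar>F (representative C') u - g (carried (representative C') u)\<bar> \<partial>sampling_mass (representative C')) < e))"

lemma LWV_representative: "openin LWV_topology U ==> C \<in> U ==> representative C \<in> bitrees"
  using openin_subset[of LWV_topology U] representative_bitree_classes by (auto simp: topspace_LWV)

lemma approximable_measurable: "approximable F ==> X \<in> bitrees ==> F X \<in> borel_measurable (sampling X)"
  unfolding approximable_def by (elim conjE) (rule bspec)

lemma approximable_bound:
  assumes "approximable F"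
  obtains B where "0 \<le> B" "\<And>X u. X \<in> bitrees ==> u \<in> space (sampling X) ==> \<bar>F X u\<bar> \<le> B"
proof -
  have "\<exists>B. \<forall>X\<in>bitrees. \<forall>u\<in>space (sampling X). \<bar>F X u\<bar> \<le> B"
    using assms unfolding approximable_def by (elim conjE)
  then obtain B where B: "\<forall>X\<in>bitrees. \<forall>u\<in>space (sampling X). \<bar>F X u\<bar> \<le> B" ..
  show ?thesis
  proof (rule that[of "max 0 B"])
    fix X u assume "X \<in> bitrees" "u \<in> space (sampling X)"
    then have "\<bar>F X u\<bar> \<le> B" using B by (simp only: Ball_def)
    then show "\<bar>F X u\<bar> \<le> max 0 B" by simp
  qed simp
qed

lemma approximable_integrable:
  assumes F: "approximable F" and X: "X \<in> bitrees" shows "integrable (sampling_mass X) (F X)"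
proof -
  obtain B where "\<And>u. u \<in> space (sampling X) ==> \<bar>F X u\<bar> \<le> B" using approximable_bound[OF F] X by metis
  then show ?thesis by (rule integrable_sampling_mass[OF X approximable_measurable[OF F X]])
qed

lemma approximable_continuous:
  assumes F: "approximable F"
  shows "continuous_map LWV_topology euclideanreal (\<lambda>C. \<integral>u. F (representative C) u \<partial>sampling_mass (representative C))"
  unfolding continuous_map_real_local topspace_LWV
proof (intro ballI allI impI)
  fix C and e :: real assume C: "C \<in> bitree_classes" and e: "e > 0"
  let ?I = "\<lambda>C. \<integral>u. F (representative C) u \<partial>sampling_mass (representative C)"
  have e3: "e / 3 > 0" using e by simp
  obtain g U where g: "g \<in> bounded_continuous tau_topology" and U: "openin LWV_topology U" "C \<in> U"
    and gU: "\<And>C'. C' \<in> U ==> (\<integral>u. \<bar>F (representative C') u - g (carried (representative C') u)\<bar> \<partial>sampling_mass (representative C')) < e / 3"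
    using F C e3 unfolding approximable_def by meson
  let ?G = "\<lambda>C. \<integral>u. g (carried (representative C) u) \<partial>sampling_mass (representative C)"
  obtain V where V: "openin LWV_topology V" "C \<in> V" "\<And>C'. C' \<in> V ==> \<bar>?G C' - ?G C\<bar> < e / 3"
    using carried_integral_continuous[OF g, unfolded continuous_map_real_local topspace_LWV] C e3 by meson
  have FG: "\<bar>?I C' - ?G C'\<bar> < e / 3" if C': "C' \<in> U" for C'
  proof -
    have X: "representative C' \<in> bitrees" using U(1) C' by (rule LWV_representative)
    have "?I C' - ?G C' = (\<integral>u. F (representative C') u - g (carried (representative C') u) \<partial>sampling_mass (representative C'))"
      by (rule Bochner_Integration.integral_diff[symmetric, OF approximable_integrable[OF F X] carried_integrable[OF X g]])
    then have "\<bar>?I C' - ?G C'\<bar> \<le> (\<integral>u. \<bar>F (representative C') u - g (carried (representative C') u)\<bar> \<partial>sampling_mass (representative C'))"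
      by (simp only: integral_abs_bound)
    with gU[OF C'] show ?thesis by linarith
  qed
  show "\<exists>U. openin LWV_topology U \<and> C \<in> U \<and> (\<forall>y\<in>U. \<bar>?I y - ?I C\<bar> < e)"
  proof (intro exI[of _ "U \<inter> V"] conjI ballI)
    fix C' assume "C' \<in> U \<inter> V"
    then have "\<bar>?I C' - ?G C'\<bar> < e / 3" "\<bar>?I C - ?G C\<bar> < e / 3" "\<bar>?G C' - ?G C\<bar> < e / 3"
      using FG[of C'] FG[OF U(2)] V(3)[of C'] by blast+
    then show "\<bar>?I C' - ?I C\<bar> < e" by linarith
  qed (use U V in auto)
qed

lemma approximable_cong:
  assumes F: "approximable F" and eq: "\<And>X u. X \<in> bitrees ==> u \<in> space (sampling X) ==> F' X u = F X u"
  shows "approximable F'"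
  unfolding approximable_def
proof (intro conjI ballI allI impI)
  fix X assume X: "X \<in> bitrees"
  have "F X \<in> borel_measurable (sampling X)" by (rule approximable_measurable[OF F X])
  then show "F' X \<in> borel_measurable (sampling X)"
    by (rule measurable_cong[THEN iffD1, rotated]) (simp add: eq[OF X])
next
  show "\<exists>B. \<forall>X\<in>bitrees. \<forall>u\<in>space (sampling X). \<bar>F' X u\<bar> \<le> B"
    using approximable_bound[OF F] eq by metis
next
  fix C and e :: real assume C: "C \<in> bitree_classes" and e: "e > 0"
  obtain g U where g: "g \<in> bounded_continuous tau_topology" and U: "openin LWV_topology U" "C \<in> U"
    and gU: "\<And>C'. C' \<in> U ==> (\<integral>u. \<bar>F (representative C') u - g (carried (representative C') u)\<bar> \<partial>sampling_mass (representative C')) < e"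
    using F C e unfolding approximable_def by meson
  have "(\<integral>u. \<bar>F' (representative C') u - g (carried (representative C') u)\<bar> \<partial>sampling_mass (representative C')) < e" if C': "C' \<in> U" for C'
  proof -
    have "(\<integral>u. \<bar>F' (representative C') u - g (carried (representative C') u)\<bar> \<partial>sampling_mass (representative C')) =
        (\<integral>u. \<bar>F (representative C') u - g (carried (representative C') u)\<bar> \<partial>sampling_mass (representative C'))"
      using eq[OF LWV_representative[OF U(1) C']]
      by (intro Bochner_Integration.integral_cong refl) (simp add: space_sampling_mass)
    with gU[OF C'] show ?thesis by simp
  qed
  with g U show "\<exists>g\<in>bounded_continuous tau_topology. \<exists>U. openin LWV_topology U \<and> C \<in> U \<and>
       (\<forall>C'\<in>U. (\<integral>u. \<bar>F' (representative C') u - g (carried (representative C') u)\<bar> \<partial>sampling_mass (representative C')) < e)"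
    by blast
qed

lemma approximable_carried:
  assumes g: "g \<in> bounded_continuous tau_topology"
  shows "approximable (\<lambda>X u. g (carried X u))"
  unfolding approximable_def
proof (intro conjI ballI allI impI)
  show "\<exists>B. \<forall>X\<in>bitrees. \<forall>u\<in>space (sampling X). \<bar>g (carried X u)\<bar> \<le> B"
    using bounded_continuous_bound[OF g] carried_topspace by metis
  fix C and e :: real assume "C \<in> bitree_classes" "e > 0"
  then show "\<exists>h\<in>bounded_continuous tau_topology. \<exists>U. openin LWV_topology U \<and> C \<in> U \<and>
       (\<forall>C'\<in>U. (\<integral>u. \<bar>g (carried (representative C') u) - h (carried (representative C') u)\<bar> \<partial>sampling_mass (representative C')) < e)"
    using openin_topspace[of LWV_topology] unfolding topspace_LWV
    by (intro bexI[OF _ g] exI[of _ bitree_classes]) simp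
qed (rule carried_function[OF _ g])

lemma bounded_continuous_mult:
  assumes "g \<in> bounded_continuous E" "h \<in> bounded_continuous E"
  shows "(\<lambda>x. g x * h x) \<in> bounded_continuous E"
proof -
  obtain b b' where "0 \<le> b" "0 \<le> b'" "\<And>x. x \<in> topspace E ==> \<bar>g x\<bar> \<le> b" "\<And>x. x \<in> topspace E ==> \<bar>h x\<bar> \<le> b'"
    using bounded_continuous_bound[OF assms(1)] bounded_continuous_bound[OF assms(2)] by metis
  then have "\<bar>g x * h x\<bar> \<le> b * b'" if "x \<in> topspace E" for x
    using that by (simp add: abs_mult mult_mono)
  moreover have "continuous_map E euclideanreal (\<lambda>x. g x * h x)"
    using assms by (intro continuous_map_real_mult) (auto simp: bounded_continuous_def)
  ultimately show ?thesis by (auto simp: bounded_continuous_def bounded_iff)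
qed

lemma approximable_mult:
  assumes F: "approximable F" and G: "approximable G"
  shows "approximable (\<lambda>X u. F X u * G X u)"
  unfolding approximable_def
proof (intro conjI ballI allI impI)
  obtain B where B: "0 \<le> B" "\<And>X u. X \<in> bitrees ==> u \<in> space (sampling X) ==> \<bar>F X u\<bar> \<le> B"
    by (rule approximable_bound[OF F]) blast
  obtain BG where BG: "0 \<le> BG" "\<And>X u. X \<in> bitrees ==> u \<in> space (sampling X) ==> \<bar>G X u\<bar> \<le> BG"
    by (rule approximable_bound[OF G]) blast
  have m: "F X \<in> borel_measurable (sampling X)" "G X \<in> borel_measurable (sampling X)" if "X \<in> bitrees" for X
    using approximable_measurable[OF F that] approximable_measurable[OF G that] .
  have pb: "\<bar>F X u * G X u\<bar> \<le> B * BG" if "X \<in> bitrees" "u \<in> space (sampling X)" for X u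
    unfolding abs_mult using B(2)[OF that] BG(2)[OF that] B(1) by (intro mult_mono) auto
  show "(\<lambda>u. F X u * G X u) \<in> borel_measurable (sampling X)" if "X \<in> bitrees" for X
    using m[OF that] by (rule borel_measurable_times)
  show "\<exists>B. \<forall>X\<in>bitrees. \<forall>u\<in>space (sampling X). \<bar>F X u * G X u\<bar> \<le> B"
    using pb by blast
  fix C and e :: real assume C: "C \<in> bitree_classes" and e: "e > 0"
  \<comment> \<open>The approximation \<open>h\<close> is fixed before \<open>g\<close>, because its
    bound \<open>b\<close> enters the accuracy required of \<open>g\<close>. The summand 2 avoids
    division by 0.\<close>
  have e1: "e / (2 * B + 2) > 0" using e B(1) by (intro divide_pos_pos) auto
  obtain h V where h: "h \<in> bounded_continuous tau_topology" and V: "openin LWV_topology V" "C \<in> V"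
    and hV: "\<And>C'. C' \<in> V ==> (\<integral>u. \<bar>G (representative C') u - h (carried (representative C') u)\<bar> \<partial>sampling_mass (representative C')) < e / (2 * B + 2)"
    using G C e1 unfolding approximable_def by meson
  obtain b where b: "0 \<le> b" "\<And>x. x \<in> topspace tau_topology ==> \<bar>h x\<bar> \<le> b"
    by (rule bounded_continuous_bound[OF h]) blast
  have e2: "e / (2 * b + 2) > 0" using e b(1) by (intro divide_pos_pos) auto
  obtain g U where g: "g \<in> bounded_continuous tau_topology" and U: "openin LWV_topology U" "C \<in> U"
    and gU: "\<And>C'. C' \<in> U ==> (\<integral>u. \<bar>F (representative C') u - g (carried (representative C') u)\<bar> \<partial>sampling_mass (representative C')) < e / (2 * b + 2)"
    using F C e2 unfolding approximable_def by meson
  have small: "c * y < e / 2" if "0 \<le> c" "y < e / (2 * c + 2)" "0 \<le> y" for c y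
  proof -
    have "c * y \<le> c * (e / (2 * c + 2))" using that by (intro mult_left_mono) auto
    also have "\<dots> < e / 2" using that(1) e by (simp add: field_simps)
    finally show ?thesis .
  qed
  show "\<exists>g\<in>bounded_continuous tau_topology. \<exists>U. openin LWV_topology U \<and> C \<in> U \<and>
       (\<forall>C'\<in>U. (\<integral>u. \<bar>F (representative C') u * G (representative C') u - g (carried (representative C') u)\<bar> \<partial>sampling_mass (representative C')) < e)"
  proof (intro bexI[of _ "\<lambda>x. g x * h x"] exI[of _ "U \<inter> V"] conjI ballI)
    fix C' assume C': "C' \<in> U \<inter> V"
    define X where "X = representative C'"
    have X: "X \<in> bitrees" using LWV_representative[OF U(1)] C' by (simp add: X_def)
    let ?M = "sampling_mass X" and ?c = "carried X"
    have iF: "integrable ?M (\<lambda>u. F X u - g (?c u))" "integrable ?M (\<lambda>u. G X u - h (?c u))"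
      by (intro Bochner_Integration.integrable_diff approximable_integrable F G carried_integrable X g h)+
    have iFG: "integrable ?M (\<lambda>u. F X u * G X u - g (?c u) * h (?c u))"
    proof (rule Bochner_Integration.integrable_diff)
      show "integrable ?M (\<lambda>u. F X u * G X u)"
      proof (rule integrable_sampling_mass[OF X])
        show "(\<lambda>u. F X u * G X u) \<in> borel_measurable (sampling X)" using m[OF X] by (rule borel_measurable_times)
      qed (rule pb[OF X])
      show "integrable ?M (\<lambda>u. g (?c u) * h (?c u))" by (rule carried_integrable[OF X bounded_continuous_mult[OF g h]])
    qed
    have pt: "\<bar>F X u * G X u - g (?c u) * h (?c u)\<bar> \<le> B * \<bar>G X u - h (?c u)\<bar> + b * \<bar>F X u - g (?c u)\<bar>"
      if u: "u \<in> space (sampling X)" for u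
    proof -
      have "F X u * G X u - g (?c u) * h (?c u) = F X u * (G X u - h (?c u)) + h (?c u) * (F X u - g (?c u))"
        by (simp add: algebra_simps)
      then have "\<bar>F X u * G X u - g (?c u) * h (?c u)\<bar> \<le> \<bar>F X u\<bar> * \<bar>G X u - h (?c u)\<bar> + \<bar>h (?c u)\<bar> * \<bar>F X u - g (?c u)\<bar>"
        using abs_triangle_ineq by (metis abs_mult)
      also have "\<dots> \<le> B * \<bar>G X u - h (?c u)\<bar> + b * \<bar>F X u - g (?c u)\<bar>"
        using B(2)[OF X u] b(2)[OF carried_topspace[OF X]] by (intro add_mono mult_right_mono) auto
      finally show ?thesis .
    qed
    have "(\<integral>u. \<bar>F X u * G X u - g (?c u) * h (?c u)\<bar> \<partial>?M) \<le> (\<integral>u. B * \<bar>G X u - h (?c u)\<bar> + b * \<bar>F X u - g (?c u)\<bar> \<partial>?M)"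
      by (rule integral_mono) (use iF iFG pt in \<open>auto simp: space_sampling_mass\<close>)
    also have "\<dots> = B * (\<integral>u. \<bar>G X u - h (?c u)\<bar> \<partial>?M) + b * (\<integral>u. \<bar>F X u - g (?c u)\<bar> \<partial>?M)"
      using iF by simp
    also have "\<dots> < e / 2 + e / 2"
      using C' B(1) b(1) hV[of C'] gU[of C'] by (intro add_strict_mono small) (auto simp: X_def)
    finally show "(\<integral>u. \<bar>F (representative C') u * G (representative C') u - g (carried (representative C') u) * h (carried (representative C') u)\<bar>
        \<partial>sampling_mass (representative C')) < e" by (simp add: X_def)
  qed (use U V bounded_continuous_mult[OF g h] in auto)
qed

section \<open>Approximation of the block functionals\<close>

lemma bounded_continuousI:
  "continuous_map E euclideanreal f ==> (\<And>x. x \<in> topspace E ==> \<bar>f x\<bar> \<le> B) ==> f \<in> bounded_continuous E"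
  by (auto simp: bounded_continuous_def bounded_iff)

lemma clamp_diff_le: "\<bar>x\<bar> \<le> b ==> \<bar>x - max (- b) (min b p)\<bar> \<le> \<bar>x - p\<bar>" for x b p :: real
  by (auto simp: max_def min_def)

definition gev_block :: "nat \<Rightarrow> nat \<Rightarrow> gen \<Rightarrow> bitree \<Rightarrow> (nat \<Rightarrow> real) \<Rightarrow> real" where
  "gev_block a k g X u = tree_gev X g (map u [a..<a + Suc k])"

lemma map_shift: "map u [a..<a + n] = map (\<lambda>i. u (a + i)) [0..<n]"
  by (rule nth_equalityI) auto

lemma gev_block_shift:
  "gev_block a k g X u = tree_gev X g (map (\<lambda>i. u (a + i)) [0..<Suc k])"
  unfolding gev_block_def map_shift ..

lemma shift_sampling: "(\<lambda>u i. u (a + i)) \<in> measurable (sampling X) (sampling X)"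
  unfolding sampling_def by (rule measurable_shift)

lemma gev_block_measurable:
  assumes X: "X \<in> bitrees" shows "gev_block a k g X \<in> borel_measurable (sampling X)"
  unfolding gev_block_shift[abs_def] by (rule measurable_compose[OF shift_sampling gev_tree_measurable[OF X]])

lemma gev_block_bound:
  assumes X: "X \<in> bitrees" and u: "u \<in> space (sampling X)" shows "\<bar>gev_block a k g X u\<bar> \<le> gbound g"
  unfolding gev_block_def
  by (rule sampler.gev_bound[OF sampler_bitree[OF X]]) (use u in \<open>auto simp: space_sampling\<close>)

text \<open>By shift invariance of an i.i.d. sequence the block at \<open>a\<close> has the law of
  the block at 0, whose mass functional is a coordinate.\<close>

lemma integral_gev_block_Mass:
  assumes X: "X \<in> bitrees"
  shows "(\<integral>u. gev_block a k Mass X u \<partial>sampling_mass X) = (\<integral>c. tau_val c (k, Mass) \<partial>varpi X)"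
proof -
  let ?g = "\<lambda>u. tree_gev X Mass (map u [0..<Suc k])"
  have s1: "samp X [(k, Mass)] = ?g" by (simp add: samp_def fun_eq_iff del: upt_Suc gev.simps)
  have "(\<integral>u. gev_block a k Mass X u \<partial>sampling_mass X) = mass X * (\<integral>u. gev_block a k Mass X u \<partial>sampling X)"
    by (rule integral_sampling_mass[OF gev_block_measurable[OF X]])
  also have "mass X * (\<integral>u. gev_block a k Mass X u \<partial>sampling X) = mass X * (\<integral>u. ?g u \<partial>sampling X)"
  proof (cases "mass X = 0")
    case False
    have tm: "total_mass (mu X) \<noteq> 0" using total_mass_mass[OF X] False mass_nonneg[of X] by simp
    have p: "prob_space (normalise (mu X))" by (rule prob_space_normalise[OF bitreesD(10)[OF X] tm])
    have p1: "prob_space (sampling X)" by (rule prob_space_sampling[OF X False])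
    have g: "?g \<in> borel_measurable (PiM UNIV (\<lambda>_. normalise (mu X)))"
      using gev_tree_measurable[OF X, of Mass "Suc k"] unfolding sampling_def .
    have "(\<integral>u. 1 * ?g (\<lambda>i. u (a + i)) \<partial>PiM UNIV (\<lambda>_. normalise (mu X))) =
        (\<integral>u. 1 \<partial>PiM (UNIV :: nat set) (\<lambda>_. normalise (mu X))) * (\<integral>u. ?g u \<partial>PiM UNIV (\<lambda>_. normalise (mu X)))"
      by (rule integral_comb_seq[where f = "\<lambda>_. 1" and g = "?g" and n = a and A = 1 and B = 1, OF p _ _ _ g]) (auto simp: depends_below_def)
    then show ?thesis
      using prob_space.prob_space[OF p1] unfolding gev_block_shift sampling_def by simp
  qed simp
  also have "\<dots> = (\<integral>c. (\<Prod>i\<leftarrow>[(k, Mass)]. tau_val c i) \<partial>varpi X)"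
    unfolding varpi_monomial[OF X] s1 ..
  finally show ?thesis by simp
qed

lemma gev_block_Mass_continuous:
  "continuous_map LWV_topology euclideanreal
    (\<lambda>C. \<integral>u. gev_block a k Mass (representative C) u \<partial>sampling_mass (representative C))"
proof -
  have "(\<lambda>c. tau_val c (k, Mass)) \<in> bounded_continuous tau_topology"
    using tau_monomial_bounded_continuous[of "[(k, Mass)]"] by simp
  from varpi_integral_continuous[OF this] show ?thesis
  proof (rule continuous_map_eq)
    fix C assume "C \<in> topspace LWV_topology"
    then have "representative C \<in> bitrees" using representative_bitree_classes by (auto simp: topspace_LWV)
    from integral_gev_block_Mass[OF this]
    show "(\<integral>c. tau_val c (k, Mass) \<partial>varpi (representative C)) =
        (\<integral>u. gev_block a k Mass (representative C) u \<partial>sampling_mass (representative C))" by (rule sym)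
  qed
qed

definition mass_fun :: "nat \<Rightarrow> nat \<Rightarrow> nat \<Rightarrow> (nat \<Rightarrow> pmm set) \<Rightarrow> real" where
  "mass_fun j a k c = exp (- mass_approx j a k (c (Suc (a + k))))"

text \<open>\<open>poly_approx\<close> can be large where \<open>mass_approx\<close> is small.
  Clamping to the range of \<open>gev\<close> restores boundedness and does not increase the
  error.\<close>

definition poly_fun :: "nat \<Rightarrow> nat \<Rightarrow> nat \<Rightarrow> (nat \<times> nat) list \<Rightarrow> (nat \<Rightarrow> pmm set) \<Rightarrow> real" where
  "poly_fun j a k l c = max (- gbound (Poly l)) (min (gbound (Poly l))
     (exp (- 2 * mass_approx j a k (c (Suc (a + k)))) * poly_approx j a k l (c (Suc (a + k)))))"

lemma mass_fun_bounded_continuous: "mass_fun j a k \<in> bounded_continuous tau_topology"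
proof -
  have "continuous_map tau_topology euclideanreal (\<lambda>c. exp (- mass_approx j a k (c (Suc (a + k)))))"
    by (intro continuous_map_exp continuous_map_minus
        continuous_map_tau_component[where f = "mass_approx j a k" and k = "a + k"] mass_approx_continuous)
  then show ?thesis
    using mass_approx_nonneg by (auto simp: bounded_continuous_def bounded_iff mass_fun_def[abs_def] intro!: exI[of _ 1])
qed

lemma poly_fun_bounded_continuous: "poly_fun j a k l \<in> bounded_continuous tau_topology"
proof -
  have "continuous_map tau_topology euclideanreal (poly_fun j a k l)"
    unfolding poly_fun_def
    by (intro continuous_map_real_max continuous_map_real_min continuous_map_real_mult continuous_map_exp
        continuous_map_real_mult_left continuous_map_const[THEN iffD2] disjI2
        continuous_map_tau_component[where f = "mass_approx j a k" and k = "a + k"]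
        continuous_map_tau_component[where f = "poly_approx j a k l" and k = "a + k"]
        mass_approx_continuous poly_approx_continuous) simp_all
  moreover have "\<bar>poly_fun j a k l c\<bar> \<le> gbound (Poly l)" for c
    using gbound_nonneg[of "Poly l"] unfolding poly_fun_def by linarith
  ultimately show ?thesis by (auto simp: bounded_continuous_def bounded_iff)
qed

text \<open>Almost every sampled point lies in the support and has a path of finite
  \<open>nu\<close>-mass, and the span is a finite union of such paths.\<close>

lemma AE_block:
  assumes X: "X \<in> bitrees"
  shows "AE u in sampling_mass X. block X u a k \<and> carried X u (Suc (a + k)) = tau X (map u [0..<Suc (a + k)])"
proof -
  note D = bitreesD[OF X]
  have "AE x in mu X. x \<in> supp_tree X \<and> emeasure (nu X) (seg (tree X) (rt X) x) < \<infinity>"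
    using AE_supp_tree(1)[OF X] D(5) by eventually_elim (use msupp_subset_supp_tree[OF D(7)] in blast)
  from AE_sampling_mass[OF X this] show ?thesis
  proof eventually_elim
    case (elim u)
    then have s: "u i \<in> supp_tree X" and f: "emeasure (nu X) (seg (tree X) (rt X) (u i)) < \<infinity>" for i by auto
    let ?us = "map u [0..<Suc (a + k)]"
    have us: "?us \<noteq> []" "set ?us \<subseteq> supp_tree X" using s by auto
    have sT: "u i \<in> mspace (tree X)" for i using s[of i] supp_tree_subset[OF D(7)] by blast
    have e: "tree_span X (set ?us) = (\<Union>v\<in>set ?us. seg (tree X) (rt X) v)"
      using root_in_seg[OF D(7) sT[of 0]] unfolding span_tree_def by (auto simp del: upt_Suc)
    have "emeasure (nu X) (tree_span X (set ?us)) \<le> (\<Sum>v\<in>set ?us. emeasure (nu X) (seg (tree X) (rt X) v))"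
      unfolding e using seg_sets[OF D(7)] sT D(3) by (intro emeasure_subadditive_finite) auto
    also have "\<dots> < \<infinity>" using f by simp
    finally have fin: "emeasure (skel_measure X) (tree_spanned X ?us) \<noteq> \<infinity>"
      unfolding emeasure_spanned[OF X us] by simp
    have "block X u a k" by (rule block.intro[OF X s fin])
    moreover have "carried X u (Suc (a + k)) = tau X ?us"
      unfolding carried_def varsigma_def using s by (simp add: carrier_map_def del: upt_Suc)
    ultimately show ?case ..
  qed
qed

lemma mass_gap_nonneg:
  assumes X: "X \<in> bitrees"
  shows "AE u in sampling_mass X. 0 \<le> gev_block a k Mass X u - mass_fun j a k (carried X u)"
  using AE_block[OF X, of a k]
proof eventually_elim
  case (elim u)
  interpret block X u a k using elim by blast
  have "gev_block a k Mass X u - mass_fun j a k (carried X u) = exp (- A) - exp (- Bj j)"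
    using gev_mass_approx[of j] elim unfolding gev_block_def mass_fun_def by simp
  then show ?case using A_le by simp
qed

lemma mass_gap_integrable:
  assumes X: "X \<in> bitrees"
  shows "integrable (sampling_mass X) (gev_block a k g X)"
    "integrable (sampling_mass X) (\<lambda>u. mass_fun j a k (carried X u))"
  by (rule integrable_sampling_mass[OF X gev_block_measurable[OF X] gev_block_bound[OF X]], assumption)
    (rule carried_integrable[OF X mass_fun_bounded_continuous])

lemma mass_gap_limit:
  assumes X: "X \<in> bitrees"
  shows "(\<lambda>j. \<integral>u. gev_block a k Mass X u - mass_fun j a k (carried X u) \<partial>sampling_mass X) \<longlonglongrightarrow> 0"
proof -
  interpret finite_measure "sampling_mass X" by (rule finite_sampling_mass[OF X])
  have "(\<lambda>j. \<integral>u. gev_block a k Mass X u - mass_fun j a k (carried X u) \<partial>sampling_mass X) \<longlonglongrightarrow> (\<integral>u. 0 \<partial>sampling_mass X)"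
  proof (rule integral_dominated_convergence[where w = "\<lambda>_. 2"])
    show "AE u in sampling_mass X. (\<lambda>j. gev_block a k Mass X u - mass_fun j a k (carried X u)) \<longlonglongrightarrow> 0"
      using AE_block[OF X, of a k]
    proof eventually_elim
      case (elim u)
      interpret block X u a k using elim by blast
      have "gev_block a k Mass X u - mass_fun j a k (carried X u) = exp (- A) - exp (- Bj j)" for j
        using gev_mass_approx[of j] elim unfolding gev_block_def mass_fun_def by simp
      moreover have "(\<lambda>j. exp (- A) - exp (- Bj j)) \<longlonglongrightarrow> exp (- A) - exp (- A)"
        by (intro tendsto_intros B_limit)
      ultimately show ?case by simp
    qed
    show "AE u in sampling_mass X. norm (gev_block a k Mass X u - mass_fun j a k (carried X u)) \<le> 2" for j
    proof (rule AE_I2)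
      fix u assume "u \<in> space (sampling_mass X)"
      then have "\<bar>gev_block a k Mass X u\<bar> \<le> 1" using gev_block_bound[OF X, of u a k Mass] by (simp add: space_sampling_mass)
      moreover have "0 \<le> mass_fun j a k (carried X u)" "mass_fun j a k (carried X u) \<le> 1"
        using mass_approx_nonneg by (simp_all add: mass_fun_def)
      ultimately show "norm (gev_block a k Mass X u - mass_fun j a k (carried X u)) \<le> 2"
        unfolding real_norm_def by linarith
    qed
    show "(\<lambda>u. gev_block a k Mass X u - mass_fun j a k (carried X u)) \<in> borel_measurable (sampling_mass X)" for j
      using mass_gap_integrable[OF X] by (intro borel_measurable_diff) auto
  qed auto
  then show ?thesis by simp
qed

text \<open>
  The approximation from below converges for a single tree by dominated convergence. It is good
  near that tree because both integrals are continuous: by shift invariance that of the block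
  functional does not depend on the position of the block.
\<close>

lemma mass_gap:
  assumes C: "C \<in> bitree_classes" and e: "e > 0"
  obtains j U where "openin LWV_topology U" "C \<in> U"
    "\<And>C'. C' \<in> U ==> (\<integral>u. gev_block a k Mass (representative C') u - mass_fun j a k (carried (representative C') u)
        \<partial>sampling_mass (representative C')) < e"
proof -
  let ?D = "\<lambda>j C. \<integral>u. gev_block a k Mass (representative C) u - mass_fun j a k (carried (representative C) u)
        \<partial>sampling_mass (representative C)"
  have R: "representative C \<in> bitrees" if "C \<in> bitree_classes" for C using representative_bitree_classes[OF that] by blast
  have cD: "continuous_map LWV_topology euclideanreal (?D j)" for j
  proof (rule continuous_map_eq[OF continuous_map_diff[OF gev_block_Mass_continuous[of a k]
          carried_integral_continuous[OF mass_fun_bounded_continuous[of j a k]]]])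
    fix C assume "C \<in> topspace LWV_topology"
    then have X: "representative C \<in> bitrees" using R by (simp add: topspace_LWV)
    show "(\<integral>u. gev_block a k Mass (representative C) u \<partial>sampling_mass (representative C)) -
        (\<integral>u. mass_fun j a k (carried (representative C) u) \<partial>sampling_mass (representative C)) = ?D j C"
      by (rule Bochner_Integration.integral_diff[symmetric, OF mass_gap_integrable[OF X]])
  qed
  have e2: "e / 2 > 0" using e by simp
  have "\<forall>\<^sub>F j in sequentially. ?D j C < e / 2"
    by (rule order_tendstoD(2)[OF mass_gap_limit[OF R[OF C]] e2])
  then obtain j where j: "?D j C < e / 2" unfolding eventually_sequentially by blast
  have "\<forall>z\<in>bitree_classes. \<forall>e>0. \<exists>U. openin LWV_topology U \<and> z \<in> U \<and> (\<forall>y\<in>U. \<bar>?D j y - ?D j z\<bar> < e)"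
    using cD[of j] unfolding continuous_map_real_local topspace_LWV .
  from this[rule_format, OF C e2]
  obtain U where U: "openin LWV_topology U" "C \<in> U" "\<forall>C'\<in>U. \<bar>?D j C' - ?D j C\<bar> < e / 2" by (elim exE conjE)
  show ?thesis
  proof (rule that[OF U(1,2)])
    fix C' assume "C' \<in> U"
    then have "\<bar>?D j C' - ?D j C\<bar> < e / 2" using U(3) by blast
    then show "?D j C' < e" using j by linarith
  qed
qed

text \<open>Whatever is dominated by the gap of the mass functional is small in mean near a given
  class, by \<open>mass_gap\<close>.\<close>

lemma approximableI_gap:
  assumes F: "\<And>X. X \<in> bitrees ==> F X \<in> borel_measurable (sampling X)"
      "\<And>X u. X \<in> bitrees ==> u \<in> space (sampling X) ==> \<bar>F X u\<bar> \<le> B"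
    and h: "\<And>j. h j \<in> bounded_continuous tau_topology" and K: "K > 0"
    and gap: "\<And>X j. X \<in> bitrees ==> AE u in sampling_mass X.
        \<bar>F X u - h j (carried X u)\<bar> \<le> K * (gev_block a k Mass X u - mass_fun j a k (carried X u))"
  shows "approximable F"
  unfolding approximable_def
proof (intro conjI ballI allI impI)
  show "\<exists>B. \<forall>X\<in>bitrees. \<forall>u\<in>space (sampling X). \<bar>F X u\<bar> \<le> B" using F(2) by blast
  fix C and e :: real assume C: "C \<in> bitree_classes" and e: "e > 0"
  have eK: "e / K > 0" using e K by simp
  obtain j U where U: "openin LWV_topology U" "C \<in> U"
    and gU: "\<And>C'. C' \<in> U ==> (\<integral>u. gev_block a k Mass (representative C') u - mass_fun j a k (carried (representative C') u)
        \<partial>sampling_mass (representative C')) < e / K"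
    by (rule mass_gap[OF C eK, of a k]) blast
  have "(\<integral>u. \<bar>F (representative C') u - h j (carried (representative C') u)\<bar> \<partial>sampling_mass (representative C')) < e"
    if C': "C' \<in> U" for C'
  proof -
    define X where "X = representative C'"
    have X: "X \<in> bitrees" using LWV_representative[OF U(1) C'] by (simp add: X_def)
    have i1: "integrable (sampling_mass X) (F X)" by (rule integrable_sampling_mass[OF X F(1)[OF X] F(2)[OF X]])
    have "(\<integral>u. \<bar>F X u - h j (carried X u)\<bar> \<partial>sampling_mass X) \<le>
        (\<integral>u. K * (gev_block a k Mass X u - mass_fun j a k (carried X u)) \<partial>sampling_mass X)"
      by (rule integral_mono_AE[OF _ _ gap[OF X]])
        (intro integrable_abs integrable_mult_right Bochner_Integration.integrable_diff i1 carried_integrable[OF X h]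
          mass_gap_integrable[OF X])+
    also have "\<dots> = K * (\<integral>u. gev_block a k Mass X u - mass_fun j a k (carried X u) \<partial>sampling_mass X)" by simp
    also have "\<dots> < K * (e / K)" using gU[OF C'] K by (intro mult_strict_left_mono) (simp_all add: X_def)
    also have "\<dots> = e" using K by simp
    finally show ?thesis by (simp add: X_def)
  qed
  then show "\<exists>g\<in>bounded_continuous tau_topology. \<exists>U. openin LWV_topology U \<and> C \<in> U \<and>
       (\<forall>C'\<in>U. (\<integral>u. \<bar>F (representative C') u - g (carried (representative C') u)\<bar> \<partial>sampling_mass (representative C')) < e)"
    using U h[of j] by metis
qed (rule F(1))

text \<open>\<open>Dist\<close> on a block is itself a coordinate of the whole sample. For
  \<open>Mass\<close> the error is the gap, and for \<open>Poly\<close> a multiple of it, with the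
  constant of \<open>exp_power_diff\<close>.\<close>

lemma approximable_gev_block: "approximable (gev_block a k g)"
proof (cases g)
  case Mass
  show ?thesis
  proof (rule approximableI_gap[where h = "\<lambda>j. mass_fun j a k" and K = 1 and a = a and k = k])
    fix X j assume X: "X \<in> bitrees"
    show "AE u in sampling_mass X. \<bar>gev_block a k g X u - mass_fun j a k (carried X u)\<bar>
        \<le> 1 * (gev_block a k Mass X u - mass_fun j a k (carried X u))"
      using mass_gap_nonneg[OF X, of a k j] unfolding Mass by eventually_elim simp
  qed (use gev_block_measurable gev_block_bound mass_fun_bounded_continuous in auto)
next
  case (Poly l)
  have K: "3 * fact (msize l) * 2 ^ length l > (0 :: real)" by simp
  show ?thesis
  proof (rule approximableI_gap[where h = "\<lambda>j. poly_fun j a k l" and a = a and k = k, OF _ _ _ K])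
    fix X j assume X: "X \<in> bitrees"
    have "AE u in sampling_mass X. u \<in> space (sampling X)" using AE_space[of "sampling_mass X"] by (simp add: space_sampling_mass)
    then show "AE u in sampling_mass X. \<bar>gev_block a k g X u - poly_fun j a k l (carried X u)\<bar>
        \<le> 3 * fact (msize l) * 2 ^ length l * (gev_block a k Mass X u - mass_fun j a k (carried X u))"
      using AE_block[OF X, of a k]
    proof eventually_elim
      case (elim u)
      interpret block X u a k using elim by blast
      let ?p = "exp (- 2 * mass_approx j a k (carried X u (Suc (a + k)))) * poly_approx j a k l (carried X u (Suc (a + k)))"
      have "\<bar>gev_block a k g X u - ?p\<bar> \<le> 3 * fact (msize l) * 2 ^ length l * (exp (- A) - exp (- Bj j))"
        using gev_poly_approx[of l j] elim unfolding gev_block_def Poly by simp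
      moreover have "gev_block a k Mass X u - mass_fun j a k (carried X u) = exp (- A) - exp (- Bj j)"
        using gev_mass_approx[of j] elim unfolding gev_block_def mass_fun_def by simp
      moreover have "\<bar>gev_block a k g X u\<bar> \<le> gbound (Poly l)"
        using gev_block_bound[OF X, of u a k g] elim(1) by (simp only: Poly)
      ultimately show ?case
        unfolding poly_fun_def using clamp_diff_le[of "gev_block a k g X u" "gbound (Poly l)" ?p]
        by (simp del: gbound.simps)
    qed
  qed (use gev_block_measurable gev_block_bound poly_fun_bounded_continuous in auto)
next
  case (Dist i j)
  show ?thesis
  proof (cases "(i, j) \<in> pairs_upto (Suc k)")
    case True
    \<comment> \<open>Shift of the indices by \<open>a\<close> that keeps the root.\<close>
    let ?s = "\<lambda>i. if i = 0 then 0 else a + i"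
    let ?i = "(a + k, Dist (?s i) (?s j))"
    have "(\<lambda>c. tau_val c ?i) \<in> bounded_continuous tau_topology"
      using tau_monomial_bounded_continuous[of "[?i]"] by simp
    from approximable_carried[OF this] show ?thesis
    proof (rule approximable_cong)
      fix X u assume X: "X \<in> bitrees" and u: "u \<in> space (sampling X)"
      have st: "(?s i, ?s j) \<in> pairs_upto (Suc (a + k))" using True by (auto simp: pairs_upto_def)
      have c: "case_nat (rt X) ((!) (map u [0..<Suc (a + k)])) (?s m) = case_nat (rt X) ((!) (map u [a..<a + Suc k])) m"
        if "m \<le> Suc k" for m
        using that by (cases m) (auto simp del: upt_Suc)
      have ij: "i \<le> Suc k" "j \<le> Suc k" using True by (auto simp: pairs_upto_def)
      have l: "length (map u [a..<a + Suc k]) = Suc k" "length (map u [0..<Suc (a + k)]) = Suc (a + k)" by simp_all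
      have "tau_val (carried X u) ?i = tree_gev X (Dist (?s i) (?s j)) (map u [0..<Suc (a + k)])"
        by (rule tau_val_carried[OF X sampling_mspace[OF X u]])
      also have "\<dots> = arctan (tree_dist X (case_nat (rt X) ((!) (map u [a..<a + Suc k])) i) (case_nat (rt X) ((!) (map u [a..<a + Suc k])) j))"
        unfolding gev.simps l c[OF ij(1)] c[OF ij(2)] by (simp only: st if_True)
      also have "\<dots> = gev_block a k g X u"
        unfolding gev_block_def Dist gev.simps l by (simp only: True if_True)
      finally show "gev_block a k g X u = tau_val (carried X u) ?i" by (rule sym)
    qed
  next
    case False
    have "(\<lambda>c. 0) \<in> bounded_continuous tau_topology" by (rule bounded_continuousI[of _ _ 0]) simp_all
    from approximable_carried[OF this] show ?thesis
      by (rule approximable_cong) (use False in \<open>simp add: gev_block_def Dist del: upt_Suc\<close>)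
  qed
qed

lemma approximable_one: "approximable (\<lambda>_ _. 1)"
  by (rule approximable_carried[of "\<lambda>_. 1"], rule bounded_continuousI[of _ _ 1]) simp_all

lemma approximable_prod_list:
  "approximable (\<lambda>X u. \<Prod>(a, k, g)\<leftarrow>L. gev_block a k g X u)"
proof (induction L)
  case (Cons p L)
  obtain a k g where p: "p = (a, k, g)" by (cases p)
  from approximable_mult[OF approximable_gev_block[of a k g] Cons.IH] show ?case by (simp add: p)
qed (simp add: approximable_one)

text \<open>The Poisson probability that up to time \<open>t\<close> no cut falls on the subtree
  spanned by the points \<open>0..k\<close>.\<close>

definition survival :: "real \<Rightarrow> nat \<Rightarrow> bitree \<Rightarrow> (nat \<Rightarrow> real) \<Rightarrow> real" where
  "survival t k X u =
     exp (- t * measure (skel_measure X) (tree_spanned X (map u [0..<Suc k])))"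

text \<open>The points start at 0, so this is the power \<open>t\<close> of a mass coordinate and
  already continuous in the sampled subtree.\<close>

lemma approximable_survival:
  assumes t: "0 \<le> t" shows "approximable (survival t k)"
proof -
  let ?f = "\<lambda>c :: nat \<Rightarrow> pmm set. tau_val c (k, Mass) powr t"
  have e: "?f c = exp (- t * ups [] (c (Suc k)))" for c
    by (simp add: tau_val_def powr_def mult.commute)
  have "continuous_map tau_topology euclideanreal (\<lambda>c. exp (- t * ups [] (c (Suc k))))"
    by (intro continuous_map_exp continuous_map_real_mult_left
        continuous_map_tau_component[where f = "ups []" and k = k] ups_continuous)
  moreover have "\<bar>exp (- t * ups [] (c (Suc k)))\<bar> \<le> 1" if "c \<in> topspace tau_topology" for c
  proof -
    have "c (Suc k) \<in> hyp_classes (Suc k)" using that by (auto simp: topspace_tau)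
    then show ?thesis using ups_bound(2) t by simp
  qed
  ultimately have "?f \<in> bounded_continuous tau_topology"
    unfolding e by (rule bounded_continuousI)
  from approximable_carried[OF this] show ?thesis
  proof (rule approximable_cong)
    fix X u assume X: "X \<in> bitrees" and u: "u \<in> space (sampling X)"
    show "survival t k X u = tau_val (carried X u) (k, Mass) powr t"
      unfolding tau_val_carried[OF X sampling_mspace[OF X u]] survival_def
      by (simp add: powr_def mult.commute del: upt_Suc)
  qed
qed

subsection \<open>Products of the coordinates of a pruned tree\<close>

text \<open>The factors of a product of \<open>Psi\<close> use independent samples, realised as
  consecutive blocks of one sequence; the first entry of a triple records where its block
  starts.\<close>

fun blocks :: "nat \<Rightarrow> (nat \<times> gen) list list \<Rightarrow> (nat \<times> nat \<times> gen) list" where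
  "blocks a [] = []"
| "blocks a (q # Q) = map (\<lambda>(k, g). (a, k, g)) q @ blocks (a + qdeg q) Q"

definition total_deg :: "(nat \<times> gen) list list \<Rightarrow> nat" where
  "total_deg Q = (\<Sum>q\<leftarrow>Q. qdeg q)"

text \<open>Here \<open>S\<close> is the set of surviving points; each factor consumes
  \<open>qdeg q\<close> points and hands on the shifted sequence.\<close>

fun joint :: "real set \<Rightarrow> bitree \<Rightarrow> (nat \<times> gen) list list \<Rightarrow> (nat \<Rightarrow> real) \<Rightarrow> real" where
  "joint S X [] u = 1"
| "joint S X (q # Q) u = ((\<Prod>i<qdeg q. indicator S (u i)) * samp X q u) * joint S X Q (\<lambda>i. u (qdeg q + i))"

lemma prod_lessThan_add: "prod f {..<a + b} = prod f {..<a} * (\<Prod>i<b. f (a + i))" for a b :: nat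
  by (induction b) (simp_all add: mult.assoc)

lemma joint_blocks:
  "joint S X Q (\<lambda>i. u (a + i)) =
    (\<Prod>i<total_deg Q. indicator S (u (a + i))) * (\<Prod>(a, k, g)\<leftarrow>blocks a Q. gev_block a k g X u)"
proof (induction Q arbitrary: a)
  case (Cons q Q)
  have 1: "samp X q (\<lambda>i. u (a + i)) = (\<Prod>(a, k, g)\<leftarrow>map (\<lambda>(k, g). (a, k, g)) q. gev_block a k g X u)"
    unfolding samp_def gev_block_shift map_map o_def by (simp add: split_beta' del: upt_Suc)
  have 2: "joint S X Q (\<lambda>i. u (a + (qdeg q + i))) =
      (\<Prod>i<total_deg Q. indicator S (u (a + (qdeg q + i)))) * (\<Prod>(a, k, g)\<leftarrow>blocks (a + qdeg q) Q. gev_block a k g X u)"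
    using Cons.IH[of "a + qdeg q"] by (simp add: add.assoc)
  have 3: "total_deg (q # Q) = qdeg q + total_deg Q" by (simp add: total_deg_def)
  show ?case unfolding joint.simps 1 2 3 prod_lessThan_add blocks.simps map_append prod_list.append
    by (simp only: mult_ac)
qed (simp add: total_deg_def)

lemma joint_eq:
  "joint S X Q u = (\<Prod>i<total_deg Q. indicator S (u i)) * (\<Prod>(a, k, g)\<leftarrow>blocks 0 Q. gev_block a k g X u)"
  using joint_blocks[of S X Q u 0] by simp

text \<open>The bound holds for every sequence, as \<open>integral_comb_seq\<close> demands: if the
  relevant points lie in \<open>S\<close>, the others can be replaced by the root.\<close>

lemma samp_restricted_bound:
  assumes X: "X \<in> bitrees" and S: "S \<subseteq> mspace (tree X)"
  shows "\<bar>(\<Prod>i<qdeg q. indicator S (u i)) * samp X q u\<bar> \<le> (\<Prod>(k, g)\<leftarrow>q. gbound g)"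
proof (cases "\<forall>i<qdeg q. u i \<in> S")
  case True
  define w where "w = (\<lambda>i. if i < qdeg q then u i else rt X)"
  have "w \<in> space (sampling X)"
    using True S bitreesD(7,12)[OF X] by (auto simp: w_def space_sampling subset_iff)
  from samp_bound[OF X this] have "\<bar>samp X q w\<bar> \<le> (\<Prod>(k, g)\<leftarrow>q. gbound g)" .
  moreover have "samp X q w = samp X q u"
    by (rule depends_belowD[OF samp_depends_below]) (simp add: w_def)
  moreover have "(\<Prod>i<qdeg q. indicator S (u i) :: real) = 1" using True by (intro prod.neutral) simp
  ultimately show ?thesis by simp
next
  case False
  then obtain i where "i < qdeg q" "u i \<notin> S" by blast
  then have "(\<Prod>i<qdeg q. indicator S (u i) :: real) = 0" by (intro prod_zero bexI[of _ i]) auto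
  moreover have "0 \<le> (\<Prod>(k, g)\<leftarrow>q. gbound g)" by (induction q) (auto simp: gbound_nonneg)
  ultimately show ?thesis by (simp only: mult_zero_left abs_zero)
qed

lemma joint_bound:
  assumes X: "X \<in> bitrees" and S: "S \<subseteq> mspace (tree X)"
  shows "\<bar>joint S X Q u\<bar> \<le> (\<Prod>q\<leftarrow>Q. \<Prod>(k, g)\<leftarrow>q. gbound g)"
proof (induction Q arbitrary: u)
  case (Cons q Q)
  show ?case unfolding joint.simps abs_mult[of "_ * _" "joint _ _ _ _"] list.map prod_list.Cons
    by (intro mult_mono samp_restricted_bound[OF X S] Cons.IH order_trans[OF abs_ge_zero samp_restricted_bound[OF X S]]) simp
qed simp

lemma joint_measurable:
  assumes X: "X \<in> bitrees" and S: "S \<in> sets (mu X)"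
  shows "joint S X Q \<in> borel_measurable (sampling X)"
proof (induction Q)
  case (Cons q Q)
  have c: "(\<lambda>u. u i) \<in> measurable (sampling X) (mu X)" for i
    unfolding measurable_cong_sets[OF sets_sampling refl] by (rule measurable_component_singleton) simp
  have 1: "(\<lambda>u. \<Prod>i<qdeg q. indicator S (u i) :: real) \<in> borel_measurable (sampling X)"
    by (intro borel_measurable_prod measurable_compose[OF c borel_measurable_indicator[OF S]])
  have 2: "(\<lambda>u. joint S X Q (\<lambda>i. u (qdeg q + i))) \<in> borel_measurable (sampling X)"
    by (rule measurable_compose[OF shift_sampling Cons.IH])
  from borel_measurable_times[OF borel_measurable_times[OF 1 samp_measurable[OF X, of q]] 2]
  show ?case by simp
qed simp

context pruning
begin

text \<open>Independence of consecutive parts of the sample turns the product of integrals into a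
  single integral.\<close>

lemma prod_Psi_pruned:
  assumes m: "mass X \<noteq> 0"
  shows "(\<Prod>q\<leftarrow>Q. Psi Y q) = mass X ^ total_deg Q * (\<integral>u. joint S X Q u \<partial>sampling X)"
proof (induction Q)
  case Nil
  then show ?case using prob_space.prob_space[OF prob_space_sampling[OF X m]] by (simp add: total_deg_def)
next
  case (Cons q Q)
  have tm: "total_mass (mu X) \<noteq> 0" using total_mass_mass[OF X] m mass_nonneg[of X] by simp
  have p: "prob_space (normalise (mu X))" by (rule prob_space_normalise[OF D(10) tm])
  let ?f = "\<lambda>u. (\<Prod>i<qdeg q. indicator S (u i)) * samp X q u"
  have f: "?f \<in> borel_measurable (sampling X)"
  proof -
    have "?f = joint S X [q]" by (rule ext) simp
    then show ?thesis using joint_measurable[OF X S_sets(2), of "[q]"] by (simp only:)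
  qed
  have dp: "depends_below (qdeg q) ?f"
    unfolding depends_below_def
  proof (intro allI impI)
    fix u w :: "nat \<Rightarrow> real" assume uw: "\<forall>i<qdeg q. u i = w i"
    have "samp X q u = samp X q w" by (rule depends_belowD[OF samp_depends_below]) (use uw in blast)
    moreover have "(\<Prod>i<qdeg q. indicator S (u i) :: real) = (\<Prod>i<qdeg q. indicator S (w i))"
      by (rule prod.cong[OF refl]) (use uw in simp)
    ultimately show "?f u = ?f w" by (simp only:)
  qed
  have e: "(\<integral>u. joint S X (q # Q) u \<partial>sampling X) = (\<integral>u. ?f u \<partial>sampling X) * (\<integral>u. joint S X Q u \<partial>sampling X)"
    unfolding joint.simps sampling_def
    by (rule integral_comb_seq[where f = ?f and g = "joint S X Q" and n = "qdeg q", OF p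
          f[unfolded sampling_def] dp samp_restricted_bound[OF X prune_set_subset]
          joint_measurable[OF X S_sets(2), unfolded sampling_def] joint_bound[OF X prune_set_subset]])
  have d: "total_deg (q # Q) = qdeg q + total_deg Q" by (simp add: total_deg_def)
  show ?case
    unfolding e d list.map prod_list.Cons Cons.IH
    unfolding Psi_pruned[OF m] power_add by (simp only: mult_ac)
qed

end

subsection \<open>The Poisson cuts\<close>

locale poisson_cuts =
  fixes X :: bitree and \<Omega> :: "'w measure" and \<pi> :: "'w \<Rightarrow> (real \<times> real) measure" and t :: real
  assumes X: "X \<in> bitrees" and ppm: "poisson_point_measure \<Omega> (pruning_intensity X) \<pi>" and t: "0 \<le> t"
begin

abbreviation "\<Lambda> \<equiv> pruning_intensity X"
abbreviation "cuts \<omega> \<equiv> cut_points X (\<pi> \<omega>) t"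
abbreviation "T \<equiv> tree X"

lemmas D = bitreesD[OF X]

sublocale P: prob_space \<Omega> using ppm by (simp add: poisson_point_measure_def)

lemma point_measure: "\<omega> \<in> space \<Omega> ==> point_measure_on \<Lambda> (\<pi> \<omega>)"
  and kernel: "B \<in> sets \<Lambda> ==> (\<lambda>\<omega>. emeasure (\<pi> \<omega>) B) \<in> borel_measurable \<Omega>"
  and poisson: "B \<in> sets \<Lambda> ==> emeasure \<Lambda> B < \<infinity> ==>
     P.prob {\<omega>\<in>space \<Omega>. emeasure (\<pi> \<omega>) B = of_nat k} = measure \<Lambda> B ^ k / fact k * exp (- measure \<Lambda> B)"
  using ppm unfolding poisson_point_measure_def by blast+

lemma slab: "B \<in> sets (nu X) ==> {0..t} \<times> B \<in> sets \<Lambda>"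
  unfolding pruning_intensity_def by (rule pair_measureI) (auto simp: sets_restrict_space_iff)

lemma emeasure_slab: "B \<in> sets (nu X) ==> emeasure \<Lambda> ({0..t} \<times> B) = ennreal t * emeasure (nu X) B"
proof -
  assume B: "B \<in> sets (nu X)"
  interpret N: sigma_finite_measure "nu X" by (rule D(4))
  have t0: "{0..t} \<in> sets (restrict_space lborel {0..})" by (auto simp: sets_restrict_space_iff)
  have "emeasure (restrict_space lborel {0..}) {0..t} = ennreal t"
    using t by (subst emeasure_restrict_space) auto
  then show ?thesis
    unfolding pruning_intensity_def N.emeasure_pair_measure_Times[OF t0 B] by simp
qed

lemma atoms:
  assumes w: "\<omega> \<in> space \<Omega>"
  shows "\<exists>I x. x \<in> I \<rightarrow> space \<Lambda> \<and> (\<forall>B\<in>sets \<Lambda>. emeasure (\<pi> \<omega>) B = 0 \<longleftrightarrow> (\<forall>i\<in>(I :: nat set). x i \<notin> B))"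
proof -
  obtain I :: "nat set" and x where x: "x \<in> I \<rightarrow> space \<Lambda>" and p: "\<pi> \<omega> = distr (count_space I) \<Lambda> x"
    using point_measure[OF w] unfolding point_measure_on_def by blast
  show ?thesis
  proof (intro exI[of _ I] exI[of _ x] conjI x ballI)
    fix B assume B: "B \<in> sets \<Lambda>"
    have xm: "x \<in> measurable (count_space I) \<Lambda>" using x by simp
    have "emeasure (\<pi> \<omega>) B = emeasure (count_space I) (x -` B \<inter> I)"
      unfolding p using emeasure_distr[OF xm B] by simp
    moreover have "emeasure (count_space I) (x -` B \<inter> I) = 0 \<longleftrightarrow> x -` B \<inter> I = {}"
      by (rule emeasure_count_space_eq_0[THEN trans]) auto
    ultimately show "emeasure (\<pi> \<omega>) B = 0 \<longleftrightarrow> (\<forall>i\<in>I. x i \<notin> B)" by auto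
  qed
qed

text \<open>A realisation is a countable sum of point masses, so that vanishing on a slab means
  absence of atoms, also over an uncountable \<open>B\<close>.\<close>

lemma cut_atoms:
  assumes w: "\<omega> \<in> space \<Omega>"
  shows "countable (cuts \<omega>)" "cuts \<omega> \<subseteq> mspace T"
    "B \<in> sets (nu X) ==> emeasure (\<pi> \<omega>) ({0..t} \<times> B) = 0 \<longleftrightarrow> cuts \<omega> \<inter> B = {}"
proof -
  obtain I :: "nat set" and x where x: "x \<in> I \<rightarrow> space \<Lambda>"
    and z0: "\<forall>B\<in>sets \<Lambda>. emeasure (\<pi> \<omega>) B = 0 \<longleftrightarrow> (\<forall>i\<in>I. x i \<notin> B)"
    using atoms[OF w] by (elim exE conjE) (rule that)
  note z = bspec[OF z0]
  have s: "{v} \<in> sets (nu X)" if "v \<in> mspace T" for v unfolding D(3) by (rule singleton_sets_borel_on[OF that])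
  have sp: "space \<Lambda> = space (restrict_space lborel {0..}) \<times> mspace T"
    unfolding pruning_intensity_def space_pair_measure D(13) ..
  have xs: "snd (x i) \<in> mspace T" if "i \<in> I" for i
    using funcset_mem[OF x that] unfolding sp by (rule mem_Times_iff[THEN iffD1, THEN conjunct2])
  have cut: "cuts \<omega> = {snd (x i) | i. i \<in> I \<and> fst (x i) \<in> {0..t}}"
  proof (intro set_eqI iffI)
    fix v assume "v \<in> cuts \<omega>"
    then have v: "v \<in> mspace T" "emeasure (\<pi> \<omega>) ({0..t} \<times> {v}) \<noteq> 0" by (auto simp: cut_points_def)
    then have "\<not> (\<forall>i\<in>I. x i \<notin> {0..t} \<times> {v})" using z[OF slab[OF s[OF v(1)]]] by (simp only: not_False_eq_True)
    then have "\<exists>i\<in>I. x i \<in> {0..t} \<times> {v}" by meson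
    then obtain i where i: "i \<in> I" "x i \<in> {0..t} \<times> {v}" by (elim bexE)
    then have "v = snd (x i)" "fst (x i) \<in> {0..t}" by (simp_all add: mem_Times_iff)
    then show "v \<in> {snd (x i) | i. i \<in> I \<and> fst (x i) \<in> {0..t}}" using i(1)
      by (intro CollectI exI[of _ i] conjI)
  next
    fix v assume "v \<in> {snd (x i) | i. i \<in> I \<and> fst (x i) \<in> {0..t}}"
    then obtain i where i: "i \<in> I" "fst (x i) \<in> {0..t}" "v = snd (x i)" by blast
    then have "x i \<in> {0..t} \<times> {v}" by (simp add: mem_Times_iff)
    then have "\<not> (\<forall>i\<in>I. x i \<notin> {0..t} \<times> {v})" using i(1) by meson
    then have "emeasure (\<pi> \<omega>) ({0..t} \<times> {v}) \<noteq> 0" using z[OF slab[OF s[OF xs[OF i(1)]]]] unfolding i(3) by (simp only: not_False_eq_True)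
    then show "v \<in> cuts \<omega>" using xs[OF i(1)] i(3) by (simp add: cut_points_def zero_less_iff_neq_zero)
  qed
  have "cuts \<omega> \<subseteq> (\<lambda>i. snd (x i)) ` I" unfolding cut by auto
  then show "countable (cuts \<omega>)" by (rule countable_subset) simp
  show "cuts \<omega> \<subseteq> mspace T" by (auto simp: cut_points_def)
  assume B: "B \<in> sets (nu X)"
  have "(\<forall>i\<in>I. x i \<notin> {0..t} \<times> B) \<longleftrightarrow> cuts \<omega> \<inter> B = {}"
    unfolding cut by (auto simp: mem_Times_iff)
  then show "emeasure (\<pi> \<omega>) ({0..t} \<times> B) = 0 \<longleftrightarrow> cuts \<omega> \<inter> B = {}" using z[OF slab[OF B]] by simp
qed

lemma pruning_cut: "\<omega> \<in> space \<Omega> ==> pruning X (cuts \<omega>)"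
  by (rule pruning.intro[OF X cut_atoms(1,2)])

text \<open>The points survive iff no cut lies on their paths to the root, and these paths make up
  the span. For empty \<open>us\<close> the span would still contain the root.\<close>

lemma prune_set_cut:
  assumes w: "\<omega> \<in> space \<Omega>" and us: "us \<noteq> []" "set us \<subseteq> mspace T"
  shows "set us \<subseteq> prune_set X (cuts \<omega>) \<longleftrightarrow> emeasure (\<pi> \<omega>) ({0..t} \<times> span_tree T (rt X) (set us)) = 0"
proof -
  have B: "span_tree T (rt X) (set us) \<in> sets (nu X)" unfolding D(3) by (rule span_tree_props(3)[OF X us(2)])
  have "rt X \<in> seg T (rt X) (hd us)" using us by (intro root_in_seg[OF D(7)]) auto
  then have e: "span_tree T (rt X) (set us) = (\<Union>v\<in>set us. seg T (rt X) v)"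
    using hd_in_set[OF us(1)] unfolding span_tree_def by (intro insert_absorb UN_I)
  have "set us \<subseteq> prune_set X (cuts \<omega>) \<longleftrightarrow> cuts \<omega> \<inter> (\<Union>v\<in>set us. seg T (rt X) v) = {}"
    (is "?l \<longleftrightarrow> ?r")
  proof
    assume l: ?l
    have "v \<notin> seg T (rt X) u" if "u \<in> set us" "v \<in> cuts \<omega>" for u v
      using subsetD[OF l that(1)] that(2) by (simp add: prune_set_def)
    then show ?r by blast
  next
    assume r: ?r
    show ?l
    proof
      fix u assume u: "u \<in> set us"
      have "v \<notin> seg T (rt X) u" if "v \<in> cuts \<omega>" for v using r u that by blast
      then show "u \<in> prune_set X (cuts \<omega>)" using subsetD[OF us(2) u] by (simp add: prune_set_def)
    qed
  qed
  then show ?thesis using cut_atoms(3)[OF w B] unfolding e by simp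
qed

lemma poisson_void:
  assumes B: "B \<in> sets (nu X)" "emeasure (nu X) B \<noteq> \<infinity>"
  shows "P.prob {\<omega>\<in>space \<Omega>. emeasure (\<pi> \<omega>) ({0..t} \<times> B) = 0} = exp (- t * measure (nu X) B)"
proof -
  have "emeasure \<Lambda> ({0..t} \<times> B) < \<infinity>" "measure \<Lambda> ({0..t} \<times> B) = t * measure (nu X) B"
    using emeasure_slab[OF B(1)] B(2) t
    by (simp_all add: ennreal_mult_less_top ennreal_mult_eq_top_iff less_top[symmetric] measure_def enn2real_mult)
  then show ?thesis using poisson[OF slab[OF B(1)], of 0] by simp
qed

lemma sigma_finite_intensity: "sigma_finite_measure \<Lambda>"
proof -
  interpret N: sigma_finite_measure "nu X" by (rule D(4))
  interpret L: sigma_finite_measure "restrict_space lborel {0 :: real..}"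
    by (rule sigma_finite_measure_restrict_space) (auto intro: lborel.sigma_finite_measure_axioms)
  interpret pair_sigma_finite "restrict_space lborel {0 :: real..}" "nu X" ..
  show ?thesis unfolding pruning_intensity_def by (rule sigma_finite_measure_axioms)
qed

text \<open>The Poisson weights add up to 1, so the finite values exhaust the probability.\<close>

lemma AE_finite:
  assumes B: "B \<in> sets \<Lambda>" "emeasure \<Lambda> B < \<infinity>"
  shows "AE \<omega> in \<Omega>. emeasure (\<pi> \<omega>) B < \<infinity>"
proof -
  let ?m = "measure \<Lambda> B"
  let ?E = "\<lambda>k :: nat. {\<omega>\<in>space \<Omega>. emeasure (\<pi> \<omega>) B = of_nat k}"
  note [measurable] = kernel[OF B(1)]
  have E: "?E k \<in> sets \<Omega>" for k by measurable
  have "(\<lambda>k. P.prob (?E k)) sums P.prob (\<Union>k. ?E k)"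
    by (rule P.finite_measure_UNION) (use E in \<open>auto simp: disjoint_family_on_def\<close>)
  moreover have "(\<lambda>k. P.prob (?E k)) sums (exp ?m * exp (- ?m))"
    unfolding poisson[OF B] using sums_mult2[OF exp_converges[of ?m], of "exp (- ?m)"]
    by (simp add: divide_inverse mult.commute)
  ultimately have "P.prob (\<Union>k. ?E k) = 1" using sums_unique2 by (fastforce simp: mult_exp_exp)
  then have "AE \<omega> in \<Omega>. \<omega> \<in> (\<Union>k. ?E k)"
    using E by (subst P.AE_in_set_eq_1) auto
  then show ?thesis by eventually_elim (auto simp: ennreal_of_nat_eq_real_of_nat)
qed

end

lemma completion_measurable_AE:
  assumes g: "g \<in> measurable M N" and ae: "AE x in M. f x = g x" and f: "\<And>x. x \<in> space M ==> f x \<in> space N"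
  shows "f \<in> measurable (completion M) N"
proof (rule measurableI)
  obtain Z where Z: "Z \<in> null_sets M" "{x \<in> space M. f x \<noteq> g x} \<subseteq> Z"
    using ae by (auto simp: eventually_ae_filter)
  fix A assume A: "A \<in> sets N"
  have gA: "g -` A \<inter> space M \<in> sets (completion M)" using measurable_sets[OF g A] by (rule sets_completionI_sets)
  have ZM: "Z \<in> sets (completion M)" using null_setsD2[OF Z(1)] by (rule sets_completionI_sets)
  have n: "f -` A \<inter> space M \<inter> Z \<in> null_sets (completion M)"
    by (rule null_sets_completion_subset[OF _ null_sets_completionI[OF Z(1)]]) auto
  have "(g -` A \<inter> space M - Z) \<union> (f -` A \<inter> space M \<inter> Z) \<in> sets (completion M)"
    by (rule sets.Un[OF sets.Diff[OF gA ZM] null_setsD2[OF n]])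
  moreover have "(g -` A \<inter> space M - Z) \<union> (f -` A \<inter> space M \<inter> Z) = f -` A \<inter> space (completion M)"
    using Z(2) by auto
  ultimately show "f -` A \<inter> space (completion M) \<in> sets (completion M)" by simp
qed (use f in simp)

lemma gev_block_samp: "gev_block a k g X u = samp X [(k, g)] (\<lambda>i. u (a + i))"
  unfolding gev_block_shift samp_def by (simp del: upt_Suc)

lemma survival_samp: "survival t k X u = samp X [(k, Mass)] u powr t"
  unfolding survival_def samp_def by (simp add: powr_def mult.commute del: upt_Suc)

text \<open>The integrand that remains after the cuts have been integrated out. The index
  \<open>total_deg Q - 1\<close> occurs because \<open>survival t k\<close> refers to the
  \<open>k + 1\<close> points \<open>0..k\<close>.\<close>

definition moment :: "real \<Rightarrow> (nat \<times> gen) list list \<Rightarrow> bitree \<Rightarrow> (nat \<Rightarrow> real) \<Rightarrow> real" where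
  "moment t Q X u = survival t (total_deg Q - 1) X u * (\<Prod>(a, k, g)\<leftarrow>blocks 0 Q. gev_block a k g X u)"

lemma approximable_moment: "0 \<le> t ==> approximable (moment t Q)"
  unfolding moment_def[abs_def] by (rule approximable_mult[OF approximable_survival approximable_prod_list])

lemma moment_transport:
  assumes X: "X \<in> bitrees" and Y: "Y \<in> bitrees" and eq: "bitree_equiv X Y" and t: "0 \<le> t"
  shows "(\<integral>u. moment t Q X u \<partial>sampling_mass X) = (\<integral>u. moment t Q Y u \<partial>sampling_mass Y)"
proof -
  note mX = approximable_measurable[OF approximable_moment[OF t] X, of Q]
  note mY = approximable_measurable[OF approximable_moment[OF t] Y, of Q]
  obtain f where f: "f \<in> measurable (borel_on (tree X)) (borel_on (tree Y))" "f (rt X) = rt Y"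
    "skel_measure Y = distr (skel_measure X) (borel_on (tree Y)) f"
    "\<And>x y. tree_dist Y (f x) (f y) = tree_dist X x y"
    and m: "mu Y = distr (mu X) (borel_on (tree Y)) f"
    using bitree_equiv_map[OF X Y eq] by metis
  have ms: "mass X = mass Y" by (rule mass_transport[OF X f(1) m])
  show ?thesis
    unfolding integral_sampling_mass[OF mX] integral_sampling_mass[OF mY] ms[symmetric]
  proof (cases "mass X = 0")
    case False
    have "(\<integral>u. moment t Q Y u \<partial>sampling Y) = (\<integral>u. moment t Q X u \<partial>sampling X)"
    proof (rule integral_sampling_transport[OF X False f(1) m mY])
      fix u assume u: "u \<in> space (sampling X)"
      have s: "samp Y q (\<lambda>k. f (u (a + k))) = samp X q (\<lambda>k. u (a + k))" for q a
        by (rule samp_transport[OF X Y f]) (rule sampling_mspace[OF X u])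
      show "moment t Q Y (\<lambda>k. f (u k)) = moment t Q X u"
        unfolding moment_def gev_block_samp survival_samp s using s[of _ 0] by simp
    qed
    then show "mass X * (\<integral>u. moment t Q X u \<partial>sampling X) = mass X * (\<integral>u. moment t Q Y u \<partial>sampling Y)" by simp
  qed simp
qed

section \<open>Joint measurability in cuts and sample\<close>

context poisson_cuts
begin

text \<open>Division by \<open>1 + emeasure (\<pi> \<omega>) (E i)\<close> produces
  subprobabilities, for which joint measurability with a random set is available. If the mass of
  \<open>E i\<close> is finite, the null sets are those of the restriction to
  \<open>E i\<close>.\<close>

definition thin :: "(nat \<Rightarrow> (real \<times> real) set) \<Rightarrow> nat \<Rightarrow> 'w \<Rightarrow> (real \<times> real) measure" where
  "thin E i \<omega> = scale_measure (inverse (1 + emeasure (\<pi> \<omega>) (E i))) (density (\<pi> \<omega>) (indicator (E i)))"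

text \<open>Points outside \<open>supp_tree X\<close> have \<open>tree_dist\<close> 0 from the root
  and would all belong to the spanned set; cuts there must not count.\<close>

definition region :: "nat \<Rightarrow> (nat \<Rightarrow> real) \<Rightarrow> (real \<times> real) set" where
  "region n u = {0..t} \<times> (tree_spanned X (map u [0..<n]) \<inter> supp_tree X)"

lemma sets_\<pi>: "\<omega> \<in> space \<Omega> ==> sets (\<pi> \<omega>) = sets \<Lambda>"
proof -
  assume "\<omega> \<in> space \<Omega>"
  then obtain I :: "nat set" and x where "\<pi> \<omega> = distr (count_space I) \<Lambda> x"
    using point_measure unfolding point_measure_on_def by blast
  then show ?thesis by simp
qed

lemma emeasure_thin:
  assumes w: "\<omega> \<in> space \<Omega>" and E: "E i \<in> sets \<Lambda>" and B: "B \<in> sets \<Lambda>"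
  shows "emeasure (thin E i \<omega>) B = inverse (1 + emeasure (\<pi> \<omega>) (E i)) * emeasure (\<pi> \<omega>) (E i \<inter> B)"
  using E B sets_\<pi>[OF w] by (simp add: thin_def emeasure_restricted)

lemma thin_measurable:
  assumes E: "E i \<in> sets \<Lambda>" shows "thin E i \<in> measurable \<Omega> (subprob_algebra \<Lambda>)"
proof (rule measurable_subprob_algebra)
  fix \<omega> assume w: "\<omega> \<in> space \<Omega>"
  show s: "sets (thin E i \<omega>) = sets \<Lambda>" using sets_\<pi>[OF w] by (simp add: thin_def)
  have sp: "space (thin E i \<omega>) = space \<Lambda>" by (rule sets_eq_imp_space_eq[OF s])
  show "subprob_space (thin E i \<omega>)"
  proof (rule subprob_spaceI)
    have "emeasure (thin E i \<omega>) (space \<Lambda>) = emeasure (\<pi> \<omega>) (E i) / (1 + emeasure (\<pi> \<omega>) (E i))"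
      using emeasure_thin[of \<omega> E i, OF w E sets.top] sets.sets_into_space[OF E]
      by (simp add: Int_absorb2 divide_ennreal_def mult.commute)
    also have "\<dots> \<le> 1"
      by (rule divide_le_posI_ennreal) (simp_all add: add_pos_nonneg)
    finally show "emeasure (thin E i \<omega>) (space (thin E i \<omega>)) \<le> 1" unfolding sp .
    have "(0, rt X) \<in> space \<Lambda>"
      using D(7) unfolding pruning_intensity_def space_pair_measure D(13) by (simp add: space_restrict_space)
    then show "space (thin E i \<omega>) \<noteq> {}" unfolding sp by blast
  qed
next
  fix B assume B: "B \<in> sets \<Lambda>"
  have "(\<lambda>\<omega>. inverse (1 + emeasure (\<pi> \<omega>) (E i)) * emeasure (\<pi> \<omega>) (E i \<inter> B)) \<in> borel_measurable \<Omega>"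
    using kernel[OF E] kernel[OF sets.Int[OF E B]] by measurable
  then show "(\<lambda>\<omega>. emeasure (thin E i \<omega>) B) \<in> borel_measurable \<Omega>"
    by (rule measurable_cong[THEN iffD1, rotated]) (simp add: emeasure_thin[of _ E i, OF _ E B])
qed

lemma region_sets:
  "(SIGMA p:space (\<Omega> \<Otimes>\<^sub>M sampling X). region n (snd p)) \<in> sets ((\<Omega> \<Otimes>\<^sub>M sampling X) \<Otimes>\<^sub>M \<Lambda>)"
proof -
  let ?N = "skel_measure X" and ?K = "(\<Omega> \<Otimes>\<^sub>M sampling X) \<Otimes>\<^sub>M \<Lambda>"
  let ?US = "PiM (UNIV :: nat set) (\<lambda>_. mu X)"
  interpret S: sampler "mu X" ?N "tree_dist X" "rt X" by (rule sampler_bitree[OF X])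
  note [simp del] = S.space_N
  let ?W = "{p \<in> space (?US \<Otimes>\<^sub>M ?N). snd p \<in> spanned ?N (tree_dist X) (rt X) (map (fst p) [0..<n])}"
  have sN: "sets ?N = sets (nu X)" unfolding skel_measure_def by simp
  have u: "(\<lambda>q. snd (fst q)) \<in> measurable ?K ?US"
    unfolding measurable_cong_sets[OF refl sets_sampling[symmetric]]
    by (rule measurable_compose[OF measurable_fst measurable_snd])
  have l: "snd \<in> measurable ?K (restrict_space lborel {0..} \<Otimes>\<^sub>M nu X)"
    unfolding pruning_intensity_def by (rule measurable_snd)
  have x: "(\<lambda>q. snd (snd q)) \<in> measurable ?K ?N"
    unfolding measurable_cong_sets[OF refl sN] by (rule measurable_compose[OF l measurable_snd])
  have "(\<lambda>q. (snd (fst q), snd (snd q))) -` ?W \<inter> space ?K \<in> sets ?K"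
    by (rule measurable_sets[OF measurable_Pair[OF u x] S.spanned_measurable])
  moreover have "supp_tree X \<in> sets (nu X)" unfolding D(3) by (rule bitree_sets(2)[OF X])
  then have "snd -` ({0..t} \<times> supp_tree X) \<inter> space ?K \<in> sets ?K"
    by (intro measurable_sets[OF measurable_snd] slab)
  ultimately have "((\<lambda>q. (snd (fst q), snd (snd q))) -` ?W \<inter> space ?K) \<inter> (snd -` ({0..t} \<times> supp_tree X) \<inter> space ?K) \<in> sets ?K"
    by (rule sets.Int)
  moreover have "(SIGMA p:space (\<Omega> \<Otimes>\<^sub>M sampling X). region n (snd p)) =
      ((\<lambda>q. (snd (fst q), snd (snd q))) -` ?W \<inter> space ?K) \<inter> (snd -` ({0..t} \<times> supp_tree X) \<inter> space ?K)" (is "?l = ?r")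
  proof (rule set_eqI)
    fix q :: "('w \<times> (nat \<Rightarrow> real)) \<times> (real \<times> real)"
    obtain w u s x where q: "q = ((w, u), (s, x))" by (metis surj_pair)
    have "spanned ?N (tree_dist X) (rt X) us \<subseteq> space ?N" for us by (auto simp: spanned_def)
    moreover have "space \<Lambda> = {0..} \<times> space ?N"
      unfolding pruning_intensity_def space_pair_measure sets_eq_imp_space_eq[OF sN] by (simp add: space_restrict_space)
    moreover have "space (sampling X) = space ?US" by (rule sets_eq_imp_space_eq[OF sets_sampling])
    ultimately show "q \<in> ?l \<longleftrightarrow> q \<in> ?r"
      unfolding q region_def by (auto simp: space_pair_measure)
  qed
  ultimately show ?thesis by (simp only:)
qed

lemma region_span:
  assumes u: "\<And>i. i \<le> k ==> u i \<in> supp_tree X"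
  shows "region (Suc k) u = {0..t} \<times> span_tree T (rt X) (set (map u [0..<Suc k]))"
proof -
  have us: "map u [0..<Suc k] \<noteq> []" "set (map u [0..<Suc k]) \<subseteq> supp_tree X" using u by auto
  have "tree_spanned X (map u [0..<Suc k]) \<inter> supp_tree X =
      span_tree T (rt X) (set (map u [0..<Suc k])) \<inter> supp_tree X"
    using spanned_span_tree[OF X us] by blast
  also have "\<dots> = span_tree T (rt X) (set (map u [0..<Suc k]))"
    using span_tree_subset_supp_tree[OF X us(2)] by blast
  finally show ?thesis unfolding region_def by (simp only:)
qed

lemma region_void:
  assumes w: "\<omega> \<in> space \<Omega>" and u: "\<And>i. i \<le> k ==> u i \<in> supp_tree X"
  shows "emeasure (\<pi> \<omega>) (region (Suc k) u) = 0 \<longleftrightarrow> (\<forall>i<Suc k. u i \<in> prune_set X (cuts \<omega>))"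
proof -
  have us: "map u [0..<Suc k] \<noteq> []" "set (map u [0..<Suc k]) \<subseteq> mspace T"
    using u supp_tree_subset[OF D(7)] by auto
  have "set (map u [0..<Suc k]) \<subseteq> prune_set X (cuts \<omega>) \<longleftrightarrow> (\<forall>i<Suc k. u i \<in> prune_set X (cuts \<omega>))"
    by (auto simp del: upt_Suc)
  moreover have "region (Suc k) u = {0..t} \<times> span_tree T (rt X) (set (map u [0..<Suc k]))" by (rule region_span[OF u])
  ultimately show ?thesis using prune_set_cut[OF w us] by (simp only:)
qed

text \<open>The region depends on the sample, so measurability in the cuts alone is not enough. Sets
  \<open>E i\<close> of finite intensity exhaust the space; almost surely they have finite mass, and
  then the region is void iff every \<open>thin E i\<close> gives it mass 0.\<close>

lemma void_indicator:
  obtains Z where "Z \<in> sets (\<Omega> \<Otimes>\<^sub>M sampling X)"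
    "AE \<omega> in \<Omega>. \<forall>u\<in>space (sampling X). (\<forall>i\<le>k. u i \<in> supp_tree X) \<longrightarrow>
       ((\<omega>, u) \<in> Z \<longleftrightarrow> emeasure (\<pi> \<omega>) (region (Suc k) u) = 0)"
proof -
  interpret L: sigma_finite_measure \<Lambda> by (rule sigma_finite_intensity)
  obtain E :: "nat \<Rightarrow> (real \<times> real) set" where E: "range E \<subseteq> sets \<Lambda>" "(\<Union>i. E i) = space \<Lambda>" "\<And>i. emeasure \<Lambda> (E i) \<noteq> \<infinity>"
    using L.sigma_finite by metis
  have Ei: "E i \<in> sets \<Lambda>" for i using E(1) by blast
  let ?M = "\<Omega> \<Otimes>\<^sub>M sampling X"
  have m: "(\<lambda>p. emeasure (thin E i (fst p)) (region (Suc k) (snd p))) \<in> borel_measurable ?M" for i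
    by (rule emeasure_measurable_subprob_algebra2[OF region_sets measurable_compose[OF measurable_fst thin_measurable[of E, OF Ei]]])
  define Z where "Z = {p \<in> space ?M. \<forall>i. emeasure (thin E i (fst p)) (region (Suc k) (snd p)) = 0}"
  have "Z \<in> sets ?M" unfolding Z_def using m by measurable
  moreover have "AE \<omega> in \<Omega>. \<forall>i. emeasure (\<pi> \<omega>) (E i) < \<infinity>"
    unfolding AE_all_countable using AE_finite[OF Ei] E(3) by (simp add: less_top[symmetric])
  then have "AE \<omega> in \<Omega>. \<forall>u\<in>space (sampling X). (\<forall>i\<le>k. u i \<in> supp_tree X) \<longrightarrow>
       ((\<omega>, u) \<in> Z \<longleftrightarrow> emeasure (\<pi> \<omega>) (region (Suc k) u) = 0)"
    using AE_space
  proof eventually_elim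
    case (elim \<omega>)
    show ?case
    proof (intro ballI impI)
      fix u assume u: "u \<in> space (sampling X)" "\<forall>i\<le>k. u i \<in> supp_tree X"
      let ?B = "region (Suc k) u"
      have us: "set (map u [0..<Suc k]) \<subseteq> mspace T" using u(2) supp_tree_subset[OF D(7)] by auto
      have "span_tree T (rt X) (set (map u [0..<Suc k])) \<in> sets (nu X)"
        unfolding D(3) by (rule span_tree_props(3)[OF X us])
      from slab[OF this] have B: "?B \<in> sets \<Lambda>" using region_span[of k u] u(2) by simp
      have "emeasure (thin E i \<omega>) ?B = 0 \<longleftrightarrow> emeasure (\<pi> \<omega>) (E i \<inter> ?B) = 0" for i
        unfolding emeasure_thin[of _ E, OF elim(2) Ei B] using elim(1) by (simp add: ennreal_inverse_eq_0_iff less_top[symmetric])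
      then have 1: "(\<omega>, u) \<in> Z \<longleftrightarrow> (\<forall>i. emeasure (\<pi> \<omega>) (E i \<inter> ?B) = 0)"
        using u(1) elim(2) by (simp add: Z_def space_pair_measure)
      have Bs: "(\<Union>i. E i \<inter> ?B) = ?B" using E(2) sets.sets_into_space[OF B] by blast
      have s: "E i \<inter> ?B \<in> sets (\<pi> \<omega>)" for i unfolding sets_\<pi>[OF elim(2)] by (rule sets.Int[OF Ei B])
      have "(\<forall>i. emeasure (\<pi> \<omega>) (E i \<inter> ?B) = 0) \<longleftrightarrow> emeasure (\<pi> \<omega>) ?B = 0"
      proof
        assume "\<forall>i. emeasure (\<pi> \<omega>) (E i \<inter> ?B) = 0"
        then have "E i \<inter> ?B \<in> null_sets (\<pi> \<omega>)" for i using s by (simp add: null_sets_def)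
        then have "(\<Union>i. E i \<inter> ?B) \<in> null_sets (\<pi> \<omega>)" by (rule null_sets_UN)
        then show "emeasure (\<pi> \<omega>) ?B = 0" unfolding Bs by (rule null_setsD1)
      next
        assume "emeasure (\<pi> \<omega>) ?B = 0"
        then have N: "?B \<in> null_sets (\<pi> \<omega>)" using B sets_\<pi>[OF elim(2)] by (simp add: null_sets_def)
        show "\<forall>i. emeasure (\<pi> \<omega>) (E i \<inter> ?B) = 0"
          using null_setsD1[OF null_sets_subset[OF N s]] by (meson Int_lower2)
      qed
      with 1 show "(\<omega>, u) \<in> Z \<longleftrightarrow> emeasure (\<pi> \<omega>) ?B = 0" by (simp only:)
    qed
  qed
  ultimately show ?thesis by (rule that)
qed

end

section \<open>Integrating out the cuts\<close>

context poisson_cuts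
begin

lemma AE_sampling_block:
  assumes m: "mass X \<noteq> 0"
  shows "AE u in sampling X. block X u 0 k"
proof -
  have "AE u in sampling_mass X. block X u 0 k" using AE_block[OF X, of 0 k] by (rule eventually_mono) blast
  then have "AE u in sampling X. 0 < ennreal (mass X) \<longrightarrow> block X u 0 k"
    unfolding sampling_mass_def by (subst (asm) AE_density) simp_all
  then show ?thesis by (rule eventually_mono) (use m mass_nonneg[of X] in \<open>simp add: ennreal_zero_less_top\<close>)
qed

text \<open>The region is a slab over the spanned subtree whose intensity is \<open>t\<close> times
  the finite mass of that subtree.\<close>

lemma void_probability:
  assumes b: "block X u 0 k"
  shows "P.prob {\<omega> \<in> space \<Omega>. emeasure (\<pi> \<omega>) (region (Suc k) u) = 0} = survival t k X u"
    "{\<omega> \<in> space \<Omega>. emeasure (\<pi> \<omega>) (region (Suc k) u) = 0} \<in> sets \<Omega>"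
proof -
  have u: "u i \<in> supp_tree X" if "i \<le> k" for i using block.us[OF b, of i] that by simp
  have us: "map u [0..<Suc k] \<noteq> []" "set (map u [0..<Suc k]) \<subseteq> supp_tree X" using u by auto
  have usT: "set (map u [0..<Suc k]) \<subseteq> mspace T" using us(2) supp_tree_subset[OF D(7)] by auto
  let ?B = "span_tree T (rt X) (set (map u [0..<Suc k]))"
  have B: "?B \<in> sets (nu X)" unfolding D(3) by (rule span_tree_props(3)[OF X usT])
  have e: "emeasure (skel_measure X) (tree_spanned X (map u [0..<Suc k])) = emeasure (nu X) ?B"
    by (rule emeasure_spanned[OF X us])
  have fin: "emeasure (nu X) ?B \<noteq> \<infinity>" using block.fin[OF b] unfolding add_0 e .
  have r: "region (Suc k) u = {0..t} \<times> ?B" by (rule region_span[OF u])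
  show "P.prob {\<omega> \<in> space \<Omega>. emeasure (\<pi> \<omega>) (region (Suc k) u) = 0} = survival t k X u"
    unfolding r poisson_void[OF B fin] survival_def by (simp only: measure_def e)
  have [measurable]: "(\<lambda>\<omega>. emeasure (\<pi> \<omega>) (region (Suc k) u)) \<in> borel_measurable \<Omega>"
    unfolding r by (rule kernel[OF slab[OF B]])
  show "{\<omega> \<in> space \<Omega>. emeasure (\<pi> \<omega>) (region (Suc k) u) = 0} \<in> sets \<Omega>" by measurable
qed

text \<open>Fubini exchanges cuts and sample: for fixed cuts the integrand is that of
  \<open>prod_Psi_pruned\<close>, for a fixed sample the survival of all its points is one void
  event. A measurable version is obtained only up to null sets, hence the form with
  \<open>g\<close>.\<close>

lemma pruned_moment:
  assumes Q: "Q \<noteq> []"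
  shows "\<exists>g\<in>borel_measurable \<Omega>. (AE \<omega> in \<Omega>. (\<Prod>q\<leftarrow>Q. Psi (pruned X (cuts \<omega>)) q) = g \<omega>) \<and>
    (\<integral>\<omega>. g \<omega> \<partial>\<Omega>) = mass X ^ (total_deg Q - 1) * (\<integral>u. moment t Q X u \<partial>sampling_mass X)"
proof (cases "mass X = 0")
  case True
  obtain q Q' where Qq: "Q = q # Q'" using Q by (cases Q) auto
  have "AE \<omega> in \<Omega>. (\<Prod>q\<leftarrow>Q. Psi (pruned X (cuts \<omega>)) q) = 0"
    using AE_space
  proof eventually_elim
    case (elim \<omega>)
    from pruning.Psi_pruned_zero[OF pruning_cut[OF elim] True, of q] show ?case
      unfolding Qq list.map prod_list.Cons by (simp only: mult_zero_left)
  qed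
  moreover have "(\<integral>u. moment t Q X u \<partial>sampling_mass X) = 0"
    unfolding integral_sampling_mass[OF approximable_measurable[OF approximable_moment[OF t] X]] using True by simp
  ultimately show ?thesis by (intro bexI[of _ "\<lambda>_. 0"]) simp_all
next
  case False
  obtain k where k: "total_deg Q = Suc k"
  proof -
    obtain q Q' where "Q = q # Q'" using Q by (cases Q) auto
    then have "total_deg Q = Suc ((\<Sum>(k, g)\<leftarrow>q. k) + total_deg Q')" by (simp add: total_deg_def qdeg_def)
    then show ?thesis by (rule that)
  qed
  interpret S: prob_space "sampling X" by (rule prob_space_sampling[OF X False])
  interpret PS: pair_prob_space \<Omega> "sampling X" ..
  let ?F = "\<lambda>u. \<Prod>(a, k, g)\<leftarrow>blocks 0 Q. gev_block a k g X u"
  have Fm: "?F \<in> borel_measurable (sampling X)" by (rule approximable_measurable[OF approximable_prod_list X])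
  obtain B where B: "0 \<le> B" "\<And>u. u \<in> space (sampling X) ==> \<bar>?F u\<bar> \<le> B"
    using approximable_bound[OF approximable_prod_list, of "blocks 0 Q"] X by metis
  obtain Z where Z: "Z \<in> sets (\<Omega> \<Otimes>\<^sub>M sampling X)" and void: "AE \<omega> in \<Omega>. \<forall>u\<in>space (sampling X). (\<forall>i\<le>k. u i \<in> supp_tree X) \<longrightarrow>
       ((\<omega>, u) \<in> Z \<longleftrightarrow> emeasure (\<pi> \<omega>) (region (Suc k) u) = 0)"
    by (rule void_indicator[of k])
  \<comment> \<open>\<open>Z\<close> stands for the event that all points survive and makes the
    integrand jointly measurable.\<close>
  let ?h = "\<lambda>\<omega> u. indicator Z (\<omega>, u) * ?F u"
  have hm: "case_prod ?h \<in> borel_measurable (\<Omega> \<Otimes>\<^sub>M sampling X)"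
    using borel_measurable_times[OF borel_measurable_indicator[OF Z] measurable_compose[OF measurable_snd Fm]]
    by (simp add: split_beta')
  have hb: "\<bar>?h \<omega> u\<bar> \<le> B" if "u \<in> space (sampling X)" for \<omega> u
    using B(1) B(2)[OF that] by (cases "(\<omega>, u) \<in> Z") simp_all
  have hi: "integrable (\<Omega> \<Otimes>\<^sub>M sampling X) (case_prod ?h)"
  proof (rule PS.integrable_const_bound[of _ B])
    show "AE p in \<Omega> \<Otimes>\<^sub>M sampling X. norm (case_prod ?h p) \<le> B"
      by (rule AE_I2) (use hb in \<open>auto simp: space_pair_measure\<close>)
  qed (rule hm)
  have hs: "?h \<omega> \<in> borel_measurable (sampling X)" if "\<omega> \<in> space \<Omega>" for \<omega>
    using measurable_compose[OF measurable_Pair1'[OF that] hm] by simp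
  define g where "g \<omega> = mass X ^ Suc k * (\<integral>u. ?h \<omega> u \<partial>sampling X)" for \<omega>
  have "g \<in> borel_measurable \<Omega>"
    unfolding g_def by (intro borel_measurable_times borel_measurable_const S.borel_measurable_lebesgue_integral hm)
  moreover have "AE \<omega> in \<Omega>. (\<Prod>q\<leftarrow>Q. Psi (pruned X (cuts \<omega>)) q) = g \<omega>"
    using void AE_space
  proof eventually_elim
    case (elim \<omega>)
    interpret R: pruning X "cuts \<omega>" by (rule pruning_cut[OF elim(2)])
    have "(\<Prod>q\<leftarrow>Q. Psi (pruned X (cuts \<omega>)) q) = mass X ^ Suc k * (\<integral>u. joint (prune_set X (cuts \<omega>)) X Q u \<partial>sampling X)"
      using R.prod_Psi_pruned[OF False, of Q] unfolding k .
    moreover have "(\<integral>u. joint (prune_set X (cuts \<omega>)) X Q u \<partial>sampling X) = (\<integral>u. ?h \<omega> u \<partial>sampling X)"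
    proof (rule integral_cong_AE)
      show "joint (prune_set X (cuts \<omega>)) X Q \<in> borel_measurable (sampling X)"
        by (rule joint_measurable[OF X R.S_sets(2)])
      show "AE u in sampling X. joint (prune_set X (cuts \<omega>)) X Q u = ?h \<omega> u"
        using AE_sampling_block[OF False, of k] AE_space
      proof eventually_elim
        case u: (elim u)
        have us: "\<forall>i\<le>k. u i \<in> supp_tree X" using block.us[OF u(1)] by simp
        have "(\<omega>, u) \<in> Z \<longleftrightarrow> (\<forall>i<Suc k. u i \<in> prune_set X (cuts \<omega>))"
          using elim(1) u(2) us region_void[OF elim(2), of k u] by blast
        then have "(\<Prod>i<Suc k. indicator (prune_set X (cuts \<omega>)) (u i) :: real) = indicator Z (\<omega>, u)"
        proof (cases "(\<omega>, u) \<in> Z")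
          case True
          with \<open>(\<omega>, u) \<in> Z \<longleftrightarrow> _\<close> show ?thesis by (subst prod.neutral) auto
        next
          case F: False
          with \<open>(\<omega>, u) \<in> Z \<longleftrightarrow> _\<close> obtain i where "i < Suc k" "u i \<notin> prune_set X (cuts \<omega>)" by blast
          then have "(\<Prod>i<Suc k. indicator (prune_set X (cuts \<omega>)) (u i) :: real) = 0"
            by (intro prod_zero bexI[of _ i]) auto
          with F show ?thesis by (simp only: indicator_simps(2) not_False_eq_True)
        qed
        then show ?case unfolding joint_eq k by (simp only:)
      qed
    qed (rule hs[OF elim(2)])
    ultimately show ?case unfolding g_def by (simp only:)
  qed
  moreover have "(\<integral>\<omega>. g \<omega> \<partial>\<Omega>) = mass X ^ (total_deg Q - 1) * (\<integral>u. moment t Q X u \<partial>sampling_mass X)"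
  proof -
    have inner: "AE u in sampling X. (\<integral>\<omega>. ?h \<omega> u \<partial>\<Omega>) = moment t Q X u"
      using AE_sampling_block[OF False, of k] AE_space
    proof eventually_elim
      case (elim u)
      let ?V = "{\<omega> \<in> space \<Omega>. emeasure (\<pi> \<omega>) (region (Suc k) u) = 0}"
      have us: "\<forall>i\<le>k. u i \<in> supp_tree X" using block.us[OF elim(1)] by simp
      have hu: "(\<lambda>\<omega>. ?h \<omega> u) \<in> borel_measurable \<Omega>"
        using measurable_compose[OF measurable_Pair2'[OF elim(2)] hm] by simp
      have "(\<integral>\<omega>. ?h \<omega> u \<partial>\<Omega>) = (\<integral>\<omega>. indicator ?V \<omega> * ?F u \<partial>\<Omega>)"
      proof (rule integral_cong_AE[OF hu])
        show "(\<lambda>\<omega>. indicator ?V \<omega> * ?F u) \<in> borel_measurable \<Omega>"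
          by (intro borel_measurable_times borel_measurable_const borel_measurable_indicator void_probability(2)[OF elim(1)])
        show "AE \<omega> in \<Omega>. ?h \<omega> u = indicator ?V \<omega> * ?F u"
          using void AE_space
        proof eventually_elim
          case w: (elim \<omega>)
          have "(\<omega>, u) \<in> Z \<longleftrightarrow> \<omega> \<in> ?V" using w us elim(2) by blast
          then have "indicator Z (\<omega>, u) = (indicator ?V \<omega> :: real)" by (simp only: indicator_def)
          then show ?case by (simp only:)
        qed
      qed
      also have "\<dots> = P.prob ?V * ?F u" using void_probability(2)[OF elim(1)] by simp
      also have "\<dots> = moment t Q X u" unfolding void_probability(1)[OF elim(1)] moment_def k by simp
      finally show ?case .
    qed
    have "(\<integral>\<omega>. g \<omega> \<partial>\<Omega>) = mass X ^ Suc k * (\<integral>\<omega>. (\<integral>u. ?h \<omega> u \<partial>sampling X) \<partial>\<Omega>)"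
      unfolding g_def by simp
    also have "(\<integral>\<omega>. (\<integral>u. ?h \<omega> u \<partial>sampling X) \<partial>\<Omega>) = (\<integral>u. (\<integral>\<omega>. ?h \<omega> u \<partial>\<Omega>) \<partial>sampling X)"
      by (rule PS.Fubini_integral[OF hi, symmetric])
    also have "\<dots> = (\<integral>u. moment t Q X u \<partial>sampling X)"
    proof (rule integral_cong_AE[OF _ approximable_measurable[OF approximable_moment[OF t] X] inner])
      show "(\<lambda>u. \<integral>\<omega>. ?h \<omega> u \<partial>\<Omega>) \<in> borel_measurable (sampling X)"
        using PS.integrable_snd[OF hi] by (rule borel_measurable_integrable)
    qed
    also have "mass X ^ Suc k * \<dots> = mass X ^ (total_deg Q - 1) * (\<integral>u. moment t Q X u \<partial>sampling_mass X)"
      unfolding integral_sampling_mass[OF approximable_measurable[OF approximable_moment[OF t] X]] k by simp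
    finally show ?thesis .
  qed
  ultimately show ?thesis by blast
qed

text \<open>\<open>prune\<close> and \<open>pruned\<close> have the same class, and
  \<open>Psi\<close> and \<open>mass\<close> are invariant under equivalence.\<close>

lemma Psi_class_pruned:
  assumes w: "\<omega> \<in> space \<Omega>"
  shows "bitree_class (prune X (cuts \<omega>)) \<in> bitree_classes"
    "Psi (representative (bitree_class (prune X (cuts \<omega>)))) q = Psi (pruned X (cuts \<omega>)) q"
    "mass (representative (bitree_class (prune X (cuts \<omega>)))) \<le> mass X"
proof -
  interpret R: pruning X "cuts \<omega>" by (rule pruning_cut[OF w])
  note Y = R.pruned_bitree
  note c = bitree_class_representative[OF Y]
  show "bitree_class (prune X (cuts \<omega>)) \<in> bitree_classes"
    unfolding R.prune_class bitree_classes_def using Y by (rule imageI)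
  show "Psi (representative (bitree_class (prune X (cuts \<omega>)))) q = Psi (pruned X (cuts \<omega>)) q"
    unfolding R.prune_class by (rule Psi_transport(1)[OF Y c(1,2), symmetric])
  show "mass (representative (bitree_class (prune X (cuts \<omega>)))) \<le> mass X"
    unfolding R.prune_class Psi_transport(2)[OF Y c(1,2), symmetric] by (rule R.mass_pruned_le)
qed

lemma expectation_Psi:
  defines "c \<omega> \<equiv> representative (bitree_class (prune X (cuts \<omega>)))"
  shows "(\<lambda>\<omega>. Psi (c \<omega>) q) \<in> borel_measurable (completion \<Omega>)"
    and "Q \<noteq> [] ==> (\<integral>\<omega>. (\<Prod>q\<leftarrow>Q. Psi (c \<omega>) q) \<partial>completion \<Omega>) =
      mass X ^ (total_deg Q - 1) * (\<integral>u. moment t Q X u \<partial>sampling_mass X)"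
proof -
  have cw: "(\<Prod>q\<leftarrow>Q. Psi (c \<omega>) q) = (\<Prod>q\<leftarrow>Q. Psi (pruned X (cuts \<omega>)) q)" if "\<omega> \<in> space \<Omega>" for \<omega> Q
    unfolding c_def Psi_class_pruned(2)[OF that] ..
  have *: "\<exists>g\<in>borel_measurable \<Omega>. (AE \<omega> in \<Omega>. (\<Prod>q\<leftarrow>Q. Psi (c \<omega>) q) = g \<omega>) \<and>
    (\<integral>\<omega>. g \<omega> \<partial>\<Omega>) = mass X ^ (total_deg Q - 1) * (\<integral>u. moment t Q X u \<partial>sampling_mass X)" if ne: "Q \<noteq> []" for Q
  proof -
    obtain g where g: "g \<in> borel_measurable \<Omega>" "AE \<omega> in \<Omega>. (\<Prod>q\<leftarrow>Q. Psi (pruned X (cuts \<omega>)) q) = g \<omega>"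
      "(\<integral>\<omega>. g \<omega> \<partial>\<Omega>) = mass X ^ (total_deg Q - 1) * (\<integral>u. moment t Q X u \<partial>sampling_mass X)"
      using pruned_moment[OF ne] by (elim bexE conjE)
    have "AE \<omega> in \<Omega>. (\<Prod>q\<leftarrow>Q. Psi (c \<omega>) q) = g \<omega>"
      using g(2) AE_space by eventually_elim (simp only: cw)
    with g(1,3) show ?thesis by blast
  qed
  have m: "(\<lambda>\<omega>. \<Prod>q\<leftarrow>Q. Psi (c \<omega>) q) \<in> borel_measurable (completion \<Omega>)" if "Q \<noteq> []" for Q
    using *[OF that] by (elim bexE conjE) (rule completion_measurable_AE, auto)
  show "(\<lambda>\<omega>. Psi (c \<omega>) q) \<in> borel_measurable (completion \<Omega>)" using m[of "[q]"] by simp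
  assume Q: "Q \<noteq> []"
  obtain g where g: "g \<in> borel_measurable \<Omega>" "AE \<omega> in \<Omega>. (\<Prod>q\<leftarrow>Q. Psi (c \<omega>) q) = g \<omega>"
      "(\<integral>\<omega>. g \<omega> \<partial>\<Omega>) = mass X ^ (total_deg Q - 1) * (\<integral>u. moment t Q X u \<partial>sampling_mass X)"
    using *[OF Q] by (elim bexE conjE)
  have "(\<integral>\<omega>. (\<Prod>q\<leftarrow>Q. Psi (c \<omega>) q) \<partial>completion \<Omega>) = (\<integral>\<omega>. g \<omega> \<partial>completion \<Omega>)"
    by (rule integral_cong_AE[OF m[OF Q] measurable_completion[OF g(1)] AE_completion[OF g(2)]])
  also have "\<dots> = (\<integral>\<omega>. g \<omega> \<partial>\<Omega>)" by (rule integral_completion[OF g(1)])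
  finally show "(\<integral>\<omega>. (\<Prod>q\<leftarrow>Q. Psi (c \<omega>) q) \<partial>completion \<Omega>) =
      mass X ^ (total_deg Q - 1) * (\<integral>u. moment t Q X u \<partial>sampling_mass X)" unfolding g(3) .
qed

end

text \<open>Covers non-integrable \<open>f\<close> too, whose integral is 0 by convention.\<close>

lemma (in prob_space) abs_integral_const_bound:
  fixes f :: "'a \<Rightarrow> real"
  assumes "\<And>x. x \<in> space M ==> \<bar>f x\<bar> \<le> b" "0 \<le> b"
  shows "\<bar>\<integral>x. f x \<partial>M\<bar> \<le> b"
proof (cases "integrable M f")
  case True
  have "\<bar>\<integral>x. f x \<partial>M\<bar> \<le> (\<integral>x. b \<partial>M)" by (rule abs_integral_le[OF True _ assms(1)]) simp_all
  then show ?thesis by (simp add: prob_space)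
qed (simp add: not_integrable_integral_eq assms(2))

theorem proposition3p4:
  fixes X :: "bitree set \<Rightarrow> bitree"
    and \<Omega> :: "bitree set \<Rightarrow> 'w measure"
    and \<pi> :: "bitree set \<Rightarrow> 'w \<Rightarrow> (real \<times> real) measure"
    and t :: real
  assumes "\<And>C. C \<in> bitree_classes ==> X C \<in> C"
    and "\<And>C. C \<in> bitree_classes ==>
           poisson_point_measure (\<Omega> C) (pruning_intensity (X C)) (\<pi> C)"
    and "t \<ge> 0"
  shows "pruning_semigroup X \<Omega> \<pi> t ` bounded_continuous LWV_topology
           \<subseteq> bounded_continuous LWV_topology"
proof (rule image_subsetI)
  fix G :: "bitree set \<Rightarrow> real" assume G: "G \<in> bounded_continuous LWV_topology"
  obtain b where b: "0 \<le> b" "\<And>C. C \<in> bitree_classes ==> \<bar>G C\<bar> \<le> b"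
    using bounded_continuous_bound[OF G] unfolding topspace_LWV by metis
  define c where "c C \<omega> = bitree_class (prune (X C) (cut_points (X C) (\<pi> C \<omega>) t))" for C \<omega>
  have SG: "pruning_semigroup X \<Omega> \<pi> t G C = (\<integral>\<omega>. G (c C \<omega>) \<partial>completion (\<Omega> C))" for C
    by (simp add: pruning_semigroup_def c_def)
  have XC: "X C \<in> bitrees" if "C \<in> bitree_classes" for C
    using assms(1)[OF that] that by (auto simp: bitree_classes_def bitree_class_def)
  have pc: "poisson_cuts (X C) (\<Omega> C) (\<pi> C) t" if "C \<in> bitree_classes" for C
    by (rule poisson_cuts.intro[OF XC[OF that] assms(2)[OF that] assms(3)])
  have prob: "prob_space (completion (\<Omega> C))" if "C \<in> bitree_classes" for C
    using assms(2)[OF that] by (intro prob_space.prob_space_completion) (simp add: poisson_point_measure_def)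
  have cC: "c C \<omega> \<in> bitree_classes" "mass (representative (c C \<omega>)) \<le> mass (X C)" if "C \<in> bitree_classes" "\<omega> \<in> space (\<Omega> C)" for C \<omega>
    using poisson_cuts.Psi_class_pruned(1,3)[OF pc[OF that(1)] that(2)] by (simp_all add: c_def)
  \<comment> \<open>The tree used for the process and the chosen representative may differ; both are
    equivalent to a common tree.\<close>
  have rep: "mass (X C) = mass (representative C)"
      "(\<integral>u. moment t Q (X C) u \<partial>sampling_mass (X C)) = (\<integral>u. moment t Q (representative C) u \<partial>sampling_mass (representative C))"
    if C: "C \<in> bitree_classes" for C Q
  proof -
    obtain Y where Y: "Y \<in> bitrees" "C = bitree_class Y" using C by (auto simp: bitree_classes_def)
    have R: "representative C \<in> bitrees" "representative C \<in> C" using representative_bitree_classes[OF C] by auto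
    have e: "bitree_equiv Y (X C)" "bitree_equiv Y (representative C)"
      using assms(1)[OF C] R(2) unfolding Y(2) bitree_class_def by blast+
    show "mass (X C) = mass (representative C)"
      using Psi_transport(2)[OF Y(1) XC[OF C] e(1)] Psi_transport(2)[OF Y(1) R(1) e(2)] by simp
    show "(\<integral>u. moment t Q (X C) u \<partial>sampling_mass (X C)) = (\<integral>u. moment t Q (representative C) u \<partial>sampling_mass (representative C))"
      using moment_transport[OF Y(1) XC[OF C] e(1) assms(3), of Q] moment_transport[OF Y(1) R(1) e(2) assms(3), of Q]
      by simp
  qed
  have bound: "\<bar>pruning_semigroup X \<Omega> \<pi> t G C\<bar> \<le> b" if C: "C \<in> bitree_classes" for C
    unfolding SG by (rule prob_space.abs_integral_const_bound[OF prob[OF C]]) (use b cC[OF C] in auto)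
  \<comment> \<open>On trees of mass below \<open>K\<close> the coordinates \<open>Psi\<close> are
    bounded, as \<open>weak_continuity\<close> requires. Pruning does not increase the mass, so the
    laws of the pruned trees stay on this set.\<close>
  have loc: "continuous_map (subtopology LWV_topology {C \<in> bitree_classes. mass (representative C) < K}) euclideanreal
      (pruning_semigroup X \<Omega> \<pi> t G)" for K
  proof -
    let ?h = "\<lambda>C. Psi (representative C)" and ?U = "{C \<in> bitree_classes. mass (representative C) < K}"
    let ?E = "subtopology LWV_topology ?U"
    have E: "?E = coord_topology ?U ?h"
    proof -
      have "bitree_classes \<inter> ?U = ?U" by blast
      then show ?thesis unfolding LWV_coord subtopology_coord_topology by (simp only:)
    qed
    have tE: "topspace ?E = ?U" by (auto simp: topspace_LWV)
    let ?\<kappa> = "\<lambda>C. distr (completion (\<Omega> C)) (borel_of (coord_topology ?U ?h)) (c C)"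
    have cm: "c C \<in> measurable (completion (\<Omega> C)) (borel_of (coord_topology ?U ?h))" if C: "C \<in> ?U" for C
    proof (rule measurable_into_coord_topology)
      have C': "C \<in> bitree_classes" using C by blast
      show "c C \<omega> \<in> ?U" if "\<omega> \<in> space (completion (\<Omega> C))" for \<omega>
        using cC[OF C', of \<omega>] that C rep(1)[OF C'] by auto
      show "(\<lambda>\<omega>. Psi (representative (c C \<omega>)) q) \<in> borel_measurable (completion (\<Omega> C))" for q
        unfolding c_def by (rule poisson_cuts.expectation_Psi(1)[OF pc[OF C']])
    qed
    interpret weak_continuity ?U ?h "\<lambda>q. K ^ qdeg q * (\<Prod>(k, g)\<leftarrow>q. gbound g)" ?E ?\<kappa>
    proof (rule weak_continuity.intro)
      fix C q assume C: "C \<in> ?U"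
      then have R: "representative C \<in> bitrees" using representative_bitree_classes by blast
      have "\<bar>?h C q\<bar> \<le> mass (representative C) ^ qdeg q * (\<Prod>(k, g)\<leftarrow>q. gbound g)" by (rule Psi_bound[OF R])
      also have "\<dots> \<le> K ^ qdeg q * (\<Prod>(k, g)\<leftarrow>q. gbound g)"
      proof (intro mult_right_mono power_mono)
        show "mass (representative C) \<le> K" "0 \<le> mass (representative C)" using C mass_nonneg by auto
        show "0 \<le> (\<Prod>(k, g)\<leftarrow>q. gbound g)" by (induction q) (auto simp: gbound_nonneg)
      qed
      finally show "\<bar>?h C q\<bar> \<le> K ^ qdeg q * (\<Prod>(k, g)\<leftarrow>q. gbound g)" .
    next
      fix C assume "C \<in> topspace ?E"
      then have C: "C \<in> ?U" unfolding tE .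
      show "sets (?\<kappa> C) = sets (borel_of (coord_topology ?U ?h))" by simp
      have "C \<in> bitree_classes" using C by blast
      then interpret prob_space "completion (\<Omega> C)" by (rule prob)
      show "finite_measure (?\<kappa> C)" by (rule finite_measure_distr[OF cm[OF C]])
    next
      fix Q
      have hm: "(\<lambda>C. \<Prod>q\<leftarrow>Q. ?h C q) \<in> borel_measurable (borel_of (coord_topology ?U ?h))"
      proof (rule continuous_map_real_borel_measurable)
        show "continuous_map (coord_topology ?U ?h) euclideanreal (\<lambda>C. \<Prod>q\<leftarrow>Q. ?h C q)"
        proof (induction Q)
          case (Cons q Q)
          from continuous_map_real_mult[OF continuous_map_coord[of ?U ?h q] Cons.IH] show ?case by simp
        qed simp
      qed
      have iC: "(\<integral>x. (\<Prod>q\<leftarrow>Q. ?h x q) \<partial>?\<kappa> C) = (\<integral>\<omega>. (\<Prod>q\<leftarrow>Q. ?h (c C \<omega>) q) \<partial>completion (\<Omega> C))" if "C \<in> ?U" for C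
        by (rule integral_distr[OF cm[OF that] hm])
      show "continuous_map ?E euclideanreal (\<lambda>C. \<integral>x. (\<Prod>q\<leftarrow>Q. ?h x q) \<partial>?\<kappa> C)"
      proof (cases "Q = []")
        \<comment> \<open>For the empty product the truncated exponent
          \<open>total_deg Q - 1\<close> would give a wrong formula; the integral is 1.\<close>
        case True
        have "continuous_map ?E euclideanreal (\<lambda>C. 1)" by simp
        then show ?thesis
        proof (rule continuous_map_eq)
          fix C assume "C \<in> topspace ?E"
          then have C: "C \<in> ?U" unfolding tE .
          then have "C \<in> bitree_classes" by blast
          from prob_space.prob_space[OF prob[OF this]]
          show "1 = (\<integral>x. (\<Prod>q\<leftarrow>Q. ?h x q) \<partial>?\<kappa> C)" unfolding iC[OF C] unfolding True by simp
        qed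
      next
        case False
        \<comment> \<open>This is the expected product of coordinates of the pruned tree;
          \<open>moment\<close> is approximable, so its integral is continuous in the class.\<close>
        have "continuous_map ?E euclideanreal (\<lambda>C. mass (representative C) ^ (total_deg Q - 1) *
            (\<integral>u. moment t Q (representative C) u \<partial>sampling_mass (representative C)))"
          by (intro continuous_map_real_mult continuous_map_real_pow continuous_map_from_subtopology mass_continuous
              approximable_continuous approximable_moment assms(3))
        then show ?thesis
        proof (rule continuous_map_eq)
          fix C assume "C \<in> topspace ?E"
          then have C: "C \<in> ?U" unfolding tE .
          then have C': "C \<in> bitree_classes" by blast
          show "mass (representative C) ^ (total_deg Q - 1) *
              (\<integral>u. moment t Q (representative C) u \<partial>sampling_mass (representative C)) = (\<integral>x. (\<Prod>q\<leftarrow>Q. ?h x q) \<partial>?\<kappa> C)"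
            unfolding iC[OF C] c_def poisson_cuts.expectation_Psi(2)[OF pc[OF C'] False] rep[OF C'] ..
        qed
      qed
    qed
    have GE: "G \<in> bounded_continuous (coord_topology ?U ?h)"
    proof (rule bounded_continuousI[where B = b])
      show "continuous_map (coord_topology ?U ?h) euclideanreal G"
        unfolding E[symmetric] using G by (intro continuous_map_from_subtopology) (simp add: bounded_continuous_def)
      show "\<bar>G C\<bar> \<le> b" if "C \<in> topspace (coord_topology ?U ?h)" for C
        using that b(2)[of C] unfolding E[symmetric] tE by blast
    qed
    from weakly_continuous[OF GE] show ?thesis
    proof (rule continuous_map_eq)
      fix C assume "C \<in> topspace ?E"
      then have C: "C \<in> ?U" unfolding tE .
      show "(\<integral>x. G x \<partial>?\<kappa> C) = pruning_semigroup X \<Omega> \<pi> t G C"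
        unfolding SG by (rule integral_distr[OF cm[OF C] bounded_continuous_borel[OF GE]])
    qed
  qed
  have "continuous_map LWV_topology euclideanreal (pruning_semigroup X \<Omega> \<pi> t G)"
    unfolding continuous_map_real_local topspace_LWV
  proof (intro ballI allI impI)
    fix C and e :: real assume C: "C \<in> bitree_classes" and e: "e > 0"
    \<comment> \<open>As the mass is continuous, this is an open neighbourhood of \<open>C\<close>,
      and continuity on it gives continuity at \<open>C\<close>.\<close>
    let ?U = "{C' \<in> bitree_classes. mass (representative C') < mass (representative C) + 1}"
    have "?U = {C' \<in> topspace LWV_topology. mass (representative C') \<in> {..<mass (representative C) + 1}}"
      by (auto simp: topspace_LWV)
    then have U: "openin LWV_topology ?U"
      using openin_continuous_map_preimage[OF mass_continuous, of "{..<mass (representative C) + 1}"] by simp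
    have CE: "C \<in> topspace (subtopology LWV_topology ?U)" using C by (simp add: topspace_LWV)
    have "\<exists>V. openin (subtopology LWV_topology ?U) V \<and> C \<in> V \<and>
        (\<forall>y\<in>V. \<bar>pruning_semigroup X \<Omega> \<pi> t G y - pruning_semigroup X \<Omega> \<pi> t G C\<bar> < e)"
      using loc[of "mass (representative C) + 1", unfolded continuous_map_real_local, rule_format, OF CE e] .
    then show "\<exists>V. openin LWV_topology V \<and> C \<in> V \<and>
        (\<forall>y\<in>V. \<bar>pruning_semigroup X \<Omega> \<pi> t G y - pruning_semigroup X \<Omega> \<pi> t G C\<bar> < e)"
      unfolding openin_open_subtopology[OF U] by blast
  qed
  then show "pruning_semigroup X \<Omega> \<pi> t G \<in> bounded_continuous LWV_topology"
    using bound by (intro bounded_continuousI[where B = b]) (simp_all add: topspace_LWV)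
qed

end
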